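(* Let $a\in C^\infty(\mathbb S)$ be positive with $\int_0^{2\pi}a^{-1}d\theta=2\pi$ and $\hat a_k=0$ for $|k|>N$, for some $N\in\mathbb N$. Then there is a unique $\alpha\in C^\infty([0,\infty),C^\infty(\mathbb S))$ such that each $\alpha_\tau$ is positive, $\alpha_0=a$, $\frac{\partial\alpha_\tau}{\partial\tau}=-\alpha_\tau(\Lambda\alpha_\tau)+(\mathcal H\alpha_\tau)(D\alpha_\tau)$ for $\tau\ge0$, and $\widehat{(\alpha_\tau)}_k=0$ for all $\tau\ge0$ and $|k|>N$. Moreover, if $c=\{c_k\}_{k\ge0}$ is a sequence of positive reals with $c_0\ge\hat a_0$, $c_1\ge\zeta_a(-1)$ and $c_{m+1}\ge\zeta_a(-2m)$ for $m\ge1$, then $\alpha_\tau\in\mathcal K_c$ for every $\tau\ge0$.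
   Context: $u=\sum\hat u_ke^{ik\theta}$. $D=-i\,d/d\theta$, $\Lambda e^{in\theta}=|n|e^{in\theta}$, $\mathcal H\mathbf 1=0$, $\mathcal He^{in\theta}=\mathrm{sgn}(n)e^{in\theta}$ ($n\ne0$). For positive $b$ with $\int b^{-1}=2\pi$, $\zeta_b$ is the meromorphic continuation of $\sum_{k\ge1}\lambda_k(b)^{-s}$ over the positive eigenvalues of $b^{1/2}\Lambda b^{1/2}$. $\mathcal K_c=\{b\in C^\infty(\mathbb S): b>0,\ \int_0^{2\pi}b^{-1}=2\pi,\ \hat b_0\le c_0,\ \zeta_b(-1)\le c_1,\ \zeta_b(-2m)\le c_{m+1}\ (m\ge1)\}$. *)

theory Defs
  imports "HOL-Analysis.Analysis"
begin

text \<open>Functions on the circle S are represented as 2pi-periodic functions on the reals.\<close>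

definition smooth_fun :: "(real \<Rightarrow> real) \<Rightarrow> bool" where
  "smooth_fun f \<longleftrightarrow> (\<forall>n x. (deriv ^^ n) f differentiable (at x))"

definition circ_smooth :: "(real \<Rightarrow> real) \<Rightarrow> bool" where
  "circ_smooth f \<longleftrightarrow> smooth_fun f \<and> (\<forall>x. f (x + 2 * pi) = f x)"

definition circ_smooth_c :: "(real \<Rightarrow> complex) \<Rightarrow> bool" where
  "circ_smooth_c u \<longleftrightarrow> circ_smooth (\<lambda>x. Re (u x)) \<and> circ_smooth (\<lambda>x. Im (u x))"

definition cx :: "(real \<Rightarrow> real) \<Rightarrow> real \<Rightarrow> complex" where
  "cx f = (\<lambda>x. complex_of_real (f x))"

definition fourier :: "(real \<Rightarrow> complex) \<Rightarrow> int \<Rightarrow> complex" where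
  "fourier u k = integral {0..2*pi} (\<lambda>\<theta>. u \<theta> * exp (- \<i> * of_int k * of_real \<theta>)) / of_real (2*pi)"

definition Lam :: "(real \<Rightarrow> complex) \<Rightarrow> real \<Rightarrow> complex" where
  "Lam u \<theta> = (\<Sum>\<^sub>\<infinity>n::int. of_int \<bar>n\<bar> * fourier u n * exp (\<i> * of_int n * of_real \<theta>))"

definition Hil :: "(real \<Rightarrow> complex) \<Rightarrow> real \<Rightarrow> complex" where
  "Hil u \<theta> = (\<Sum>\<^sub>\<infinity>n::int. of_int (sgn n) * fourier u n * exp (\<i> * of_int n * of_real \<theta>))"

definition Dop :: "(real \<Rightarrow> complex) \<Rightarrow> real \<Rightarrow> complex" where
  "Dop u \<theta> = - \<i> * vector_derivative u (at \<theta>)"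

definition is_eigenfun :: "(real \<Rightarrow> real) \<Rightarrow> real \<Rightarrow> (real \<Rightarrow> complex) \<Rightarrow> bool" where
  "is_eigenfun b lam u \<longleftrightarrow> circ_smooth_c u \<and>
     (\<forall>\<theta>. of_real (sqrt (b \<theta>)) * Lam (\<lambda>x. of_real (sqrt (b x)) * u x) \<theta> = of_real lam * u \<theta>)"

definition lin_indep_fam :: "nat \<Rightarrow> (nat \<Rightarrow> real \<Rightarrow> complex) \<Rightarrow> bool" where
  "lin_indep_fam n u \<longleftrightarrow>
     (\<forall>c::nat \<Rightarrow> complex. (\<forall>\<theta>. (\<Sum>i<n. c i * u i \<theta>) = 0) \<longrightarrow> (\<forall>i<n. c i = 0))"

definition eig_mult :: "(real \<Rightarrow> real) \<Rightarrow> real \<Rightarrow> nat" where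
  "eig_mult b lam = (GREATEST n. \<exists>u. (\<forall>i<n. is_eigenfun b lam (u i)) \<and> lin_indep_fam n u)"

definition pos_eigs :: "(real \<Rightarrow> real) \<Rightarrow> real set" where
  "pos_eigs b = {lam. lam > 0 \<and> (\<exists>u. is_eigenfun b lam u \<and> (\<exists>\<theta>. u \<theta> \<noteq> 0))}"

definition zeta_series :: "(real \<Rightarrow> real) \<Rightarrow> complex \<Rightarrow> complex" where
  "zeta_series b s = (\<Sum>\<^sub>\<infinity>lam\<in>pos_eigs b. of_nat (eig_mult b lam) * (of_real lam) powr (- s))"

text \<open>v is the value at z of the meromorphic continuation of the zeta series:
  there is a holomorphic f on a connected open set containing the half plane Re s > 1
  (where the series converges) and z, agreeing with the series there.\<close>
definition zeta_val :: "(real \<Rightarrow> real) \<Rightarrow> complex \<Rightarrow> complex \<Rightarrow> bool" where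
  "zeta_val b z v \<longleftrightarrow> (\<exists>S f. open S \<and> connected S \<and> {s. Re s > 1} \<subseteq> S \<and> z \<in> S \<and>
      f holomorphic_on S \<and>
      (\<forall>s. Re s > 1 \<longrightarrow>
         (\<lambda>lam. of_nat (eig_mult b lam) * (of_real lam) powr (- s)) summable_on pos_eigs b \<and>
         zeta_series b s = f s) \<and>
      f z = v)"

definition zeta :: "(real \<Rightarrow> real) \<Rightarrow> complex \<Rightarrow> complex" where
  "zeta b z = (THE v. zeta_val b z v)"

definition Kc :: "(nat \<Rightarrow> real) \<Rightarrow> (real \<Rightarrow> real) set" where
  "Kc c = {b. circ_smooth b \<and> (\<forall>\<theta>. b \<theta> > 0) \<and>
      integral {0..2*pi} (\<lambda>\<theta>. 1 / b \<theta>) = 2 * pi \<and>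
      Re (fourier (cx b) 0) \<le> c 0 \<and>
      Re (zeta b (-1)) \<le> c 1 \<and>
      (\<forall>m::nat. m \<ge> 1 \<longrightarrow> Re (zeta b (- 2 * of_nat m)) \<le> c (m + 1))}"

text \<open>Curves [0,oo) -> C^oo(S) with the Frechet topology of the seminorms sup |d^j f|.\<close>
definition curve_cont :: "(real \<Rightarrow> real \<Rightarrow> real) \<Rightarrow> bool" where
  "curve_cont g \<longleftrightarrow> (\<forall>j \<tau>. \<tau> \<ge> 0 \<longrightarrow> (\<forall>e>0. \<forall>\<^sub>F \<sigma> in at \<tau> within {0..}.
      \<forall>\<theta>. \<bar>(deriv ^^ j) (g \<sigma>) \<theta> - (deriv ^^ j) (g \<tau>) \<theta>\<bar> \<le> e))"

definition curve_deriv :: "(real \<Rightarrow> real \<Rightarrow> real) \<Rightarrow> (real \<Rightarrow> real \<Rightarrow> real) \<Rightarrow> bool" where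
  "curve_deriv g g' \<longleftrightarrow> (\<forall>j \<tau>. \<tau> \<ge> 0 \<longrightarrow> (\<forall>e>0. \<forall>\<^sub>F \<sigma> in at \<tau> within {0..}.
      \<forall>\<theta>. \<bar>((deriv ^^ j) (g \<sigma>) \<theta> - (deriv ^^ j) (g \<tau>) \<theta>) / (\<sigma> - \<tau>)
             - (deriv ^^ j) (g' \<tau>) \<theta>\<bar> \<le> e))"

definition smooth_curve :: "(real \<Rightarrow> real \<Rightarrow> real) \<Rightarrow> bool" where
  "smooth_curve g \<longleftrightarrow> (\<exists>A. A 0 = g \<and> (\<forall>n. (\<forall>\<tau>\<ge>0. circ_smooth (A n \<tau>)) \<and>
      curve_cont (A n) \<and> curve_deriv (A n) (A (Suc n))))"

definition flow_sol :: "nat \<Rightarrow> (real \<Rightarrow> real) \<Rightarrow> (real \<Rightarrow> real \<Rightarrow> real) \<Rightarrow> bool" where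
  "flow_sol N a \<alpha> \<longleftrightarrow> smooth_curve \<alpha> \<and>
     (\<forall>\<tau>\<ge>0. \<forall>\<theta>. \<alpha> \<tau> \<theta> > 0) \<and>
     \<alpha> 0 = a \<and>
     (\<exists>\<beta>. curve_deriv \<alpha> \<beta> \<and> (\<forall>\<tau>\<ge>0. \<forall>\<theta>.
        complex_of_real (\<beta> \<tau> \<theta>) =
          - cx (\<alpha> \<tau>) \<theta> * Lam (cx (\<alpha> \<tau>)) \<theta> + Hil (cx (\<alpha> \<tau>)) \<theta> * Dop (cx (\<alpha> \<tau>)) \<theta>)) \<and>
     (\<forall>\<tau>\<ge>0. \<forall>k::int. \<bar>k\<bar> > int N \<longrightarrow> fourier (cx (\<alpha> \<tau>)) k = 0)"

end

theory Submission
 imports Defs "HOL-Complex_Analysis.Complex_Analysis" "HOL-Library.Real_Mod"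
begin

text \<open>Let \<open>\<phi> = \<integral>d\<theta>/b\<close> and \<open>mode_coef n l\<close> the Fourier coefficients of \<open>cis (n \<phi>)\<close>. In the basis \<open>cis (n \<phi>)\<close> the operator
 \<open>b \<Lambda>\<close> becomes \<open>|n| \<delta> + r\<close> with \<open>r\<close> rapidly decreasing, because \<open>mode_coef n l\<close> decays rapidly when \<open>n l \<le> 0\<close>. Hence
 \<open>\<zeta>\<^sub>b(s) = 2 \<zeta>(s) + G(s)\<close> with \<open>G\<close> entire, \<open>G(-1)\<close> is the trace of \<open>r\<close>, and \<open>G(-2m)\<close> is the trace of the finite-rank
 operator \<open>toep\<^bsup>2m\<^esup> - sgn_toep\<^bsup>2m\<^esup>\<close>, where \<open>toep\<close> has entries \<open>\<surd>|l k| b\<^sub>l\<^sub>-\<^sub>k\<close> and \<open>sgn_toep\<close> is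
 its product with the sign of \<open>l\<close>.

 With \<open>\<beta> = -i H \<alpha>\<close> the flow reads \<open>\<alpha>' = \<beta> \<alpha>\<^sub>\<theta> - \<alpha> \<beta>\<^sub>\<theta>\<close>: a quadratic system for finitely many coefficients that transports
 \<open>1/\<alpha>\<close>. It preserves positivity by a minimum principle, hence \<open>|\<alpha>\<^sub>n| \<le> \<alpha>\<^sub>0\<close>, and \<open>\<alpha>\<^sub>0\<close> decreases, so solutions
 are global. For \<open>toep\<close> it is a commutator up to \<open>-2 cross toep\<close>, with \<open>cross\<close> the part coupling opposite signs, which gives
 \<open>G(-2m)' = -4m Tr (cross toep\<^bsup>2m\<^esup>) \<le> 0\<close>; and \<open>G(-1)'\<close> is \<open>-4 \<Sum> l k |\<alpha>\<^sub>l\<^sub>+\<^sub>k|\<^sup>2\<close> over positive \<open>l\<close>, \<open>k\<close>.\<close>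

type_synonym cseq = "int => complex"

abbreviation freqs :: "nat => int set" where "freqs N \<equiv> {- int N..int N}"

abbreviation window :: "nat => int => int set" where "window N l \<equiv> {l - int N..l + int N}"

abbreviation (input) has_vd (infix "has'_vd" 50) where "(f has_vd f') F \<equiv> (f has_vector_derivative f') F"

lemmas abs_summable_dominated = Infinite_Sum.abs_summable_on_comparison_test'

section \<open>Infinite sums\<close>

lemma tendsto_infsum_dominated:
 fixes f :: "nat => 'a => 'b::banach"
 assumes lim: "!!x. x \<in> X ==> (%i. f i x) \<longlonglongrightarrow> g x"
  and bound: "!!i x. x \<in> X ==> norm (f i x) <= h x" and h: "h summable_on X"
 shows "(%i. \<Sum>\<^sub>\<infinity>x\<in>X. f i x) \<longlonglongrightarrow> (\<Sum>\<^sub>\<infinity>x\<in>X. g x)"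
proof -
 have "norm (g x) <= h x" if "x \<in> X" for x
  using tendsto_norm[OF lim[OF that]] bound[OF that] by (intro LIMSEQ_le_const2) auto
 hence "g summable_on X"
  by (metis abs_summable_dominated[OF h] abs_summable_summable)
 hence "((%X'. \<Sum>x\<in>X'. g x) \<longlongrightarrow> (\<Sum>\<^sub>\<infinity>x\<in>X. g x)) (finite_subsets_at_top X)"
  by (simp add: infsum_tendsto)
 moreover have "uniform_limit UNIV (%X' i. \<Sum>x\<in>X'. f i x) (%i. \<Sum>\<^sub>\<infinity>x\<in>X. f i x) (finite_subsets_at_top X)"
  by (rule Weierstrass_m_test_general[OF bound h])
 moreover have "\<forall>\<^sub>F X' in finite_subsets_at_top X. (%i. \<Sum>x\<in>X'. f i x) \<longlonglongrightarrow> (\<Sum>x\<in>X'. g x)"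
  by (rule eventually_finite_subsets_at_top_weakI) (auto intro!: tendsto_sum lim)
 ultimately show ?thesis
  by (intro swap_uniform_limit'[where f="%X' i. \<Sum>x\<in>X'. f i x" and g="%X'. \<Sum>x\<in>X'. g x"
     and F="finite_subsets_at_top X" and S=UNIV]) auto
qed

lemma has_sum_integral:
 fixes f :: "'a => real => 'b::banach"
 assumes cont: "!!x. continuous_on {a..b} (f x)"
  and bound: "!!x t. t \<in> {a..b} ==> norm (f x t) <= M x" and M: "M summable_on UNIV"
 shows "((%x. integral {a..b} (f x)) has_sum integral {a..b} (%t. INFSUM x. f x t)) UNIV"
proof -
 have u: "uniform_limit {a..b} (%X t. \<Sum>x\<in>X. f x t) (%t. INFSUM x. f x t) (finite_subsets_at_top UNIV)"
  by (rule Weierstrass_m_test_general[OF bound M])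
 obtain I J where IJ: "!!X. ((%t. \<Sum>x\<in>X. f x t) has_integral I X) {a..b}"
  "((%t. INFSUM x. f x t) has_integral J) {a..b}" "(I \<longlongrightarrow> J) (finite_subsets_at_top UNIV)"
  by (rule uniform_limit_integral[OF u]) (auto intro!: cont continuous_on_sum)
 have "I X = (\<Sum>x\<in>X. integral {a..b} (f x))" for X
  using integral_unique[OF IJ(1)[of X]] integral_sum[of X f "{a..b}"] integrable_continuous_interval[OF cont]
  by (cases "finite X") auto
 hence "I = (%X. \<Sum>x\<in>X. integral {a..b} (f x))" by auto
 with IJ show ?thesis unfolding has_sum_def by (metis integral_unique)
qed

lemma continuous_on_infsum:
 fixes f :: "'a => real => 'b::banach"
 assumes cont: "!!x. continuous_on S (f x)"
  and bound: "!!x t. t \<in> S ==> norm (f x t) <= M x" and M: "M summable_on UNIV"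
 shows "continuous_on S (%t. INFSUM x. f x t)"
 by (rule uniform_limit_theorem[OF _ Weierstrass_m_test_general[OF bound M]])
  (auto intro!: always_eventually continuous_on_sum cont)

lemma has_sum_diff:
 fixes f :: "'a => 'b::real_normed_field"
 assumes "(f has_sum x) A" "(g has_sum y) A" shows "((%i. f i - g i) has_sum (x - y)) A"
 using has_sum_add[OF assms(1) has_sum_cmult_right[OF assms(2), of "- 1"]] by simp

lemma has_sum_sum:
 fixes f :: "'a => 'b => 'c::topological_comm_monoid_add"
 assumes "finite X" "!!x. x \<in> X ==> (f x has_sum s x) A"
 shows "((%n. \<Sum>x\<in>X. f x n) has_sum (\<Sum>x\<in>X. s x)) A"
 using assms by (induction X rule: finite_induct) (auto intro: has_sum_add)

lemma infsum_single: "(!!k. k \<noteq> n ==> f k = 0) ==> infsum f UNIV = f n"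
 using infsum_cong_neutral[of UNIV "{n}" f f] by simp

lemma summable_on_product:
 fixes f g :: "'a => real"
 assumes "f summable_on UNIV" "g summable_on UNIV" "!!x. f x >= 0" "!!x. g x >= 0"
 shows "(%(x,y). f x * g y) summable_on UNIV"
proof -
 have "(%(x,y). f x * g y) summable_on (Sigma UNIV (%_. UNIV))"
  by (rule summable_on_SigmaI[where g="%x. f x * (INFSUM y. g y)"])
   (auto intro!: has_sum_cmult_right has_sum_infsum summable_on_cmult_left mult_nonneg_nonneg assms)
 thus ?thesis by simp
qed

lemma infsum_swap_product:
 fixes h :: "'a => 'a => 'b::banach"
 assumes "f summable_on UNIV" "g summable_on UNIV" "!!x. f x >= 0" "!!x. g x >= (0::real)"
  and "!!x y. norm (h x y) <= f x * g y"
 shows "(INFSUM x. INFSUM y. h x y) = (INFSUM y. INFSUM x. h x y)"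
proof (rule infsum_swap_banach)
 have "(%p. norm (case p of (x,y) => h x y)) summable_on UNIV"
  by (rule abs_summable_dominated[OF summable_on_product[OF assms(1-4)]]) (use assms(5) in auto)
 thus "(%(x, y). h x y) summable_on UNIV \<times> UNIV" using abs_summable_summable by fastforce
qed

lemma filterlim_symmetric_Icc_finite_subsets:
 "filterlim (%n::nat. {- int n..int n}) (finite_subsets_at_top UNIV) sequentially"
 unfolding filterlim_finite_subsets_at_top
proof (intro allI impI)
 fix X :: "int set" assume "finite X \<and> X \<subseteq> UNIV"
 then obtain B where "\<forall>x\<in>X. \<bar>x\<bar> <= B"
  by (metis finite_imageI finite_set abs_le_iff Max_ge imageI)
 thus "\<forall>\<^sub>F n::nat in sequentially. finite {- int n..int n} \<and> X \<subseteq> {- int n..int n} \<and> {- int n..int n} \<subseteq> UNIV"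
  by (intro eventually_sequentiallyI[of "nat B"]) fastforce
qed

section \<open>The Japanese bracket\<close>

definition bracket :: "int => real" where "bracket n = 1 + \<bar>real_of_int n\<bar>"

lemma bracket_ge_1: "bracket n >= 1" and bracket_pos [simp]: "bracket n > 0" and bracket_nonzero [simp]: "bracket n \<noteq> 0"
 and bracket_minus [simp]: "bracket (- n) = bracket n" and abs_le_bracket: "\<bar>real_of_int n\<bar> <= bracket n"
 by (auto simp: bracket_def)

lemma bracket_add_le: "bracket (m + n) <= bracket m * bracket n"
proof -
 have "bracket (m + n) <= 1 + \<bar>real_of_int m\<bar> + \<bar>real_of_int n\<bar>" by (simp add: bracket_def)
 also have "... <= bracket m * bracket n" by (simp add: bracket_def algebra_simps)
 finally show ?thesis .
qed

lemma bracket_diff_le: "bracket (m - n) <= bracket m * bracket n"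
 using bracket_add_le[of m "- n"] by simp

lemma bracket_power_ge_1: "bracket n ^ K >= 1" by (simp add: bracket_ge_1 one_le_power)

lemma bracket_power_le: "bracket n ^ K <= 2 ^ K * (1 + \<bar>real_of_int n\<bar> ^ K)"
proof (cases "n = 0")
 case False
 hence "1 <= \<bar>real_of_int n\<bar>" by linarith
 hence "bracket n <= 2 * \<bar>real_of_int n\<bar>" by (simp add: bracket_def)
 hence "bracket n ^ K <= (2 * \<bar>real_of_int n\<bar>) ^ K" by (intro power_mono) (auto simp: less_imp_le)
 thus ?thesis by (simp add: power_mult_distrib distrib_left add_increasing)
qed (simp add: bracket_def add_increasing2 algebra_simps)

lemma bracket_power_mult_le:
 assumes "0 <= x" "x <= A" "\<bar>real_of_int n\<bar> ^ K * x <= B"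
 shows "bracket n ^ K * x <= 2 ^ K * (A + B)"
proof -
 have "bracket n ^ K * x <= 2 ^ K * (1 + \<bar>real_of_int n\<bar> ^ K) * x"
  by (intro mult_right_mono bracket_power_le assms)
 also have "... = 2 ^ K * (x + \<bar>real_of_int n\<bar> ^ K * x)" by (simp add: algebra_simps)
 also have "... <= 2 ^ K * (A + B)" using assms by (intro mult_left_mono add_mono) auto
 finally show ?thesis .
qed

lemma summable_on_inverse_bracket_sq: "(%n. 1 / bracket n ^ 2) summable_on UNIV"
proof -
 have "summable (%n::nat. inverse (real (Suc n) ^ 2))"
  using inverse_power_summable[of 2, where 'a=real] by (subst summable_Suc_iff) simp
 hence "(%n::nat. 1 / bracket (int n) ^ 2) summable_on UNIV"
  by (subst summable_on_UNIV_nonneg_real_iff) (auto simp: bracket_def field_simps)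
 hence "(%n. 1 / bracket n ^ 2) summable_on range int" "(%n. 1 / bracket n ^ 2) summable_on range (%n. - int n)"
  by (subst summable_on_reindex; simp add: inj_on_def o_def)+
 moreover have "range int \<union> range (%n. - int n) = UNIV"
  by (auto intro: int_cases2)
 ultimately show ?thesis
  using summable_on_union by metis
qed

lemma
 fixes f :: "int => 'a::banach"
 assumes bound: "!!n. norm (f n) <= C / bracket n ^ 2"
 shows summable_on_bracket_bound: "f summable_on UNIV"
  and abs_summable_on_bracket_bound: "(%n. norm (f n)) summable_on UNIV"
  and norm_infsum_bracket_bound: "norm (INFSUM n. f n) <= C * (INFSUM n. 1 / bracket n ^ 2)"
proof -
 have majorant: "((%n. C / bracket n ^ 2) has_sum C * (INFSUM n. 1 / bracket n ^ 2)) UNIV"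
  using has_sum_cmult_right[OF has_sum_infsum[OF summable_on_inverse_bracket_sq], of C] by simp
 show "(%n. norm (f n)) summable_on UNIV"
  by (rule abs_summable_dominated[OF has_sum_imp_summable[OF majorant] bound])
 thus summable: "f summable_on UNIV" by (rule abs_summable_summable)
 show "norm (INFSUM n. f n) <= C * (INFSUM n. 1 / bracket n ^ 2)"
  by (rule norm_infsum_le[OF has_sum_infsum[OF summable] majorant bound])
qed

section \<open>Rapidly decreasing sequences and matrices\<close>

definition rapid :: "cseq => bool" where
 "rapid a \<longleftrightarrow> (\<forall>K. \<exists>C. \<forall>n. bracket n ^ K * cmod (a n) <= C)"

lemma rapidE:
 assumes "rapid a"
 obtains C where "C >= 0" "!!n. bracket n ^ K * cmod (a n) <= C"
proof -
 obtain C where C: "!!n. bracket n ^ K * cmod (a n) <= C" using assms unfolding rapid_def by blast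
 have "0 <= bracket 0 ^ K * cmod (a 0)" by (simp add: less_imp_le)
 thus thesis using that C order_trans by blast
qed

lemma rapid_dominated:
 assumes g: "rapid g" and F: "finite F" and le: "!!n. n \<notin> F ==> cmod (a n) <= cmod (g n)"
 shows "rapid a"
 unfolding rapid_def
proof
 fix K
 define S where "S = (\<Sum>n\<in>F. bracket n ^ K * cmod (a n))"
 obtain C where C: "C >= 0" "!!n. bracket n ^ K * cmod (g n) <= C" using rapidE[OF g] by blast
 have "bracket n ^ K * cmod (a n) <= S + C" for n
 proof (cases "n \<in> F")
  case True
  hence "bracket n ^ K * cmod (a n) <= S"
   unfolding S_def by (intro member_le_sum F) (auto simp: less_imp_le)
  thus ?thesis using C(1) by linarith
 next
  case False
  hence "bracket n ^ K * cmod (a n) <= bracket n ^ K * cmod (g n)" by (intro mult_left_mono le) (auto simp: less_imp_le)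
  moreover have "S >= 0" unfolding S_def by (intro sum_nonneg) (auto simp: less_imp_le)
  ultimately show ?thesis using C(2)[of n] by linarith
 qed
 thus "\<exists>C. \<forall>n. bracket n ^ K * cmod (a n) <= C" by blast
qed

lemma rapid_zero: "rapid (%n. 0)" by (auto simp: rapid_def)

lemma rapid_finite_support: "finite F ==> (!!n. n \<notin> F ==> a n = 0) ==> rapid a"
 by (rule rapid_dominated[OF rapid_zero]) auto

definition delta :: "int => cseq" where "delta k l = (if l = k then 1 else 0)"

lemma rapid_delta: "rapid (delta k)"
 by (rule rapid_finite_support[of "{k}"]) (auto simp: delta_def)

lemma rapid_mult:
 assumes a: "rapid a" and q: "!!n. cmod (q n) <= D * bracket n ^ M"
 shows "rapid (%n. q n * a n)"
 unfolding rapid_def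
proof
 fix K
 have D: "D >= 0" using order_trans[OF norm_ge_zero q[of 0]] by (simp add: bracket_def)
 obtain C where C: "!!n. bracket n ^ (K + M) * cmod (a n) <= C" using rapidE[OF a] by blast
 have "bracket n ^ K * cmod (q n * a n) <= D * C" for n
 proof -
  have "bracket n ^ K * cmod (q n * a n) <= bracket n ^ K * (D * bracket n ^ M * cmod (a n))"
   unfolding norm_mult by (intro mult_left_mono mult_right_mono q) (auto simp: less_imp_le)
  also have "... = D * (bracket n ^ (K + M) * cmod (a n))" by (simp add: power_add mult_ac)
  also have "... <= D * C" using C D by (intro mult_left_mono)
  finally show ?thesis .
 qed
 thus "\<exists>C. \<forall>n. bracket n ^ K * cmod (q n * a n) <= C" by blast
qed

lemma rapid_cmult: "rapid a ==> rapid (%n. z * a n)"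
 using rapid_mult[of a "%_. z" "cmod z" 0] by simp

lemma rapid_int_mult: "rapid a ==> rapid (%n. \<i> * of_int n * a n)"
 using rapid_mult[of a "%n. \<i> * of_int n" 1 1] by (auto simp: norm_mult bracket_def)

lemma rapid_abs_mult: "rapid a ==> rapid (%n. of_int \<bar>n\<bar> * a n)"
 using rapid_mult[of a "%n. of_int \<bar>n\<bar>" 1 1] by (auto simp: bracket_def)

lemma rapid_add:
 assumes a: "rapid a" and a': "rapid a'"
 shows "rapid (%n. a n + a' n)"
 unfolding rapid_def
proof
 fix K
 obtain C where C: "!!n. bracket n ^ K * cmod (a n) <= C" using rapidE[OF a] by blast
 obtain D where D: "!!n. bracket n ^ K * cmod (a' n) <= D" using rapidE[OF a'] by blast
 have "bracket n ^ K * cmod (a n + a' n) <= C + D" for n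
 proof -
  have "bracket n ^ K * cmod (a n + a' n) <= bracket n ^ K * (cmod (a n) + cmod (a' n))"
    by (intro mult_left_mono norm_triangle_ineq) (auto simp: less_imp_le)
  thus ?thesis using C[of n] D[of n] by (simp add: distrib_left)
 qed
 thus "\<exists>C. \<forall>n. bracket n ^ K * cmod (a n + a' n) <= C" by blast
qed

lemma rapid_sum: "(!!x. x \<in> X ==> rapid (f x)) ==> rapid (%n. \<Sum>x\<in>X. f x n)"
 by (induction X rule: infinite_finite_induct) (auto intro: rapid_zero rapid_add)

lemma rapid_shift:
 assumes g: "rapid g"
 shows "rapid (%l. g (l - j))"
 unfolding rapid_def
proof
 fix K
 obtain C where C: "!!n. bracket n ^ K * cmod (g n) <= C" using rapidE[OF g] by blast
 have "bracket l ^ K * cmod (g (l - j)) <= bracket j ^ K * C" for l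
 proof -
  have "bracket l ^ K <= (bracket (l - j) * bracket j) ^ K" using bracket_add_le[of "l - j" j] by (intro power_mono) (auto simp: less_imp_le)
  hence "bracket l ^ K * cmod (g (l - j)) <= bracket j ^ K * (bracket (l - j) ^ K * cmod (g (l - j)))"
   using mult_right_mono[of "bracket l ^ K" "(bracket (l - j) * bracket j) ^ K" "cmod (g (l - j))"] by (simp add: power_mult_distrib mult_ac)
  also have "... <= bracket j ^ K * C" by (intro mult_left_mono C) (auto simp: less_imp_le)
  finally show ?thesis .
 qed
 thus "\<exists>C. \<forall>l. bracket l ^ K * cmod (g (l - j)) <= C" by blast
qed

lemma rapid_bounded:
 assumes "rapid a"
 obtains C where "C >= 0" "!!n. cmod (a n) <= C"
 using rapidE[OF assms, of 0] that unfolding power_0 mult_1 by blast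

lemma rapid_abs_summable:
 assumes "rapid a"
 shows "(%n. cmod (a n)) summable_on UNIV"
proof -
 obtain C where "!!n. bracket n ^ 2 * cmod (a n) <= C" using rapidE[OF assms] by blast
 hence "cmod (a n) <= C / bracket n ^ 2" for n by (simp add: field_simps)
 thus ?thesis by (rule abs_summable_on_bracket_bound)
qed

lemmas rapid_summable = abs_summable_summable[OF rapid_abs_summable]

lemma rapid_bracket_sq_summable:
 assumes a: "rapid a"
 shows "(%n. bracket n * (cmod (a n))\<^sup>2) summable_on UNIV"
proof -
 obtain C where C: "!!n. cmod (a n) <= C" using rapid_bounded[OF a] by blast
 have "rapid (%n. (of_real (bracket n) * cnj (a n)) * a n)"
  by (rule rapid_mult[OF a, of _ C 1]) (simp add: norm_mult C less_imp_le mult.commute mult_left_mono)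
 from rapid_abs_summable[OF this] show ?thesis by (simp add: norm_mult power2_eq_square less_imp_le mult.assoc)
qed

definition tempered :: "(int => cseq) => bool" where
 "tempered M \<longleftrightarrow> (\<forall>K. \<exists>C L. \<forall>n l. bracket l ^ K * cmod (M n l) <= C * bracket n ^ L)"

lemma
 assumes y: "rapid y" and M: "tempered M"
 shows rapid_tempered_apply: "rapid (%l. INFSUM n. y n * M n l)"
  and tempered_apply_summable: "(%n. y n * M n l) summable_on UNIV"
proof -
 have bound: "\<exists>D. \<forall>n l. cmod (of_real (bracket l ^ K) * (y n * M n l)) <= D / bracket n ^ 2" for K
 proof -
  obtain C L where C: "!!n l. bracket l ^ K * cmod (M n l) <= C * bracket n ^ L" using M unfolding tempered_def by blast
  have C0: "C >= 0" using order_trans[OF _ C[of 0 0], of 0] by (simp add: bracket_def)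
  obtain D where D: "!!n. bracket n ^ (L + 2) * cmod (y n) <= D" using rapidE[OF y] by blast
  have "cmod (of_real (bracket l ^ K) * (y n * M n l)) <= C * D / bracket n ^ 2" for n l
  proof -
   have "bracket n ^ 2 * (cmod (y n) * (bracket l ^ K * cmod (M n l))) <= bracket n ^ 2 * (cmod (y n) * (C * bracket n ^ L))"
    by (intro mult_left_mono C) auto
   also have "... = C * (bracket n ^ (L + 2) * cmod (y n))" by (simp add: power_add power2_eq_square mult_ac)
   also have "... <= C * D" using C0 D by (intro mult_left_mono)
   finally show ?thesis by (simp add: norm_mult norm_power less_imp_le field_simps)
  qed
  thus ?thesis by blast
 qed
 obtain D where "!!n l. cmod (y n * M n l) <= D / bracket n ^ 2" using bound[of 0] by auto
 thus "(%n. y n * M n l) summable_on UNIV" by (rule summable_on_bracket_bound)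
 show "rapid (%l. INFSUM n. y n * M n l)"
  unfolding rapid_def
 proof
  fix K
  obtain D where D: "!!n l. cmod (of_real (bracket l ^ K) * (y n * M n l)) <= D / bracket n ^ 2" using bound by blast
  have "bracket l ^ K * cmod (INFSUM n. y n * M n l) <= D * (INFSUM n. 1 / bracket n ^ 2)" for l
   using norm_infsum_bracket_bound[OF D[where l=l]] unfolding infsum_cmult_right' by (simp add: norm_mult norm_power less_imp_le)
  thus "\<exists>C. \<forall>l. bracket l ^ K * cmod (INFSUM n. y n * M n l) <= C" by blast
 qed
qed

definition rapid_matrix :: "(int => cseq) => bool" where
 "rapid_matrix s \<longleftrightarrow> (\<forall>K. \<exists>C. \<forall>n k. bracket n ^ K * bracket k ^ K * cmod (s n k) <= C)"

lemma rapid_matrix_decay: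
 assumes "rapid_matrix s"
 obtains C where "C >= 0" "!!n k. cmod (s n k) <= C / bracket n ^ K / bracket k ^ L"
proof -
 obtain C where C: "!!n k. bracket n ^ (K + L) * bracket k ^ (K + L) * cmod (s n k) <= C"
  using assms unfolding rapid_matrix_def by blast
 have "bracket n ^ K * bracket k ^ L * cmod (s n k) <= bracket n ^ (K + L) * bracket k ^ (K + L) * cmod (s n k)" for n k
  by (intro mult_right_mono mult_mono power_increasing bracket_ge_1) (auto simp: less_imp_le)
 with C have dominated: "bracket n ^ K * bracket k ^ L * cmod (s n k) <= C" for n k by (meson order_trans)
 have "C >= 0" using order_trans[OF _ dominated[of 0 0], of 0] by (simp add: bracket_def)
 moreover have "cmod (s n k) <= C / bracket n ^ K / bracket k ^ L" for n k using dominated[of n k] by (simp add: field_simps)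
 ultimately show thesis by (rule that)
qed

lemma rapid_matrixI:
 assumes "!!K. \<exists>C. \<forall>n k. cmod (s n k) <= C / bracket n ^ K / bracket k ^ K"
 shows "rapid_matrix s"
 unfolding rapid_matrix_def
proof
 fix K
 obtain C where "\<forall>n k. cmod (s n k) <= C / bracket n ^ K / bracket k ^ K" using assms by blast
 thus "\<exists>C. \<forall>n k. bracket n ^ K * bracket k ^ K * cmod (s n k) <= C" by (intro exI[of _ C]) (simp add: field_simps)
qed

lemma rapid_matrix_bounded:
 assumes "rapid_matrix s"
 obtains C where "C >= 0" "!!n k. cmod (s n k) <= C"
 using rapid_matrix_decay[OF assms, of 0 0] that unfolding power_0 div_by_1 by blast

lemma rapid_matrix_row:
 assumes "rapid_matrix s"
 shows "rapid (s n)"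
 unfolding rapid_def
proof
 fix K
 obtain C where "!!n k. cmod (s n k) <= C / bracket n ^ 0 / bracket k ^ K" using rapid_matrix_decay[OF assms] by blast
 thus "\<exists>C. \<forall>k. bracket k ^ K * cmod (s n k) <= C" by (intro exI[of _ C]) (simp add: field_simps)
qed

lemma rapid_matrix_abs_summable:
 assumes "rapid_matrix s"
 shows "(%(n,k). cmod (s n k)) summable_on UNIV"
proof -
 obtain C where C: "!!n k. cmod (s n k) <= C / bracket n ^ 2 / bracket k ^ 2" using rapid_matrix_decay[OF assms] by blast
 have "(%(n,k). (1 / bracket n ^ 2) * (1 / bracket k ^ 2)) summable_on UNIV"
  by (intro summable_on_product summable_on_inverse_bracket_sq) auto
 hence "(%p. C * (case p of (n,k) => (1 / bracket n ^ 2) * (1 / bracket k ^ 2))) summable_on UNIV"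
  by (rule summable_on_cmult_right)
 thus ?thesis by (rule summable_on_comparison_test) (use C in auto)
qed

lemma
 assumes s: "rapid_matrix s" and v: "!!k. cmod (v k) <= M"
 shows rapid_matrix_apply_summable: "(%k. s n k * v k) summable_on UNIV"
  and rapid_matrix_apply: "rapid (%n. INFSUM k. s n k * v k)"
proof -
 have M: "M >= 0" using order_trans[OF norm_ge_zero v] .
 have bound: "\<exists>C. \<forall>n k. cmod (s n k * v k) <= (C / bracket n ^ K) / bracket k ^ 2" for K
 proof -
  obtain C where C: "!!n k. cmod (s n k) <= C / bracket n ^ K / bracket k ^ 2" using rapid_matrix_decay[OF s] by blast
  have "cmod (s n k * v k) <= (C / bracket n ^ K / bracket k ^ 2) * M" for n k
   unfolding norm_mult by (rule mult_mono'[OF C v]) auto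
  thus ?thesis by (intro exI[of _ "C * M"]) (simp add: mult.commute)
 qed
 obtain C where "!!n k. cmod (s n k * v k) <= (C / bracket n ^ 0) / bracket k ^ 2" using bound by blast
 thus "(%k. s n k * v k) summable_on UNIV" by (rule summable_on_bracket_bound)
 show "rapid (%n. INFSUM k. s n k * v k)"
  unfolding rapid_def
 proof
  fix K
  obtain C where C: "!!n k. cmod (s n k * v k) <= (C / bracket n ^ K) / bracket k ^ 2" using bound by blast
  thus "\<exists>C. \<forall>n. bracket n ^ K * cmod (INFSUM k. s n k * v k) <= C"
   using norm_infsum_bracket_bound[OF C] by (intro exI[of _ "C * (INFSUM k. 1 / bracket k ^ 2)"]) (simp add: field_simps)
 qed
qed

lemma rapid_matrix_mult:
 assumes s: "rapid_matrix s" and r: "rapid_matrix r"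
 shows "rapid_matrix (%n k. INFSUM l. s n l * r l k)"
proof (rule rapid_matrixI)
 fix K
 obtain C where C: "C >= 0" "!!n l. cmod (s n l) <= C / bracket n ^ K / bracket l ^ 2" using rapid_matrix_decay[OF s] by blast
 obtain D where D: "D >= 0" "!!l k. cmod (r l k) <= D / bracket l ^ 0 / bracket k ^ K" using rapid_matrix_decay[OF r] by blast
 have "cmod (s n l * r l k) <= (C * D / bracket n ^ K / bracket k ^ K) / bracket l ^ 2" for n k l
  using mult_mono'[OF C(2)[of n l] D(2)[of l k]] by (simp add: norm_mult mult_ac)
 from norm_infsum_bracket_bound[OF this]
 show "\<exists>C. \<forall>n k. cmod (INFSUM l. s n l * r l k) <= C / bracket n ^ K / bracket k ^ K"
  by (intro exI[of _ "C * D * (INFSUM l. 1 / bracket l ^ 2)"]) simp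
qed

lemma rapid_matrix_add:
 assumes s: "rapid_matrix s" and r: "rapid_matrix r"
 shows "rapid_matrix (%n k. s n k + r n k)"
proof (rule rapid_matrixI)
 fix K
 obtain C where C: "!!n k. cmod (s n k) <= C / bracket n ^ K / bracket k ^ K" using rapid_matrix_decay[OF s] by blast
 obtain D where D: "!!n k. cmod (r n k) <= D / bracket n ^ K / bracket k ^ K" using rapid_matrix_decay[OF r] by blast
 have "cmod (s n k + r n k) <= (C + D) / bracket n ^ K / bracket k ^ K" for n k
  using norm_triangle_le[OF add_mono[OF C D]] by (simp add: add_divide_distrib)
 thus "\<exists>C. \<forall>n k. cmod (s n k + r n k) <= C / bracket n ^ K / bracket k ^ K" by blast
qed

lemma rapid_matrix_bracket_mult:
 assumes s: "rapid_matrix s"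
 shows "rapid_matrix (%n k. of_real (bracket k) * s n k)"
proof (rule rapid_matrixI)
 fix K
 obtain C where C: "!!n k. cmod (s n k) <= C / bracket n ^ K / bracket k ^ (K + 1)" using rapid_matrix_decay[OF s] by blast
 show "\<exists>C. \<forall>n k. cmod (of_real (bracket k) * s n k) <= C / bracket n ^ K / bracket k ^ K"
  using C by (intro exI[of _ C]) (simp add: norm_mult less_imp_le field_simps)
qed

lemma rapid_matrix_assoc:
 assumes s: "rapid_matrix s" and r: "rapid_matrix r" and v: "rapid v"
 shows "(INFSUM k. s n k * (INFSUM l. r k l * v l)) = (INFSUM l. (INFSUM k. s n k * r k l) * v l)"
proof -
 obtain R where R: "R >= 0" "!!k l. cmod (r k l) <= R" using rapid_matrix_bounded[OF r] by blast
 have "(INFSUM k. INFSUM l. s n k * (r k l * v l)) = (INFSUM l. INFSUM k. s n k * (r k l * v l))"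
 proof (rule infsum_swap_product[OF summable_on_cmult_right[OF rapid_abs_summable[OF rapid_matrix_row[OF s]], of R n] rapid_abs_summable[OF v]])
  show "cmod (s n k * (r k l * v l)) <= R * cmod (s n k) * cmod (v l)" for k l
   using mult_right_mono[OF R(2)[of k l], of "cmod (s n k) * cmod (v l)"] by (simp add: norm_mult mult_ac)
 qed (use R in auto)
 thus ?thesis unfolding infsum_cmult_right' infsum_cmult_left'[symmetric] by (simp add: mult.assoc)
qed

section \<open>Vector derivatives and difference quotients\<close>

lemma has_vector_derivative_iff_slope:
 fixes f :: "real => 'a::real_normed_vector"
 shows "(f has_vd D) (at x within S) \<longleftrightarrow> ((%y. (f y - f x) /\<^sub>R (y - x)) \<longlongrightarrow> D) (at x within S)"
proof -
 have "(f has_vd D) (at x within S) \<longleftrightarrow> ((%y. norm (f y - f x - (y - x) *\<^sub>R D) / norm (y - x)) \<longlongrightarrow> 0) (at x within S)"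
  by (simp add: has_vector_derivative_def has_derivative_iff_norm bounded_linear_scaleR_left)
 also have "... \<longleftrightarrow> ((%y. norm ((f y - f x) /\<^sub>R (y - x) - D)) \<longlongrightarrow> 0) (at x within S)"
 proof (rule Lim_cong_within)
  fix y assume "y \<noteq> x"
  hence "(f y - f x) /\<^sub>R (y - x) - D = (f y - f x - (y - x) *\<^sub>R D) /\<^sub>R (y - x)"
   by (simp add: scaleR_diff_right)
  thus "norm (f y - f x - (y - x) *\<^sub>R D) / norm (y - x) = norm ((f y - f x) /\<^sub>R (y - x) - D)"
   by (simp add: divide_inverse mult.commute)
 qed auto
 also have "... \<longleftrightarrow> ((%y. (f y - f x) /\<^sub>R (y - x)) \<longlongrightarrow> D) (at x within S)"
  by (simp add: tendsto_norm_zero_iff LIM_zero_iff)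
 finally show ?thesis .
qed

lemma isCont_quotient_of_simple_zeros:
 fixes f d :: "real => 'a::real_normed_field"
 assumes f: "!!t. (f has_vd f' t) (at t)" and d: "!!t. (d has_vd d' t) (at t)"
  and zero: "!!t. d t = 0 ==> f t = 0 \<and> d' t \<noteq> 0"
 shows "isCont (%t. if d t = 0 then f' t / d' t else f t / d t) t"
proof (cases "d t = 0")
 case False
 have cont: "isCont f t" "isCont d t" using f d has_vector_derivative_continuous by blast+
 with False have "isCont (%s. f s / d s) t" by (intro continuous_intros)
 moreover have "\<forall>\<^sub>F s in nhds t. d s \<noteq> 0"
  using False cont(2) by (simp add: continuous_at tendsto_imp_eventually_ne eventually_nhds_conv_at)
 hence "\<forall>\<^sub>F s in nhds t. f s / d s = (if d s = 0 then f' s / d' s else f s / d s)"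
  by eventually_elim simp
 ultimately show ?thesis by (simp cong: isCont_cong)
next
 case True
 hence zeros: "f t = 0" "d' t \<noteq> 0" using zero by auto
 note slopes = f[of t, unfolded has_vector_derivative_iff_slope] d[of t, unfolded has_vector_derivative_iff_slope]
 have "\<forall>\<^sub>F s in at t. (d s - d t) /\<^sub>R (s - t) \<noteq> 0"
  by (rule tendsto_imp_eventually_ne[OF slopes(2) zeros(2)])
 hence "\<forall>\<^sub>F s in at t. ((f s - f t) /\<^sub>R (s - t)) / ((d s - d t) /\<^sub>R (s - t)) = (if d s = 0 then f' s / d' s else f s / d s)"
  using eventually_neq_at_within[of t t UNIV]
  by eventually_elim (use True zeros in \<open>auto simp: scaleR_conv_of_real\<close>)
 with tendsto_divide[OF slopes zeros(2)]
 have "((%s. if d s = 0 then f' s / d' s else f s / d s) \<longlongrightarrow> f' t / d' t) (at t)"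
  by (rule Lim_transform_eventually)
 thus ?thesis using True by (simp add: isCont_def)
qed

lemma has_vector_derivative_cis:
 assumes "(\<phi> has_real_derivative d) (at x within S)"
 shows "((%x. cis (c * \<phi> x)) has_vd \<i> * of_real (c * d) * cis (c * \<phi> x)) (at x within S)"
proof -
 have "((%x. cis (c * \<phi> x)) has_derivative (%t. (c * (d * t)) *\<^sub>R (\<i> * cis (c * \<phi> x)))) (at x within S)"
  using assms by (auto intro!: derivative_eq_intros simp: has_field_derivative_def)
 thus ?thesis
  by (simp add: has_vector_derivative_def scaleR_conv_of_real mult_ac)
qed

section \<open>Fourier inversion in a reparametrised circle\<close>

locale circle_param =
 fixes \<phi> w :: "real => real"
 assumes deriv_phi: "!!x. (\<phi> has_real_derivative w x) (at x)"
  and w_pos: "!!x. w x > 0" and w_cont: "continuous_on UNIV w"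
  and phi_period: "!!x. \<phi> (x + 2 * pi) = \<phi> x + 2 * pi"
begin

lemma continuous_on_weight [continuous_intros]: "continuous_on S w"
 using w_cont continuous_on_subset by blast

lemma continuous_on_phi [continuous_intros]: "continuous_on S \<phi>"
 by (meson DERIV_continuous_on deriv_phi has_field_derivative_at_within)

lemma phi_strict_mono: "x < y ==> \<phi> x < \<phi> y"
 by (meson DERIV_pos_imp_increasing deriv_phi w_pos)

lemma phi_plus_2pi_int: "\<phi> (x + of_int m * (2 * pi)) = \<phi> x + of_int m * (2 * pi)"
proof -
 interpret periodic_fun_simple "%x. \<phi> x - x" "2 * pi" by unfold_locales (simp add: phi_period)
 show ?thesis using plus_of_int[of x m] by (simp add: algebra_simps)
qed

lemma cis_phi_period: "cis (of_int n * \<phi> (t + 2 * pi)) = cis (of_int n * \<phi> t)"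
proof -
 have "of_int n * \<phi> (t + 2 * pi) = of_int n * \<phi> t + 2 * pi * of_int n"
  unfolding phi_period by (simp add: algebra_simps)
 thus ?thesis by (simp add: cis_multiple_2pi flip: cis_mult)
qed

definition phi_fourier :: "(real => complex) => cseq" where
 "phi_fourier f n = integral {0..2*pi} (%t. f t * cis (- (of_int n * \<phi> t)) * of_real (w t)) / of_real (2*pi)"

lemma integral_cis_phi:
 "integral {0..2*pi} (%t. cis (of_int m * \<phi> t) * of_real (w t)) = (if m = 0 then 2 * pi else 0)"
proof (cases "m = 0")
 case True
 have "((%t. of_real (w t)) has_integral complex_of_real (\<phi> (2*pi)) - of_real (\<phi> 0)) {0..2*pi}"
  by (rule fundamental_theorem_of_calculus)
   (auto intro!: has_vector_derivative_of_real DERIV_subset[OF deriv_phi])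
 thus ?thesis using True phi_period[of 0] by (simp add: integral_unique)
next
 case False
 have "((%t. (1 / (\<i> * of_int m)) * cis (of_int m * \<phi> t)) has_vd cis (of_int m * \<phi> t) * of_real (w t))
   (at t within {0..2*pi})" for t
  using has_vector_derivative_mult_right[OF has_vector_derivative_cis[OF DERIV_subset[OF deriv_phi[of t]]],
   of "{0..2*pi}" "1 / (\<i> * of_int m)" "of_int m"] False by (simp add: mult_ac)
 hence "((%t. cis (of_int m * \<phi> t) * of_real (w t)) has_integral
   1 / (\<i> * of_int m) * cis (of_int m * \<phi> (2*pi)) - 1 / (\<i> * of_int m) * cis (of_int m * \<phi> 0)) {0..2*pi}"
  by (intro fundamental_theorem_of_calculus) auto
 thus ?thesis using False cis_phi_period[of m 0] by (simp add: integral_unique)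
qed

definition phi_poly :: "int set => cseq => real => complex" where
 "phi_poly F a t = (\<Sum>n\<in>F. a n * cis (of_int n * \<phi> t))"

lemma continuous_on_phi_poly [continuous_intros]: "continuous_on S (phi_poly F a)"
 unfolding phi_poly_def by (intro continuous_intros)

lemma phi_fourier_phi_poly:
 assumes "finite F"
 shows "phi_fourier (phi_poly F a) n = (if n \<in> F then a n else 0)"
proof -
 have "cis (of_int (m - n) * \<phi> t) = cis (of_int m * \<phi> t) * cis (- (of_int n * \<phi> t))" for m t
  by (simp add: cis_mult algebra_simps)
 hence "integral {0..2*pi} (%t. phi_poly F a t * cis (- (of_int n * \<phi> t)) * of_real (w t))
   = integral {0..2*pi} (%t. \<Sum>m\<in>F. a m * (cis (of_int (m - n) * \<phi> t) * of_real (w t)))"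
  by (simp add: phi_poly_def sum_distrib_right sum_distrib_left mult_ac del: of_int_diff)
 also have "... = (\<Sum>m\<in>F. a m * integral {0..2*pi} (%t. cis (of_int (m - n) * \<phi> t) * of_real (w t)))"
  by (intro integral_unique has_integral_sum assms has_integral_mult_right integrable_integral
    integrable_continuous_interval continuous_intros)
 also have "... = 2 * pi * (if n \<in> F then a n else 0)"
  unfolding integral_cis_phi using assms by (simp add: if_distrib sum.delta cong: if_cong)
 finally show ?thesis by (simp add: phi_fourier_def)
qed

lemma integral_mult_cnj_phi_poly:
 assumes "continuous_on {0..2*pi} h" and "finite F"
 shows "integral {0..2*pi} (%t. h t * cnj (phi_poly F a t) * of_real (w t)) = 2 * pi * (\<Sum>n\<in>F. cnj (a n) * phi_fourier h n)"
proof -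
 have "integral {0..2*pi} (%t. h t * cnj (phi_poly F a t) * of_real (w t))
   = integral {0..2*pi} (%t. \<Sum>n\<in>F. cnj (a n) * (h t * cis (- (of_int n * \<phi> t)) * of_real (w t)))"
  by (simp add: phi_poly_def sum_distrib_left sum_distrib_right mult_ac cis_cnj)
 also have "... = (\<Sum>n\<in>F. cnj (a n) * integral {0..2*pi} (%t. h t * cis (- (of_int n * \<phi> t)) * of_real (w t)))"
  by (subst integral_sum) (auto intro!: integrable_continuous_interval continuous_intros assms)
 finally show ?thesis by (simp add: phi_fourier_def sum_distrib_left mult_ac)
qed

lemma bessel_inequality:
 assumes g: "continuous_on {0..2*pi} g" and F: "finite F"
 shows "(\<Sum>n\<in>F. (cmod (phi_fourier g n))\<^sup>2) <= integral {0..2*pi} (%t. (cmod (g t))\<^sup>2 * w t) / (2*pi)"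
proof -
 define P where "P = phi_poly F (phi_fourier g)"
 define S where "S = (\<Sum>n\<in>F. (cmod (phi_fourier g n))\<^sup>2)"
 note [continuous_intros] = g
 have P_cont [continuous_intros]: "continuous_on {0..2*pi} P"
  unfolding P_def by (intro continuous_intros)
 have "(\<Sum>n\<in>F. cnj (phi_fourier g n) * phi_fourier g n) = of_real S"
  unfolding S_def by (simp add: complex_norm_square mult.commute del: of_real_power)
 hence gP: "((%t. g t * cnj (P t) * of_real (w t)) has_integral of_real (2 * pi * S)) {0..2*pi}"
  and PP: "((%t. P t * cnj (P t) * of_real (w t)) has_integral of_real (2 * pi * S)) {0..2*pi}"
  using integral_mult_cnj_phi_poly[OF g F, of "phi_fourier g"] integral_mult_cnj_phi_poly[OF P_cont F, of "phi_fourier g"]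
  by (simp_all add: has_integral_iff P_def phi_fourier_phi_poly[OF F] integrable_continuous_interval continuous_intros)
 have "0 <= integral {0..2*pi} (%t. (cmod (g t - P t))\<^sup>2 * w t)"
  using w_pos by (intro integral_nonneg integrable_continuous_interval continuous_intros) (simp add: less_imp_le)
 also have "... = integral {0..2*pi} (%t. (cmod (g t))\<^sup>2 * w t
   - 2 * Re (g t * cnj (P t) * of_real (w t)) + Re (P t * cnj (P t) * of_real (w t)))"
  by (intro arg_cong[where f="integral _"] ext) (simp add: cmod_power2, simp add: power2_eq_square algebra_simps)
 also have "... = integral {0..2*pi} (%t. (cmod (g t))\<^sup>2 * w t) - 2 * Re (of_real (2 * pi * S)) + Re (of_real (2 * pi * S))"
  by (intro integral_unique has_integral_add has_integral_diff has_integral_mult_right has_integral_Re gP PP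
    integrable_integral integrable_continuous_interval continuous_intros)
 finally show ?thesis by (simp add: S_def field_simps)
qed

lemma riemann_lebesgue:
 assumes g: "continuous_on {0..2*pi} g" and h: "inj h"
 shows "(%n::nat. phi_fourier g (h n)) \<longlonglongrightarrow> 0"
proof -
 have "summable (%n. (cmod (phi_fourier g (h n)))\<^sup>2)"
 proof (rule bounded_imp_summable)
  fix n
  have "(\<Sum>k\<le>n. (cmod (phi_fourier g (h k)))\<^sup>2) = (\<Sum>k\<in>h ` {..n}. (cmod (phi_fourier g k))\<^sup>2)"
   using h by (subst sum.reindex) (auto simp: inj_on_def)
  thus "(\<Sum>k\<le>n. (cmod (phi_fourier g (h k)))\<^sup>2) <= integral {0..2*pi} (%t. (cmod (g t))\<^sup>2 * w t) / (2*pi)"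
   using bessel_inequality[OF g, of "h ` {..n}"] by simp
 qed auto
 hence "(%n. (cmod (phi_fourier g (h n)))\<^sup>2) \<longlonglongrightarrow> 0" by (rule summable_LIMSEQ_zero)
 hence "(%n. sqrt ((cmod (phi_fourier g (h n)))\<^sup>2)) \<longlonglongrightarrow> sqrt 0" by (intro tendsto_intros)
 thus ?thesis by (simp add: tendsto_norm_zero_iff)
qed

lemma phi_eq_imp_translate:
 assumes "cis (\<phi> t - \<phi> x) = 1"
 obtains m :: int where "t = x + of_int m * (2 * pi)"
proof -
 obtain m :: int where "\<phi> t - \<phi> x = of_int m * (2 * pi)" using assms unfolding cis_eq_1_iff by blast
 hence "\<phi> t = \<phi> (x + of_int m * (2 * pi))" by (simp add: phi_plus_2pi_int)
 hence "t = x + of_int m * (2 * pi)" using phi_strict_mono by (metis less_irrefl linorder_neqE_linordered_idom)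
 thus thesis by (rule that)
qed

lemma phi_fourier_factor:
 assumes g: "continuous_on {0..2*pi} g" and f: "!!t. f t = z + g t * (cis (\<phi> t - \<phi> x) - 1)"
 shows "phi_fourier f n = (if n = 0 then z else 0) + (cis (- \<phi> x) * phi_fourier g (n - 1) - phi_fourier g n)"
proof -
 note [continuous_intros] = g
 have "cis (\<phi> t - \<phi> x) * cis (- (of_int n * \<phi> t)) = cis (- \<phi> x) * cis (- (of_int (n - 1) * \<phi> t))" for t
  by (simp add: cis_mult algebra_simps)
 hence "f t * cis (- (of_int n * \<phi> t)) * of_real (w t) = z * (cis (of_int (- n) * \<phi> t) * of_real (w t))
   + (cis (- \<phi> x) * (g t * cis (- (of_int (n - 1) * \<phi> t)) * of_real (w t))
    - g t * cis (- (of_int n * \<phi> t)) * of_real (w t))" for t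
  unfolding f[of t] ring_distribs mult.assoc by (simp add: algebra_simps del: cis_mult)
 hence "integral {0..2*pi} (%t. f t * cis (- (of_int n * \<phi> t)) * of_real (w t))
   = z * integral {0..2*pi} (%t. cis (of_int (- n) * \<phi> t) * of_real (w t))
   + (cis (- \<phi> x) * integral {0..2*pi} (%t. g t * cis (- (of_int (n - 1) * \<phi> t)) * of_real (w t))
    - integral {0..2*pi} (%t. g t * cis (- (of_int n * \<phi> t)) * of_real (w t)))"
  by (simp only:) (intro integral_unique has_integral_add has_integral_diff has_integral_mult_right integrable_integral
    integrable_continuous_interval continuous_intros)
 thus ?thesis by (subst (asm) integral_cis_phi) (auto simp: phi_fourier_def field_simps)
qed

text \<open>Chernoff's argument: dividing \<open>f - f x\<close> by \<open>cis (\<phi> - \<phi> x) - 1\<close> turns the partial sums into a telescope.\<close>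

lemma phi_fourier_telescope:
 assumes per: "!!x. f (x + 2 * pi) = f x" and deriv: "!!x. (f has_vd f' x) (at x)"
 obtains \<gamma> where "!!n. phi_fourier f n * cis (of_int n * \<phi> x) = (if n = 0 then f x else 0) + (\<gamma> (n - 1) - \<gamma> n)"
  "!!h::nat => int. inj h ==> (%n. \<gamma> (h n)) \<longlonglongrightarrow> 0"
proof -
 interpret periodic_fun_simple f "2 * pi" by unfold_locales (rule per)
 define d where "d t = cis (\<phi> t - \<phi> x) - 1" for t
 define d' where "d' t = \<i> * of_real (w t) * cis (\<phi> t - \<phi> x)" for t
 define g where "g t = (if d t = 0 then f' t / d' t else (f t - f x) / d t)" for t
 define \<gamma> where "\<gamma> n = cis (of_int n * \<phi> x) * phi_fourier g n" for n
 have zero: "f t - f x = 0 \<and> d' t \<noteq> 0" if t: "d t = 0" for t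
 proof
  obtain m where "t = x + of_int m * (2 * pi)"
   by (rule phi_eq_imp_translate[of t x]) (use t in \<open>simp add: d_def\<close>)
  thus "f t - f x = 0" by (simp add: plus_of_int)
  show "d' t \<noteq> 0" using w_pos[of t] by (simp add: d'_def)
 qed
 have f_deriv: "((%t. f t - f x) has_vd f' t) (at t)" for t
  using has_vector_derivative_diff[OF deriv has_vector_derivative_const] by force
 have d_deriv: "(d has_vd d' t) (at t)" for t
 proof -
  have "((%t. cis (1 * (\<phi> t - \<phi> x))) has_vd \<i> * of_real (1 * w t) * cis (1 * (\<phi> t - \<phi> x))) (at t)"
   by (rule has_vector_derivative_cis) (auto intro!: derivative_eq_intros deriv_phi)
  from has_vector_derivative_diff[OF this has_vector_derivative_const[of 1]] show ?thesis
   by (simp add: d_def[abs_def] d'_def)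
 qed
 have g_cont: "continuous_on {0..2*pi} g"
  using isCont_quotient_of_simple_zeros[OF f_deriv d_deriv zero] unfolding g_def[abs_def]
  by (intro continuous_at_imp_continuous_on) blast
 have "f t = f x + g t * (cis (\<phi> t - \<phi> x) - 1)" for t
  using zero[of t] by (auto simp: g_def d_def)
 note factor = phi_fourier_factor[OF g_cont this]
 show thesis
 proof (rule that[of \<gamma>])
  fix n
  have "cis (- \<phi> x) * cis (of_int n * \<phi> x) = cis (of_int (n - 1) * \<phi> x)"
   by (simp add: cis_mult algebra_simps)
  thus "phi_fourier f n * cis (of_int n * \<phi> x) = (if n = 0 then f x else 0) + (\<gamma> (n - 1) - \<gamma> n)"
   unfolding factor[of n] \<gamma>_def by (auto simp: algebra_simps simp del: cis_mult)
 next
  show "(%n. \<gamma> (h n)) \<longlonglongrightarrow> 0" if "inj h" for h :: "nat => int"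
   using tendsto_norm_zero[OF riemann_lebesgue[OF g_cont that]]
   by (intro tendsto_norm_zero_cancel[of "%n. \<gamma> (h n)"]) (simp add: \<gamma>_def norm_mult)
 qed
qed

theorem inversion:
 assumes per: "!!x. f (x + 2 * pi) = f x"
  and deriv: "!!x. (f has_vd f' x) (at x)"
  and summable: "phi_fourier f summable_on UNIV"
 shows "f x = (INFSUM n. phi_fourier f n * cis (of_int n * \<phi> x))"
proof -
 obtain \<gamma> where \<gamma>: "!!n. phi_fourier f n * cis (of_int n * \<phi> x) = (if n = 0 then f x else 0) + (\<gamma> (n - 1) - \<gamma> n)"
  "!!h::nat => int. inj h ==> (%n. \<gamma> (h n)) \<longlonglongrightarrow> 0"
  using phi_fourier_telescope[OF per deriv] by blast
 have telescope: "(\<Sum>n\<in>{- int M..int M}. \<gamma> (n - 1) - \<gamma> n) = \<gamma> (- int M - 1) - \<gamma> (int M)" for M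
 proof (induction M)
  case (Suc M)
  have "{- int (Suc M)..int (Suc M)} = insert (int (Suc M)) (insert (- int (Suc M)) {- int M..int M})" by auto
  moreover have "\<gamma> (- int M - 1) = \<gamma> (- 1 - int M)" by (rule arg_cong[where f=\<gamma>]) simp
  ultimately show ?case using Suc by (simp add: algebra_simps)
 qed simp
 have partial: "(\<Sum>n\<in>{- int M..int M}. phi_fourier f n * cis (of_int n * \<phi> x)) = f x + (\<gamma> (- int M - 1) - \<gamma> (int M))" for M
  by (simp add: \<gamma>(1) sum.distrib telescope)
 have "(%n. phi_fourier f n * cis (of_int n * \<phi> x)) summable_on UNIV"
  using summable by (simp add: summable_on_iff_abs_summable_on_complex norm_mult)
 hence "((%F. \<Sum>n\<in>F. phi_fourier f n * cis (of_int n * \<phi> x)) \<longlongrightarrow> (INFSUM n. phi_fourier f n * cis (of_int n * \<phi> x)))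
   (finite_subsets_at_top UNIV)"
  by (rule infsum_tendsto)
 from filterlim_compose[OF this filterlim_symmetric_Icc_finite_subsets]
 have "(%M. f x + (\<gamma> (- int M - 1) - \<gamma> (int M))) \<longlonglongrightarrow> (INFSUM n. phi_fourier f n * cis (of_int n * \<phi> x))"
  unfolding partial .
 moreover have "(%M. f x + (\<gamma> (- int M - 1) - \<gamma> (int M))) \<longlonglongrightarrow> f x + (0 - 0)"
  by (intro tendsto_intros \<gamma>(2)) (simp_all add: inj_on_def)
 ultimately have "(INFSUM n. phi_fourier f n * cis (of_int n * \<phi> x)) = f x + (0 - 0)" by (rule LIMSEQ_unique)
 thus ?thesis by simp
qed

end
section \<open>Fourier coefficients\<close>

interpretation id_circle: circle_param "%x. x" "%_. 1"
 by unfold_locales (auto intro!: derivative_eq_intros)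

lemma exp_eq_cis: "exp (- \<i> * of_int k * of_real t) = cis (- (of_int k * t))"
 "exp (\<i> * of_int k * of_real t) = cis (of_int k * t)"
 by (simp_all add: cis_conv_exp mult_ac)

lemma fourier_cis: "fourier u k = integral {0..2*pi} (%t. u t * cis (- (of_int k * t))) / of_real (2*pi)"
 unfolding fourier_def exp_eq_cis ..

lemma fourier_eq_phi_fourier: "fourier u k = id_circle.phi_fourier u k"
 by (simp add: fourier_cis id_circle.phi_fourier_def)

lemma fourier_inversion:
 assumes "!!x. f (x + 2 * pi) = f x" "!!x. (f has_vd f' x) (at x)"
  and "fourier f summable_on UNIV"
 shows "f x = (INFSUM n. fourier f n * cis (of_int n * x))"
 using id_circle.inversion[of f f' x] assms unfolding fourier_eq_phi_fourier[abs_def] by simp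

lemma norm_fourier_le:
 assumes "continuous_on {0..2*pi} u" "!!t. t \<in> {0..2*pi} ==> cmod (u t) <= B"
 shows "cmod (fourier u k) <= B"
proof -
 have "cmod (integral {0..2*pi} (%t. u t * cis (- (of_int k * t)))) <= B * (2 * pi - 0)"
  by (rule integral_bound) (auto intro!: continuous_intros assms simp: norm_mult)
 thus ?thesis by (simp add: fourier_cis norm_divide field_simps)
qed

lemma has_sum_fourier:
 assumes "!!x. continuous_on {0..2*pi} (f x)" "!!x t. t \<in> {0..2*pi} ==> cmod (f x t) <= M x" "M summable_on UNIV"
 shows "((%x. fourier (f x) k) has_sum fourier (%t. INFSUM x. f x t) k) UNIV"
proof -
 have "((%x. integral {0..2*pi} (%t. f x t * cis (- (of_int k * t)))) has_sum
   integral {0..2*pi} (%t. INFSUM x. f x t * cis (- (of_int k * t)))) UNIV"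
  using assms by (intro has_sum_integral[where M=M]) (auto intro!: continuous_intros simp: norm_mult)
 hence "((%x. integral {0..2*pi} (%t. f x t * cis (- (of_int k * t))) / of_real (2*pi)) has_sum
   integral {0..2*pi} (%t. INFSUM x. f x t * cis (- (of_int k * t))) / of_real (2*pi)) UNIV"
  by (rule has_sum_divide_const)
 thus ?thesis by (simp add: fourier_cis infsum_cmult_left')
qed

lemma fourier_cis_int: "fourier (%t. cis (of_int n * t)) k = (if k = n then 1 else 0)"
proof -
 have "fourier (%t. cis (of_int n * t)) k = integral {0..2*pi} (%t. cis (of_int (n - k) * t) * of_real 1) / of_real (2*pi)"
  by (simp add: fourier_cis cis_mult algebra_simps)
 thus ?thesis using id_circle.integral_cis_phi[of "n - k"] by simp
qed

lemma fourier_cmult: "fourier (%t. c * u t) k = c * fourier u k"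
 by (simp add: fourier_cis mult.assoc)

lemma fourier_sum:
 assumes "!!x. x \<in> X ==> continuous_on {0..2*pi} (f x)"
 shows "fourier (%t. \<Sum>x\<in>X. f x t) k = (\<Sum>x\<in>X. fourier (f x) k)"
proof (cases "finite X")
 case True
 have "integral {0..2*pi} (%t. \<Sum>x\<in>X. f x t * cis (- (of_int k * t))) = (\<Sum>x\<in>X. integral {0..2*pi} (%t. f x t * cis (- (of_int k * t))))"
  using assms True by (intro integral_sum integrable_continuous_interval continuous_intros) auto
 thus ?thesis by (simp add: fourier_cis sum_distrib_right sum_divide_distrib)
qed (simp add: fourier_cis)

lemma fourier_shift: "fourier (%t. cis (of_int j * t) * u t) k = fourier u (k - j)"
 by (simp add: fourier_cis cis_mult algebra_simps mult.left_commute)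

lemma cnj_fourier: "cnj (fourier u k) = fourier (%t. cnj (u t)) (- k)"
 by (simp add: fourier_cis integral_cnj cis_cnj)

lemma fourier_series:
 assumes "(%n. cmod (a n)) summable_on UNIV"
 shows "fourier (%t. INFSUM n. a n * cis (of_int n * t)) k = a k"
proof -
 have "((%n. fourier (%t. a n * cis (of_int n * t)) k) has_sum fourier (%t. INFSUM n. a n * cis (of_int n * t)) k) UNIV"
  by (rule has_sum_fourier[OF _ _ assms]) (auto intro!: continuous_intros simp: norm_mult)
 moreover have "((%n. fourier (%t. a n * cis (of_int n * t)) k) has_sum a k) UNIV"
  unfolding fourier_cmult fourier_cis_int
  by (rule has_sum_finite_neutralI[of "{k}"]) (auto split: if_splits)
 ultimately show ?thesis using has_sum_unique by blast
qed

lemma cis_int_period: "cis (of_int k * (t + 2 * pi)) = cis (of_int k * t)"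
 by (rule id_circle.cis_phi_period)

lemma has_vector_derivative_cis_int:
 "((%t. cis (of_int k * t)) has_vd \<i> * of_int k * cis (of_int k * t)) (at t within S)"
 using has_vector_derivative_cis[of "%x. x" 1 t S "of_int k"] by (auto intro!: derivative_eq_intros)

lemma fourier_deriv:
 assumes per: "u (2 * pi) = u 0"
  and deriv: "!!x. (u has_vd u' x) (at x)" and cont: "continuous_on {0..2*pi} u'"
 shows "fourier u' k = \<i> * of_int k * fourier u k"
proof -
 have u_cont: "continuous_on {0..2*pi} u"
  using deriv by (meson has_vector_derivative_continuous continuous_at_imp_continuous_on)
 have cis_deriv: "((%t. cis (- (of_int k * t))) has_vd - \<i> * of_int k * cis (- (of_int k * t))) (at t within S)" for t S
  using has_vector_derivative_cis_int[of "- k"] by simp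
 have "((%t. u t * (- \<i> * of_int k * cis (- (of_int k * t))) + u' t * cis (- (of_int k * t))) has_integral
  u (2*pi) * cis (- (of_int k * (2*pi))) - u 0 * cis (- (of_int k * 0))) {0..2*pi}"
  by (intro fundamental_theorem_of_calculus has_vector_derivative_mult cis_deriv has_vector_derivative_at_within[OF deriv]) auto
 moreover have "cis (- (of_int k * (2*pi))) = 1"
  using cis_int_period[of "- k" 0] by simp
 ultimately have "integral {0..2*pi} (%t. u t * (- \<i> * of_int k * cis (- (of_int k * t))) + u' t * cis (- (of_int k * t))) = 0"
  using per by (simp add: integral_unique)
 moreover have "integral {0..2*pi} (%t. (- \<i> * of_int k) * (u t * cis (- (of_int k * t))) + u' t * cis (- (of_int k * t)))
  = (- \<i> * of_int k) * integral {0..2*pi} (%t. u t * cis (- (of_int k * t))) + integral {0..2*pi} (%t. u' t * cis (- (of_int k * t)))"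
  by (intro integral_unique has_integral_add has_integral_mult_right integrable_integral integrable_continuous_interval
    continuous_intros u_cont cont)
 ultimately have "integral {0..2*pi} (%t. u' t * cis (- (of_int k * t))) = \<i> * of_int k * integral {0..2*pi} (%t. u t * cis (- (of_int k * t)))"
  by (simp add: mult_ac add_eq_0_iff)
 thus ?thesis by (simp add: fourier_cis)
qed

lemma has_sum_parseval:
 assumes a: "(%n. cmod (a n)) summable_on UNIV" and v: "continuous_on {0..2*pi} v"
 shows "((%n. a n * cnj (fourier v n)) has_sum
  integral {0..2*pi} (%t. (INFSUM n. a n * cis (of_int n * t)) * cnj (v t)) / of_real (2*pi)) UNIV"
proof -
 have "bounded (v ` {0..2*pi})" using v compact_continuous_image compact_imp_bounded by blast
 then obtain B where B: "!!t. t \<in> {0..2*pi} ==> cmod (v t) <= B" unfolding bounded_iff by blast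
 have "((%n. fourier (%t. a n * cis (of_int n * t) * cnj (v t)) 0) has_sum
   fourier (%t. INFSUM n. a n * cis (of_int n * t) * cnj (v t)) 0) UNIV"
  by (rule has_sum_fourier[where M="%n. cmod (a n) * B"])
   (auto intro!: continuous_intros v a summable_on_cmult_left mult_left_mono B simp: norm_mult)
 moreover have "fourier (%t. a n * cis (of_int n * t) * cnj (v t)) 0 = a n * cnj (fourier v n)" for n
  using fourier_cmult[of "a n" "%t. cis (of_int n * t) * cnj (v t)" 0] fourier_shift[of n "%t. cnj (v t)" 0]
  by (simp add: cnj_fourier mult.assoc)
 ultimately show ?thesis by (simp add: fourier_cis infsum_cmult_left')
qed

lemma translate_into_period:
 obtains m :: int where "t + of_int m * (2 * pi) \<in> {0..2*pi}"
proof (rule that[of "- \<lfloor>t / (2 * pi)\<rfloor>"])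
 define m where "m = \<lfloor>t / (2 * pi)\<rfloor>"
 have "of_int m <= t / (2 * pi)" "t / (2 * pi) < of_int m + 1" unfolding m_def by linarith+
 hence "of_int m * (2 * pi) <= t" "t < (of_int m + 1) * (2 * pi)" by (simp_all add: field_simps)
 thus "t + of_int (- \<lfloor>t / (2 * pi)\<rfloor>) * (2 * pi) \<in> {0..2*pi}" by (simp add: m_def ring_distribs)
qed

section \<open>Positive trigonometric polynomials and the change of variables\<close>

definition trig_poly :: "nat => cseq => real => complex" where
 "trig_poly N a t = (\<Sum>k\<in>freqs N. a k * cis (of_int k * t))"

lemma continuous_on_trig_poly [continuous_intros]: "continuous_on S (trig_poly N a)"
 unfolding trig_poly_def by (intro continuous_intros)

lemma trig_poly_period: "trig_poly N a (t + 2 * pi) = trig_poly N a t"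
 unfolding trig_poly_def cis_int_period ..

lemma has_vector_derivative_trig_poly:
 "(trig_poly N a has_vd trig_poly N (%k. \<i> * of_int k * a k) t) (at t within S)"
proof -
 have "((%t. \<Sum>k\<in>freqs N. a k * cis (of_int k * t)) has_vd
  (\<Sum>k\<in>freqs N. a k * (\<i> * of_int k * cis (of_int k * t)))) (at t within S)"
  by (intro has_vector_derivative_sum has_vector_derivative_mult_right has_vector_derivative_cis_int)
 thus ?thesis by (simp add: trig_poly_def[abs_def] mult_ac)
qed

lemma fourier_trig_poly: "fourier (trig_poly N a) k = (if \<bar>k\<bar> <= int N then a k else 0)"
 unfolding trig_poly_def[abs_def]
 by (subst fourier_sum) (auto intro!: continuous_intros simp: fourier_cmult fourier_cis_int if_distrib cong: if_cong)

locale pos_trig_poly =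
 fixes N :: nat and bc :: cseq and b \<phi> :: "real => real"
 assumes band: "!!k. \<bar>k\<bar> > int N ==> bc k = 0"
  and b_eq_trig_poly: "!!t. of_real (b t) = trig_poly N bc t"
  and b_pos: "!!t. b t > 0"
  and phi_deriv: "!!t. (\<phi> has_real_derivative 1 / b t) (at t)"
  and phi_plus_2pi: "!!t. \<phi> (t + 2 * pi) = \<phi> t + 2 * pi"
begin

lemma b_eq_Re: "b t = Re (trig_poly N bc t)" using b_eq_trig_poly[of t] by (metis Re_complex_of_real)

lemma continuous_on_b [continuous_intros]: "continuous_on S b"
 unfolding b_eq_Re[abs_def] by (intro continuous_intros)

lemma b_nonzero [simp]: "b t \<noteq> 0" using b_pos[of t] by simp

sublocale circle_param \<phi> "%t. 1 / b t"
 by unfold_locales (auto intro!: continuous_intros phi_deriv phi_plus_2pi b_pos)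

lemma b_period: "b (t + 2 * pi) = b t"
 by (simp add: b_eq_Re trig_poly_period)

lemma fourier_b: "fourier (cx b) k = bc k"
 using band[of k] unfolding cx_def b_eq_trig_poly fourier_trig_poly by auto

lemma cnj_bc: "cnj (bc k) = bc (- k)"
 using cnj_fourier[of "cx b" k] unfolding fourier_b by (simp add: cx_def flip: fourier_b)

definition mode :: "int => real => complex" where "mode n t = cis (of_int n * \<phi> t)"
definition mode_coef :: "int => cseq" where "mode_coef n l = fourier (mode n) l"

lemma continuous_on_mode [continuous_intros]: "continuous_on S (mode n)"
 unfolding mode_def by (intro continuous_intros)

lemma has_vector_derivative_mode: "(mode n has_vd \<i> * of_int n * (1 / of_real (b t)) * mode n t) (at t within S)"
 using has_vector_derivative_cis[OF DERIV_subset[OF phi_deriv], where c="of_int n"] by (simp add: mode_def[abs_def])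

lemma mode_period: "mode n (t + 2 * pi) = mode n t"
 unfolding mode_def by (rule cis_phi_period)

lemma norm_mode_coef_le_1: "cmod (mode_coef n l) <= 1"
 unfolding mode_coef_def by (rule norm_fourier_le) (auto intro!: continuous_intros simp: mode_def)

lemma mode_coef_0: "mode_coef 0 l = (if l = 0 then 1 else 0)"
 using fourier_cis_int[of 0 l] by (simp add: mode_coef_def mode_def[abs_def])

lemma fourier_mode_deriv: "fourier (%t. \<i> * of_int n * (1 / of_real (b t)) * mode n t) m = \<i> * of_int m * mode_coef n m"
 unfolding mode_coef_def using mode_period[of n 0]
 by (intro fourier_deriv has_vector_derivative_mode) (auto intro!: continuous_intros)

lemma mode_coef_recursion:
 "(\<Sum>j\<in>freqs N. bc j * of_int (l - j) * mode_coef n (l - j)) = of_int n * mode_coef n l"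
proof -
 define u where "u t = \<i> * of_int n * (1 / of_real (b t)) * mode n t" for t
 have u_cont: "continuous_on S u" for S unfolding u_def by (intro continuous_intros) auto
 have fourier_u: "fourier u m = \<i> * of_int m * mode_coef n m" for m
  unfolding u_def by (rule fourier_mode_deriv)
 have "\<i> * of_int n * mode n t = of_real (b t) * u t" for t by (simp add: u_def)
 hence "fourier (%t. \<i> * of_int n * mode n t) l = fourier (%t. \<Sum>j\<in>freqs N. bc j * (cis (of_int j * t) * u t)) l"
  by (simp add: b_eq_trig_poly trig_poly_def sum_distrib_right mult.assoc)
 also have "... = (\<Sum>j\<in>freqs N. bc j * (\<i> * of_int (l - j) * mode_coef n (l - j)))"
  by (subst fourier_sum) (auto intro!: continuous_intros u_cont simp: fourier_cmult fourier_shift fourier_u)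
 finally have "\<i> * (of_int n * mode_coef n l) = \<i> * (\<Sum>j\<in>freqs N. bc j * of_int (l - j) * mode_coef n (l - j))"
  unfolding fourier_cmult mode_coef_def[symmetric] by (simp add: sum_distrib_left mult_ac)
 thus ?thesis by simp
qed

lemma b_lower_bound: obtains \<delta> where "\<delta> > 0" "!!t. b t >= \<delta>"
proof -
 interpret periodic_fun_simple b "2 * pi" by unfold_locales (rule b_period)
 obtain s where s: "!!t. t \<in> {0..2*pi} ==> b s <= b t"
  using continuous_attains_inf[of "{0..2*pi}" b, OF compact_Icc _ continuous_on_b] by force
 have "b s <= b t" for t
  by (rule translate_into_period[of t]) (metis s plus_of_int)
 thus ?thesis using that[OF b_pos] by blast
qed

end

locale pos_trig_family =
 fixes I :: "'i set" and N :: nat and \<delta> M :: real and bc :: "'i => cseq" and b \<phi> :: "'i => real => real"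
 assumes member: "!!i. i \<in> I ==> pos_trig_poly N (bc i) (b i) (\<phi> i)"
  and b_ge: "!!i t. i \<in> I ==> b i t >= \<delta>" and delta_pos: "\<delta> > 0"
  and bc_bound: "!!i k. i \<in> I ==> cmod (bc i k) <= M"
begin

abbreviation coefs where "coefs i \<equiv> pos_trig_poly.mode_coef (\<phi> i)"

text \<open>The phase \<open>n * \<phi> - l * t\<close> has derivative \<open>l * (n / l - b) / b\<close>, which does not vanish if \<open>n / l <= \<delta> / 2\<close>.\<close>

definition nonstationary :: "int => int => bool" where
 "nonstationary n l \<longleftrightarrow> l \<noteq> 0 \<and> real_of_int n / real_of_int l <= \<delta> / 2"

definition osc :: "'i => int => int => real => complex" where
 "osc i n l t = cis (of_int n * \<phi> i t - of_int l * t)"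

text \<open>The amplitudes produced by repeated integration by parts against \<open>osc\<close>, as functions of the slope \<open>s = n / l\<close>;
 everything in the class is bounded uniformly in \<open>i\<close> and \<open>s <= \<delta> / 2\<close>.\<close>

inductive amplitude :: "('i => real => real => complex) => bool" where
 const: "(!!i. i \<in> I ==> cmod (f i) <= C) ==> amplitude (%i s t. f i)"
| cis: "amplitude (%i s t. cis (of_int k * t))"
| inverse: "amplitude (%i s t. inverse (of_real (b i t) - of_real s))"
| add: "amplitude f ==> amplitude g ==> amplitude (%i s t. f i s t + g i s t)"
| mult: "amplitude f ==> amplitude g ==> amplitude (%i s t. f i s t * g i s t)"

lemma amplitude_sum: "finite X ==> (!!x. x \<in> X ==> amplitude (f x)) ==> amplitude (%i s t. \<Sum>x\<in>X. f x i s t)"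
proof (induction X rule: finite_induct)
 case empty
 show ?case using amplitude.const[of "%_. 0" 0] by simp
next
 case (insert x X)
 thus ?case using amplitude.add[of "f x" "%i s t. \<Sum>x\<in>X. f x i s t"] by simp
qed

lemma amplitude_trig_poly:
 assumes "!!i k. i \<in> I ==> cmod (a i k) <= C k"
 shows "amplitude (%i s t. trig_poly N (a i) t)"
 unfolding trig_poly_def using assms
 by (intro amplitude_sum amplitude.mult amplitude.cis) (auto intro: amplitude.const[of "%i. a i k" "C k" for k])

lemma b_minus_slope_ge: "i \<in> I ==> s <= \<delta>/2 ==> \<delta>/2 <= b i t - s"
 using b_ge[of i t] by (simp add: field_simps)

lemma b_minus_slope_nonzero: "i \<in> I ==> s <= \<delta>/2 ==> complex_of_real (b i t) - of_real s \<noteq> 0"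
 using b_minus_slope_ge[of i s t] delta_pos by (auto simp flip: of_real_diff)

lemma amplitude_bounded: "amplitude g ==> \<exists>C. \<forall>i\<in>I. \<forall>s\<le>\<delta>/2. \<forall>t. cmod (g i s t) <= C"
proof (induction rule: amplitude.induct)
 case (const f C)
 thus ?case by blast
next
 case (cis k)
 thus ?case by (intro exI[of _ 1]) simp
next
 case inverse
 show ?case
 proof (intro exI[of _ "inverse (\<delta> / 2)"] ballI allI impI)
  fix i s t assume "i \<in> I" "s <= \<delta>/2"
  hence "\<delta> / 2 <= \<bar>b i t - s\<bar>" using b_minus_slope_ge[of i s t] by linarith
  moreover have "cmod (inverse (of_real (b i t) - of_real s)) = inverse \<bar>b i t - s\<bar>"
   by (metis norm_inverse norm_of_real of_real_diff)
  ultimately show "cmod (inverse (of_real (b i t) - of_real s)) <= inverse (\<delta> / 2)"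
   using delta_pos by (simp only:) (intro le_imp_inverse_le, auto)
 qed
next
 case (add f g)
 then obtain C D where "\<forall>i\<in>I. \<forall>s\<le>\<delta>/2. \<forall>t. cmod (f i s t) <= C" "\<forall>i\<in>I. \<forall>s\<le>\<delta>/2. \<forall>t. cmod (g i s t) <= D" by blast
 thus ?case by (intro exI[of _ "C + D"] ballI allI impI norm_triangle_le add_mono) auto
next
 case (mult f g)
 then obtain C D where "\<forall>i\<in>I. \<forall>s\<le>\<delta>/2. \<forall>t. cmod (f i s t) <= C" "\<forall>i\<in>I. \<forall>s\<le>\<delta>/2. \<forall>t. cmod (g i s t) <= D" by blast
 thus ?case by (intro exI[of _ "C * D"] ballI allI impI) (auto simp: norm_mult intro!: mult_mono' )
qed

lemma amplitude_period: "amplitude g ==> i \<in> I ==> g i s (t + 2 * pi) = g i s t"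
 by (induction arbitrary: rule: amplitude.induct) (auto simp: cis_int_period pos_trig_poly.b_period[OF member])

lemma inverse_amplitude_deriv:
 assumes i: "i \<in> I" and s: "s <= \<delta>/2"
 shows "((%t. inverse (of_real (b i t) - of_real s)) has_vd
  - 1 * (trig_poly N (%k. \<i> * of_int k * bc i k) t *
   (inverse (of_real (b i t) - of_real s) * inverse (of_real (b i t) - of_real s)))) (at t)"
proof -
 have "((%t. complex_of_real (b i t) - of_real s) has_vd trig_poly N (%k. \<i> * of_int k * bc i k) t) (at t)"
  unfolding pos_trig_poly.b_eq_trig_poly[OF member[OF i]]
  using has_vector_derivative_diff[OF has_vector_derivative_trig_poly has_vector_derivative_const] by force
 from field_vector_diff_chain_at[OF this DERIV_inverse[OF b_minus_slope_nonzero[OF i s]]]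
 show ?thesis by (simp add: o_def)
qed

lemma amplitude_deriv:
 "amplitude g ==> \<exists>g'. amplitude g' \<and> (\<forall>i\<in>I. \<forall>s\<le>\<delta>/2. \<forall>t. (g i s has_vd g' i s t) (at t))"
proof (induction rule: amplitude.induct)
 case (const f C)
 have "amplitude (%i s t. 0)" using amplitude.const[of "%_. 0" 0] by simp
 thus ?case by (intro exI[of _ "%i s t. 0"]) auto
next
 case (cis k)
 have "amplitude (%i s t. \<i> * of_int k * cis (of_int k * t))"
  by (intro amplitude.mult amplitude.cis amplitude.const[of "%_. \<i>" 1] amplitude.const[of "%_. of_int k" "cmod (of_int k)"]) auto
 thus ?case by (intro exI[of _ "%i s t. \<i> * of_int k * cis (of_int k * t)"]) (auto intro!: has_vector_derivative_cis_int)
next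
 case inverse
 have "amplitude (%i s t. - 1 * (trig_poly N (%k. \<i> * of_int k * bc i k) t *
   (inverse (of_real (b i t) - of_real s) * inverse (of_real (b i t) - of_real s))))"
  by (intro amplitude.mult amplitude.inverse amplitude.const[of "%_. - 1" 1] amplitude_trig_poly[where C="%k. \<bar>of_int k\<bar> * M"])
   (auto simp: norm_mult intro!: mult_left_mono bc_bound)
 thus ?case using inverse_amplitude_deriv by blast
next
 case (add f g)
 then obtain f' g' where "amplitude f'" "\<forall>i\<in>I. \<forall>s\<le>\<delta>/2. \<forall>t. (f i s has_vd f' i s t) (at t)"
  "amplitude g'" "\<forall>i\<in>I. \<forall>s\<le>\<delta>/2. \<forall>t. (g i s has_vd g' i s t) (at t)" by blast
 thus ?case
  by (intro exI[of _ "%i s t. f' i s t + g' i s t"] conjI amplitude.add ballI allI impI has_vector_derivative_add) auto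
next
 case (mult f g)
 then obtain f' g' where "amplitude f'" "\<forall>i\<in>I. \<forall>s\<le>\<delta>/2. \<forall>t. (f i s has_vd f' i s t) (at t)"
  "amplitude g'" "\<forall>i\<in>I. \<forall>s\<le>\<delta>/2. \<forall>t. (g i s has_vd g' i s t) (at t)" by blast
 thus ?case using mult
  by (intro exI[of _ "%i s t. f i s t * g' i s t + f' i s t * g i s t"] conjI amplitude.add amplitude.mult ballI allI impI
    has_vector_derivative_mult) auto
qed

lemma amplitude_continuous: "amplitude g ==> i \<in> I ==> s <= \<delta>/2 ==> continuous_on S (g i s)"
 using amplitude_deriv by (meson has_vector_derivative_continuous continuous_at_imp_continuous_on)

lemma has_vector_derivative_osc:
 assumes "i \<in> I"
 shows "(osc i n l has_vd \<i> * of_real (of_int n / b i t - of_int l) * osc i n l t) (at t)"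
proof -
 interpret pos_trig_poly N "bc i" "b i" "\<phi> i" by (rule member[OF assms])
 have "((%t. of_int n * \<phi> i t - of_int l * t) has_real_derivative of_int n / b i t - of_int l) (at t)"
  by (auto intro!: derivative_eq_intros phi_deriv)
 from has_vector_derivative_cis[OF this, of 1] show ?thesis by (simp add: osc_def[abs_def])
qed

lemma continuous_on_osc: "i \<in> I ==> continuous_on S (osc i n l)"
 by (meson has_vector_derivative_osc has_vector_derivative_continuous continuous_at_imp_continuous_on)

lemma osc_2pi:
 assumes "i \<in> I"
 shows "osc i n l (2 * pi) = osc i n l 0"
proof -
 interpret pos_trig_poly N "bc i" "b i" "\<phi> i" by (rule member[OF assms])
 show ?thesis using cis_phi_period[of n 0] cis_int_period[of l 0] by (simp add: osc_def flip: cis_divide)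
qed

lemma integration_by_parts:
 assumes g: "amplitude g"
 obtains g' where "amplitude g'"
  "!!i n l. i \<in> I ==> nonstationary n l ==> integral {0..2*pi} (%t. g' i (of_int n / of_int l) t * osc i n l t)
   = \<i> * of_int l * integral {0..2*pi} (%t. g i (of_int n / of_int l) t * osc i n l t)"
proof -
 define h where "h i s t = g i s t * (trig_poly N (bc i) t * inverse (of_real (b i t) - of_real s))" for i s t
 have h: "amplitude h" unfolding h_def[abs_def]
  by (intro amplitude.mult[of g] amplitude.mult[of "%i s t. trig_poly N (bc i) t"] g amplitude.inverse
    amplitude_trig_poly[where a=bc and C="%_. M"] bc_bound)
 then obtain h' where h': "amplitude h'" "\<forall>i\<in>I. \<forall>s\<le>\<delta>/2. \<forall>t. (h i s has_vd h' i s t) (at t)"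
  using amplitude_deriv by blast
 show thesis
 proof (rule that[OF h'(1)])
  fix i and n l :: int assume i: "i \<in> I" and nl: "nonstationary n l"
  interpret pos_trig_poly N "bc i" "b i" "\<phi> i" by (rule member[OF i])
  define s where "s = real_of_int n / real_of_int l"
  have s: "s <= \<delta>/2" and n: "of_int n = complex_of_real s * of_int l" using nl by (auto simp: s_def nonstationary_def)
  note cont = amplitude_continuous[OF g i s] amplitude_continuous[OF h'(1) i s] continuous_on_osc[OF i]
  let ?D = "%t. h' i s t * osc i n l t - \<i> * of_int l * (g i s t * osc i n l t)"
  have deriv: "((%t. h i s t * osc i n l t) has_vd ?D t) (at t)" for t
  proof -
   have "h i s t * (\<i> * of_real (of_int n / b i t - of_int l) * osc i n l t) = - \<i> * of_int l * (g i s t * osc i n l t)"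
    unfolding h_def b_eq_trig_poly[symmetric] using b_minus_slope_nonzero[OF i s, of t] n by (simp add: field_simps)
   thus ?thesis using has_vector_derivative_mult[OF h'(2)[rule_format, OF i s, of t] has_vector_derivative_osc[OF i, of n l t]] by simp
  qed
  have "(?D has_integral
    h i s (2*pi) * osc i n l (2*pi) - h i s 0 * osc i n l 0) {0..2*pi}"
   by (intro fundamental_theorem_of_calculus has_vector_derivative_at_within[OF deriv]) auto
  hence "integral {0..2*pi} ?D = 0"
   using amplitude_period[OF h i, of s 0] osc_2pi[OF i] by (simp add: integral_unique)
  moreover have "integral {0..2*pi} ?D
   = integral {0..2*pi} (%t. h' i s t * osc i n l t) - \<i> * of_int l * integral {0..2*pi} (%t. g i s t * osc i n l t)"
   by (intro integral_unique has_integral_diff has_integral_mult_right integrable_integral integrable_continuous_interval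
     continuous_intros cont)
  ultimately show "integral {0..2*pi} (%t. h' i (of_int n / of_int l) t * osc i n l t)
    = \<i> * of_int l * integral {0..2*pi} (%t. g i (of_int n / of_int l) t * osc i n l t)" by (simp add: s_def)
 qed
qed

lemma osc_integral_decay:
 "amplitude g ==> \<exists>C. \<forall>i\<in>I. \<forall>n l. nonstationary n l \<longrightarrow>
  \<bar>real_of_int l\<bar> ^ K * cmod (integral {0..2*pi} (%t. g i (of_int n / of_int l) t * osc i n l t)) <= C"
proof (induction K arbitrary: g)
 case 0
 obtain C where C: "\<forall>i\<in>I. \<forall>s\<le>\<delta>/2. \<forall>t. cmod (g i s t) <= C" using amplitude_bounded[OF 0] by blast
 have "cmod (integral {0..2*pi} (%t. g i (of_int n / of_int l) t * osc i n l t)) <= C * (2 * pi - 0)"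
  if "i \<in> I" "nonstationary n l" for i n l
  using that C by (intro integral_bound continuous_intros amplitude_continuous[OF 0] continuous_on_osc)
   (auto simp: norm_mult osc_def nonstationary_def)
 thus ?case by (intro exI[of _ "C * (2 * pi - 0)"]) simp
next
 case (Suc K)
 obtain g' where g': "amplitude g'"
  "!!i n l. i \<in> I ==> nonstationary n l ==> integral {0..2*pi} (%t. g' i (of_int n / of_int l) t * osc i n l t)
   = \<i> * of_int l * integral {0..2*pi} (%t. g i (of_int n / of_int l) t * osc i n l t)"
  using integration_by_parts[OF Suc.prems] by blast
 show ?case using Suc.IH[OF g'(1)] g'(2) by (simp add: norm_mult mult_ac)
qed

lemma coefs_eq_osc_integral: "i \<in> I ==> coefs i n l = integral {0..2*pi} (osc i n l) / of_real (2*pi)"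
 by (simp add: pos_trig_poly.mode_coef_def[OF member] pos_trig_poly.mode_def[OF member] fourier_cis cis_mult osc_def[abs_def])

lemma coefs_nonstationary_decay:
 "\<exists>C\<ge>0. \<forall>i\<in>I. \<forall>n l. l = 0 \<or> nonstationary n l \<longrightarrow> bracket l ^ K * cmod (coefs i n l) <= C"
proof -
 have "amplitude (%i s t. 1)" using amplitude.const[of "%_. 1" 1] by simp
 from osc_integral_decay[OF this, of K] obtain C where C: "\<forall>i\<in>I. \<forall>n l. nonstationary n l \<longrightarrow>
  \<bar>real_of_int l\<bar> ^ K * cmod (integral {0..2*pi} (%t. 1 * osc i n l t)) <= C" by (elim exE)
 show ?thesis
 proof (intro exI[of _ "2 ^ K * (1 + (1 + \<bar>C / (2 * pi)\<bar>))"] conjI ballI allI impI bracket_power_mult_le norm_ge_zero)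
  fix i n l assume i: "i \<in> I" and nl: "l = 0 \<or> nonstationary n l"
  show le_1: "cmod (coefs i n l) <= 1" by (rule pos_trig_poly.norm_mode_coef_le_1[OF member[OF i]])
  show "\<bar>real_of_int l\<bar> ^ K * cmod (coefs i n l) <= 1 + \<bar>C / (2 * pi)\<bar>"
  proof (cases "l = 0")
   case True
   hence "\<bar>real_of_int l\<bar> ^ K * cmod (coefs i n l) <= 1" using le_1 by (auto simp: power_0_left)
   thus ?thesis by linarith
  next
   case False
   with nl have "\<bar>real_of_int l\<bar> ^ K * cmod (integral {0..2*pi} (osc i n l)) / (2 * pi) <= C / (2 * pi)"
    using C i by (intro divide_right_mono) auto
   hence "\<bar>real_of_int l\<bar> ^ K * cmod (coefs i n l) <= C / (2 * pi)"
    using coefs_eq_osc_integral[OF i, of n l] by (simp add: norm_divide)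
   thus ?thesis by linarith
  qed
 qed auto
qed

lemma coefs_index_decay_abs: "\<exists>C\<ge>0. \<forall>i\<in>I. \<forall>n l. \<bar>real_of_int n\<bar> ^ K * cmod (coefs i n l) <= C * bracket l ^ K"
proof (induction K)
 case 0
 show ?case using pos_trig_poly.norm_mode_coef_le_1[OF member] by (intro exI[of _ 1]) auto
next
 case (Suc K)
 then obtain C where C: "C >= 0" "!!i n l. i \<in> I ==> \<bar>real_of_int n\<bar> ^ K * cmod (coefs i n l) <= C * bracket l ^ K" by blast
 define C' where "C' = (\<Sum>j\<in>freqs N. \<bar>M\<bar> * C * bracket j ^ Suc K)"
 show ?case
 proof (intro exI[of _ C'] conjI ballI allI)
  show "C' >= 0" unfolding C'_def using C by (intro sum_nonneg) (auto simp: less_imp_le)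
  fix i n l assume i: "i \<in> I"
  interpret pos_trig_poly N "bc i" "b i" "\<phi> i" by (rule member[OF i])
  have "\<bar>real_of_int n\<bar> ^ Suc K * cmod (mode_coef n l)
    = \<bar>real_of_int n\<bar> ^ K * cmod (\<Sum>j\<in>freqs N. bc i j * of_int (l - j) * mode_coef n (l - j))"
   unfolding mode_coef_recursion by (simp add: norm_mult)
  also have "... <= \<bar>real_of_int n\<bar> ^ K * (\<Sum>j\<in>freqs N. cmod (bc i j * of_int (l - j) * mode_coef n (l - j)))"
   by (intro mult_left_mono norm_sum) auto
  also have "... = (\<Sum>j\<in>freqs N. cmod (bc i j) * (\<bar>real_of_int (l - j)\<bar> * (\<bar>real_of_int n\<bar> ^ K * cmod (mode_coef n (l - j)))))"
   by (simp add: sum_distrib_left norm_mult mult_ac del: of_int_diff)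
  also have "... <= (\<Sum>j\<in>freqs N. \<bar>M\<bar> * (bracket (l - j) * (C * bracket (l - j) ^ K)))"
  proof (intro sum_mono mult_mono[of "cmod x" for x] mult_mono[of "\<bar>x\<bar>" for x] abs_le_bracket C(2)[OF i])
   show "cmod (bc i j) <= \<bar>M\<bar>" for j using bc_bound[OF i, of j] by linarith
  qed (use C(1) in \<open>auto simp: less_imp_le\<close>)
  also have "... = (\<Sum>j\<in>freqs N. \<bar>M\<bar> * C * bracket (l - j) ^ Suc K)" by (simp add: mult_ac)
  also have "... <= (\<Sum>j\<in>freqs N. \<bar>M\<bar> * C * (bracket l * bracket j) ^ Suc K)"
   using C(1) by (intro sum_mono mult_left_mono power_mono bracket_diff_le) (auto simp: less_imp_le)
  also have "... = C' * bracket l ^ Suc K"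
   by (simp add: C'_def sum_distrib_right sum_distrib_left power_mult_distrib mult_ac)
  finally show "\<bar>real_of_int n\<bar> ^ Suc K * cmod (mode_coef n l) <= C' * bracket l ^ Suc K" .
 qed
qed

lemma coefs_index_decay: "\<exists>C\<ge>0. \<forall>i\<in>I. \<forall>n l. bracket n ^ K * cmod (coefs i n l) <= C * bracket l ^ K"
proof -
 obtain C where C: "C >= 0" "!!i n l. i \<in> I ==> \<bar>real_of_int n\<bar> ^ K * cmod (coefs i n l) <= C * bracket l ^ K"
  using coefs_index_decay_abs by blast
 have "bracket n ^ K * cmod (coefs i n l) <= 2 ^ K * (1 * bracket l ^ K + C * bracket l ^ K)" if "i \<in> I" for i n l
 proof (intro bracket_power_mult_le norm_ge_zero C that)
  show "cmod (coefs i n l) <= 1 * bracket l ^ K"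
   using pos_trig_poly.norm_mode_coef_le_1[OF member[OF that], of n l] bracket_power_ge_1[of l K] by linarith
 qed
 thus ?thesis using C(1) by (intro exI[of _ "2 ^ K * (1 + C)"]) (simp add: distrib_right mult.assoc)
qed

lemma coefs_opposite_sign_decay:
 "\<exists>C\<ge>0. \<forall>i\<in>I. \<forall>n l. n * l <= 0 \<longrightarrow> bracket n ^ K * bracket l ^ K * cmod (coefs i n l) <= C"
proof -
 obtain C where C: "C >= 0" "!!i n l. i \<in> I ==> l = 0 \<or> nonstationary n l ==> bracket l ^ (4*K) * cmod (coefs i n l) <= C"
  using coefs_nonstationary_decay[of "4*K"] by meson
 obtain D where D: "D >= 0" "!!i n l. i \<in> I ==> bracket n ^ (2*K) * cmod (coefs i n l) <= D * bracket l ^ (2*K)"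
  using coefs_index_decay[of "2*K"] by meson
 show ?thesis
 proof (intro exI[of _ "sqrt (D * C)"] conjI ballI allI impI real_le_rsqrt)
  fix i and n l :: int assume i: "i \<in> I" and nl: "n * l <= 0"
  let ?x = "cmod (coefs i n l)"
  have "real_of_int n / real_of_int l <= 0"
   using nl by (auto simp: mult_le_0_iff divide_le_0_iff)
  also have "0 <= \<delta> / 2" using delta_pos by simp
  finally have "l = 0 \<or> nonstationary n l" unfolding nonstationary_def by blast
  hence l_decay: "bracket l ^ (4*K) * ?x <= C" by (rule C(2)[OF i])
  have "(bracket n ^ K * bracket l ^ K * ?x)\<^sup>2 = (bracket n ^ (2*K) * ?x) * (bracket l ^ (2*K) * ?x)"
   by (simp add: power2_eq_square power_mult) (simp add: power_mult_distrib power2_eq_square mult_ac)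
  also have "... <= (D * bracket l ^ (2*K)) * (bracket l ^ (2*K) * ?x)"
   by (intro mult_right_mono D(2) i) (auto simp: less_imp_le)
  also have "... = D * (bracket l ^ (4*K) * ?x)"
   by (simp add: mult_ac flip: power_add)
  also have "... <= D * C" using l_decay D by (intro mult_left_mono)
  finally show "(bracket n ^ K * bracket l ^ K * ?x)\<^sup>2 <= D * C" .
 qed (use C D in auto)
qed

lemma coefs_freq_decay: "\<exists>C\<ge>0. \<forall>i\<in>I. \<forall>n l. bracket l ^ K * cmod (coefs i n l) <= C * bracket n ^ K"
proof -
 obtain C where C: "C >= 0" "!!i n l. i \<in> I ==> l = 0 \<or> nonstationary n l ==> bracket l ^ K * cmod (coefs i n l) <= C"
  using coefs_nonstationary_decay[of K] by meson
 show ?thesis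
 proof (intro exI[of _ "C + (1 + 2 / \<delta>) ^ K"] conjI ballI allI)
  fix i and n l :: int assume i: "i \<in> I"
  show "bracket l ^ K * cmod (coefs i n l) <= (C + (1 + 2 / \<delta>) ^ K) * bracket n ^ K"
  proof (cases "l = 0 \<or> nonstationary n l")
   case True
   hence "bracket l ^ K * cmod (coefs i n l) <= C * 1" using C(2) i by simp
   also have "... <= (C + (1 + 2 / \<delta>) ^ K) * bracket n ^ K"
    using C delta_pos by (intro mult_mono bracket_power_ge_1) auto
   finally show ?thesis .
  next
   case False
   hence "l \<noteq> 0" "\<delta>/2 < \<bar>real_of_int n / real_of_int l\<bar>" unfolding nonstationary_def by (simp, linarith)
   hence "\<delta> * \<bar>real_of_int l\<bar> < 2 * \<bar>real_of_int n\<bar>" by (simp add: abs_divide field_simps)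
   hence "bracket l <= 1 + 2 / \<delta> * \<bar>real_of_int n\<bar>" using delta_pos by (simp add: bracket_def field_simps)
   also have "... <= (1 + 2 / \<delta>) * bracket n" using delta_pos by (simp add: bracket_def algebra_simps add_divide_distrib)
   finally have "bracket l ^ K <= ((1 + 2 / \<delta>) * bracket n) ^ K" by (intro power_mono) (auto simp: less_imp_le)
   hence "bracket l ^ K * cmod (coefs i n l) <= ((1 + 2 / \<delta>) * bracket n) ^ K * 1"
    using pos_trig_poly.norm_mode_coef_le_1[OF member[OF i]] delta_pos by (intro mult_mono) (auto simp: less_imp_le)
   also have "... <= (C + (1 + 2 / \<delta>) ^ K) * bracket n ^ K"
    unfolding power_mult_distrib using C(1) by (simp add: distrib_right less_imp_le)
   finally show ?thesis .
  qed
 qed (use C delta_pos in auto)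
qed

end

section \<open>The matrix of the operator in the new variable\<close>

lemma two_sided_decay:
 assumes "a >= (0::real)" "b >= 0" "x >= 0" "a ^ (2*K) * x <= C" "b ^ (2*K) * x <= D" "C >= 0"
 shows "a ^ K * b ^ K * x <= sqrt (C * D)"
proof (rule real_le_rsqrt)
 have "(a ^ K * b ^ K * x)\<^sup>2 = (a ^ (2*K) * x) * (b ^ (2*K) * x)"
  by (simp add: power2_eq_square power_mult) (simp add: power_mult_distrib power2_eq_square mult_ac)
 also have "... <= C * D" using assms by (intro mult_mono) auto
 finally show "(a ^ K * b ^ K * x)\<^sup>2 <= C * D" .
qed

context pos_trig_poly
begin

lemma bc_bounded: obtains M where "M >= 0" "!!k. cmod (bc k) <= M"
proof (rule that[of "\<Sum>k\<in>freqs N. cmod (bc k)"])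
 fix k
 show "cmod (bc k) <= (\<Sum>k\<in>freqs N. cmod (bc k))"
 proof (cases "\<bar>k\<bar> <= int N")
  case True
  thus ?thesis by (intro member_le_sum) auto
 next
  case False
  thus ?thesis using band[of k] by (auto simp: sum_nonneg)
 qed
qed (simp add: sum_nonneg)

lemma singleton_family: obtains \<delta> M where "pos_trig_family {()} N \<delta> M (%_. bc) (%_. b) (%_. \<phi>)"
proof -
 obtain \<delta> where \<delta>: "\<delta> > 0" "!!t. b t >= \<delta>" using b_lower_bound by blast
 obtain M where "!!k. cmod (bc k) <= M" using bc_bounded by blast
 hence "pos_trig_family {()} N \<delta> M (%_. bc) (%_. b) (%_. \<phi>)"
  using \<delta> pos_trig_poly_axioms by unfold_locales (auto simp: pos_trig_poly_def)
 thus ?thesis by (rule that)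
qed

lemma mode_coef_opposite_sign_decay:
 obtains C where "C >= 0" "!!n l. n * l <= 0 ==> bracket n ^ K * bracket l ^ K * cmod (mode_coef n l) <= C"
proof -
 obtain \<delta> M where "pos_trig_family {()} N \<delta> M (%_. bc) (%_. b) (%_. \<phi>)" by (rule singleton_family)
 from pos_trig_family.coefs_opposite_sign_decay[OF this, of K] that show thesis by auto
qed

lemma mode_coef_freq_decay:
 obtains C where "C >= 0" "!!n l. bracket l ^ K * cmod (mode_coef n l) <= C * bracket n ^ K"
proof -
 obtain \<delta> M where "pos_trig_family {()} N \<delta> M (%_. bc) (%_. b) (%_. \<phi>)" by (rule singleton_family)
 from pos_trig_family.coefs_freq_decay[OF this, of K] that show thesis by auto
qed

lemma mode_coef_index_decay:
 obtains C where "C >= 0" "!!n l. bracket n ^ K * cmod (mode_coef n l) <= C * bracket l ^ K"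
proof -
 obtain \<delta> M where "pos_trig_family {()} N \<delta> M (%_. bc) (%_. b) (%_. \<phi>)" by (rule singleton_family)
 from pos_trig_family.coefs_index_decay[OF this, of K] that show thesis by auto
qed

lemma mode_coef_index_summable: "(%n. cmod (mode_coef n l)) summable_on UNIV"
proof -
 obtain C where "C >= 0" "!!n l. bracket n ^ 2 * cmod (mode_coef n l) <= C * bracket l ^ 2"
  using mode_coef_index_decay[where K=2] by blast
 hence "norm (mode_coef n l) <= (C * bracket l ^ 2) / bracket n ^ 2" for n by (simp add: field_simps)
 thus ?thesis by (rule abs_summable_on_bracket_bound)
qed

lemma mode_coef_freq_summable: "(%l. \<bar>real_of_int l\<bar> * cmod (mode_coef k l)) summable_on UNIV"
proof -
 obtain C where C: "C >= 0" "!!n l. bracket l ^ 3 * cmod (mode_coef n l) <= C * bracket n ^ 3"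
  using mode_coef_freq_decay[where K=3] by blast
 have "norm (\<bar>real_of_int l\<bar> * cmod (mode_coef k l)) <= (C * bracket k ^ 3) / bracket l ^ 2" for l
 proof -
  have "\<bar>real_of_int l\<bar> * cmod (mode_coef k l) * bracket l ^ 2 <= bracket l * cmod (mode_coef k l) * bracket l ^ 2"
   by (intro mult_right_mono abs_le_bracket) auto
  also have "... <= C * bracket k ^ 3" using C(2)[of l k] by (simp add: power3_eq_cube power2_eq_square mult_ac)
  finally show ?thesis by (simp add: field_simps)
 qed
 from summable_on_bracket_bound[OF this] show ?thesis .
qed

lemma mode_coef_completeness: "((%n. mode_coef n l * cnj (mode_coef n k)) has_sum bc (l - k)) UNIV"
proof -
 define f where "f t = of_real (b t) * cis (of_int k * t)" for t
 have coef: "phi_fourier f n = cnj (mode_coef n k)" for n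
  by (simp add: phi_fourier_def f_def mode_coef_def mode_def[abs_def] fourier_cis integral_cnj cis_cnj mult_ac)
 have summable: "(%n. cmod (cnj (mode_coef n k))) summable_on UNIV" using mode_coef_index_summable by simp
 have period: "f (t + 2 * pi) = f t" for t by (simp add: f_def b_period cis_int_period)
 have deriv: "(f has_vd (trig_poly N bc t * (\<i> * of_int k * cis (of_int k * t))
   + trig_poly N (%k. \<i> * of_int k * bc k) t * cis (of_int k * t))) (at t)" for t
  unfolding f_def b_eq_trig_poly
  by (intro has_vector_derivative_mult has_vector_derivative_trig_poly has_vector_derivative_cis_int)
 have expansion: "f t = (INFSUM n. cnj (mode_coef n k) * mode n t)" for t
  using inversion[of f, OF period deriv, of t] abs_summable_summable[OF summable] by (simp add: coef[abs_def] mode_def)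
 have "((%n. fourier (%t. cnj (mode_coef n k) * mode n t) l) has_sum fourier (%t. INFSUM n. cnj (mode_coef n k) * mode n t) l) UNIV"
  by (rule has_sum_fourier[OF _ _ summable]) (auto intro!: continuous_intros simp: norm_mult mode_def)
 moreover have "fourier (%t. INFSUM n. cnj (mode_coef n k) * mode n t) l = bc (l - k)"
  using fourier_shift[of k "cx b" l] fourier_b[of "l - k"] unfolding expansion[symmetric] f_def
  by (simp add: cx_def mult.commute)
 ultimately show ?thesis unfolding fourier_cmult mode_coef_def[symmetric] by (simp add: mult.commute[of "cnj x" for x])
qed

lemma mode_deriv_expansion:
 "of_int k * (1 / of_real (b t)) * mode k t = (INFSUM l. (of_int l * mode_coef k l) * cis (of_int l * t))"
proof -
 define u where "u t = of_int k * (1 / of_real (b t)) * mode k t" for t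
 have "\<i> * fourier u l = \<i> * (of_int l * mode_coef k l)" for l
  using fourier_mode_deriv[of k l] by (simp add: u_def fourier_cmult mult.assoc flip: fourier_cmult)
 hence fourier_u: "fourier u l = of_int l * mode_coef k l" for l by simp
 have period: "u (t + 2 * pi) = u t" for t by (simp add: u_def b_period mode_period)
 have b_deriv: "((%t. complex_of_real (b t)) has_vd trig_poly N (%k. \<i> * of_int k * bc k) t) (at t)" for t
  unfolding b_eq_trig_poly by (rule has_vector_derivative_trig_poly)
 have "\<exists>d. (u has_vd d) (at t)" for t
  unfolding u_def
  using has_vector_derivative_mult[OF has_vector_derivative_mult_right[OF field_vector_diff_chain_at[OF b_deriv DERIV_inverse]]
    has_vector_derivative_mode, of t "of_int k" k]
  by (auto simp: o_def inverse_eq_divide)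
 then obtain u' where deriv: "!!t. (u has_vd u' t) (at t)" by metis
 have "fourier u summable_on UNIV"
  by (rule abs_summable_summable) (use mode_coef_freq_summable[of k] in \<open>simp add: fourier_u norm_mult\<close>)
 from fourier_inversion[of u, OF period deriv this, of t] show ?thesis by (simp add: fourier_u u_def)
qed

lemma mode_coef_orthogonality:
 "((%l. of_int l * mode_coef k l * cnj (mode_coef n l)) has_sum (if k = n then of_int k else 0)) UNIV"
proof -
 have "(%l. cmod (of_int l * mode_coef k l)) summable_on UNIV"
  using mode_coef_freq_summable[of k] by (simp add: norm_mult)
 hence "((%l. (of_int l * mode_coef k l) * cnj (fourier (mode n) l)) has_sum
   integral {0..2*pi} (%t. of_int k * (1 / of_real (b t)) * mode k t * cnj (mode n t)) / of_real (2*pi)) UNIV"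
  using has_sum_parseval[of "%l. of_int l * mode_coef k l" "mode n"] unfolding mode_deriv_expansion by (simp add: continuous_intros)
 moreover have "integral {0..2*pi} (%t. of_int k * (1 / of_real (b t)) * mode k t * cnj (mode n t))
   = of_int k * integral {0..2*pi} (%t. cis (of_int (k - n) * \<phi> t) * of_real (1 / b t))"
  by (subst integral_mult_right[symmetric])
   (auto intro!: arg_cong[where f="integral _"] simp: mode_def cis_cnj cis_mult algebra_simps fun_eq_iff)
 ultimately show ?thesis
  unfolding integral_cis_phi by (auto simp: mode_coef_def[symmetric])
qed

text \<open>The entries of \<open>\<Lambda>\<close> between the modes \<open>k\<close> and \<open>n\<close>, and their deviation from \<open>|n|\<close> on the diagonal.\<close>

definition Lambda_entry :: "int => cseq" where
 "Lambda_entry n k = (INFSUM l. of_int \<bar>l\<bar> * cnj (mode_coef n l) * mode_coef k l)"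
definition remainder :: "int => cseq" where
 "remainder n k = (INFSUM l. of_int (\<bar>l\<bar> - sgn n * l) * cnj (mode_coef n l) * mode_coef k l)"

lemma Lambda_entry_summable: "(%l. of_int \<bar>l\<bar> * cnj (mode_coef n l) * mode_coef k l) summable_on UNIV"
proof (rule abs_summable_summable, rule abs_summable_dominated[OF mode_coef_freq_summable[of n]])
 show "cmod (of_int \<bar>l\<bar> * cnj (mode_coef n l) * mode_coef k l) <= \<bar>real_of_int l\<bar> * cmod (mode_coef n l)" for l
  using norm_mode_coef_le_1[of k l] by (simp add: norm_mult mult_left_le)
qed

lemma Lambda_entry_eq_remainder: "Lambda_entry n k = remainder n k + (if n = k then of_int \<bar>n\<bar> else 0)"
proof -
 have "((%l. of_int \<bar>l\<bar> * cnj (mode_coef n l) * mode_coef k l - of_int (sgn n) * (of_int l * mode_coef k l * cnj (mode_coef n l)))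
  has_sum (Lambda_entry n k - of_int (sgn n) * (if k = n then of_int k else 0))) UNIV"
  unfolding Lambda_entry_def
  by (intro has_sum_diff has_sum_infsum Lambda_entry_summable has_sum_cmult_right mode_coef_orthogonality)
 hence "remainder n k = Lambda_entry n k - of_int (sgn n) * (if k = n then of_int k else 0)"
  unfolding remainder_def by (intro infsumI) (simp add: algebra_simps)
 moreover have "complex_of_int (sgn n) * of_int n = of_int \<bar>n\<bar>"
  by (metis abs_sgn mult.commute of_int_mult)
 ultimately show ?thesis by auto
qed

lemma cnj_remainder: "cnj (remainder n k) = remainder k n"
proof -
 have "cnj (Lambda_entry n k) = Lambda_entry k n"
  unfolding Lambda_entry_def infsum_cnj[symmetric] by (simp add: mult_ac)
 thus ?thesis unfolding Lambda_entry_eq_remainder by (auto split: if_splits)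
qed

lemma remainder_term_bound:
 obtains C where "C >= 0" "!!n k l. cmod (of_int (\<bar>l\<bar> - sgn n * l) * cnj (mode_coef n l) * mode_coef k l)
   <= (C / bracket n ^ K) / bracket l ^ 2"
proof -
 obtain C where C: "C >= 0" "!!n l. n * l <= 0 ==> bracket n ^ (K + 3) * bracket l ^ (K + 3) * cmod (mode_coef n l) <= C"
  using mode_coef_opposite_sign_decay[where K="K + 3"] by blast
 let ?t = "%n k l. of_int (\<bar>l\<bar> - sgn n * l) * cnj (mode_coef n l) * mode_coef k l"
 have "cmod (?t n k l) <= (2 * C / bracket n ^ K) / bracket l ^ 2" for n k l
 proof (cases "n * l <= 0")
  case True
  have "\<bar>real_of_int (\<bar>l\<bar> - sgn n * l)\<bar> <= 2 * bracket l"
   by (auto simp: sgn_if bracket_def abs_if)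
  hence "cmod (?t n k l) <= (2 * bracket l) * cmod (mode_coef n l) * 1"
   unfolding norm_mult complex_mod_cnj norm_of_int using norm_mode_coef_le_1[of k l] by (intro mult_mono) (auto simp: less_imp_le)
  moreover have "bracket n ^ K * bracket l ^ 3 * cmod (mode_coef n l) <= bracket n ^ (K + 3) * bracket l ^ (K + 3) * cmod (mode_coef n l)"
   by (intro mult_right_mono mult_mono power_increasing bracket_ge_1) (auto simp: less_imp_le)
  hence "bracket n ^ K * bracket l ^ 3 * cmod (mode_coef n l) <= C" using C(2)[OF True] by linarith
  hence "(2 * bracket l) * cmod (mode_coef n l) <= (2 * C / bracket n ^ K) / bracket l ^ 2"
   by (simp add: field_simps power3_eq_cube power2_eq_square)
  ultimately show ?thesis by linarith
 next
  case False
  hence "\<bar>l\<bar> - sgn n * l = 0" by (auto simp: not_le zero_less_mult_iff sgn_if)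
  thus ?thesis using C by (simp add: less_imp_le)
 qed
 thus thesis using that[of "2 * C"] C(1) by simp
qed

lemma rapid_matrix_remainder: "rapid_matrix remainder"
proof -
 have row_decay: "\<exists>C\<ge>0. \<forall>n k. bracket n ^ K * cmod (remainder n k) <= C" for K
 proof -
  obtain C where C: "C >= 0" "!!n k l. cmod (of_int (\<bar>l\<bar> - sgn n * l) * cnj (mode_coef n l) * mode_coef k l)
    <= (C / bracket n ^ K) / bracket l ^ 2" using remainder_term_bound[where K=K] by blast
  have "0 <= C * (INFSUM l. 1 / bracket l ^ 2)" using C by (intro mult_nonneg_nonneg infsum_nonneg) auto
  moreover have "bracket n ^ K * cmod (remainder n k) <= C * (INFSUM l. 1 / bracket l ^ 2)" for n k
   using norm_infsum_bracket_bound[OF C(2)[where n=n and k=k]] by (simp add: remainder_def field_simps)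
  ultimately show ?thesis by blast
 qed
 show ?thesis
  unfolding rapid_matrix_def
 proof
  fix K
  obtain C where C: "C >= 0" "!!n k. bracket n ^ (2*K) * cmod (remainder n k) <= C" using row_decay by blast
  have "bracket k ^ (2*K) * cmod (remainder n k) <= C" for n k
   using C(2)[of k n] cnj_remainder[of n k] by (metis complex_mod_cnj)
  thus "\<exists>C. \<forall>n k. bracket n ^ K * bracket k ^ K * cmod (remainder n k) <= C"
   using C two_sided_decay[of "bracket n" "bracket k" "cmod (remainder n k)" K C C for n k]
   by (intro exI[of _ "sqrt (C * C)"]) (auto simp: less_imp_le)
 qed
qed

end

section \<open>The spectral theorem for forms with compact sublevel sets\<close>

lemma first_variation_eq_0:
 assumes q: "q >= 0" and nonneg: "!!z. 0 <= 2 * Re (z * d) + (cmod z)\<^sup>2 * q"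
 shows "d = 0"
proof -
 let ?z = "- of_real (1 / (q + 1)) * cnj d"
 have re: "Re (?z * d) = - ((cmod d)\<^sup>2 * (q + 1)) / (q + 1)\<^sup>2"
  using q by (simp add: cmod_power2) (simp add: power2_eq_square add_divide_distrib)
 have cm: "(cmod ?z)\<^sup>2 = (cmod d)\<^sup>2 / (q + 1)\<^sup>2"
  using q by (simp add: norm_mult norm_divide power_mult_distrib power_divide)
 have "0 <= (2 * - ((cmod d)\<^sup>2 * (q + 1)) + (cmod d)\<^sup>2 * q) / (q + 1)\<^sup>2"
  using nonneg[of ?z] unfolding re cm by (simp add: diff_divide_distrib)
 hence "(cmod d)\<^sup>2 * (q + 2) <= 0" using q by (simp add: zero_le_divide_iff algebra_simps)
 thus ?thesis using q by (simp add: mult_le_0_iff)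
qed

locale spectral_form =
 fixes V :: "'v set" and zero :: 'v and comb :: "'v => complex => 'v => 'v"
  and G B :: "'v => 'v => complex" and e :: "nat => 'v" and \<kappa> :: real
 assumes zero: "zero \<in> V" "!!v. v \<in> V ==> G zero v = 0" "!!v. v \<in> V ==> B zero v = 0"
  and comb_V: "!!v z w. v \<in> V ==> w \<in> V ==> comb v z w \<in> V"
  and G_comb: "!!v z w u. v \<in> V ==> w \<in> V ==> u \<in> V ==> G (comb v z w) u = G v u + z * G w u"
  and B_comb: "!!v z w u. v \<in> V ==> w \<in> V ==> u \<in> V ==> B (comb v z w) u = B v u + z * B w u"
  and G_cnj: "!!v u. v \<in> V ==> u \<in> V ==> G v u = cnj (G u v)"
  and B_cnj: "!!v u. v \<in> V ==> u \<in> V ==> B v u = cnj (B u v)"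
  and G_pos: "!!v. v \<in> V ==> Re (G v v) >= 0"
  and B_ge: "!!v. v \<in> V ==> Re (B v v) >= - \<kappa> * Re (G v v)"
  and e: "!!n. e n \<in> V" "!!m n. G (e m) (e n) = (if m = n then 1 else 0)"
  and compact: "!!v C c. (!!i::nat. v i \<in> V) ==> (!!i. Re (G (v i) (v i)) = 1) ==> (!!i. Re (B (v i) (v i)) <= C i) ==>
   C \<longlonglongrightarrow> c ==> \<exists>s u. strict_mono s \<and> u \<in> V \<and> Re (G u u) = 1 \<and> Re (B u u) <= c \<and>
     (\<forall>w\<in>V. (%i. G (v (s i)) w) \<longlonglongrightarrow> G u w)"
begin

lemma G_comb_right: "v \<in> V ==> w \<in> V ==> u \<in> V ==> G u (comb v z w) = G u v + cnj z * G u w"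
 using G_comb[of v w u z] G_cnj[of u] comb_V[of v w z] by (metis complex_cnj_add complex_cnj_mult)

lemma B_comb_right: "v \<in> V ==> w \<in> V ==> u \<in> V ==> B u (comb v z w) = B u v + cnj z * B u w"
 using B_comb[of v w u z] B_cnj[of u] comb_V[of v w z] by (metis complex_cnj_add complex_cnj_mult)

lemma G_real: "v \<in> V ==> G v v = of_real (Re (G v v))"
 using G_cnj[of v v] by (metis Reals_cnj_iff of_real_Re)

lemma B_real: "v \<in> V ==> B v v = of_real (Re (B v v))"
 using B_cnj[of v v] by (metis Reals_cnj_iff of_real_Re)

definition orthonormal :: "(nat => 'v) => nat => bool" where
 "orthonormal \<psi> j \<longleftrightarrow> (\<forall>i<j. \<psi> i \<in> V) \<and> (\<forall>i<j. \<forall>k<j. G (\<psi> i) (\<psi> k) = (if i = k then 1 else 0))"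

definition complement :: "(nat => 'v) => nat => 'v set" where
 "complement \<psi> j = {u \<in> V. \<forall>i<j. G u (\<psi> i) = 0}"

primrec residual :: "(nat => 'v) => 'v => nat => 'v" where
 "residual \<psi> f 0 = f"
| "residual \<psi> f (Suc j) = comb (residual \<psi> f j) (- G f (\<psi> j)) (\<psi> j)"

lemma orthonormal_V: "orthonormal \<psi> j ==> i < j ==> \<psi> i \<in> V" by (auto simp: orthonormal_def)

lemma orthonormal_Suc: "orthonormal \<psi> (Suc j) ==> orthonormal \<psi> j" by (auto simp: orthonormal_def)

lemma complement_V: "u \<in> complement \<psi> j ==> u \<in> V" by (simp add: complement_def)

lemma residual_V: "orthonormal \<psi> j ==> f \<in> V ==> residual \<psi> f j \<in> V"
proof (induction j)
 case (Suc j)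
 thus ?case using orthonormal_Suc by (auto simp: orthonormal_def intro!: comb_V)
qed simp

lemma G_residual:
 "orthonormal \<psi> j ==> f \<in> V ==> u \<in> V ==> G (residual \<psi> f j) u = G f u - (\<Sum>i<j. G f (\<psi> i) * G (\<psi> i) u)"
proof (induction j)
 case (Suc j)
 thus ?case using orthonormal_Suc[of \<psi> j] residual_V[of \<psi> j f] by (subst residual.simps, subst G_comb) (auto simp: orthonormal_def)
qed simp

lemma B_residual:
 "orthonormal \<psi> j ==> f \<in> V ==> u \<in> V ==> B (residual \<psi> f j) u = B f u - (\<Sum>i<j. G f (\<psi> i) * B (\<psi> i) u)"
proof (induction j)
 case (Suc j)
 thus ?case using orthonormal_Suc[of \<psi> j] residual_V[of \<psi> j f] by (subst residual.simps, subst B_comb) (auto simp: orthonormal_def)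
qed simp

lemma residual_complement:
 assumes o: "orthonormal \<psi> j" and f: "f \<in> V"
 shows "residual \<psi> f j \<in> complement \<psi> j"
 unfolding complement_def
proof (intro CollectI conjI allI impI residual_V[OF o f])
 fix i assume i: "i < j"
 have "(\<Sum>k<j. G f (\<psi> k) * G (\<psi> k) (\<psi> i)) = (\<Sum>k<j. if k = i then G f (\<psi> i) else 0)"
  using o i by (intro sum.cong) (auto simp: orthonormal_def)
 thus "G (residual \<psi> f j) (\<psi> i) = 0" using o i f by (subst G_residual) (auto simp: orthonormal_def)
qed

lemma norm_residual:
 assumes o: "orthonormal \<psi> j" and f: "f \<in> V"
 shows "Re (G (residual \<psi> f j) (residual \<psi> f j)) = Re (G f f) - (\<Sum>i<j. (cmod (G f (\<psi> i)))\<^sup>2)"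
proof -
 note V = residual_V[OF o f] orthonormal_V[OF o]
 have "G (residual \<psi> f j) (residual \<psi> f j) = G f (residual \<psi> f j)"
  using residual_complement[OF o f] V G_cnj[of "\<psi> i" "residual \<psi> f j" for i]
  by (subst G_residual[OF o f V(1)]) (simp add: complement_def)
 also have "... = cnj (G (residual \<psi> f j) f)" by (rule G_cnj[OF f V(1)])
 also have "G (residual \<psi> f j) f = G f f - (\<Sum>i<j. of_real ((cmod (G f (\<psi> i)))\<^sup>2))"
  using V G_cnj[OF _ f] by (subst G_residual[OF o f f]) (simp flip: complex_norm_square)
 finally show ?thesis by simp
qed

lemma bessel_G: "orthonormal \<psi> j ==> f \<in> V ==> (\<Sum>i<j. (cmod (G f (\<psi> i)))\<^sup>2) <= Re (G f f)"
 using norm_residual[of \<psi> j f] G_pos[OF residual_V[of \<psi> j f]] by simp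

lemma normalise:
 assumes u: "u \<in> complement \<psi> j" and g: "Re (G u u) > 0" and o: "orthonormal \<psi> j"
 obtains y where "y \<in> complement \<psi> j" "Re (G y y) = 1" "Re (B y y) = Re (B u u) / Re (G u u)"
proof -
 note uV = complement_V[OF u]
 define z where "z = complex_of_real (1 / sqrt (Re (G u u)))"
 define y where "y = comb zero z u"
 have zz: "z * cnj z = of_real (1 / Re (G u u))"
  using g by (simp add: z_def flip: of_real_mult)
 have yV: "y \<in> V" unfolding y_def by (intro comb_V zero uV)
 have Gy: "G y w = z * G u w" and By: "B y w = z * B u w" if "w \<in> V" for w
  using that uV zero by (simp_all add: y_def G_comb B_comb)
 have "G y y = z * (cnj z * G u u)" using Gy[OF yV] Gy[OF uV] G_cnj[OF uV yV] G_cnj[OF uV uV] by simp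
 hence "G y y = of_real (1 / Re (G u u)) * of_real (Re (G u u))" using zz G_real[OF uV] by (simp flip: mult.assoc)
 moreover have "B y y = z * (cnj z * B u u)" using By[OF yV] By[OF uV] B_cnj[OF uV yV] B_cnj[OF uV uV] by simp
 hence "B y y = of_real (1 / Re (G u u)) * of_real (Re (B u u))" using zz B_real[OF uV] by (simp flip: mult.assoc)
 moreover have "y \<in> complement \<psi> j" using u yV Gy orthonormal_V[OF o] by (auto simp: complement_def)
 ultimately show thesis using that g by simp
qed

lemma complement_nontrivial:
 assumes o: "orthonormal \<psi> j"
 obtains u where "u \<in> complement \<psi> j" "Re (G u u) > 0"
proof -
 note psi = orthonormal_V[OF o]
 have "\<exists>n. Re (G (residual \<psi> (e n) j) (residual \<psi> (e n) j)) > 0"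
 proof (rule ccontr)
  assume "\<not> ?thesis"
  hence "Re (G (residual \<psi> (e n) j) (residual \<psi> (e n) j)) = 0" for n
   using G_pos[OF residual_V[OF o e(1)]] by (meson order_antisym_conv not_le)
  hence complete: "(\<Sum>i<j. (cmod (G (e n) (\<psi> i)))\<^sup>2) = 1" for n
   using norm_residual[OF o e(1), of n] e(2)[of n n] by simp
  have e_on: "orthonormal e (Suc j)" using e by (simp add: orthonormal_def)
  have "real (Suc j) = (\<Sum>n<Suc j. \<Sum>i<j. (cmod (G (e n) (\<psi> i)))\<^sup>2)" by (simp add: complete)
  also have "... = (\<Sum>i<j. \<Sum>n<Suc j. (cmod (G (\<psi> i) (e n)))\<^sup>2)"
   using G_cnj[OF e(1) psi] by (subst sum.swap) (auto intro!: sum.cong)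
  also have "... <= (\<Sum>i<j. Re (G (\<psi> i) (\<psi> i)))"
   by (intro sum_mono bessel_G[OF e_on] psi) auto
  also have "... = real j" using o by (simp add: orthonormal_def)
  finally show False by simp
 qed
 thus thesis using that residual_complement[OF o e(1)] by blast
qed

definition minimizer :: "(nat => 'v) => nat => 'v => bool" where
 "minimizer \<psi> j v \<longleftrightarrow> v \<in> complement \<psi> j \<and> G v v = 1 \<and>
  (\<forall>u\<in>complement \<psi> j. Re (B u u) >= Re (B v v) * Re (G u u))"

lemma normalised_minimum:
 assumes o: "orthonormal \<psi> j"
 obtains v where "v \<in> complement \<psi> j" "Re (G v v) = 1"
  "!!u. u \<in> complement \<psi> j ==> Re (G u u) = 1 ==> Re (B v v) <= Re (B u u)"
proof -
 define S where "S = {Re (B u u) | u. u \<in> complement \<psi> j \<and> Re (G u u) = 1}"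
 obtain u where u: "u \<in> complement \<psi> j" "Re (G u u) > 0" by (rule complement_nontrivial[OF o])
 obtain y where "y \<in> complement \<psi> j" "Re (G y y) = 1" by (rule normalise[OF u o])
 hence ne: "S \<noteq> {}" by (auto simp: S_def)
 have bdd: "bdd_below S" using B_ge complement_V by (intro bdd_belowI[of _ "-\<kappa>"]) (fastforce simp: S_def)
 have "\<exists>v. v \<in> complement \<psi> j \<and> Re (G v v) = 1 \<and> Re (B v v) <= Inf S + 1 / real (Suc k)" for k
 proof -
  obtain x where "x \<in> S" "x < Inf S + 1 / real (Suc k)" using cInf_lessD[OF ne, of "Inf S + 1 / real (Suc k)"] by auto
  thus ?thesis by (force simp: S_def)
 qed
 then obtain v where v: "!!k::nat. v k \<in> complement \<psi> j" "!!k. Re (G (v k) (v k)) = 1"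
  "!!k. Re (B (v k) (v k)) <= Inf S + 1 / real (Suc k)" by metis
 have "(%k. Inf S + 1 / real (Suc k)) \<longlonglongrightarrow> Inf S + 0"
  using LIMSEQ_inverse_real_of_nat by (intro tendsto_intros) (simp add: inverse_eq_divide)
 hence "(%k. Inf S + 1 / real (Suc k)) \<longlonglongrightarrow> Inf S" by simp
 from compact[of v, OF complement_V[OF v(1)] v(2,3) this]
 obtain s w where w: "w \<in> V" "Re (G w w) = 1" "Re (B w w) <= Inf S" "!!x. x \<in> V ==> (%i. G (v (s i)) x) \<longlonglongrightarrow> G w x"
  by blast
 have "G w (\<psi> i) = 0" if "i < j" for i
  using w(4)[OF orthonormal_V[OF o that]] v(1) that by (simp add: complement_def LIMSEQ_const_iff)
 hence "w \<in> complement \<psi> j" using w(1) by (simp add: complement_def)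
 moreover have "Re (B w w) <= Re (B u u)" if "u \<in> complement \<psi> j" "Re (G u u) = 1" for u
  using w(3) cInf_lower[OF _ bdd, of "Re (B u u)"] that by (fastforce simp: S_def)
 ultimately show thesis using that w(2) by blast
qed

lemma minimizer_exists:
 assumes o: "orthonormal \<psi> j"
 shows "\<exists>v. minimizer \<psi> j v"
proof -
 obtain v where v: "v \<in> complement \<psi> j" "Re (G v v) = 1"
  "!!u. u \<in> complement \<psi> j ==> Re (G u u) = 1 ==> Re (B v v) <= Re (B u u)"
  using normalised_minimum[OF o] by blast
 have "Re (B u u) >= Re (B v v) * Re (G u u)" if u: "u \<in> complement \<psi> j" for u
 proof (cases "Re (G u u) > 0")
  case True
  obtain y where "y \<in> complement \<psi> j" "Re (G y y) = 1" "Re (B y y) = Re (B u u) / Re (G u u)" by (rule normalise[OF u True o])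
  hence "Re (B v v) <= Re (B u u) / Re (G u u)" using v(3) by metis
  thus ?thesis using True by (simp add: field_simps)
 next
  case False
  hence "Re (G u u) = 0" using G_pos[OF complement_V[OF u]] by simp
  thus ?thesis using B_ge[OF complement_V[OF u]] by simp
 qed
 hence "minimizer \<psi> j v" using v G_real[OF complement_V[OF v(1)]] by (auto simp: minimizer_def)
 thus ?thesis by blast
qed

lemma minimizer_eigen_complement:
 assumes o: "orthonormal \<psi> j" and r: "minimizer \<psi> j r" and u: "u \<in> complement \<psi> j"
 shows "B u r = of_real (Re (B r r)) * G u r"
proof -
 define l where "l = Re (B r r)"
 define d where "d = B u r - of_real l * G u r"
 define q where "q = Re (B u u) - l * Re (G u u)"
 have rV: "r \<in> V" and Gr: "G r r = 1" and rC: "r \<in> complement \<psi> j"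
  using r complement_V by (auto simp: minimizer_def)
 note uV = complement_V[OF u]
 have "0 <= 2 * Re (z * d) + (cmod z)\<^sup>2 * q" for z
 proof -
  define x where "x = comb r z u"
  have xV: "x \<in> V" unfolding x_def by (intro comb_V rV uV)
  have "x \<in> complement \<psi> j"
   using u rC xV orthonormal_V[OF o] uV rV by (auto simp: complement_def x_def G_comb)
  hence "Re (B x x) >= l * Re (G x x)" using r by (simp add: minimizer_def l_def)
  moreover have "B x x = B r r + z * B u r + cnj z * (cnj (B u r) + z * B u u)"
   using xV uV rV B_cnj[OF rV uV] by (simp add: x_def B_comb B_comb_right comb_V algebra_simps)
  hence "Re (B x x) = l + 2 * Re (z * B u r) + (cmod z)\<^sup>2 * Re (B u u)"
   using B_real[OF uV] by (simp add: l_def cmod_power2, simp add: power2_eq_square algebra_simps)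
  moreover have "G x x = 1 + z * G u r + cnj z * (cnj (G u r) + z * G u u)"
   using xV uV rV G_cnj[OF rV uV] Gr by (simp add: x_def G_comb G_comb_right comb_V algebra_simps)
  hence "Re (G x x) = 1 + 2 * Re (z * G u r) + (cmod z)\<^sup>2 * Re (G u u)"
   using G_real[OF uV] by (simp add: cmod_power2, simp add: power2_eq_square algebra_simps)
  ultimately show ?thesis by (simp add: d_def q_def algebra_simps)
 qed
 moreover have "q >= 0" using r u unfolding minimizer_def q_def l_def by auto
 ultimately have "d = 0" by (intro first_variation_eq_0)
 thus ?thesis by (simp add: d_def l_def)
qed

lemma minimizer_eigen:
 assumes o: "orthonormal \<psi> j" and r: "minimizer \<psi> j r"
  and eigen: "!!i v. i < j ==> v \<in> V ==> B v (\<psi> i) = of_real (lam i) * G v (\<psi> i)" and v: "v \<in> V"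
 shows "B v r = of_real (Re (B r r)) * G v r"
proof -
 have rV: "r \<in> V" and orth: "!!i. i < j ==> G r (\<psi> i) = 0" using r by (auto simp: minimizer_def complement_def)
 have "B (\<psi> i) r = 0" "G (\<psi> i) r = 0" if "i < j" for i
  using B_cnj[OF orthonormal_V[OF o that] rV] G_cnj[OF orthonormal_V[OF o that] rV] eigen[OF that rV] orth[OF that] by auto
 thus ?thesis
  using minimizer_eigen_complement[OF o r residual_complement[OF o v]] B_residual[OF o v rV] G_residual[OF o v rV] by simp
qed

lemma orthonormal_minimizers:
 assumes min: "!!i. i < j ==> minimizer \<psi> i (\<psi> i)"
 shows "orthonormal \<psi> j"
proof -
 have V: "\<psi> i \<in> V" "G (\<psi> i) (\<psi> i) = 1" if "i < j" for i using min[OF that] by (auto simp: minimizer_def complement_def)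
 have "G (\<psi> i) (\<psi> k) = 0" if "k < i" "i < j" for i k using min[OF that(2)] that by (simp add: minimizer_def complement_def)
 thus ?thesis unfolding orthonormal_def using V G_cnj
  by (metis complex_cnj_zero linorder_neqE_nat order.strict_trans)
qed

lemma minimizers_exist: obtains \<psi> where "!!j. minimizer \<psi> j (\<psi> j)"
proof -
 have "\<exists>\<psi>. \<forall>j. minimizer \<psi> j (\<psi> j)"
 proof (rule dependent_wellorder_choice)
  show "minimizer f x r = minimizer g x r" if "!!y. y < x ==> f y = g y" for r f g x
   using that by (auto simp: minimizer_def complement_def)
  show "\<exists>r. minimizer f x r" if "!!y. y < x ==> minimizer f y (f y)" for x f
   using minimizer_exists[OF orthonormal_minimizers[OF that]] by blast
 qed
 thus thesis using that by blast
qed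

context
 fixes \<psi> assumes min: "!!j. minimizer \<psi> j (\<psi> j)"
begin

definition eigenvalue :: "nat => real" where "eigenvalue j = Re (B (\<psi> j) (\<psi> j))"

lemma minimizers_orthonormal: "orthonormal \<psi> j"
 by (rule orthonormal_minimizers) (rule min)

lemma minimizers_V: "\<psi> i \<in> V"
 using min[of i] by (simp add: minimizer_def complement_def)

lemma G_minimizers: "G (\<psi> i) (\<psi> j) = (if i = j then 1 else 0)"
 using minimizers_orthonormal[of "Suc (max i j)"] by (simp add: orthonormal_def less_Suc_eq_le)

lemma eigenvalue_eq: "v \<in> V ==> B v (\<psi> j) = of_real (eigenvalue j) * G v (\<psi> j)"
proof (induction j arbitrary: v rule: less_induct)
 case (less j)
 thus ?case using minimizer_eigen[OF minimizers_orthonormal min, of j eigenvalue v] by (simp add: eigenvalue_def)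
qed

lemma eigenvalue_mono:
 assumes "j <= k"
 shows "eigenvalue j <= eigenvalue k"
proof -
 have "\<psi> k \<in> complement \<psi> j" using assms by (auto simp: complement_def G_minimizers minimizers_V)
 thus ?thesis using min[of j] by (fastforce simp: minimizer_def eigenvalue_def G_minimizers)
qed

lemma eigenvalue_unbounded: "\<exists>j. eigenvalue j > C"
proof (rule ccontr)
 assume "\<not> ?thesis"
 hence le: "Re (B (\<psi> j) (\<psi> j)) <= C" for j by (simp add: eigenvalue_def not_less)
 have "Re (G (\<psi> i) (\<psi> i)) = 1" for i by (simp add: G_minimizers)
 from compact[of \<psi>, OF minimizers_V this le tendsto_const]
 obtain s u where u: "u \<in> V" "Re (G u u) = 1" "!!w. w \<in> V ==> (%i. G (\<psi> (s i)) w) \<longlonglongrightarrow> G u w" and s: "strict_mono s"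
  by blast
 have "G u (\<psi> k) = 0" for k
 proof -
  have "s n \<noteq> k" if "Suc k <= n" for n using strict_mono_imp_increasing[OF s, of n] that by linarith
  hence "\<forall>\<^sub>F i in sequentially. G (\<psi> (s i)) (\<psi> k) = 0"
   by (intro eventually_sequentiallyI[of "Suc k"]) (simp add: G_minimizers)
  hence "(%i. G (\<psi> (s i)) (\<psi> k)) \<longlonglongrightarrow> 0" by (rule tendsto_eventually)
  thus ?thesis using u(3)[OF minimizers_V[of k]] LIMSEQ_unique by blast
 qed
 hence "G (\<psi> (s i)) u = 0" for i using G_cnj[OF minimizers_V u(1)] by simp
 hence "G u u = 0" using u(3)[OF u(1)] by (simp add: LIMSEQ_const_iff)
 thus False using u(2) by simp
qed

lemma eigenvalue_at_top: "filterlim eigenvalue at_top sequentially"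
 unfolding filterlim_at_top eventually_sequentially
proof
 fix Z
 obtain j where "eigenvalue j > Z" using eigenvalue_unbounded by blast
 thus "\<exists>N. \<forall>n\<ge>N. Z <= eigenvalue n" using eigenvalue_mono by (intro exI[of _ j]) (meson less_le_trans order.strict_implies_order)
qed

lemma eigenvalue_residual_le:
 assumes f: "f \<in> V"
 shows "eigenvalue j * (Re (G f f) - (\<Sum>i<j. (cmod (G f (\<psi> i)))\<^sup>2)) <= \<bar>Re (B f f)\<bar> + \<bar>\<kappa>\<bar> * Re (G f f)"
proof -
 let ?p = "residual \<psi> f j"
 note o = minimizers_orthonormal[of j]
 have pC: "?p \<in> complement \<psi> j" by (rule residual_complement[OF o f])
 note pV = complement_V[OF pC]
 have "B (\<psi> i) ?p = 0" if "i < j" for i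
  using B_cnj[OF minimizers_V pV] eigenvalue_eq[OF pV] pC that by (simp add: complement_def)
 hence "B ?p ?p = cnj (B ?p f)" using B_residual[OF o f pV] B_cnj[OF f pV] by simp
 moreover have "G f (\<psi> i) * B (\<psi> i) f = of_real (eigenvalue i * (cmod (G f (\<psi> i)))\<^sup>2)" for i
  using B_cnj[OF minimizers_V f, of i] eigenvalue_eq[OF f, of i] by (simp flip: complex_norm_square)
 hence "B ?p f = B f f - (\<Sum>i<j. of_real (eigenvalue i * (cmod (G f (\<psi> i)))\<^sup>2))"
  using B_residual[OF o f f] by simp
 ultimately have "Re (B ?p ?p) = Re (B f f) - (\<Sum>i<j. eigenvalue i * (cmod (G f (\<psi> i)))\<^sup>2)" by simp
 moreover have "- \<bar>\<kappa>\<bar> <= eigenvalue i" for i using B_ge[OF minimizers_V[of i]] by (simp add: G_minimizers eigenvalue_def)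
 hence "(\<Sum>i<j. (- \<bar>\<kappa>\<bar>) * (cmod (G f (\<psi> i)))\<^sup>2) <= (\<Sum>i<j. eigenvalue i * (cmod (G f (\<psi> i)))\<^sup>2)"
  by (intro sum_mono mult_right_mono) auto
 moreover have "(\<Sum>i<j. (- \<bar>\<kappa>\<bar>) * (cmod (G f (\<psi> i)))\<^sup>2) = - (\<bar>\<kappa>\<bar> * (\<Sum>i<j. (cmod (G f (\<psi> i)))\<^sup>2))"
  by (simp add: sum_distrib_left sum_negf)
 moreover have "\<bar>\<kappa>\<bar> * (\<Sum>i<j. (cmod (G f (\<psi> i)))\<^sup>2) <= \<bar>\<kappa>\<bar> * Re (G f f)"
  by (intro mult_left_mono bessel_G[OF o f]) auto
 moreover have "Re (B ?p ?p) >= eigenvalue j * Re (G ?p ?p)"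
  using min[of j] pC by (simp add: minimizer_def eigenvalue_def)
 ultimately show ?thesis unfolding norm_residual[OF o f] by linarith
qed

lemma minimizers_parseval:
 assumes f: "f \<in> V"
 shows "(%j. (cmod (G f (\<psi> j)))\<^sup>2) sums Re (G f f)"
proof -
 define K where "K = \<bar>Re (B f f)\<bar> + \<bar>\<kappa>\<bar> * Re (G f f)"
 have "(%j. Re (G f f) - (\<Sum>i<j. (cmod (G f (\<psi> i)))\<^sup>2)) \<longlonglongrightarrow> 0"
 proof (rule tendsto_sandwich)
  show "\<forall>\<^sub>F j in sequentially. 0 <= Re (G f f) - (\<Sum>i<j. (cmod (G f (\<psi> i)))\<^sup>2)"
   using bessel_G[OF minimizers_orthonormal f] by simp
  have "\<forall>\<^sub>F j in sequentially. eigenvalue j > 0" using eigenvalue_at_top by (simp add: filterlim_at_top_dense)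
  thus "\<forall>\<^sub>F j in sequentially. Re (G f f) - (\<Sum>i<j. (cmod (G f (\<psi> i)))\<^sup>2) <= K / eigenvalue j"
   by eventually_elim (use eigenvalue_residual_le[OF f] in \<open>simp add: K_def field_simps\<close>)
  show "(%j. K / eigenvalue j) \<longlonglongrightarrow> 0"
   using eigenvalue_at_top by (intro tendsto_divide_0[OF tendsto_const] filterlim_at_top_imp_at_infinity)
 qed simp
 hence "(%j. Re (G f f) - (Re (G f f) - (\<Sum>i<j. (cmod (G f (\<psi> i)))\<^sup>2))) \<longlonglongrightarrow> Re (G f f) - 0"
  by (intro tendsto_intros)
 thus ?thesis by (simp add: sums_def)
qed

end

theorem spectral:
 obtains \<psi> lam where "!!j. \<psi> j \<in> V" "!!i j. G (\<psi> i) (\<psi> j) = (if i = j then 1 else 0)"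
  "!!j v. v \<in> V ==> B v (\<psi> j) = of_real (lam j) * G v (\<psi> j)" "filterlim lam at_top sequentially"
  "!!f. f \<in> V ==> (%j. (cmod (G f (\<psi> j)))\<^sup>2) sums Re (G f f)"
proof -
 obtain \<psi> where min: "!!j. minimizer \<psi> j (\<psi> j)" using minimizers_exist by blast
 show thesis
  by (rule that[OF minimizers_V[OF min] G_minimizers[OF min] eigenvalue_eq[OF min] eigenvalue_at_top[OF min]
    minimizers_parseval[OF min]])
qed

end

section \<open>Smoothing perturbations of \<open>\<bar>n\<bar>\<close>\<close>

lemma two_mult_le_sum_squares: "2 * (x * y) <= x\<^sup>2 + (y::real)\<^sup>2"
 using sum_squares_bound[of x y] by (simp add: mult.assoc)

lemma finite_bracket_le: "finite {n. bracket n <= M}"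
proof (rule finite_subset)
 show "{n. bracket n <= M} \<subseteq> {- \<lceil>M\<rceil>..\<lceil>M\<rceil>}"
 proof
  fix n assume "n \<in> {n. bracket n <= M}"
  hence "\<bar>real_of_int n\<bar> <= M" by (simp add: bracket_def)
  thus "n \<in> {- \<lceil>M\<rceil>..\<lceil>M\<rceil>}" by (auto simp: le_ceiling_iff) linarith+
 qed
qed auto

definition half_sobolev :: "cseq set" where
 "half_sobolev = {v. (%n. bracket n * (cmod (v n))\<^sup>2) summable_on UNIV}"
definition energy :: "cseq => real" where "energy v = (INFSUM n. bracket n * (cmod (v n))\<^sup>2)"
definition l2_form :: "cseq => cseq => complex" where
 "l2_form v w = (INFSUM n. v n * cnj (w n))"
definition abs_form :: "cseq => cseq => complex" where
 "abs_form v w = (INFSUM n. of_int \<bar>n\<bar> * (v n * cnj (w n)))"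

lemma half_sobolevI:
 assumes "!!F. finite F ==> (\<Sum>n\<in>F. bracket n * (cmod (v n))\<^sup>2) <= D"
 shows "v \<in> half_sobolev"
 unfolding half_sobolev_def mem_Collect_eq
 by (rule nonneg_bdd_above_summable_on) (auto simp: less_imp_le bdd_above_def intro!: exI[of _ D] assms)

lemma has_sum_energy: "v \<in> half_sobolev ==> ((%n. bracket n * (cmod (v n))\<^sup>2) has_sum energy v) UNIV"
 by (simp add: half_sobolev_def energy_def)

lemma sum_le_energy: "v \<in> half_sobolev ==> finite F ==> (\<Sum>n\<in>F. bracket n * (cmod (v n))\<^sup>2) <= energy v"
 by (rule finite_sum_le_has_sum[OF has_sum_energy]) (auto simp: less_imp_le)

lemma coord_sq_le_energy: "v \<in> half_sobolev ==> bracket n * (cmod (v n))\<^sup>2 <= energy v"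
 using sum_le_energy[of v "{n}"] by simp

lemma rapid_half_sobolev: "rapid y ==> y \<in> half_sobolev"
 using rapid_bracket_sq_summable by (simp add: half_sobolev_def)

lemma half_sobolev_product:
 assumes "v \<in> half_sobolev" "w \<in> half_sobolev"
 shows "(%n. bracket n * (cmod (v n) * cmod (w n))) summable_on UNIV"
proof -
 have "(%n. bracket n * (cmod (v n))\<^sup>2 + bracket n * (cmod (w n))\<^sup>2) summable_on UNIV"
  using assms unfolding half_sobolev_def by (intro summable_on_add) auto
 thus ?thesis
 proof (rule summable_on_comparison_test)
  fix n
  have "cmod (v n) * cmod (w n) <= 2 * (cmod (v n) * cmod (w n))" by simp
  also have "... <= (cmod (v n))\<^sup>2 + (cmod (w n))\<^sup>2" by (rule two_mult_le_sum_squares)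
  finally show "bracket n * (cmod (v n) * cmod (w n)) <= bracket n * (cmod (v n))\<^sup>2 + bracket n * (cmod (w n))\<^sup>2"
   by (simp flip: distrib_left)
 qed (auto simp: less_imp_le)
qed

lemma l2_form_summable:
 assumes "v \<in> half_sobolev" "w \<in> half_sobolev"
 shows "(%n. v n * cnj (w n)) summable_on UNIV"
proof (rule abs_summable_summable, rule summable_on_comparison_test[OF half_sobolev_product[OF assms]])
 show "cmod (v n * cnj (w n)) <= bracket n * (cmod (v n) * cmod (w n))" for n
  using mult_right_mono[OF bracket_ge_1[of n], of "cmod (v n) * cmod (w n)"] by (simp add: norm_mult)
qed auto

lemma abs_form_summable:
 assumes "v \<in> half_sobolev" "w \<in> half_sobolev"
 shows "(%n. of_int \<bar>n\<bar> * (v n * cnj (w n))) summable_on UNIV"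
proof (rule abs_summable_summable, rule summable_on_comparison_test[OF half_sobolev_product[OF assms]])
 show "cmod (of_int \<bar>n\<bar> * (v n * cnj (w n))) <= bracket n * (cmod (v n) * cmod (w n))" for n
  unfolding norm_mult by (auto intro!: mult_right_mono simp: bracket_def)
qed auto

lemma half_sobolev_comb:
 assumes "v \<in> half_sobolev" "w \<in> half_sobolev"
 shows "(%n. v n + z * w n) \<in> half_sobolev"
proof -
 have "(%n. 2 * (bracket n * (cmod (v n))\<^sup>2) + 2 * (cmod z)\<^sup>2 * (bracket n * (cmod (w n))\<^sup>2)) summable_on UNIV"
  using assms unfolding half_sobolev_def by (intro summable_on_add summable_on_cmult_right) auto
 hence "(%n. bracket n * (cmod (v n + z * w n))\<^sup>2) summable_on UNIV"
 proof (rule summable_on_comparison_test)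
  fix n
  have "(cmod (v n + z * w n))\<^sup>2 <= (cmod (v n) + cmod (z * w n))\<^sup>2"
   by (intro power_mono norm_triangle_ineq) auto
  also have "... <= 2 * (cmod (v n))\<^sup>2 + 2 * (cmod (z * w n))\<^sup>2"
   using two_mult_le_sum_squares[of "cmod (v n)" "cmod (z * w n)"] by (simp add: power2_sum)
  finally have "bracket n * (cmod (v n + z * w n))\<^sup>2 <= bracket n * (2 * (cmod (v n))\<^sup>2 + 2 * (cmod (z * w n))\<^sup>2)"
   by (intro mult_left_mono) (auto simp: less_imp_le)
  thus "bracket n * (cmod (v n + z * w n))\<^sup>2 <= 2 * (bracket n * (cmod (v n))\<^sup>2) + 2 * (cmod z)\<^sup>2 * (bracket n * (cmod (w n))\<^sup>2)"
   by (simp add: norm_mult power_mult_distrib algebra_simps)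
 qed (auto simp: less_imp_le)
 thus ?thesis by (simp add: half_sobolev_def)
qed

lemma l2_form_comb:
 assumes "v \<in> half_sobolev" "w \<in> half_sobolev" "u \<in> half_sobolev"
 shows "l2_form (%n. v n + z * w n) u = l2_form v u + z * l2_form w u"
 unfolding l2_form_def infsum_cmult_right'[symmetric]
 by (subst infsum_add[OF l2_form_summable summable_on_cmult_right[OF l2_form_summable], symmetric])
  (auto intro!: infsum_cong assms simp: algebra_simps)

lemma abs_form_comb:
 assumes "v \<in> half_sobolev" "w \<in> half_sobolev" "u \<in> half_sobolev"
 shows "abs_form (%n. v n + z * w n) u = abs_form v u + z * abs_form w u"
 unfolding abs_form_def infsum_cmult_right'[symmetric]
 by (subst infsum_add[OF abs_form_summable summable_on_cmult_right[OF abs_form_summable], symmetric])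
  (auto intro!: infsum_cong assms simp: algebra_simps)

lemma l2_form_cnj: "l2_form v u = cnj (l2_form u v)" and abs_form_cnj: "abs_form v u = cnj (abs_form u v)"
 unfolding l2_form_def abs_form_def infsum_cnj[symmetric] by (simp_all add: mult_ac)

lemma has_sum_l2_norm:
 assumes "v \<in> half_sobolev"
 shows "((%n. (cmod (v n))\<^sup>2) has_sum Re (l2_form v v)) UNIV"
 using has_sum_Re[OF has_sum_infsum[OF l2_form_summable[OF assms assms]]]
 by (simp add: l2_form_def complex_mult_cnj cmod_power2)

lemma has_sum_abs_norm:
 assumes "v \<in> half_sobolev"
 shows "((%n. of_int \<bar>n\<bar> * (cmod (v n))\<^sup>2) has_sum Re (abs_form v v)) UNIV"
 using has_sum_Re[OF has_sum_infsum[OF abs_form_summable[OF assms assms]]]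
 by (simp add: abs_form_def complex_mult_cnj cmod_power2)

lemma energy_eq:
 assumes "v \<in> half_sobolev"
 shows "energy v = Re (l2_form v v) + Re (abs_form v v)"
 using has_sum_unique[OF has_sum_energy[OF assms], of "Re (l2_form v v) + Re (abs_form v v)"]
  has_sum_add[OF has_sum_l2_norm[OF assms] has_sum_abs_norm[OF assms]]
 by (simp add: bracket_def algebra_simps)

lemma coord_le_l2_norm:
 assumes "v \<in> half_sobolev"
 shows "(cmod (v n))\<^sup>2 <= Re (l2_form v v)"
 using finite_sum_le_has_sum[OF has_sum_l2_norm[OF assms], of "{n}"] by simp

lemma l2_norm_tail_le:
 assumes v: "v \<in> half_sobolev" and M: "M > 0"
 shows "Re (l2_form v v) <= (\<Sum>n | bracket n <= M. (cmod (v n))\<^sup>2) + energy v / M"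
proof -
 define F where "F = {n. bracket n <= M}"
 have "((%n. if n \<in> F then (cmod (v n))\<^sup>2 else 0) has_sum (\<Sum>n\<in>F. (cmod (v n))\<^sup>2)) UNIV"
  by (rule has_sum_finite_neutralI[of F]) (auto simp: F_def finite_bracket_le)
 from has_sum_add[OF this has_sum_cmult_right[OF has_sum_energy[OF v], of "1 / M"]]
 have "Re (l2_form v v) <= (\<Sum>n\<in>F. (cmod (v n))\<^sup>2) + 1 / M * energy v"
 proof (rule has_sum_mono[OF has_sum_l2_norm[OF v]])
  fix n
  show "(cmod (v n))\<^sup>2 <= (if n \<in> F then (cmod (v n))\<^sup>2 else 0) + 1 / M * (bracket n * (cmod (v n))\<^sup>2)"
  proof (cases "n \<in> F")
   case False
   hence "M * (cmod (v n))\<^sup>2 <= bracket n * (cmod (v n))\<^sup>2" by (intro mult_right_mono) (auto simp: F_def)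
   thus ?thesis using False M by (simp add: field_simps)
  qed (use M in \<open>auto simp: less_imp_le\<close>)
 qed
 thus ?thesis by (simp add: F_def)
qed

lemma l2_form_delta: "l2_form (delta n) v = cnj (v n)"
 unfolding l2_form_def by (subst infsum_single[of n]) (auto simp: delta_def)

lemma abs_form_delta: "abs_form (delta n) v = of_int \<bar>n\<bar> * cnj (v n)"
 unfolding abs_form_def by (subst infsum_single[of n]) (auto simp: delta_def)

text \<open>Pointwise limits of sequences that are bounded in the Sobolev space.\<close>

context
 fixes v :: "nat => cseq" and u :: cseq and D :: real
 assumes v: "!!i. v i \<in> half_sobolev" and energy_le: "!!i. energy (v i) <= D"
  and pointwise: "!!n. (%i. v i n) \<longlonglongrightarrow> u n"
begin

lemma bounded_coord: "bracket n * (cmod (v i n))\<^sup>2 <= D"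
 using coord_sq_le_energy[OF v] energy_le by (rule order_trans)

lemma pointwise_limit_half_sobolev: "u \<in> half_sobolev"
proof (rule half_sobolevI, rule LIMSEQ_le_const2)
 fix F :: "int set" assume F: "finite F"
 show "(%i. \<Sum>n\<in>F. bracket n * (cmod (v i n))\<^sup>2) \<longlonglongrightarrow> (\<Sum>n\<in>F. bracket n * (cmod (u n))\<^sup>2)"
  by (intro tendsto_intros pointwise)
 have "(\<Sum>n\<in>F. bracket n * (cmod (v i n))\<^sup>2) <= D" for i using sum_le_energy[OF v F] energy_le by (rule order_trans)
 thus "\<exists>N. \<forall>i\<ge>N. (\<Sum>n\<in>F. bracket n * (cmod (v i n))\<^sup>2) <= D" by blast
qed

lemma l2_form_tendsto:
 assumes w: "w \<in> half_sobolev"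
 shows "(%i. l2_form (v i) w) \<longlonglongrightarrow> l2_form u w"
 unfolding l2_form_def
proof (rule tendsto_infsum_dominated[where h="%n. bracket n * (cmod (w n))\<^sup>2 + D * (1 / bracket n ^ 2)"])
 show "(%i. v i n * cnj (w n)) \<longlonglongrightarrow> u n * cnj (w n)" for n by (intro tendsto_intros pointwise)
 show "(%n. bracket n * (cmod (w n))\<^sup>2 + D * (1 / bracket n ^ 2)) summable_on UNIV"
  using w by (intro summable_on_add summable_on_cmult_right summable_on_inverse_bracket_sq) (simp add: half_sobolev_def)
 fix i n
 let ?x = "cmod (v i n)" and ?y = "cmod (w n)"
 have "bracket n * (2 * ((?x / bracket n) * ?y)) <= bracket n * ((?x / bracket n)\<^sup>2 + ?y\<^sup>2)"
  by (intro mult_left_mono two_mult_le_sum_squares) (auto simp: less_imp_le)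
 hence "2 * (?x * ?y) <= bracket n * ?y\<^sup>2 + ?x\<^sup>2 / bracket n" by (simp add: power2_eq_square algebra_simps)
 also have "?x\<^sup>2 / bracket n = (bracket n * ?x\<^sup>2) * (1 / bracket n ^ 2)" by (simp add: power2_eq_square)
 also have "... <= D * (1 / bracket n ^ 2)" using bounded_coord by (intro mult_right_mono) auto
 finally have "2 * (?x * ?y) <= bracket n * ?y\<^sup>2 + D * (1 / bracket n ^ 2)" by simp
 moreover have "?x * ?y <= 2 * (?x * ?y)" by simp
 ultimately show "cmod (v i n * cnj (w n)) <= bracket n * (cmod (w n))\<^sup>2 + D * (1 / bracket n ^ 2)"
  unfolding norm_mult complex_mod_cnj by linarith
qed

lemma l2_norm_limit_eq_1:
 assumes norm: "!!i. Re (l2_form (v i) (v i)) = 1"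
 shows "Re (l2_form u u) = 1"
proof (rule antisym)
 have lim: "(%i. \<Sum>n\<in>F. (cmod (v i n))\<^sup>2) \<longlonglongrightarrow> (\<Sum>n\<in>F. (cmod (u n))\<^sup>2)" for F
  by (intro tendsto_intros pointwise)
 have "(\<Sum>n\<in>F. (cmod (u n))\<^sup>2) <= 1" if "finite F" for F
  using finite_sum_le_has_sum[OF has_sum_l2_norm[OF v] that] norm by (intro LIMSEQ_le_const2[OF lim]) fastforce
 thus "Re (l2_form u u) <= 1" by (rule has_sum_le_finite_sums[OF has_sum_l2_norm[OF pointwise_limit_half_sobolev]])
 have "1 - D / M <= Re (l2_form u u)" if M: "M > 0" for M
 proof -
  have "1 - D / M <= (\<Sum>n | bracket n <= M. (cmod (v i n))\<^sup>2)" for i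
   using l2_norm_tail_le[OF v M, of i] divide_right_mono[OF energy_le[of i], of M] M by (simp add: norm)
  hence "1 - D / M <= (\<Sum>n | bracket n <= M. (cmod (u n))\<^sup>2)" by (intro LIMSEQ_le_const[OF lim]) auto
  also have "... <= Re (l2_form u u)"
   by (rule finite_sum_le_has_sum[OF has_sum_l2_norm[OF pointwise_limit_half_sobolev] finite_bracket_le]) auto
  finally show ?thesis .
 qed
 hence "\<forall>\<^sub>F M in at_top. 1 - D / M <= Re (l2_form u u)" by (meson eventually_at_top_dense)
 moreover have "((%M. 1 - D / M) \<longlongrightarrow> 1 - 0) at_top"
  by (intro tendsto_intros tendsto_divide_0[OF tendsto_const] filterlim_at_top_imp_at_infinity filterlim_ident)
 ultimately show "1 <= Re (l2_form u u)"
  using tendsto_le[of at_top "%_. Re (l2_form u u)" "Re (l2_form u u)" "%M. 1 - D / M" 1] by simp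
qed

end

lemma bounded_energy_subsequence:
 assumes v: "!!i::nat. v i \<in> half_sobolev" and energy: "!!i. energy (v i) <= D"
 obtains s u where "strict_mono s" "!!n. (%i. v (s i) n) \<longlonglongrightarrow> u n"
proof -
 have "cmod (v i n) <= sqrt D" for i n
 proof (rule real_le_rsqrt)
  have "(cmod (v i n))\<^sup>2 <= bracket n * (cmod (v i n))\<^sup>2" using bracket_ge_1[of n] by (simp add: mult_le_cancel_right1)
  thus "(cmod (v i n))\<^sup>2 <= D" using coord_sq_le_energy[OF v, of n i] energy[of i] by linarith
 qed
 then obtain s where "strict_mono s" "!!n. n \<in> UNIV ==> \<exists>l. (%i. v (s i) n) \<longlonglongrightarrow> l"
  using function_convergent_subsequence[of "UNIV::int set" v "sqrt D"] by blast
 thus thesis using that by (metis UNIV_I)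
qed

locale smoothing_matrix =
 fixes r :: "int => cseq"
 assumes r_cnj: "!!n k. cnj (r n k) = r k n" and r_rapid: "rapid_matrix r"
begin

definition r_form :: "cseq => cseq => complex" where
 "r_form v w = (\<Sum>\<^sub>\<infinity>(n,k). r n k * v k * cnj (w n))"
definition r_norm :: real where "r_norm = (\<Sum>\<^sub>\<infinity>(n,k). cmod (r n k))"

lemma r_form_term_le:
 assumes "!!n. (cmod (v n))\<^sup>2 <= D" "!!n. (cmod (w n))\<^sup>2 <= D"
 shows "cmod (case p of (n,k) => r n k * v k * cnj (w n)) <= (case p of (n,k) => cmod (r n k)) * D"
proof (cases p)
 case (Pair n k)
 have "cmod (v k) * cmod (w n) <= D"
  using two_mult_le_sum_squares[of "cmod (v k)" "cmod (w n)"] assms(1)[of k] assms(2)[of n] by linarith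
 thus ?thesis by (simp add: Pair norm_mult mult.assoc mult_left_mono)
qed

lemma r_form_abs_summable:
 assumes "v \<in> half_sobolev" "w \<in> half_sobolev"
 shows "(%p. cmod (case p of (n,k) => r n k * v k * cnj (w n))) summable_on UNIV"
proof (rule abs_summable_dominated[OF _ r_form_term_le])
 show "(%p. (case p of (n,k) => cmod (r n k)) * (Re (l2_form v v) + Re (l2_form w w))) summable_on UNIV"
  by (intro summable_on_cmult_left rapid_matrix_abs_summable r_rapid)
 show "(cmod (v n))\<^sup>2 <= Re (l2_form v v) + Re (l2_form w w)" "(cmod (w n))\<^sup>2 <= Re (l2_form v v) + Re (l2_form w w)" for n
  using coord_le_l2_norm[OF assms(1), of n] coord_le_l2_norm[OF assms(2), of n]
  by (smt (verit) zero_le_power2)+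
qed

lemmas r_form_summable = abs_summable_summable[OF r_form_abs_summable]

lemma r_form_comb:
 assumes "v \<in> half_sobolev" "w \<in> half_sobolev" "u \<in> half_sobolev"
 shows "r_form (%n. v n + z * w n) u = r_form v u + z * r_form w u"
 unfolding r_form_def infsum_cmult_right'[symmetric]
 by (subst infsum_add[OF r_form_summable summable_on_cmult_right[OF r_form_summable], symmetric])
  (auto intro!: infsum_cong assms simp: algebra_simps)

lemma r_form_cnj: "r_form v u = cnj (r_form u v)"
proof -
 have "cnj (r_form u v) = (\<Sum>\<^sub>\<infinity>(n,k). r k n * cnj (u k) * v n)"
  unfolding r_form_def infsum_cnj[symmetric] by (intro infsum_cong) (auto simp: r_cnj)
 also have "... = (\<Sum>\<^sub>\<infinity>(n,k). r n k * cnj (u n) * v k)"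
  by (rule infsum_reindex_bij_witness[of _ prod.swap prod.swap]) auto
 finally show ?thesis unfolding r_form_def by (simp add: mult_ac)
qed

lemma norm_r_form_le:
 assumes "v \<in> half_sobolev"
 shows "cmod (r_form v v) <= r_norm * Re (l2_form v v)"
proof -
 have "cmod (r_form v v) <= (INFSUM p. (case p of (n,k) => cmod (r n k)) * Re (l2_form v v))"
  unfolding r_form_def using r_form_summable[OF assms assms] rapid_matrix_abs_summable[OF r_rapid] coord_le_l2_norm[OF assms]
  by (intro norm_infsum_le[OF has_sum_infsum has_sum_infsum] summable_on_cmult_left r_form_term_le)
 also have "... = r_norm * Re (l2_form v v)"
  unfolding r_norm_def by (intro infsum_cmult_left rapid_matrix_abs_summable r_rapid)
 finally show ?thesis .
qed

lemma r_form_tendsto: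
 assumes "!!n. (%i::nat. v i n) \<longlonglongrightarrow> u n" and "!!i n. (cmod (v i n))\<^sup>2 <= D"
 shows "(%i. r_form (v i) (v i)) \<longlonglongrightarrow> r_form u u"
 unfolding r_form_def
proof (rule tendsto_infsum_dominated[OF _ r_form_term_le])
 show "(%i. case p of (n,k) => r n k * v i k * cnj (v i n)) \<longlonglongrightarrow> (case p of (n,k) => r n k * u k * cnj (u n))" for p
  by (cases p) (auto intro!: tendsto_intros assms)
 show "(%p. (case p of (n,k) => cmod (r n k)) * D) summable_on UNIV"
  by (intro summable_on_cmult_left rapid_matrix_abs_summable r_rapid)
qed (use assms in auto)

lemma form_compact:
 assumes v: "!!i::nat. v i \<in> half_sobolev" and norm: "!!i. Re (l2_form (v i) (v i)) = 1"
  and form: "!!i. Re (abs_form (v i) (v i) + r_form (v i) (v i)) <= C i" and C: "C \<longlonglongrightarrow> c"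
 shows "\<exists>s u. strict_mono s \<and> u \<in> half_sobolev \<and> Re (l2_form u u) = 1 \<and> Re (abs_form u u + r_form u u) <= c \<and>
     (\<forall>w\<in>half_sobolev. (%i. l2_form (v (s i)) w) \<longlonglongrightarrow> l2_form u w)"
proof -
 have "bounded (range C)" using C convergent_def convergent_imp_bounded by blast
 then obtain K where K: "!!i. C i <= K" unfolding bounded_iff by (metis abs_le_D1 rangeI real_norm_def)
 have energy: "energy (v i) <= K + r_norm + 1" for i
  using norm_r_form_le[OF v[of i]] abs_Re_le_cmod[of "r_form (v i) (v i)"] form[of i] K[of i]
  by (simp add: energy_eq[OF v] norm)
 obtain s u where s: "strict_mono s" and lim: "!!n. (%i. v (s i) n) \<longlonglongrightarrow> u n"
  using bounded_energy_subsequence[of v, OF v energy] by blast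
 note uV = pointwise_limit_half_sobolev[of "%i. v (s i)", OF v energy lim]
 have r_lim: "(%i. r_form (v (s i)) (v (s i))) \<longlonglongrightarrow> r_form u u"
  by (rule r_form_tendsto[OF lim, where D=1]) (use coord_le_l2_norm[OF v] norm in metis)
 have "Re (abs_form u u) <= c - Re (r_form u u)"
 proof (rule has_sum_le_finite_sums[OF has_sum_abs_norm[OF uV]])
  fix F :: "int set" assume F: "finite F"
  let ?E = "%u. (\<Sum>n\<in>F. of_int \<bar>n\<bar> * (cmod (u n))\<^sup>2) + Re (r_form u u)"
  have "(%i. ?E (v (s i))) \<longlonglongrightarrow> ?E u"
   by (intro tendsto_intros lim r_lim)
  moreover have "(%i. C (s i)) \<longlonglongrightarrow> c" using C s LIMSEQ_subseq_LIMSEQ by (force simp: o_def)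
  moreover have "?E (v (s i)) <= C (s i)" for i
   using finite_sum_le_has_sum[OF has_sum_abs_norm[OF v[of "s i"]] F] form[of "s i"] by simp
  ultimately have "?E u <= c" by (intro LIMSEQ_le) auto
  thus "(\<Sum>n\<in>F. of_int \<bar>n\<bar> * (cmod (u n))\<^sup>2) <= c - Re (r_form u u)" by simp
 qed
 thus ?thesis
  using s uV l2_norm_limit_eq_1[of "%i. v (s i)", OF v energy lim norm] l2_form_tendsto[of "%i. v (s i)", OF v energy lim]
  by (intro exI[of _ s] exI[of _ u]) auto
qed

sublocale spectral_form half_sobolev "%_. 0" "%v z w n. v n + z * w n" l2_form "%v w. abs_form v w + r_form v w"
 "%j. delta (int j)" r_norm
proof
 show "(%_. 0) \<in> half_sobolev" by (simp add: half_sobolev_def)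
 show "l2_form (%_. 0) v = 0" "abs_form (%_. 0) v + r_form (%_. 0) v = 0" for v
  by (simp_all add: l2_form_def abs_form_def r_form_def case_prod_unfold)
 show "abs_form (%n. v n + z * w n) u + r_form (%n. v n + z * w n) u = abs_form v u + r_form v u + z * (abs_form w u + r_form w u)"
  if "v \<in> half_sobolev" "w \<in> half_sobolev" "u \<in> half_sobolev" for v z w u
  using that by (simp add: abs_form_comb r_form_comb algebra_simps)
 show "abs_form v u + r_form v u = cnj (abs_form u v + r_form u v)" for v u using abs_form_cnj[of v u] r_form_cnj[of v u] by simp
 show "0 <= Re (l2_form v v)" if "v \<in> half_sobolev" for v
  using has_sum_l2_norm[OF that] by (rule has_sum_nonneg) auto
 show "- r_norm * Re (l2_form v v) <= Re (abs_form v v + r_form v v)" if v: "v \<in> half_sobolev" for v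
 proof -
  have "Re (abs_form v v) >= 0" using has_sum_abs_norm[OF v] by (rule has_sum_nonneg) auto
  moreover have "- (r_norm * Re (l2_form v v)) <= Re (r_form v v)" using norm_r_form_le[OF v] abs_Re_le_cmod[of "r_form v v"] by linarith
  ultimately show ?thesis by simp
 qed
 show "l2_form (delta (int m)) (delta (int n)) = (if m = n then 1 else 0)" for m n
  unfolding l2_form_delta by (auto simp: delta_def)
 show "\<exists>s u. strict_mono s \<and> u \<in> half_sobolev \<and> Re (l2_form u u) = 1 \<and> Re (abs_form u u + r_form u u) <= c \<and>
   (\<forall>w\<in>half_sobolev. (%i. l2_form (v (s i)) w) \<longlonglongrightarrow> l2_form u w)"
  if "!!i::nat. v i \<in> half_sobolev" "!!i. Re (l2_form (v i) (v i)) = 1"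
   "!!i. Re (abs_form (v i) (v i) + r_form (v i) (v i)) <= C i" "C \<longlonglongrightarrow> c" for v C c
  by (rule form_compact[OF that])
qed (auto intro: half_sobolev_comb l2_form_comb l2_form_cnj rapid_half_sobolev rapid_delta)

lemma r_form_eq_iterated:
 assumes "v \<in> half_sobolev" "w \<in> half_sobolev"
 shows "r_form v w = (INFSUM n. (INFSUM k. r n k * v k) * cnj (w n))"
  "(%n. (INFSUM k. r n k * v k) * cnj (w n)) summable_on UNIV"
 using r_form_summable[OF assms] infsum_Sigma'_banach[of "%n k. r n k * v k * cnj (w n)" UNIV "%_. UNIV"]
  summable_on_Sigma_banach[of "%n k. r n k * v k * cnj (w n)" UNIV "%_. UNIV"]
 by (simp_all add: r_form_def infsum_cmult_left')

lemma eigenvector_rapid: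
 assumes eigen: "!!n. of_real (lam - of_int \<bar>n\<bar>) * v n = (INFSUM k. r n k * v k)" and bounded: "!!n. cmod (v n) <= C"
 shows "rapid v"
proof (rule rapid_dominated[OF rapid_matrix_apply[OF r_rapid bounded] finite_bracket_le[of "\<bar>lam\<bar> + 2"]])
 fix n assume "n \<notin> {n. bracket n <= \<bar>lam\<bar> + 2}"
 hence "1 <= \<bar>lam - of_int \<bar>n\<bar>\<bar>" by (simp add: bracket_def)
 hence "cmod (v n) <= \<bar>lam - of_int \<bar>n\<bar>\<bar> * cmod (v n)" by (simp add: mult_le_cancel_right1)
 also have "... = cmod (INFSUM k. r n k * v k)" unfolding eigen[symmetric] norm_mult norm_of_real ..
 finally show "cmod (v n) <= cmod (INFSUM k. r n k * v k)" .
qed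

theorem eigenbasis:
 obtains \<psi> lam where
  "!!j v. v \<in> half_sobolev ==> abs_form v (\<psi> j) + r_form v (\<psi> j) = of_real (lam j) * l2_form v (\<psi> j)"
  "!!j. rapid (\<psi> j)"
  "!!j n. of_real (lam j - of_int \<bar>n\<bar>) * \<psi> j n = (INFSUM k. r n k * \<psi> j k)"
  "!!i j. l2_form (\<psi> i) (\<psi> j) = (if i = j then 1 else 0)"
  "filterlim lam at_top sequentially"
  "!!f. f \<in> half_sobolev ==> (%j. (cmod (l2_form f (\<psi> j)))\<^sup>2) sums Re (l2_form f f)"
proof -
 obtain \<psi> lam where V: "!!j. \<psi> j \<in> half_sobolev" and on: "!!i j. l2_form (\<psi> i) (\<psi> j) = (if i = j then 1 else 0)"
  and form: "!!j v. v \<in> half_sobolev ==> abs_form v (\<psi> j) + r_form v (\<psi> j) = of_real (lam j) * l2_form v (\<psi> j)"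
  and top: "filterlim lam at_top sequentially"
  and parseval: "!!f. f \<in> half_sobolev ==> (%j. (cmod (l2_form f (\<psi> j)))\<^sup>2) sums Re (l2_form f f)"
  using spectral by blast
 have eigen: "of_real (lam j - of_int \<bar>n\<bar>) * \<psi> j n = (INFSUM k. r n k * \<psi> j k)" for j n
 proof -
  have delta: "delta n \<in> half_sobolev" by (rule rapid_half_sobolev[OF rapid_delta])
  have "r_form (\<psi> j) (delta n) = (INFSUM k. r n k * \<psi> j k)"
   unfolding r_form_eq_iterated(1)[OF V delta] by (subst infsum_single[of n]) (auto simp: delta_def)
  moreover have "cnj (abs_form (delta n) (\<psi> j) + r_form (delta n) (\<psi> j)) = cnj (of_real (lam j) * l2_form (delta n) (\<psi> j))"
   by (simp only: form[OF delta])
  ultimately show ?thesis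
   using r_form_cnj[of "\<psi> j" "delta n"] by (simp add: abs_form_delta l2_form_delta algebra_simps del: of_int_abs)
 qed
 have "cmod (\<psi> j n) <= 1" for j n
  using coord_le_l2_norm[OF V, of j n] by (simp add: on power2_le_iff_abs_le abs_square_le_1)
 hence "rapid (\<psi> j)" for j by (rule eigenvector_rapid[OF eigen])
 thus thesis using that form eigen on top parseval by blast
qed

end
section \<open>Smooth functions and rapidly decreasing Fourier coefficients\<close>

lemma smooth_fun_deriv:
 assumes "smooth_fun f" shows "(f has_real_derivative deriv f x) (at x)" "smooth_fun (deriv f)"
proof -
 have "f differentiable (at x)" using assms[unfolded smooth_fun_def, rule_format, of 0 x] by simp
 thus "(f has_real_derivative deriv f x) (at x)"
  by (simp add: DERIV_deriv_iff_real_differentiable)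
 have "(deriv ^^ n) (deriv f) = (deriv ^^ Suc n) f" for n by (simp only: funpow_Suc_right o_apply)
 thus "smooth_fun (deriv f)" using assms unfolding smooth_fun_def by presburger
qed

lemma smooth_fun_coinduct:
 assumes cl: "!!f. f \<in> S ==> \<exists>f'\<in>S. \<forall>x. (f has_real_derivative f' x) (at x)" and f: "f \<in> S"
 shows "smooth_fun f"
proof -
 have step: "deriv g \<in> S" if "g \<in> S" for g
 proof -
  obtain g' where g': "g' \<in> S" "!!x. (g has_real_derivative g' x) (at x)" using cl \<open>g \<in> S\<close> by blast
  hence "deriv g = g'" by (intro ext DERIV_imp_deriv)
  thus ?thesis using g' by simp
 qed
 have "(deriv ^^ n) f \<in> S" for n by (induction n) (auto intro: f step)
 thus ?thesis unfolding smooth_fun_def using cl real_differentiable_def by metis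
qed

inductive smooth_algebra :: "(real => real) => (real => real) => bool" for b where
 smooth: "smooth_fun f ==> smooth_algebra b f"
| powr: "smooth_algebra b (%x. b x powr p)"
| add: "smooth_algebra b f ==> smooth_algebra b g ==> smooth_algebra b (%x. f x + g x)"
| mult: "smooth_algebra b f ==> smooth_algebra b g ==> smooth_algebra b (%x. f x * g x)"

lemma smooth_fun_const: "smooth_fun (%x. c)"
 by (rule smooth_fun_coinduct[of "range (%c x. c)"]) (auto intro!: derivative_eq_intros exI[of _ 0])

lemma smooth_fun_smooth_algebra:
 assumes b: "smooth_fun b" "!!x. b x > 0" and f: "smooth_algebra b f"
 shows "smooth_fun f"
proof (rule smooth_fun_coinduct[of "Collect (smooth_algebra b)"])
 fix f assume "f \<in> Collect (smooth_algebra b)"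
 hence "smooth_algebra b f" by simp
 thus "\<exists>f'\<in>Collect (smooth_algebra b). \<forall>x. (f has_real_derivative f' x) (at x)"
 proof (induction rule: smooth_algebra.induct)
  case (smooth f)
  thus ?case using smooth_fun_deriv[OF smooth] by (auto intro: smooth_algebra.smooth)
 next
  case (powr p)
  have "smooth_algebra b (%x. p * (b x powr (p - 1) * deriv b x))"
   by (intro smooth_algebra.mult smooth_algebra.powr
     smooth_algebra.smooth[OF smooth_fun_deriv(2)[OF b(1)]] smooth_algebra.smooth[OF smooth_fun_const])
  moreover have "((%x. b x powr p) has_real_derivative p * (b x powr (p - 1) * deriv b x)) (at x)" for x
   using smooth_fun_deriv(1)[OF b(1), of x] b(2)[of x]
   by (auto intro!: derivative_eq_intros)
  ultimately show ?case by (intro bexI[of _ "%x. p * (b x powr (p - 1) * deriv b x)"]) auto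
 next
  case (add f g)
  then obtain f' g' where "smooth_algebra b f'" "smooth_algebra b g'"
    "\<forall>x. (f has_real_derivative f' x) (at x)" "\<forall>x. (g has_real_derivative g' x) (at x)" by blast
  thus ?case by (intro bexI[of _ "%x. f' x + g' x"]) (auto intro!: derivative_eq_intros smooth_algebra.add)
 next
  case (mult f g)
  then obtain f' g' where "smooth_algebra b f'" "smooth_algebra b g'"
    "\<forall>x. (f has_real_derivative f' x) (at x)" "\<forall>x. (g has_real_derivative g' x) (at x)" by blast
  thus ?case using mult by (intro bexI[of _ "%x. f' x * g x + f x * g' x"])
    (auto intro!: derivative_eq_intros smooth_algebra.add smooth_algebra.mult)
 qed
qed (use f in simp)

lemma circ_smooth_c_powr_mult:
 assumes b: "circ_smooth b" "!!x. b x > 0" and u: "circ_smooth_c u"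
 shows "circ_smooth_c (%x. of_real (b x powr p) * u x)"
 using assms unfolding circ_smooth_c_def circ_smooth_def
 by (auto intro!: smooth_fun_smooth_algebra[of b] smooth_algebra.mult smooth_algebra.powr intro: smooth_algebra.smooth)

definition circle_deriv :: "(real => complex) => real => complex" where
 "circle_deriv u x = Complex (deriv (%x. Re (u x)) x) (deriv (%x. Im (u x)) x)"

lemma circ_smooth_deriv:
 assumes "circ_smooth f" shows "circ_smooth (deriv f)"
proof -
 have "deriv f (x + 2 * pi) = deriv f x" for x
 proof -
  have "((%x. f (x + 2 * pi)) has_real_derivative deriv f (x + 2 * pi)) (at x)"
   using smooth_fun_deriv(1)[of f "x + 2 * pi"] assms DERIV_shift by (simp add: circ_smooth_def DERIV_shift)
  thus ?thesis using assms DERIV_imp_deriv by (force simp: circ_smooth_def)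
 qed
 thus ?thesis using assms smooth_fun_deriv(2) by (simp add: circ_smooth_def)
qed

lemma circle_deriv:
 assumes "circ_smooth_c u"
 shows "(u has_vd circle_deriv u x) (at x)" "circ_smooth_c (circle_deriv u)"
proof -
 show "(u has_vd circle_deriv u x) (at x)"
  unfolding has_vector_derivative_complex_iff circle_deriv_def
  using assms by (auto simp: circ_smooth_c_def circ_smooth_def has_real_derivative_iff_has_vector_derivative[symmetric] intro: smooth_fun_deriv)
 show "circ_smooth_c (circle_deriv u)"
  using assms circ_smooth_deriv unfolding circ_smooth_c_def circle_deriv_def by simp
qed

lemma circ_smooth_c_period: "circ_smooth_c u ==> u (x + 2 * pi) = u x"
 unfolding circ_smooth_c_def circ_smooth_def by (auto intro: complex_eqI)

lemma continuous_on_circ_smooth_c: "circ_smooth_c u ==> continuous_on S u"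
 by (meson circle_deriv(1) has_vector_derivative_continuous continuous_at_imp_continuous_on)

lemma fourier_power_bound:
 "circ_smooth_c u ==> \<exists>C. \<forall>k. \<bar>real_of_int k\<bar> ^ K * cmod (fourier u k) <= C"
proof (induction K arbitrary: u)
 case 0
 have cont: "continuous_on {0..2*pi} u" by (rule continuous_on_circ_smooth_c[OF 0])
 hence "bounded (u ` {0..2*pi})" using compact_continuous_image compact_imp_bounded by blast
 then obtain B where "!!t. t \<in> {0..2*pi} ==> cmod (u t) <= B" unfolding bounded_iff by blast
 hence "cmod (fourier u k) <= B" for k by (intro norm_fourier_le cont)
 thus ?case by (intro exI[of _ B]) auto
next
 case (Suc K)
 have "fourier (circle_deriv u) k = \<i> * of_int k * fourier u k" for k
  using circ_smooth_c_period[OF Suc.prems, of 0]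
  by (intro fourier_deriv circle_deriv(1) continuous_on_circ_smooth_c circle_deriv(2) Suc.prems) auto
 hence "\<bar>real_of_int k\<bar> ^ Suc K * cmod (fourier u k) = \<bar>real_of_int k\<bar> ^ K * cmod (fourier (circle_deriv u) k)" for k
  by (simp add: norm_mult)
 thus ?case using Suc.IH[OF circle_deriv(2)[OF Suc.prems]] by presburger
qed

lemma rapid_fourier:
 assumes u: "circ_smooth_c u"
 shows "rapid (fourier u)"
 unfolding rapid_def
proof
 fix K
 obtain C where C: "!!k. \<bar>real_of_int k\<bar> ^ K * cmod (fourier u k) <= C" using fourier_power_bound[OF u] by blast
 obtain D where D: "!!k. \<bar>real_of_int k\<bar> ^ 0 * cmod (fourier u k) <= D" using fourier_power_bound[OF u] by blast
 have "bracket n ^ K * cmod (fourier u n) <= 2 ^ K * (D + C)" for n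
  using C D by (intro bracket_power_mult_le) auto
 thus "\<exists>C. \<forall>n. bracket n ^ K * cmod (fourier u n) <= C" by blast
qed

definition trig_series :: "cseq => real => complex" where
 "trig_series a t = (INFSUM n. a n * cis (of_int n * t))"

lemma trig_series_summable: "rapid a ==> (%n. a n * cis (of_int n * t)) summable_on UNIV"
 using rapid_abs_summable[of a] by (intro abs_summable_summable[where f="%n. a n * cis (of_int n * t)"]) (simp add: norm_mult)

lemma continuous_on_trig_series: "rapid a ==> continuous_on S (trig_series a)"
 unfolding trig_series_def by (rule continuous_on_infsum[OF _ _ rapid_abs_summable]) (auto intro!: continuous_intros simp: norm_mult)

lemma fourier_trig_series: "rapid a ==> fourier (trig_series a) k = a k"
 unfolding trig_series_def by (rule fourier_series[OF rapid_abs_summable])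

lemma trig_series_period: "trig_series a (t + 2 * pi) = trig_series a t" unfolding trig_series_def cis_int_period ..

lemma trig_series_cmult: "trig_series (%n. z * a n) t = z * trig_series a t"
 unfolding trig_series_def mult.assoc by (rule infsum_cmult_right')

lemma trig_series_lincomb:
 assumes "finite X" "!!i. i \<in> X ==> rapid (a i)"
 shows "trig_series (%n. \<Sum>i\<in>X. z i * a i n) t = (\<Sum>i\<in>X. z i * trig_series (a i) t)"
 unfolding trig_series_def sum_distrib_right mult.assoc
 by (intro infsumI has_sum_sum has_sum_cmult_right has_sum_infsum trig_series_summable assms)

lemma trig_series_eq_0: "rapid a ==> (!!t. trig_series a t = 0) ==> a n = 0"
 using fourier_trig_series[of a n] by (simp add: fourier_cis cong: if_cong)

lemma trig_series_finite:
 assumes "!!k. \<bar>k\<bar> > int N ==> a k = 0"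
 shows "trig_series a t = trig_poly N a t"
 unfolding trig_series_def trig_poly_def by (rule infsumI, rule has_sum_finite_neutralI) (auto simp: assms)

lemma trig_series_eq_integral:
 assumes a: "rapid a" and "t0 <= t"
 shows "trig_series a t = trig_series a t0 + integral {t0..t} (trig_series (%n. \<i> * of_int n * a n))"
proof -
 let ?a' = "%n. \<i> * of_int n * a n"
 have i: "integral {t0..t} (%x. ?a' n * cis (of_int n * x)) = a n * cis (of_int n * t) - a n * cis (of_int n * t0)" for n
 proof (rule integral_unique, rule fundamental_theorem_of_calculus)
  show "((%x. a n * cis (of_int n * x)) has_vd ?a' n * cis (of_int n * x)) (at x within {t0..t})" for x
   using has_vector_derivative_mult_right[OF has_vector_derivative_cis_int, of "a n" n x] by (simp add: mult_ac)
 qed fact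
 have "((%n. integral {t0..t} (%x. ?a' n * cis (of_int n * x))) has_sum integral {t0..t} (%x. INFSUM n. ?a' n * cis (of_int n * x))) UNIV"
  by (rule has_sum_integral[OF _ _ rapid_abs_summable[OF rapid_int_mult[OF a]]]) (auto intro!: continuous_intros simp: norm_mult)
 moreover have "((%n. a n * cis (of_int n * t) - a n * cis (of_int n * t0)) has_sum (trig_series a t - trig_series a t0)) UNIV"
  unfolding trig_series_def by (intro has_sum_diff has_sum_infsum trig_series_summable a)
 ultimately have "trig_series a t - trig_series a t0 = integral {t0..t} (trig_series ?a')"
  unfolding i trig_series_def[abs_def] by (rule has_sum_unique[rotated])
 thus ?thesis unfolding diff_eq_eq by (simp only: add.commute)
qed

lemma has_vector_derivative_trig_series:
 assumes a: "rapid a"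
 shows "(trig_series a has_vd trig_series (%n. \<i> * of_int n * a n) t) (at t)"
proof -
 let ?b = "trig_series (%n. \<i> * of_int n * a n)"
 have "((%s. trig_series a (t - 1) + integral {t - 1..s} ?b) has_vd 0 + ?b t) (at t within {t-1..t+1})"
  by (intro has_vector_derivative_add has_vector_derivative_const integral_has_vector_derivative
    continuous_on_trig_series rapid_int_mult a) auto
 hence "(trig_series a has_vd ?b t) (at t within {t-1..t+1})"
  by (intro has_vector_derivative_transform[OF _ trig_series_eq_integral[OF a]]) auto
 moreover have "at t within {t-1..t+1} = at t" by (rule at_within_Icc_at) auto
 ultimately show ?thesis by (simp only:)
qed

lemma circ_smooth_trig_series:
 assumes a: "rapid a"
 shows "circ_smooth_c (trig_series a)"
proof -
 have smooth: "smooth_fun (%x. Re (trig_series a x))" if a: "rapid a" for a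
 proof (rule smooth_fun_coinduct[of "{%x. Re (trig_series a x) | a. rapid a}"])
  fix f assume "f \<in> {%x. Re (trig_series a x) | a. rapid a}"
  then obtain a where a: "rapid a" "f = (%x. Re (trig_series a x))" by blast
  have "(f has_real_derivative Re (trig_series (%n. \<i> * of_int n * a n) x)) (at x)" for x
   using has_vector_derivative_trig_series[OF a(1), of x]
   by (simp add: a(2) has_vector_derivative_complex_iff has_real_derivative_iff_has_vector_derivative)
  thus "\<exists>f'\<in>{%x. Re (trig_series a x) | a. rapid a}. \<forall>x. (f has_real_derivative f' x) (at x)"
   using rapid_int_mult[OF a(1)] by (intro bexI[of _ "%x. Re (trig_series (%n. \<i> * of_int n * a n) x)"]) auto
 qed (use a in blast)
 have "Im (trig_series a x) = Re (trig_series (%n. (-\<i>) * a n) x)" for x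
  unfolding trig_series_cmult by simp
 thus ?thesis
  using smooth[OF a] smooth[OF rapid_cmult[OF a, of "-\<i>"]]
  by (auto simp: circ_smooth_c_def circ_smooth_def trig_series_period)
qed

lemma circ_smooth_c_inversion: "circ_smooth_c u ==> u t = trig_series (fourier u) t"
 unfolding trig_series_def
 by (intro fourier_inversion[of u "circle_deriv u"] circ_smooth_c_period circle_deriv(1) rapid_summable rapid_fourier)

lemma Lam_eq_trig_series: "Lam u t = trig_series (%n. of_int \<bar>n\<bar> * fourier u n) t"
 unfolding Lam_def trig_series_def exp_eq_cis ..

section \<open>Eigenfunctions and the basis of modes\<close>

context pos_trig_poly
begin

sublocale smoothing_matrix remainder
 by unfold_locales (rule cnj_remainder rapid_matrix_remainder)+

text \<open>On Fourier coefficients, \<open>bLam\<close> is \<open>b \<Lambda>\<close>. The coefficients \<open>y\<close> with respect to the modes are converted to Fourier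
 coefficients by \<open>mode_sum\<close>, and \<open>Lam_pair x n\<close> pairs \<open>\<Lambda> x\<close> with the mode \<open>n\<close>.\<close>

definition mult_b :: "cseq => cseq" where "mult_b g l = (\<Sum>j\<in>freqs N. bc j * g (l - j))"
definition bLam :: "cseq => cseq" where "bLam x = mult_b (%l. of_int \<bar>l\<bar> * x l)"
definition mode_sum :: "cseq => cseq" where "mode_sum y l = (INFSUM n. y n * mode_coef n l)"
definition Lam_pair :: "cseq => cseq" where
 "Lam_pair x n = (INFSUM l. x l * (of_int \<bar>l\<bar> * cnj (mode_coef n l)))"
definition mode_op :: "cseq => cseq" where "mode_op y = Lam_pair (mode_sum y)"

lemma rapid_bLam: "rapid x ==> rapid (bLam x)"
 unfolding bLam_def mult_b_def[abs_def] by (intro rapid_sum rapid_cmult rapid_shift[where g="%l. of_int \<bar>l\<bar> * x l"] rapid_abs_mult)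

lemma trig_series_shift:
 assumes g: "rapid g"
 shows "trig_series (%l. g (l - j)) t = cis (of_int j * t) * trig_series g t"
proof -
 have "trig_series (%l. g (l - j)) t = (INFSUM n. g n * cis (of_int (n + j) * t))"
  unfolding trig_series_def by (rule infsum_reindex_bij_witness[of _ "%n. n + j" "%l. l - j"]) auto
 also have "... = (INFSUM n. cis (of_int j * t) * (g n * cis (of_int n * t)))"
  by (intro infsum_cong) (simp add: distrib_right mult.left_commute flip: cis_mult)
 finally show ?thesis by (simp add: trig_series_def infsum_cmult_right')
qed

lemma trig_series_mult_b: "rapid g ==> trig_series (mult_b g) t = of_real (b t) * trig_series g t"
 unfolding mult_b_def[abs_def]
 by (subst trig_series_lincomb) (auto intro: rapid_shift simp: trig_series_shift b_eq_trig_poly trig_poly_def sum_distrib_right mult.assoc)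

lemma trig_series_bLam: "rapid x ==> trig_series (bLam x) t = of_real (b t) * trig_series (%l. of_int \<bar>l\<bar> * x l) t"
 unfolding bLam_def by (rule trig_series_mult_b[OF rapid_abs_mult])

lemma circ_smooth_b: "circ_smooth b"
proof -
 have bc: "rapid bc" by (rule rapid_finite_support[of "freqs N"]) (auto intro: band)
 have "of_real (b t) = trig_series bc t" for t using trig_series_finite[of N bc t] band by (simp add: b_eq_trig_poly)
 hence "trig_series bc = (%t. of_real (b t))" by auto
 thus ?thesis using circ_smooth_trig_series[OF bc] by (simp add: circ_smooth_c_def)
qed

lemma tempered_mode_coef: "tempered mode_coef"
 unfolding tempered_def using mode_coef_freq_decay by metis

lemma tempered_Lam_pair: "tempered (%l n. of_int \<bar>l\<bar> * cnj (mode_coef n l))"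
 unfolding tempered_def
proof
 fix K
 obtain C where C: "C >= 0" "!!n l. bracket n ^ K * cmod (mode_coef n l) <= C * bracket l ^ K" by (rule mode_coef_index_decay) blast
 have "bracket n ^ K * cmod (of_int \<bar>l\<bar> * cnj (mode_coef n l)) <= C * bracket l ^ (K + 1)" for n l
  using mult_mono[OF abs_le_bracket[of l] C(2)[of n l]] by (simp add: norm_mult less_imp_le mult_ac)
 thus "\<exists>C L. \<forall>l n. bracket n ^ K * cmod (of_int \<bar>l\<bar> * cnj (mode_coef n l)) <= C * bracket l ^ L" by blast
qed

lemma rapid_mode_sum: "rapid y ==> rapid (mode_sum y)"
 unfolding mode_sum_def[abs_def] by (rule rapid_tempered_apply[OF _ tempered_mode_coef])

lemma rapid_Lam_pair: "rapid x ==> rapid (Lam_pair x)"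
 unfolding Lam_pair_def[abs_def] by (rule rapid_tempered_apply[OF _ tempered_Lam_pair])

lemma rapid_mode_op: "rapid y ==> rapid (mode_op y)"
 unfolding mode_op_def by (intro rapid_Lam_pair rapid_mode_sum)

lemma Lam_pair_summable: "rapid x ==> (%l. x l * (of_int \<bar>l\<bar> * cnj (mode_coef n l))) summable_on UNIV"
 by (rule tempered_apply_summable[OF _ tempered_Lam_pair])

lemma mode_sum_cmult: "mode_sum (%n. z * y n) l = z * mode_sum y l"
 unfolding mode_sum_def mult.assoc by (rule infsum_cmult_right')

lemma mode_sum_lincomb:
 assumes "finite X" "!!i. i \<in> X ==> rapid (y i)"
 shows "mode_sum (%n. \<Sum>i\<in>X. z i * y i n) l = (\<Sum>i\<in>X. z i * mode_sum (y i) l)"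
 unfolding mode_sum_def sum_distrib_right mult.assoc
 by (intro infsumI has_sum_sum has_sum_cmult_right has_sum_infsum tempered_apply_summable[OF _ tempered_mode_coef] assms)

lemma mode_sum_delta: "mode_sum (delta n) l = mode_coef n l"
 unfolding mode_sum_def by (subst infsum_single[of n]) (auto simp: delta_def)

lemma mode_op_eq:
 assumes y: "rapid y"
 shows "mode_op y n = of_int \<bar>n\<bar> * y n + (INFSUM k. remainder n k * y k)"
proof -
 have "mode_op y n = (INFSUM l. INFSUM k. y k * mode_coef k l * (of_int \<bar>l\<bar> * cnj (mode_coef n l)))"
  unfolding mode_op_def Lam_pair_def mode_sum_def infsum_cmult_left' ..
 also have "... = (INFSUM k. INFSUM l. y k * mode_coef k l * (of_int \<bar>l\<bar> * cnj (mode_coef n l)))"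
 proof (rule infsum_swap_product[OF mode_coef_freq_summable[of n] rapid_abs_summable[OF y]])
  show "cmod (y k * mode_coef k l * (of_int \<bar>l\<bar> * cnj (mode_coef n l))) <= \<bar>real_of_int l\<bar> * cmod (mode_coef n l) * cmod (y k)" for l k
   using mult_left_mono[OF norm_mode_coef_le_1[of k l], of "\<bar>real_of_int l\<bar> * cmod (mode_coef n l) * cmod (y k)"]
     by (simp add: norm_mult mult_ac)
 qed auto
 also have "... = (INFSUM k. Lambda_entry n k * y k)"
  unfolding Lambda_entry_def infsum_cmult_left'[symmetric] by (simp add: mult_ac)
 also have "... = (INFSUM k. (if n = k then of_int \<bar>n\<bar> * y k else 0) + remainder n k * y k)"
  unfolding Lambda_entry_eq_remainder by (intro infsum_cong) (simp add: algebra_simps)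
 also have "... = of_int \<bar>n\<bar> * y n + (INFSUM k. remainder n k * y k)"
 proof (rule infsumI, rule has_sum_add)
  show "((%k. if n = k then of_int \<bar>n\<bar> * y k else 0) has_sum of_int \<bar>n\<bar> * y n) UNIV"
   by (rule has_sum_finite_neutralI[of "{n}"]) auto
  obtain C where C: "!!k. cmod (y k) <= C" using rapid_bounded[OF y] by blast
  show "((%k. remainder n k * y k) has_sum (INFSUM k. remainder n k * y k)) UNIV"
   by (rule has_sum_infsum[OF rapid_matrix_apply_summable[OF r_rapid C]])
 qed
 finally show ?thesis .
qed

lemma mode_sum_Lam_pair:
 assumes x: "rapid x"
 shows "mode_sum (Lam_pair x) l = bLam x l"
proof -
 have "mode_sum (Lam_pair x) l = (INFSUM n. INFSUM k. x k * (of_int \<bar>k\<bar> * cnj (mode_coef n k)) * mode_coef n l)"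
  unfolding Lam_pair_def mode_sum_def infsum_cmult_left' ..
 also have "... = (INFSUM k. INFSUM n. x k * (of_int \<bar>k\<bar> * cnj (mode_coef n k)) * mode_coef n l)"
 proof (rule infsum_swap_product[OF mode_coef_index_summable[of l] rapid_abs_summable[OF rapid_abs_mult[OF x]]])
  show "cmod (x k * (of_int \<bar>k\<bar> * cnj (mode_coef n k)) * mode_coef n l) <= cmod (mode_coef n l) * cmod (of_int \<bar>k\<bar> * x k)" for n k
   using mult_left_mono[OF norm_mode_coef_le_1[of n k], of "\<bar>real_of_int k\<bar> * cmod (mode_coef n l) * cmod (x k)"]
     by (simp add: norm_mult mult_ac)
 qed auto
 also have "... = (INFSUM k. of_int \<bar>k\<bar> * x k * bc (l - k))"
 proof (rule infsum_cong)
  fix k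
  have "((%n. of_int \<bar>k\<bar> * x k * (mode_coef n l * cnj (mode_coef n k))) has_sum of_int \<bar>k\<bar> * x k * bc (l - k)) UNIV"
   by (intro has_sum_cmult_right mode_coef_completeness)
  thus "(INFSUM n. x k * (of_int \<bar>k\<bar> * cnj (mode_coef n k)) * mode_coef n l) = of_int \<bar>k\<bar> * x k * bc (l - k)"
   by (intro infsumI) (simp add: mult_ac)
 qed
 also have "... = (INFSUM j. of_int \<bar>l - j\<bar> * x (l - j) * bc j)"
  by (rule infsum_reindex_bij_witness[of _ "%j. l - j" "%j. l - j"]) auto
 also have "... = (\<Sum>j\<in>freqs N. of_int \<bar>l - j\<bar> * x (l - j) * bc j)"
  by (rule infsumI, rule has_sum_finite_neutralI) (auto simp: band)
 finally show ?thesis by (simp add: bLam_def mult_b_def mult_ac)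
qed

lemma mode_sum_orthogonality:
 assumes y: "rapid y"
 shows "(INFSUM l. of_int l * mode_sum y l * cnj (mode_coef n l)) = of_int n * y n"
proof -
 have "(INFSUM l. of_int l * mode_sum y l * cnj (mode_coef n l)) = (INFSUM l. INFSUM k. y k * mode_coef k l * (of_int l * cnj (mode_coef n l)))"
  unfolding mode_sum_def infsum_cmult_left' by (simp add: mult_ac)
 also have "... = (INFSUM k. INFSUM l. y k * mode_coef k l * (of_int l * cnj (mode_coef n l)))"
 proof (rule infsum_swap_product[OF mode_coef_freq_summable[of n] rapid_abs_summable[OF y]])
  show "cmod (y k * mode_coef k l * (of_int l * cnj (mode_coef n l))) <= \<bar>real_of_int l\<bar> * cmod (mode_coef n l) * cmod (y k)" for l k
   using mult_left_mono[OF norm_mode_coef_le_1[of k l], of "\<bar>real_of_int l\<bar> * cmod (mode_coef n l) * cmod (y k)"]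
     by (simp add: norm_mult mult_ac)
 qed auto
 also have "... = (INFSUM k. y k * (if k = n then of_int k else 0))"
 proof (rule infsum_cong)
  fix k
  have "((%l. y k * (of_int l * mode_coef k l * cnj (mode_coef n l))) has_sum y k * (if k = n then of_int k else 0)) UNIV"
   by (intro has_sum_cmult_right mode_coef_orthogonality)
  thus "(INFSUM l. y k * mode_coef k l * (of_int l * cnj (mode_coef n l))) = y k * (if k = n then of_int k else 0)"
   by (intro infsumI) (simp add: mult_ac)
 qed
 also have "... = of_int n * y n" by (subst infsum_single[of n]) auto
 finally show ?thesis .
qed

lemma mode_sum_eq_0:
 assumes y: "rapid y" and zero: "!!l. mode_sum y l = 0"
 shows "y n = 0"
proof -
 have nonzero: "y n = 0" if "n \<noteq> 0" for n using mode_sum_orthogonality[OF y, of n] that by (simp add: zero)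
 moreover have "mode_sum y 0 = y 0" unfolding mode_sum_def by (subst infsum_single[of 0]) (auto simp: nonzero mode_coef_0)
 ultimately show ?thesis using zero[of 0] by metis
qed

lemma l2_form_Lam_pair:
 assumes x: "rapid x" and y: "rapid y"
 shows "l2_form (Lam_pair x) y = abs_form x (mode_sum y)"
proof -
 have "l2_form (Lam_pair x) y = (INFSUM n. INFSUM l. x l * (of_int \<bar>l\<bar> * cnj (mode_coef n l)) * cnj (y n))"
  unfolding l2_form_def Lam_pair_def infsum_cmult_left' ..
 also have "... = (INFSUM l. INFSUM n. x l * (of_int \<bar>l\<bar> * cnj (mode_coef n l)) * cnj (y n))"
 proof (rule infsum_swap_product[OF rapid_abs_summable[OF y] rapid_abs_summable[OF rapid_abs_mult[OF x]]])
  show "cmod (x l * (of_int \<bar>l\<bar> * cnj (mode_coef n l)) * cnj (y n)) <= cmod (y n) * cmod (of_int \<bar>l\<bar> * x l)" for n l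
   using mult_left_mono[OF norm_mode_coef_le_1[of n l], of "\<bar>real_of_int l\<bar> * cmod (y n) * cmod (x l)"] by (simp add: norm_mult mult_ac)
 qed auto
 also have "... = (INFSUM l. of_int \<bar>l\<bar> * x l * (INFSUM n. cnj (y n * mode_coef n l)))"
  unfolding infsum_cmult_right'[symmetric] by (simp add: mult_ac)
 finally show ?thesis unfolding infsum_cnj by (simp add: abs_form_def mode_sum_def mult.assoc)
qed

lemma l2_form_mode_op:
 assumes y: "rapid y" and w: "w \<in> half_sobolev"
 shows "l2_form (mode_op y) w = abs_form y w + r_form y w"
proof -
 note summable = abs_form_summable[OF rapid_half_sobolev[OF y] w] r_form_eq_iterated(2)[OF rapid_half_sobolev[OF y] w]
 show ?thesis
  unfolding abs_form_def r_form_eq_iterated(1)[OF rapid_half_sobolev[OF y] w] l2_form_def mode_op_eq[OF y]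
  by (subst infsum_add[OF summable, symmetric]) (simp add: algebra_simps)
qed

lemma eigenfun_fourier:
 assumes e: "is_eigenfun b lam u"
 defines "x \<equiv> fourier (%x. of_real (sqrt (b x)) * u x)"
 shows "rapid x" "bLam x l = of_real lam * x l" "of_real (sqrt (b t)) * u t = trig_series x t"
proof -
 define v where "v = (%x. complex_of_real (sqrt (b x)) * u x)"
 have "circ_smooth_c (%x. of_real (b x powr (1/2)) * u x)"
  using e unfolding is_eigenfun_def by (intro circ_smooth_c_powr_mult circ_smooth_b b_pos) auto
 hence v: "circ_smooth_c v" unfolding v_def using b_pos by (simp add: powr_half_sqrt less_imp_le)
 show x: "rapid x" unfolding x_def v_def[symmetric] by (rule rapid_fourier[OF v])
 have v_eq: "v t = trig_series x t" for t unfolding x_def v_def[symmetric] by (rule circ_smooth_c_inversion[OF v])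
 thus "of_real (sqrt (b t)) * u t = trig_series x t" by (simp add: v_def)
 have "trig_series (bLam x) t = trig_series (%n. of_real lam * x n) t" for t
 proof -
  have "trig_series (bLam x) t = of_real (b t) * Lam v t"
   unfolding trig_series_bLam[OF x] Lam_eq_trig_series by (simp add: x_def v_def)
  also have "of_real (b t) = complex_of_real (sqrt (b t)) * of_real (sqrt (b t))" using b_pos[of t] by (simp flip: of_real_mult)
  also have "... * Lam v t = of_real (sqrt (b t)) * (of_real lam * u t)"
   using e unfolding is_eigenfun_def v_def mult.assoc by simp
  also have "... = of_real lam * v t" by (simp add: v_def)
  finally show ?thesis by (simp add: trig_series_cmult v_eq)
 qed
 hence "fourier (trig_series (bLam x)) l = fourier (trig_series (%n. of_real lam * x n)) l" by presburger
 thus "bLam x l = of_real lam * x l" using x by (simp add: fourier_trig_series rapid_bLam rapid_cmult)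
qed

definition eigenfun_of :: "cseq => real => complex" where
 "eigenfun_of x t = of_real (b t powr (-1/2)) * trig_series x t"

lemma sqrt_eigenfun_of: "of_real (sqrt (b t)) * eigenfun_of x t = trig_series x t"
proof -
 have "sqrt (b t) * b t powr (-1/2) = 1"
  using b_pos[of t] by (simp add: powr_half_sqrt[symmetric] less_imp_le flip: powr_add)
 thus ?thesis unfolding eigenfun_of_def mult.assoc[symmetric] by (simp flip: of_real_mult)
qed

lemma is_eigenfun_eigenfun_of:
 assumes x: "rapid x" and bLam: "!!l. bLam x l = of_real lam * x l"
 shows "is_eigenfun b lam (eigenfun_of x)"
 unfolding is_eigenfun_def sqrt_eigenfun_of
proof (intro conjI allI)
 show "circ_smooth_c (eigenfun_of x)"
  unfolding eigenfun_of_def[abs_def] by (intro circ_smooth_c_powr_mult circ_smooth_b b_pos circ_smooth_trig_series x)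
 fix t
 have "of_real (b t) * Lam (trig_series x) t = trig_series (bLam x) t"
  unfolding Lam_eq_trig_series fourier_trig_series[OF x] trig_series_bLam[OF x] ..
 also have "... = of_real lam * trig_series x t" using trig_series_cmult[of _ x] by (simp add: bLam[abs_def])
 also have "... = of_real (sqrt (b t)) * (of_real lam * eigenfun_of x t)" unfolding sqrt_eigenfun_of[symmetric] by (simp add: mult_ac)
 finally have "of_real (sqrt (b t)) * (of_real (sqrt (b t)) * Lam (trig_series x) t) = of_real (sqrt (b t)) * (of_real lam * eigenfun_of x t)"
  using b_pos[of t] by (simp flip: mult.assoc of_real_mult)
 thus "of_real (sqrt (b t)) * Lam (trig_series x) t = of_real lam * eigenfun_of x t" using b_pos[of t] by simp
qed

lemma eigenfun_of_mode_sum_lincomb: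
 assumes "finite X" "!!i. i \<in> X ==> rapid (y i)"
 shows "eigenfun_of (mode_sum (%n. \<Sum>i\<in>X. z i * y i n)) t = (\<Sum>i\<in>X. z i * eigenfun_of (mode_sum (y i)) t)"
proof -
 have "mode_sum (%n. \<Sum>i\<in>X. z i * y i n) = (%l. \<Sum>i\<in>X. z i * mode_sum (y i) l)"
  by (rule ext) (rule mode_sum_lincomb[OF assms])
 thus ?thesis unfolding eigenfun_of_def
  by (simp add: trig_series_lincomb assms rapid_mode_sum sum_distrib_left mult_ac)
qed

lemma eigenfun_of_mode_sum_eq_0:
 assumes "rapid y" "!!t. eigenfun_of (mode_sum y) t = 0"
 shows "y n = 0"
proof (rule mode_sum_eq_0[OF assms(1)])
 have "trig_series (mode_sum y) t = 0" for t using sqrt_eigenfun_of[of t "mode_sum y"] assms(2) by simp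
 thus "mode_sum y l = 0" for l by (rule trig_series_eq_0[OF rapid_mode_sum[OF assms(1)]])
qed

lemma eigenfun_in_modes:
 assumes e: "is_eigenfun b \<mu> u" and \<mu>: "\<mu> > 0"
 obtains y where "rapid y" "!!n. mode_op y n = of_real \<mu> * y n" "u = eigenfun_of (mode_sum y)"
proof -
 define x where "x = fourier (%x. of_real (sqrt (b x)) * u x)"
 note x = eigenfun_fourier[OF e, folded x_def]
 define y where "y n = of_real (1 / \<mu>) * Lam_pair x n" for n
 have "mode_sum y l = of_real (1 / \<mu>) * bLam x l" for l
  unfolding y_def[abs_def] mode_sum_cmult mode_sum_Lam_pair[OF x(1)] ..
 hence y_sum: "mode_sum y = x" using x(2) \<mu> by auto
 have "of_real (sqrt (b t)) * u t = of_real (sqrt (b t)) * eigenfun_of x t" for t by (simp add: sqrt_eigenfun_of x(3))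
 hence "u t = eigenfun_of x t" for t using b_pos[of t] by simp
 hence "u = eigenfun_of (mode_sum y)" unfolding y_sum by (rule ext)
 moreover have "rapid y" unfolding y_def by (intro rapid_cmult rapid_Lam_pair x)
 moreover have "mode_op y n = of_real \<mu> * y n" for n unfolding mode_op_def y_sum y_def using \<mu> by simp
 ultimately show thesis by (intro that)
qed

end

section \<open>Positive eigenvalues and their multiplicities\<close>

lemma linear_system_nontrivial:
 fixes M :: "'a => 'b => complex"
 assumes "finite J" "finite I" "card J < card I"
 shows "\<exists>z. (\<exists>i\<in>I. z i \<noteq> 0) \<and> (\<forall>j\<in>J. (\<Sum>i\<in>I. z i * M i j) = 0)"
 using assms
proof (induction J arbitrary: I M rule: finite_induct)
 case empty
 hence "I \<noteq> {}" by auto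
 thus ?case by (intro exI[of _ "%_. 1"]) auto
next
 case (insert j0 J)
 show ?case
 proof (cases "\<forall>i\<in>I. M i j0 = 0")
  case True
  have "card J < card I" using insert by simp
  from insert.IH[OF \<open>finite I\<close> this, of M] True show ?thesis by auto
 next
  case False
  then obtain i0 where i0: "i0 \<in> I" "M i0 j0 \<noteq> 0" by blast
  let ?I = "I - {i0}"
  define M' where "M' i j = M i j - M i j0 / M i0 j0 * M i0 j" for i j
  have "card J < card ?I" using insert i0 by simp
  from insert.IH[OF _ this, of M'] insert.prems obtain z where z: "\<exists>i\<in>?I. z i \<noteq> 0" "\<forall>j\<in>J. (\<Sum>i\<in>?I. z i * M' i j) = 0" by auto
  define w where "w = - (\<Sum>i\<in>?I. z i * M i j0) / M i0 j0"
  define z' where "z' i = (if i = i0 then w else z i)" for i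
  have split: "(\<Sum>i\<in>I. z' i * M i j) = w * M i0 j + (\<Sum>i\<in>?I. z i * M i j)" for j
   using insert.prems i0 by (subst sum.remove[of I i0]) (auto simp: z'_def intro!: sum.cong)
  have "(\<Sum>i\<in>?I. z i * M' i j) = (\<Sum>i\<in>?I. z i * M i j) + w * M i0 j" for j
   by (simp add: M'_def w_def algebra_simps sum_subtractf sum_distrib_left sum_distrib_right sum_divide_distrib)
  hence "(\<Sum>i\<in>I. z' i * M i j) = 0" if "j \<in> J" for j using z(2) that split by (metis add.commute)
  moreover have "(\<Sum>i\<in>I. z' i * M i j0) = 0" using i0 by (simp add: split w_def)
  moreover have "\<exists>i\<in>I. z' i \<noteq> 0" using z(1) by (auto simp: z'_def)
  ultimately show ?thesis by auto
 qed
qed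

locale mode_eigenbasis = pos_trig_poly +
 fixes \<psi> :: "nat => cseq" and lam :: "nat => real"
 assumes psi_form: "!!j v. v \<in> half_sobolev ==> abs_form v (\<psi> j) + r_form v (\<psi> j) = of_real (lam j) * l2_form v (\<psi> j)"
  and psi_rapid: "!!j. rapid (\<psi> j)"
  and psi_eigen: "!!j n. of_real (lam j - of_int \<bar>n\<bar>) * \<psi> j n = (INFSUM k. remainder n k * \<psi> j k)"
  and psi_orthonormal: "!!i j. l2_form (\<psi> i) (\<psi> j) = (if i = j then 1 else 0)"
  and lam_at_top: "filterlim lam at_top sequentially"
  and psi_parseval: "!!f. f \<in> half_sobolev ==> (%j. (cmod (l2_form f (\<psi> j)))\<^sup>2) sums Re (l2_form f f)"

lemma (in pos_trig_poly) mode_eigenbasis_exists: obtains \<psi> lam where "mode_eigenbasis N bc b \<phi> \<psi> lam"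
proof (rule eigenbasis, goal_cases)
 case (1 \<psi> lam)
 hence "mode_eigenbasis N bc b \<phi> \<psi> lam" by unfold_locales
 thus ?case by (rule that)
qed

context mode_eigenbasis
begin

lemma l2_form_lincomb:
 assumes "finite X" "!!i. i \<in> X ==> rapid (y i)"
 shows "l2_form (%n. \<Sum>i\<in>X. z i * y i n) (\<psi> j) = (\<Sum>i\<in>X. z i * l2_form (y i) (\<psi> j))"
 unfolding l2_form_def sum_distrib_right mult.assoc
 by (intro infsumI has_sum_sum has_sum_cmult_right has_sum_infsum l2_form_summable rapid_half_sobolev psi_rapid assms)

lemma psi_mode_op: "mode_op (\<psi> j) n = of_real (lam j) * \<psi> j n"
 using mode_op_eq[OF psi_rapid, of j n] psi_eigen[of j n] by (simp add: algebra_simps del: of_int_abs)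

lemma psi_bLam: "bLam (mode_sum (\<psi> j)) l = of_real (lam j) * mode_sum (\<psi> j) l"
 using mode_sum_Lam_pair[OF rapid_mode_sum[OF psi_rapid], of j l] psi_mode_op[of j, abs_def]
 by (simp add: mode_op_def mode_sum_cmult)

lemma eq_0_if_orthogonal:
 assumes y: "rapid y" and orth: "!!j. l2_form y (\<psi> j) = 0"
 shows "y n = 0"
proof -
 note yV = rapid_half_sobolev[OF y]
 have "Re (l2_form y y) = 0" using psi_parseval[OF yV] sums_unique2[OF _ sums_zero] by (simp add: orth)
 thus ?thesis using coord_le_l2_norm[OF yV, of n] by simp
qed

lemma eigenvectors_orthogonal:
 assumes y: "rapid y" and eigen: "!!n. mode_op y n = of_real \<mu> * y n" and "lam j \<noteq> \<mu>"
 shows "l2_form y (\<psi> j) = 0"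
proof -
 have "of_real \<mu> * l2_form y (\<psi> j) = l2_form (mode_op y) (\<psi> j)"
  unfolding l2_form_def eigen mult.assoc infsum_cmult_right' ..
 also have "... = of_real (lam j) * l2_form y (\<psi> j)"
  by (simp add: l2_form_mode_op[OF y] psi_form rapid_half_sobolev y psi_rapid)
 finally show ?thesis using assms(3) by simp
qed

lemma psi_nonzero: "\<exists>n. \<psi> j n \<noteq> 0"
 by (rule ccontr) (use psi_orthonormal[of j j] in \<open>simp add: l2_form_def\<close>)

lemma finite_lam_le: "finite {j. lam j <= C}"
proof -
 have "\<forall>\<^sub>F j in sequentially. lam j > C" using lam_at_top by (simp add: filterlim_at_top_dense)
 then obtain m where "!!j. j >= m ==> lam j > C" unfolding eventually_sequentially by blast
 hence "{j. lam j <= C} \<subseteq> {..<m}" by (metis (no_types, lifting) lessThan_iff linorder_not_le mem_Collect_eq subsetI)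
 thus ?thesis by (rule finite_subset) auto
qed

lemma finite_eigenspace: "finite {j. lam j = \<mu>}"
 by (rule finite_subset[OF _ finite_lam_le[of \<mu>]]) auto

lemma psi_eigenfun: "is_eigenfun b (lam j) (eigenfun_of (mode_sum (\<psi> j)))"
 by (intro is_eigenfun_eigenfun_of rapid_mode_sum psi_rapid psi_bLam)

lemma psi_eigenfuns_independent:
 assumes f: "inj_on f {..<m}"
 shows "lin_indep_fam m (%i. eigenfun_of (mode_sum (\<psi> (f i))))"
 unfolding lin_indep_fam_def
proof (intro allI impI)
 fix z i assume z: "\<forall>t. (\<Sum>i<m. z i * eigenfun_of (mode_sum (\<psi> (f i))) t) = 0" and i: "i < m"
 have "rapid (%n. \<Sum>i<m. z i * \<psi> (f i) n)" by (intro rapid_sum rapid_cmult psi_rapid)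
 moreover have "eigenfun_of (mode_sum (%n. \<Sum>i<m. z i * \<psi> (f i) n)) t = 0" for t
  using z by (subst eigenfun_of_mode_sum_lincomb) (auto intro: psi_rapid)
 ultimately have "(\<Sum>i<m. z i * \<psi> (f i) n) = 0" for n by (rule eigenfun_of_mode_sum_eq_0)
 hence "(\<Sum>k<m. z k * l2_form (\<psi> (f k)) (\<psi> (f i))) = 0"
  using l2_form_lincomb[of "{..<m}" "%k. \<psi> (f k)" z "f i"] by (simp add: psi_rapid l2_form_def)
 moreover have "(\<Sum>k<m. z k * l2_form (\<psi> (f k)) (\<psi> (f i))) = (\<Sum>k<m. if k = i then z k else 0)"
  using f i by (intro sum.cong) (auto simp: psi_orthonormal inj_on_def)
 ultimately show "z i = 0" using i by simp
qed

lemma independent_eigenfuns_le: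
 assumes \<mu>: "\<mu> > 0" and u: "!!i. i < n ==> is_eigenfun b \<mu> (u i)" and indep: "lin_indep_fam n u"
 shows "n <= card {j. lam j = \<mu>}"
proof (rule ccontr)
 assume "\<not> ?thesis"
 hence lt: "card {j. lam j = \<mu>} < card {..<n}" by simp
 have "\<exists>y. rapid y \<and> (\<forall>n. mode_op y n = of_real \<mu> * y n) \<and> u i = eigenfun_of (mode_sum y)" if "i < n" for i
  using eigenfun_in_modes[OF u[OF that] \<mu>] by metis
 then obtain y where y: "!!i. i < n ==> rapid (y i)" "!!i m. i < n ==> mode_op (y i) m = of_real \<mu> * y i m"
  "!!i. i < n ==> u i = eigenfun_of (mode_sum (y i))" by metis
 obtain z where z: "\<exists>i\<in>{..<n}. z i \<noteq> 0" "\<forall>j\<in>{j. lam j = \<mu>}. (\<Sum>i\<in>{..<n}. z i * l2_form (y i) (\<psi> j)) = 0"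
  using linear_system_nontrivial[OF finite_eigenspace finite_lessThan lt, of "%i j. l2_form (y i) (\<psi> j)"] by blast
 have "(\<Sum>i<n. z i * l2_form (y i) (\<psi> j)) = 0" for j
  using z(2) y eigenvectors_orthogonal[of "y i" \<mu> j for i] by (cases "lam j = \<mu>") auto
 hence orth: "l2_form (%m. \<Sum>i<n. z i * y i m) (\<psi> j) = 0" for j using y(1) by (subst l2_form_lincomb) auto
 have "rapid (%m. \<Sum>i<n. z i * y i m)" using y(1) by (intro rapid_sum rapid_cmult) auto
 hence "(\<Sum>i<n. z i * y i m) = 0" for m by (rule eq_0_if_orthogonal) (rule orth)
 hence "eigenfun_of (mode_sum (%m. \<Sum>i<n. z i * y i m)) t = 0" for t
  by (simp add: eigenfun_of_def trig_series_def mode_sum_def)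
 hence "(\<Sum>i<n. z i * u i t) = 0" for t
  using y by (subst (asm) eigenfun_of_mode_sum_lincomb) auto
 hence "\<forall>i<n. z i = 0" using indep unfolding lin_indep_fam_def by blast
 thus False using z(1) by auto
qed

lemma eig_mult_eq:
 assumes \<mu>: "\<mu> > 0"
 shows "eig_mult b \<mu> = card {j. lam j = \<mu>}"
 unfolding eig_mult_def
proof (rule Greatest_equality)
 obtain f where f: "bij_betw f {..<card {j. lam j = \<mu>}} {j. lam j = \<mu>}"
  using ex_bij_betw_nat_finite[OF finite_eigenspace[of \<mu>]] by (auto simp: atLeast0LessThan)
 hence "is_eigenfun b \<mu> (eigenfun_of (mode_sum (\<psi> (f i))))" if "i < card {j. lam j = \<mu>}" for i
  using that psi_eigenfun[of "f i"] by (auto simp: bij_betw_def)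
 thus "\<exists>u. (\<forall>i<card {j. lam j = \<mu>}. is_eigenfun b \<mu> (u i)) \<and> lin_indep_fam (card {j. lam j = \<mu>}) u"
  using psi_eigenfuns_independent[of f] f by (intro exI[of _ "%i. eigenfun_of (mode_sum (\<psi> (f i)))"]) (auto simp: bij_betw_def)
qed (use independent_eigenfuns_le[OF \<mu>] in blast)

lemma pos_eigs_eq: "pos_eigs b = {\<mu>. \<mu> > 0 \<and> (\<exists>j. lam j = \<mu>)}"
proof (intro equalityI subsetI; clarsimp simp: pos_eigs_def)
 fix \<mu> u t assume \<mu>: "\<mu> > 0" and e: "is_eigenfun b \<mu> u" and nz: "u t \<noteq> 0"
 obtain y where y: "rapid y" "!!n. mode_op y n = of_real \<mu> * y n" "u = eigenfun_of (mode_sum y)"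
  using eigenfun_in_modes[OF e \<mu>] by metis
 show "\<exists>j. lam j = \<mu>"
 proof (rule ccontr)
  assume "\<nexists>j. lam j = \<mu>"
  hence "y n = 0" for n using eq_0_if_orthogonal[OF y(1)] eigenvectors_orthogonal[OF y(1,2)] by blast
  thus False using nz by (simp add: y(3) eigenfun_of_def mode_sum_def trig_series_def)
 qed
next
 fix j assume "lam j > 0"
 have "\<exists>t. eigenfun_of (mode_sum (\<psi> j)) t \<noteq> 0" using eigenfun_of_mode_sum_eq_0[OF psi_rapid] psi_nonzero[of j] by blast
 thus "\<exists>u. is_eigenfun b (lam j) u \<and> (\<exists>t. u t \<noteq> 0)" using psi_eigenfun by blast
qed

lemma psi_0_eq_0:
 assumes "lam j > 0"
 shows "\<psi> j 0 = 0"
proof -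
 have "mode_op (\<psi> j) 0 = 0" unfolding mode_op_def Lam_pair_def by (rule infsum_0) (simp add: mode_coef_0)
 thus ?thesis using psi_mode_op[of j 0] assms by simp
qed

lemma psi_eq_0_if_nonpos:
 assumes lam: "lam j <= 0" and n: "n \<noteq> 0"
 shows "\<psi> j n = 0"
proof -
 define x where "x = mode_sum (\<psi> j)"
 have x: "rapid x" unfolding x_def by (intro rapid_mode_sum psi_rapid)
 have "abs_form x x = l2_form (mode_op (\<psi> j)) (\<psi> j)"
  unfolding mode_op_def x_def by (rule l2_form_Lam_pair[OF rapid_mode_sum[OF psi_rapid] psi_rapid, symmetric])
 also have "... = of_real (lam j) * l2_form (\<psi> j) (\<psi> j)"
  unfolding l2_form_def psi_mode_op mult.assoc infsum_cmult_right' ..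
 finally have "abs_form x x = of_real (lam j)" by (simp add: psi_orthonormal)
 hence "((%l. of_int \<bar>l\<bar> * (cmod (x l))\<^sup>2) has_sum lam j) UNIV" using has_sum_abs_norm[OF rapid_half_sobolev[OF x]] by simp
 hence "of_int \<bar>l\<bar> * (cmod (x l))\<^sup>2 = 0" for l
  using lam nonneg_has_sum_le_0D[of "%l. of_int \<bar>l\<bar> * (cmod (x l))\<^sup>2" UNIV "lam j" l] by simp
 hence "l = 0 \<or> x l = 0" for l by simp
 hence zero: "of_int l * x l = 0" for l by (metis mult_zero_left mult_zero_right of_int_0)
 have "of_int n * \<psi> j n = (INFSUM l. of_int l * x l * cnj (mode_coef n l))"
  unfolding x_def by (rule mode_sum_orthogonality[OF psi_rapid, symmetric])
 also have "... = 0" unfolding zero by simp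
 finally show ?thesis using n by simp
qed

lemma remainder_iterate:
 "\<exists>s. rapid_matrix s \<and> (\<forall>j n. of_real ((1 + lam j) ^ K) * (INFSUM k. remainder n k * \<psi> j k) = (INFSUM k. s n k * \<psi> j k))"
proof (induction K)
 case 0
 show ?case using r_rapid by (intro exI[of _ remainder]) auto
next
 case (Suc K)
 then obtain s where s: "rapid_matrix s"
  "!!j n. of_real ((1 + lam j) ^ K) * (INFSUM k. remainder n k * \<psi> j k) = (INFSUM k. s n k * \<psi> j k)" by blast
 define t where "t n k = of_real (bracket k) * s n k + (INFSUM l. s n l * remainder l k)" for n k
 note bs = rapid_matrix_bracket_mult[OF s(1)] and sr = rapid_matrix_mult[OF s(1) r_rapid]
 have "of_real ((1 + lam j) ^ Suc K) * (INFSUM k. remainder n k * \<psi> j k) = (INFSUM k. t n k * \<psi> j k)" for j n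
 proof -
  obtain C where C: "!!k. cmod (\<psi> j k) <= C" using rapid_bounded[OF psi_rapid] by blast
  obtain D where "D >= 0" and D: "!!k. cmod (INFSUM l. remainder k l * \<psi> j l) <= D"
   by (rule rapid_bounded[OF rapid_matrix_apply[where v="\<psi> j", OF r_rapid C]]) blast
  have expand: "of_real (1 + lam j) * \<psi> j k = of_real (bracket k) * \<psi> j k + (INFSUM l. remainder k l * \<psi> j l)" for k
   unfolding psi_eigen[symmetric] by (simp add: bracket_def algebra_simps)
  have "of_real ((1 + lam j) ^ Suc K) * (INFSUM k. remainder n k * \<psi> j k) = of_real (1 + lam j) * (INFSUM k. s n k * \<psi> j k)"
   unfolding s(2)[symmetric] by simp
  also have "... = (INFSUM k. s n k * (of_real (1 + lam j) * \<psi> j k))"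
   unfolding infsum_cmult_right'[symmetric] by (simp add: mult.left_commute)
  also have "... = (INFSUM k. of_real (bracket k) * s n k * \<psi> j k + s n k * (INFSUM l. remainder k l * \<psi> j l))"
   unfolding expand by (simp add: algebra_simps)
  also have "... = (INFSUM k. of_real (bracket k) * s n k * \<psi> j k) + (INFSUM k. s n k * (INFSUM l. remainder k l * \<psi> j l))"
   by (rule infsum_add[OF rapid_matrix_apply_summable[OF bs C] rapid_matrix_apply_summable[OF s(1) D]])
  also have "... = (INFSUM k. of_real (bracket k) * s n k * \<psi> j k + (INFSUM l. s n l * remainder l k) * \<psi> j k)"
   unfolding rapid_matrix_assoc[OF s(1) r_rapid psi_rapid]
   by (rule infsum_add[OF rapid_matrix_apply_summable[OF bs C] rapid_matrix_apply_summable[OF sr C], symmetric])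
  finally show ?thesis by (simp add: t_def algebra_simps)
 qed
 moreover have "rapid_matrix t" unfolding t_def[abs_def] by (rule rapid_matrix_add[OF bs sr])
 ultimately show ?case by blast
qed

end

section \<open>The Riemann zeta function\<close>

lemma norm_diff_le_deriv:
 fixes f :: "real => complex"
 assumes "x <= y" "!!t. t \<in> {x..y} ==> (f has_vd f' t) (at t within {x..y})" "!!t. t \<in> {x..y} ==> norm (f' t) <= B"
 shows "norm (f y - f x) <= B * (y - x)"
proof -
 have "norm (f y - f x) <= B * norm (y - x)"
 proof (rule differentiable_bound[of "{x..y}" f "%t h. h *\<^sub>R f' t"])
  show "(f has_derivative (%h. h *\<^sub>R f' t)) (at t within {x..y})" if "t \<in> {x..y}" for t
   using assms(2)[OF that] by (simp add: has_vector_derivative_def)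
  show "onorm (%h. h *\<^sub>R f' t) <= B" if "t \<in> {x..y}" for t
   by (rule onorm_le) (metis assms(3)[OF that] mult.commute mult_right_mono norm_ge_zero norm_scaleR real_norm_def)
 qed (use assms(1) in auto)
 thus ?thesis using assms(1) by simp
qed

lemma holomorphic_infsum:
 assumes S: "open S" and hol: "!!x. x \<in> X ==> f x holomorphic_on S"
  and bd: "!!z. z \<in> S ==> \<exists>d M. d > 0 \<and> cball z d \<subseteq> S \<and> M summable_on X \<and> (\<forall>x\<in>X. \<forall>w\<in>cball z d. cmod (f x w) <= M x)"
 shows "(%s. \<Sum>\<^sub>\<infinity>x\<in>X. f x s) holomorphic_on S"
proof -
 have "(%s. \<Sum>\<^sub>\<infinity>x\<in>X. f x s) field_differentiable (at z)" if z: "z \<in> S" for z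
 proof -
  obtain d M where d: "d > 0" "cball z d \<subseteq> S" "M summable_on X" "!!x w. x \<in> X ==> w \<in> cball z d ==> cmod (f x w) <= M x"
   using bd[OF z] by blast
  have u: "uniform_limit (cball z d) (%Y s. \<Sum>x\<in>Y. f x s) (%s. \<Sum>\<^sub>\<infinity>x\<in>X. f x s) (finite_subsets_at_top X)"
   by (rule Weierstrass_m_test_general[OF d(4) d(3)])
  have h: "(%s. \<Sum>x\<in>Y. f x s) holomorphic_on S" if "Y \<subseteq> X" for Y
   using hol that by (intro holomorphic_intros) auto
  have "eventually (%Y. continuous_on (cball z d) (%s. \<Sum>x\<in>Y. f x s) \<and> (%s. \<Sum>x\<in>Y. f x s) holomorphic_on ball z d) (finite_subsets_at_top X)"
  proof (rule eventually_finite_subsets_at_top_weakI)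
   fix Y assume "finite Y" "Y \<subseteq> X"
   thus "continuous_on (cball z d) (%s. \<Sum>x\<in>Y. f x s) \<and> (%s. \<Sum>x\<in>Y. f x s) holomorphic_on ball z d"
    using holomorphic_on_subset[OF h d(2)] holomorphic_on_subset[OF h, of Y "ball z d"] d(2) ball_subset_cball
    by (meson holomorphic_on_imp_continuous_on order_trans)
  qed
  hence "(%s. \<Sum>\<^sub>\<infinity>x\<in>X. f x s) holomorphic_on ball z d"
   using holomorphic_uniform_limit[OF _ u] by auto
  thus ?thesis using d(1) holomorphic_on_imp_differentiable_at[of _ "ball z d"] by (simp add: centre_in_ball)
 qed
 thus ?thesis using holomorphic_on_def field_differentiable_at_within by blast
qed

primrec powr_fdiff :: "nat => complex => real => complex" where
 "powr_fdiff 0 s x = of_real x powr (- s)"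
| "powr_fdiff (Suc K) s x = powr_fdiff K s x - powr_fdiff K s (x + 1)"

lemma has_vector_derivative_powr:
 assumes "x > 0" shows "((%x. complex_of_real x powr s) has_vd s * of_real x powr (s - 1)) (at x within A)"
proof -
 have "((%z. z powr s) has_field_derivative s * of_real x powr (s - 1)) (at (complex_of_real x))"
  using assms by (intro has_field_derivative_powr) (auto simp: complex_nonpos_Reals_iff)
 thus ?thesis by (rule has_vector_derivative_real_field)
qed

lemma has_vector_derivative_powr_fdiff: "x > 0 ==> (powr_fdiff K s has_vd (- s) * powr_fdiff K (s + 1) x) (at x within A)"
proof (induction K arbitrary: x A)
 case 0
 have "- (s + 1) = - s - 1" by simp
 thus ?case using has_vector_derivative_powr[OF 0, of "- s" A] by (simp only: powr_fdiff.simps(1)[abs_def])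
next
 case (Suc K)
 have "((%x. x + 1) has_real_derivative 1) (at x)" by (auto intro!: derivative_eq_intros)
 hence "((%x. x + 1) has_vd 1) (at x)" by (simp add: has_real_derivative_iff_has_vector_derivative)
 hence "((%x. powr_fdiff K s (x + 1)) has_vd (- s) * powr_fdiff K (s + 1) (x + 1)) (at x)"
  using vector_diff_chain_at[of "%x. x + 1" 1 x "powr_fdiff K s" "(- s) * powr_fdiff K (s + 1) (x + 1)"] Suc.IH[of "x + 1" UNIV] Suc.prems
  by (simp add: o_def)
 hence "((%x. powr_fdiff K s x - powr_fdiff K s (x + 1)) has_vd (- s) * powr_fdiff K (s + 1) x - (- s) * powr_fdiff K (s + 1) (x + 1)) (at x)"
  using Suc by (intro has_vector_derivative_diff) auto
 moreover have "powr_fdiff (Suc K) s = (%x. powr_fdiff K s x - powr_fdiff K s (x + 1))" by (rule ext) simp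
 ultimately have "(powr_fdiff (Suc K) s has_vd (- s) * powr_fdiff (Suc K) (s + 1) x) (at x)" by (simp add: right_diff_distrib)
 thus ?case by (rule has_vector_derivative_at_within)
qed

lemma norm_powr_fdiff_le: "x >= 1 ==> Re s + real K >= 0 ==> cmod (powr_fdiff K s x) <= cmod (pochhammer s K) * x powr (- (Re s + real K))"
proof (induction K arbitrary: s x)
 case 0
 thus ?case by (simp add: norm_powr_real_powr)
next
 case (Suc K)
 have "norm (powr_fdiff K s (x + 1) - powr_fdiff K s x)
   <= (cmod s * (cmod (pochhammer (s + 1) K) * x powr (- (Re s + 1 + real K)))) * (x + 1 - x)"
 proof (rule norm_diff_le_deriv)
  fix t assume t: "t \<in> {x..x + 1}"
  show "(powr_fdiff K s has_vd (- s) * powr_fdiff K (s + 1) t) (at t within {x..x+1})"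
   using t Suc.prems by (intro has_vector_derivative_powr_fdiff) auto
  have "cmod (powr_fdiff K (s + 1) t) <= cmod (pochhammer (s + 1) K) * t powr (- (Re (s + 1) + real K))"
   using t Suc.prems by (intro Suc.IH) auto
  also have "... <= cmod (pochhammer (s + 1) K) * x powr (- (Re s + 1 + real K))"
   using t Suc.prems by (intro mult_left_mono) (auto intro!: powr_mono2')
  finally show "norm ((- s) * powr_fdiff K (s + 1) t) <= cmod s * (cmod (pochhammer (s + 1) K) * x powr (- (Re s + 1 + real K)))"
   by (simp add: norm_mult mult_left_mono)
 qed simp
 thus ?case by (simp add: pochhammer_rec norm_mult norm_minus_commute algebra_simps)
qed

lemma holomorphic_powr_fdiff: "x > 0 ==> (%s. powr_fdiff K s x) holomorphic_on A"
 by (induction K arbitrary: x) (auto intro!: holomorphic_intros)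

lemma summable_powr_nat: assumes "a > 1" shows "(%n::nat. real (Suc n) powr (- a)) summable_on UNIV"
proof -
 have "summable (%n. real (Suc n) powr (- a))"
  using assms by (subst summable_Suc_iff[of "%n. real n powr (- a)"]) (simp add: summable_real_powr_iff)
 thus ?thesis by (subst summable_on_UNIV_nonneg_real_iff) auto
qed

definition eta_series :: "nat => complex => complex" where
 "eta_series K s = (\<Sum>i<K. powr_fdiff i s 1 / 2 ^ Suc i) + (INFSUM n::nat. (-1) ^ n * powr_fdiff K s (real (Suc n))) / 2 ^ K"

lemma powr_fdiff_abs_summable:
 assumes "Re s + real K > 1" shows "(%n::nat. cmod ((-1) ^ n * powr_fdiff K s (real (Suc n)))) summable_on UNIV"
proof -
 have "(%n::nat. cmod (pochhammer s K) * real (Suc n) powr (- (Re s + real K))) summable_on UNIV"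
  using assms by (intro summable_on_cmult_right summable_powr_nat)
 thus ?thesis
  by (rule summable_on_comparison_test) (use assms norm_powr_fdiff_le[of "real (Suc n)" s K for n] in \<open>auto simp: norm_mult norm_power\<close>)
qed

lemma eta_series_Suc: assumes "Re s + real K > 1" shows "eta_series (Suc K) s = eta_series K s"
proof -
 define a where "a n = (-1) ^ n * powr_fdiff K s (real (Suc n))" for n
 have sa: "a summable_on UNIV" unfolding a_def by (rule abs_summable_summable[OF powr_fdiff_abs_summable[OF assms]])
 hence "a sums (INFSUM n. a n)" by (intro has_sum_imp_sums) simp
 hence "(%n. a (Suc n)) sums ((INFSUM n. a n) - a 0)" by (simp add: sums_Suc_iff)
 from sums_add[OF \<open>a sums (INFSUM n. a n)\<close> this]
 have "(%n. a n + a (Suc n)) sums (2 * (INFSUM n. a n) - powr_fdiff K s 1)" by (simp add: a_def algebra_simps)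
 moreover have "a n + a (Suc n) = (-1) ^ n * powr_fdiff (Suc K) s (real (Suc n))" for n
  by (simp add: a_def algebra_simps)
 moreover have "(%n. (-1) ^ n * powr_fdiff (Suc K) s (real (Suc n))) sums (INFSUM n. (-1) ^ n * powr_fdiff (Suc K) s (real (Suc n)))"
  using assms by (intro has_sum_imp_sums has_sum_infsum abs_summable_summable[OF powr_fdiff_abs_summable]) auto
 ultimately have eq: "(INFSUM n. (-1) ^ n * powr_fdiff (Suc K) s (real (Suc n))) = 2 * (INFSUM n. a n) - powr_fdiff K s 1"
  using sums_unique2 by (metis (no_types, lifting) sums_cong)
 show ?thesis unfolding eta_series_def eq unfolding a_def[symmetric] by (simp add: field_simps)
qed

lemma eta_series_independent: assumes "K <= L" "Re s + real K > 1" shows "eta_series L s = eta_series K s"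
 using assms(1)
proof (induction L rule: dec_induct)
 case (step n)
 thus ?case using eta_series_Suc[of s n] assms(2) by simp
qed simp

lemma norm_powr_fdiff_locally_dominated:
 assumes z: "Re z + real K > 1"
 obtains d M where "d > 0" "cball z d \<subseteq> {s. Re s + real K > 1}" "M summable_on UNIV"
  "!!n s. s \<in> cball z d ==> cmod ((-1) ^ n * powr_fdiff K s (real (Suc n))) <= M n"
proof -
 define d where "d = (Re z + real K - 1) / 2"
 have d: "d > 0" using z by (simp add: d_def)
 have Re_ge: "Re s + real K >= 1 + d" if "s \<in> cball z d" for s
 proof -
  have "\<bar>Re (z - s)\<bar> <= d" using that abs_Re_le_cmod[of "z - s"] by (simp add: dist_norm)
  moreover have "Re z + real K = 1 + 2 * d" by (simp add: d_def field_simps)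
  ultimately show ?thesis by simp
 qed
 have "continuous_on (cball z d) (%s. pochhammer s K)"
  by (intro holomorphic_on_imp_continuous_on holomorphic_pochhammer holomorphic_intros)
 hence "bounded ((%s. pochhammer s K) ` cball z d)" by (intro compact_imp_bounded compact_continuous_image compact_cball)
 then obtain B where B: "B > 0" "!!s. s \<in> cball z d ==> cmod (pochhammer s K) <= B"
  unfolding bounded_pos by blast
 show thesis
 proof
  show "cmod ((-1) ^ n * powr_fdiff K s (real (Suc n))) <= B * real (Suc n) powr (- (1 + d))" if s: "s \<in> cball z d" for n s
  proof -
   have "cmod ((-1) ^ n * powr_fdiff K s (real (Suc n))) <= cmod (pochhammer s K) * real (Suc n) powr (- (Re s + real K))"
    using norm_powr_fdiff_le[of "real (Suc n)" s K] Re_ge[OF s] d by (simp add: norm_mult norm_power)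
   also have "... <= B * real (Suc n) powr (- (1 + d))"
    using B Re_ge[OF s] s by (intro mult_mono powr_mono) auto
   finally show ?thesis .
  qed
  show "(%n. B * real (Suc n) powr (- (1 + d))) summable_on UNIV"
   using d by (intro summable_on_cmult_right summable_powr_nat) auto
  show "cball z d \<subseteq> {s. Re s + real K > 1}" using Re_ge d by force
 qed (rule d)
qed

lemma open_eta_series_domain: "open {s. Re s + real K > 1}"
 using open_halfspace_Re_gt[of "1 - real K"] by (simp add: diff_less_eq)

lemma holomorphic_eta_series: "eta_series K holomorphic_on {s. Re s + real K > 1}"
proof -
 have "(%s. INFSUM n::nat. (-1) ^ n * powr_fdiff K s (real (Suc n))) holomorphic_on {s. Re s + real K > 1}"
 proof (rule holomorphic_infsum[OF open_eta_series_domain])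
  show "(%s. (-1) ^ n * powr_fdiff K s (real (Suc n))) holomorphic_on {s. Re s + real K > 1}" for n :: nat
   by (intro holomorphic_intros holomorphic_powr_fdiff) auto
  fix z assume "z \<in> {s. Re s + real K > 1}"
  thus "\<exists>d M. d > 0 \<and> cball z d \<subseteq> {s. Re s + real K > 1} \<and> M summable_on UNIV \<and>
    (\<forall>n\<in>UNIV. \<forall>w\<in>cball z d. cmod ((-1) ^ n * powr_fdiff K w (real (Suc n))) <= M n)"
   using norm_powr_fdiff_locally_dominated[of z K] by (metis mem_Collect_eq)
 qed
 thus ?thesis
  unfolding eta_series_def[abs_def] by (intro holomorphic_intros holomorphic_powr_fdiff) auto
qed

definition dirichlet_eta :: "complex => complex" where "dirichlet_eta s = eta_series (nat \<lceil>2 - Re s\<rceil>) s"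

lemma dirichlet_eta_eq_series: assumes "Re s + real K > 1" shows "dirichlet_eta s = eta_series K s"
proof -
 define L where "L = nat \<lceil>2 - Re s\<rceil>"
 have "Re s + real L > 1" unfolding L_def by linarith
 hence "eta_series (max K L) s = eta_series L s" "eta_series (max K L) s = eta_series K s" using assms by (auto intro!: eta_series_independent)
 thus ?thesis by (simp add: dirichlet_eta_def L_def)
qed

lemma holomorphic_dirichlet_eta: "dirichlet_eta holomorphic_on A"
proof -
 have "dirichlet_eta field_differentiable (at z)" for z
 proof -
  define K where "K = nat \<lceil>2 - Re z\<rceil>"
  have z: "z \<in> {s. Re s + real K > 1}" unfolding K_def by simp linarith
  have "dirichlet_eta holomorphic_on {s. Re s + real K > 1}"
   using holomorphic_eta_series[of K] by (rule holomorphic_transform) (simp add: dirichlet_eta_eq_series)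
  thus ?thesis using z open_eta_series_domain holomorphic_on_imp_differentiable_at by blast
 qed
 thus ?thesis using holomorphic_on_def field_differentiable_at_within by blast
qed

text \<open>The zeros of the factor relating the zeta function to the alternating series, all on the line \<open>Re s = 1\<close>.
 \<open>riemann_zeta\<close> has the junk value 0 there.\<close>

definition eta_factor_zeros :: "complex set" where "eta_factor_zeros = {s. 2 powr (1 - s) = 1}"

definition riemann_zeta :: "complex => complex" where "riemann_zeta s = dirichlet_eta s / (1 - 2 powr (1 - s))"

lemma Re_eta_factor_zero: assumes "s \<in> eta_factor_zeros" shows "Re s = 1"
proof -
 have "cmod (2 powr (1 - s)) = 1" using assms by (simp add: eta_factor_zeros_def)
 hence "2 powr (1 - Re s) = (1::real)" using norm_powr_real_powr[of 2 "1 - s"] by simp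
 thus ?thesis by (simp add: powr_eq_one_iff_gen)
qed

lemma has_sum_dirichlet_eta:
 assumes s: "Re s > 1"
 shows "((%n::nat. (-1) ^ n * of_real (real (Suc n)) powr (- s)) has_sum dirichlet_eta s) UNIV"
proof -
 have "(%n::nat. (-1) ^ n * complex_of_real (real (Suc n)) powr (- s)) summable_on UNIV"
  by (rule abs_summable_summable) (use powr_fdiff_abs_summable[of s 0] s in simp)
 moreover have "dirichlet_eta s = (INFSUM n::nat. (-1) ^ n * of_real (real (Suc n)) powr (- s))"
  using dirichlet_eta_eq_series[of s 0] s by (simp add: eta_series_def)
 ultimately show ?thesis by simp
qed

lemma has_sum_riemann_zeta:
 assumes s: "Re s > 1"
 shows "((%n::nat. of_real (real (Suc n)) powr (- s)) has_sum riemann_zeta s) UNIV"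
proof -
 define f where "f n = complex_of_real (real (Suc n)) powr (- s)" for n :: nat
 define Z where "Z = (INFSUM n. f n)"
 have "f summable_on UNIV"
  by (rule abs_summable_summable) (use summable_powr_nat[OF s] in \<open>simp add: f_def norm_powr_real_powr\<close>)
 hence Z: "(f has_sum Z) UNIV" unfolding Z_def by simp
 have difference: "((%n. f n - (-1) ^ n * f n) has_sum (Z - dirichlet_eta s)) UNIV"
  unfolding f_def by (intro has_sum_diff has_sum_dirichlet_eta[OF s] Z[unfolded f_def[abs_def]])
 have inj: "inj (%m::nat. 2 * m + 1)" by (auto simp: inj_on_def)
 have "((%n. f n - (-1) ^ n * f n) has_sum (Z - dirichlet_eta s)) (range (%m. 2 * m + 1))"
 proof (rule has_sum_cong_neutral[THEN iffD1, OF _ _ _ difference])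
  fix n :: nat assume "n \<in> UNIV - range (%m. 2 * m + 1)"
  hence "even n" by (metis DiffD2 oddE rangeI)
  thus "f n - (-1) ^ n * f n = 0" by simp
 qed auto
 hence "((%n. f n - (-1) ^ n * f n) \<circ> (%m. 2 * m + 1) has_sum (Z - dirichlet_eta s)) UNIV"
  by (subst (asm) has_sum_reindex[OF inj])
 moreover have "((%n. f n - (-1) ^ n * f n) \<circ> (%m. 2 * m + 1)) m = 2 powr (1 - s) * f m" for m
 proof -
  have "complex_of_real (real (Suc (2 * m + 1))) = 2 * of_real (real (Suc m))" by simp
  hence "f (2 * m + 1) = 2 powr (- s) * f m"
   unfolding f_def using powr_times_real[of 2 "of_real (real (Suc m))" "- s"] by simp
  moreover have "(2::complex) powr (1 - s) = 2 * 2 powr (- s)" by (simp add: powr_diff powr_minus field_simps)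
  ultimately show ?thesis by simp
 qed
 ultimately have "((%m. 2 powr (1 - s) * f m) has_sum (Z - dirichlet_eta s)) UNIV" by (simp add: o_def)
 hence "2 powr (1 - s) * Z = Z - dirichlet_eta s" using has_sum_unique has_sum_cmult_right[OF Z] by blast
 moreover have "2 powr (1 - s) \<noteq> 1" using Re_eta_factor_zero[of s] s by (auto simp: eta_factor_zeros_def)
 ultimately have "Z = riemann_zeta s" by (simp add: riemann_zeta_def field_simps)
 thus ?thesis using Z unfolding f_def[abs_def] by simp
qed

lemma closed_eta_factor_zeros: "closed eta_factor_zeros"
proof -
 have "continuous_on UNIV (%s::complex. 2 powr (1 - s))" by (intro continuous_intros) auto
 thus ?thesis unfolding eta_factor_zeros_def using continuous_closed_preimage_constant[of UNIV "%s::complex. 2 powr (1 - s)" 1] by simp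
qed

lemma countable_eta_factor_zeros: "countable eta_factor_zeros"
proof -
 have "eta_factor_zeros \<subseteq> range (%n::int. 1 - of_real (2 * of_int n * pi / ln 2) * \<i>)"
 proof
  fix s assume s: "s \<in> eta_factor_zeros"
  have "Ln 2 = complex_of_real (ln 2)" using Ln_of_real[of 2] by simp
  with s have "exp ((1 - s) * of_real (ln 2)) = 1" by (simp add: eta_factor_zeros_def powr_def)
  then obtain n :: int where n: "Im ((1 - s) * of_real (ln 2)) = of_int (2 * n) * pi" using exp_eq_1 by blast
  hence "Im s = - (2 * of_int n * pi / ln 2)" by (simp add: field_simps)
  hence "s = 1 - of_real (2 * of_int n * pi / ln 2) * \<i>" using Re_eta_factor_zero[OF s] by (intro complex_eqI) auto
  thus "s \<in> range (%n::int. 1 - of_real (2 * of_int n * pi / ln 2) * \<i>)" by blast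
 qed
 thus ?thesis by (rule countable_subset) auto
qed

lemma holomorphic_riemann_zeta: "riemann_zeta holomorphic_on (- eta_factor_zeros)"
 unfolding riemann_zeta_def[abs_def] by (intro holomorphic_intros holomorphic_dirichlet_eta) (auto simp: eta_factor_zeros_def)

lemma has_sum_riemann_zeta_int:
 assumes s: "Re s > 1"
 shows "((%n::int. of_real \<bar>of_int n\<bar> powr (- s)) has_sum 2 * riemann_zeta s) {n. n \<noteq> 0}"
proof -
 let ?g = "%n::int. complex_of_real \<bar>of_int n\<bar> powr (- s)"
 let ?pos = "range (%n. int (Suc n))" and ?neg = "range (%n. - int (Suc n))"
 have "(?g has_sum riemann_zeta s) ?pos" "(?g has_sum riemann_zeta s) ?neg"
  using has_sum_riemann_zeta[OF s] by (subst has_sum_reindex; auto simp: inj_on_def o_def add.commute)+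
 moreover have "?pos \<inter> ?neg = {}" by auto
 moreover have "?pos \<union> ?neg = {n. n \<noteq> 0}"
 proof (intro equalityI subsetI)
  fix n :: int assume "n \<in> {n. n \<noteq> 0}"
  thus "n \<in> ?pos \<union> ?neg" by (cases n rule: int_cases3) (auto simp: image_iff gr0_conv_Suc)
 qed auto
 ultimately show ?thesis by (metis has_sum_Un_disjoint mult_2)
qed

lemma abs_summable_riemann_zeta_int:
 "Re s > 1 ==> (%n::int. cmod (of_real \<bar>of_int n\<bar> powr (- s))) summable_on {n. n \<noteq> 0}"
 by (rule iffD1[OF summable_on_iff_abs_summable_on_complex has_sum_imp_summable[OF has_sum_riemann_zeta_int]])

section \<open>The zeta function of a positive trigonometric polynomial\<close>

lemma powr_minus_1_le_powers:
 assumes x0: "0 < x0" "x0 <= 1" and t: "x0 <= t" and r: "\<bar>r\<bar> <= real K"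
 shows "t powr (r - 1) <= (1 + t) ^ K * (1 + (1 / x0) ^ (K + 1))"
proof -
 have "t powr (r - 1) <= (1 + t) ^ K + (1 / x0) ^ (K + 1)"
 proof (cases "r - 1 >= 0")
  case True
  have "t powr (r - 1) <= (1 + t) powr (r - 1)" using True x0 t by (intro powr_mono2) auto
  also have "... <= (1 + t) powr real K" using x0 t r by (intro powr_mono) auto
  also have "... = (1 + t) ^ K" using x0 t by (simp add: powr_realpow)
  finally show ?thesis using x0 by (simp add: add_increasing2)
 next
  case False
  have "t powr (r - 1) <= x0 powr (r - 1)" using False x0 t by (intro powr_mono2') auto
  also have "... = (1 / x0) powr (1 - r)" using x0 by (simp add: powr_divide powr_diff)
  also have "... <= (1 / x0) powr real (K + 1)" using x0 r by (intro powr_mono) auto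
  also have "... = (1 / x0) ^ (K + 1)" using x0 by (intro powr_realpow) auto
  finally show ?thesis using x0 t by (simp add: add_increasing)
 qed
 also have "... <= (1 + t) ^ K * (1 + (1 / x0) ^ (K + 1))"
 proof -
  have "1 * (1 / x0) ^ (K + 1) <= (1 + t) ^ K * (1 / x0) ^ (K + 1)" using x0 t by (intro mult_right_mono one_le_power) auto
  thus ?thesis by (simp add: distrib_left)
 qed
 finally show ?thesis .
qed

lemma norm_powr_diff_le:
 assumes x0: "0 < x0" "x0 <= 1" and x: "x >= x0" and y: "y >= x0" and s: "cmod s <= real K"
 shows "cmod (of_real x powr (- s) - of_real y powr (- s)) <= real K * (1 + (1 / x0) ^ (K + 1)) * (\<bar>x - y\<bar> * ((1 + x) ^ K * (1 + y) ^ K))"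
 using x y
proof (induction x y rule: linorder_wlog)
 case (sym x y)
 thus ?case by (simp add: norm_minus_commute abs_minus_commute mult_ac)
next
 case (le x y)
 let ?B = "(1 + (1 / x0) ^ (K + 1)) * ((1 + x) ^ K * (1 + y) ^ K)"
 have "cmod (of_real y powr (- s) - of_real x powr (- s)) <= real K * ?B * (y - x)"
 proof (rule norm_diff_le_deriv[OF le(1)])
  fix t assume t: "t \<in> {x..y}"
  have t0: "t > 0" "x0 <= t" using t le x0 by auto
  show "((%x. complex_of_real x powr - s) has_vd (- s) * of_real t powr (- s - 1)) (at t within {x..y})"
   by (rule has_vector_derivative_powr[OF t0(1)])
  have "t powr (- Re s - 1) <= (1 + t) ^ K * (1 + (1 / x0) ^ (K + 1))"
   using s abs_Re_le_cmod[of s] by (intro powr_minus_1_le_powers x0 t0) simp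
  also have "... <= ((1 + x) ^ K * (1 + y) ^ K) * (1 + (1 / x0) ^ (K + 1))"
  proof (intro mult_right_mono)
   have "1 * (1 + t) ^ K <= (1 + x) ^ K * (1 + y) ^ K" using t le x0 by (intro mult_mono one_le_power power_mono) auto
   thus "(1 + t) ^ K <= (1 + x) ^ K * (1 + y) ^ K" by simp
  qed (use x0 in auto)
  finally have "cmod s * t powr (- Re s - 1) <= real K * ?B"
   using s by (intro mult_mono) (auto simp: mult.commute)
  thus "norm ((- s) * of_real t powr (- s - 1)) <= real K * ?B"
   using t0 norm_powr_real_powr[of t "- s - 1"] by (simp add: norm_mult)
 qed
 thus ?case using le(1) by (simp add: norm_minus_commute mult_ac)
qed

lemma mult_le_sum_squares: "x * y <= x\<^sup>2 + (y::real)\<^sup>2"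
 using two_mult_le_sum_squares[of x y] sum_power2_ge_zero[of x y] by linarith

lemma rapid_matrix_row_norm_decay:
 assumes "rapid_matrix s"
 obtains C where "!!n. (INFSUM k. (cmod (s n k))\<^sup>2) <= C / bracket n ^ (2 * K)"
proof -
 obtain C where C: "!!n k. cmod (s n k) <= C / bracket n ^ K / bracket k ^ 1" using rapid_matrix_decay[OF assms] by blast
 have "norm ((cmod (s n k))\<^sup>2) <= (C\<^sup>2 / bracket n ^ (2 * K)) / bracket k ^ 2" for n k
 proof -
  have "(cmod (s n k))\<^sup>2 <= (C / bracket n ^ K / bracket k ^ 1)\<^sup>2" by (intro power_mono C) simp
  also have "... = (C\<^sup>2 / bracket n ^ (2 * K)) / bracket k ^ 2"
   by (simp add: power_divide power_mult_distrib mult.commute flip: power_mult)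
  finally show ?thesis by simp
 qed
 from norm_infsum_bracket_bound[OF this]
 have "(INFSUM k. (cmod (s n k))\<^sup>2) <= C\<^sup>2 * (INFSUM n. 1 / bracket n ^ 2) / bracket n ^ (2 * K)" for n
  by (simp add: infsum_nonneg)
 thus thesis by (rule that)
qed

context mode_eigenbasis
begin

definition weight :: "int => nat => real" where "weight n j = (cmod (\<psi> j n))\<^sup>2"

lemma weight_nonneg: "weight n j >= 0" by (simp add: weight_def)

lemma has_sum_parseval_psi:
 assumes "rapid f" shows "((%j. (cmod (l2_form f (\<psi> j)))\<^sup>2) has_sum Re (l2_form f f)) UNIV"
 by (rule sums_nonneg_imp_has_sum[OF psi_parseval[OF rapid_half_sobolev[OF assms]]]) auto

lemma has_sum_weight_eigenvalues: "((%j. weight n j) has_sum 1) UNIV"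
 using has_sum_parseval_psi[OF rapid_delta[of n]] by (simp add: l2_form_delta weight_def delta_def)

lemma has_sum_weight_modes: "((%n. weight n j) has_sum 1) UNIV"
 using has_sum_l2_norm[OF rapid_half_sobolev[OF psi_rapid[of j]]] by (simp add: psi_orthonormal weight_def)

definition pos_idx :: "nat set" where "pos_idx = {j. lam j > 0}"

definition pos_pairs :: "(int \<times> nat) set" where "pos_pairs = {n. n \<noteq> 0} \<times> pos_idx"

lemma has_sum_weight_pos_idx: assumes "n \<noteq> 0" shows "((%j. weight n j) has_sum 1) pos_idx"
 by (rule has_sum_cong_neutral[THEN iffD1, OF _ _ _ has_sum_weight_eigenvalues[of n]])
  (auto simp: pos_idx_def weight_def not_less psi_eq_0_if_nonpos[OF _ assms])

lemma has_sum_weight_nonzero_modes: assumes "j \<in> pos_idx" shows "((%n. weight n j) has_sum 1) {n. n \<noteq> 0}"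
 by (rule has_sum_cong_neutral[THEN iffD1, OF _ _ _ has_sum_weight_modes[of j]])
  (use assms psi_0_eq_0 in \<open>auto simp: pos_idx_def weight_def\<close>)

lemma pos_lam_bounded_below: obtains x0 where "0 < x0" "x0 <= 1" "!!j. j \<in> pos_idx ==> x0 <= lam j"
proof -
 define F where "F = insert 1 (lam ` {j \<in> pos_idx. lam j <= 1})"
 have F: "finite F" unfolding F_def using finite_lam_le[of 1] by (auto intro: finite_subset)
 have "Min F <= lam j" if j: "j \<in> pos_idx" for j
 proof (cases "lam j <= 1")
  case True
  thus ?thesis using F j by (intro Min_le) (auto simp: F_def)
 next
  case False
  moreover have "Min F <= 1" using F by (intro Min_le) (auto simp: F_def)
  ultimately show ?thesis by linarith
 qed
 moreover have "0 < Min F" using F by (subst Min_gr_iff) (auto simp: F_def pos_idx_def)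
 moreover have "Min F <= 1" using F by (intro Min_le) (auto simp: F_def)
 ultimately show thesis using that by blast
qed

definition correction_term :: "complex => int \<times> nat => complex" where
 "correction_term s p = (case p of (n, j) => of_real (weight n j) * (of_real (lam j) powr (- s) - of_real \<bar>of_int n\<bar> powr (- s)))"

lemma summable_weight_div_bracket: "(%(n, j). weight n j / bracket n ^ 2) summable_on UNIV \<times> UNIV"
proof (rule summable_on_SigmaI)
 show "((%j. case (n, j) of (n, j) => weight n j / bracket n ^ 2) has_sum 1 / bracket n ^ 2) UNIV" for n
  using has_sum_cmult_left[OF has_sum_weight_eigenvalues[of n], of "1 / bracket n ^ 2"] by simp
qed (use summable_on_inverse_bracket_sq in \<open>auto simp: weight_nonneg\<close>)

lemma has_sum_parseval_rapid_matrix: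
 assumes "rapid_matrix s"
 shows "((%j. (cmod (INFSUM k. s n k * \<psi> j k))\<^sup>2) has_sum (INFSUM k. (cmod (s n k))\<^sup>2)) UNIV"
proof -
 have row: "rapid (%k. cnj (s n k))" using rapid_matrix_row[OF assms, of n] by (simp add: rapid_def)
 have "l2_form (%k. cnj (s n k)) (\<psi> j) = cnj (INFSUM k. s n k * \<psi> j k)" for j
  unfolding l2_form_def infsum_cnj[symmetric] by simp
 moreover have "Re (l2_form (%k. cnj (s n k)) (%k. cnj (s n k))) = (INFSUM k. (cmod (s n k))\<^sup>2)"
  using infsumI[OF has_sum_l2_norm[OF rapid_half_sobolev[OF row]]] by simp
 ultimately show ?thesis using has_sum_parseval_psi[OF row] by simp
qed

lemma summable_parseval_rapid_matrix:
 assumes "rapid_matrix s"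
 shows "(%(n, j). bracket n ^ (2 * K) * (cmod (INFSUM k. s n k * \<psi> j k))\<^sup>2) summable_on UNIV \<times> UNIV"
proof (rule summable_on_SigmaI)
 show "((%j. case (n, j) of (n, j) => bracket n ^ (2 * K) * (cmod (INFSUM k. s n k * \<psi> j k))\<^sup>2)
   has_sum bracket n ^ (2 * K) * (INFSUM k. (cmod (s n k))\<^sup>2)) UNIV" for n
  unfolding prod.case by (intro has_sum_cmult_right has_sum_parseval_rapid_matrix assms)
 obtain C where C: "!!n. (INFSUM k. (cmod (s n k))\<^sup>2) <= C / bracket n ^ (2 * (K + 1))"
  using rapid_matrix_row_norm_decay[OF assms] by blast
 have "norm (bracket n ^ (2 * K) * (INFSUM k. (cmod (s n k))\<^sup>2)) <= C / bracket n ^ 2" for n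
 proof -
  have "bracket n ^ (2 * K) * (INFSUM k. (cmod (s n k))\<^sup>2) <= bracket n ^ (2 * K) * (C / bracket n ^ (2 * (K + 1)))"
   by (intro mult_left_mono C) (simp add: less_imp_le)
  thus ?thesis by (simp add: power_add infsum_nonneg less_imp_le power2_eq_square)
 qed
 thus "(%n. bracket n ^ (2 * K) * (INFSUM k. (cmod (s n k))\<^sup>2)) summable_on UNIV" by (rule summable_on_bracket_bound)
qed (auto simp: less_imp_le)

lemma norm_correction_term_le:
 assumes x0: "0 < x0" "x0 <= 1" "!!j. j \<in> pos_idx ==> x0 <= lam j" and z: "cmod z <= real K"
  and s: "of_real ((1 + lam j) ^ K) * (INFSUM k. remainder n k * \<psi> j k) = (INFSUM k. s n k * \<psi> j k)"
  and nj: "n \<noteq> 0" "j \<in> pos_idx"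
 shows "cmod (correction_term z (n, j)) <= real K * (1 + (1 / x0) ^ (K + 1)) *
  (weight n j / bracket n ^ 2 + bracket n ^ (2 * (K + 1)) * (cmod (INFSUM k. s n k * \<psi> j k))\<^sup>2)"
proof -
 define C where "C = real K * (1 + (1 / x0) ^ (K + 1))"
 have C: "C >= 0" unfolding C_def using x0 by auto
 define \<sigma> where "\<sigma> = cmod (INFSUM k. s n k * \<psi> j k)"
 have lam: "lam j > 0" using nj by (simp add: pos_idx_def)
 have n1: "1 <= \<bar>real_of_int n\<bar>" using nj(1) by linarith
 have "\<sigma> = (1 + lam j) ^ K * cmod (of_real (lam j - of_int \<bar>n\<bar>) * \<psi> j n)"
  unfolding \<sigma>_def s[symmetric] psi_eigen norm_mult norm_of_real using lam by simp
 also have "... = (1 + lam j) ^ K * (\<bar>lam j - \<bar>of_int n\<bar>\<bar> * cmod (\<psi> j n))" by (simp only: norm_mult norm_of_real of_int_abs)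
 finally have sigma: "\<sigma> = (1 + lam j) ^ K * (\<bar>lam j - \<bar>of_int n\<bar>\<bar> * cmod (\<psi> j n))" .
 have "cmod (correction_term z (n, j)) = (cmod (\<psi> j n))\<^sup>2 * cmod (of_real (lam j) powr (- z) - of_real \<bar>of_int n\<bar> powr (- z))"
  by (simp add: correction_term_def norm_mult weight_nonneg flip: weight_def)
 also have "... <= (cmod (\<psi> j n))\<^sup>2 * (C * (\<bar>lam j - \<bar>of_int n\<bar>\<bar> * ((1 + lam j) ^ K * (1 + \<bar>of_int n\<bar>) ^ K)))"
  unfolding C_def using x0(3)[OF nj(2)] n1 x0(1,2) z by (intro mult_left_mono norm_powr_diff_le) auto
 also have "... = C * ((cmod (\<psi> j n) / bracket n) * (bracket n ^ (K + 1) * \<sigma>))"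
  unfolding sigma by (simp add: bracket_def[symmetric] power2_eq_square mult_ac)
 also have "... <= C * ((cmod (\<psi> j n) / bracket n)\<^sup>2 + (bracket n ^ (K + 1) * \<sigma>)\<^sup>2)"
  by (intro mult_left_mono C mult_le_sum_squares)
 also have "... = C * (weight n j / bracket n ^ 2 + bracket n ^ (2 * (K + 1)) * \<sigma>\<^sup>2)"
  by (simp only: weight_def power_divide power_mult_distrib power_even_eq)
 finally show ?thesis unfolding C_def \<sigma>_def .
qed

lemma correction_term_dominated:
 obtains M where "M summable_on pos_pairs" "!!s p. cmod s <= real K ==> p \<in> pos_pairs ==> cmod (correction_term s p) <= M p"
proof -
 obtain x0 where x0: "0 < x0" "x0 <= 1" "!!j. j \<in> pos_idx ==> x0 <= lam j" by (rule pos_lam_bounded_below) blast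
 obtain s where s: "rapid_matrix s" "!!j n. of_real ((1 + lam j) ^ K) * (INFSUM k. remainder n k * \<psi> j k) = (INFSUM k. s n k * \<psi> j k)"
  using remainder_iterate by blast
 define M where "M p = real K * (1 + (1 / x0) ^ (K + 1)) * ((case p of (n, j) => weight n j / bracket n ^ 2)
  + (case p of (n, j) => bracket n ^ (2 * (K + 1)) * (cmod (INFSUM k. s n k * \<psi> j k))\<^sup>2))" for p
 have "M summable_on UNIV \<times> UNIV" unfolding M_def
  by (intro summable_on_cmult_right summable_on_add summable_weight_div_bracket summable_parseval_rapid_matrix s)
 hence "M summable_on pos_pairs" by (rule summable_on_subset) auto
 moreover have "cmod (correction_term z p) <= M p" if "cmod z <= real K" "p \<in> pos_pairs" for z p
  using that norm_correction_term_le[OF x0 that(1), where s=s] s(2) by (auto simp: M_def pos_pairs_def)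
 ultimately show thesis using that by blast
qed

definition zeta_correction :: "complex => complex" where "zeta_correction s = (\<Sum>\<^sub>\<infinity>p\<in>pos_pairs. correction_term s p)"

lemma correction_term_abs_summable: "(%p. cmod (correction_term s p)) summable_on pos_pairs"
proof -
 obtain M where M: "M summable_on pos_pairs" "!!z p. cmod z <= real (nat \<lceil>cmod s\<rceil>) ==> p \<in> pos_pairs ==> cmod (correction_term z p) <= M p"
  using correction_term_dominated by blast
 show ?thesis by (rule abs_summable_dominated[OF M(1)]) (rule M(2), linarith)
qed

lemma holomorphic_zeta_correction: "zeta_correction holomorphic_on UNIV"
 unfolding zeta_correction_def[abs_def]
proof (rule holomorphic_infsum)
 fix p assume p: "p \<in> pos_pairs"
 hence "lam (snd p) \<noteq> 0" "fst p \<noteq> 0" by (auto simp: pos_pairs_def pos_idx_def)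
 thus "(%s. correction_term s p) holomorphic_on UNIV"
  unfolding correction_term_def case_prod_beta by (intro holomorphic_intros) auto
next
 fix z :: complex
 obtain M where M: "M summable_on pos_pairs"
  "!!w p. cmod w <= real (nat \<lceil>cmod z + 1\<rceil>) ==> p \<in> pos_pairs ==> cmod (correction_term w p) <= M p"
  using correction_term_dominated by blast
 have "cmod (correction_term w p) <= M p" if "w \<in> cball z 1" "p \<in> pos_pairs" for w p
 proof (rule M(2)[OF _ that(2)])
  have "cmod w <= cmod z + 1" using that(1) norm_triangle_ineq2[of w z] by (simp add: dist_norm norm_minus_commute)
  thus "cmod w <= real (nat \<lceil>cmod z + 1\<rceil>)" by linarith
 qed
 thus "\<exists>d M. d > 0 \<and> cball z d \<subseteq> UNIV \<and> M summable_on pos_pairs \<and> (\<forall>p\<in>pos_pairs. \<forall>w\<in>cball z d. cmod (correction_term w p) <= M p)"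
  using M(1) by (intro exI[of _ 1] exI[of _ M]) auto
qed auto

lemma has_sum_weighted_zeta_int:
 assumes s: "Re s > 1"
 shows "((%(n, j). of_real (weight n j) * complex_of_real \<bar>of_int n\<bar> powr (- s)) has_sum 2 * riemann_zeta s) pos_pairs"
 unfolding pos_pairs_def
proof (rule has_sum_SigmaI)
 show "((%j. case (n, j) of (n, j) => of_real (weight n j) * complex_of_real \<bar>of_int n\<bar> powr (- s))
   has_sum of_real \<bar>of_int n\<bar> powr (- s)) pos_idx"
  if "n \<in> {n. n \<noteq> 0}" for n
  using has_sum_cmult_left[OF has_sum_of_real[OF has_sum_weight_pos_idx, where 'a=complex]] that by fastforce
 show "((%n. of_real \<bar>of_int n\<bar> powr (- s)) has_sum 2 * riemann_zeta s) {n. n \<noteq> (0::int)}" by (rule has_sum_riemann_zeta_int[OF s])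
 show "(%(n, j). of_real (weight n j) * complex_of_real \<bar>of_int n\<bar> powr (- s)) summable_on {n. n \<noteq> 0} \<times> pos_idx"
 proof (rule abs_summable_summable, rule summable_on_SigmaI)
  show "((%j. cmod (case (n, j) of (n, j) => of_real (weight n j) * complex_of_real \<bar>of_int n\<bar> powr (- s)))
    has_sum cmod (complex_of_real \<bar>of_int n\<bar> powr (- s))) pos_idx" if "n \<in> {n. n \<noteq> 0}" for n
   using has_sum_cmult_left[OF has_sum_weight_pos_idx, of n "cmod (complex_of_real \<bar>of_int n\<bar> powr (- s))"] that
   by (simp add: norm_mult weight_nonneg)
 qed (use abs_summable_riemann_zeta_int[OF s] in auto)
qed

lemma has_sum_pos_lam_powr:
 assumes s: "Re s > 1" shows "((%j. of_real (lam j) powr (- s)) has_sum (2 * riemann_zeta s + zeta_correction s)) pos_idx"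
proof -
 have "(correction_term s has_sum zeta_correction s) pos_pairs"
  unfolding zeta_correction_def by (intro has_sum_infsum abs_summable_summable[OF correction_term_abs_summable])
 from has_sum_add[OF has_sum_weighted_zeta_int[OF s] this]
 have "((%(n, j). of_real (weight n j) * of_real (lam j) powr (- s)) has_sum (2 * riemann_zeta s + zeta_correction s)) ({n. n \<noteq> 0} \<times> pos_idx)"
  by (simp add: pos_pairs_def correction_term_def case_prod_unfold algebra_simps)
 hence swapped: "((%(j, n). of_real (weight n j) * of_real (lam j) powr (- s))
   has_sum (2 * riemann_zeta s + zeta_correction s)) (pos_idx \<times> {n. n \<noteq> 0})"
  by (subst (asm) has_sum_swap) (simp add: case_prod_beta)
 show ?thesis
 proof (rule has_sum_SigmaD[OF swapped])
  fix j assume "j \<in> pos_idx"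
  from has_sum_cmult_left[OF has_sum_of_real[OF has_sum_weight_nonzero_modes[OF this], where 'a=complex], of "of_real (lam j) powr (- s)"]
  show "((%n. case (j, n) of (j, n) => of_real (weight n j) * of_real (lam j) powr (- s)) has_sum of_real (lam j) powr (- s)) {n. n \<noteq> 0}" by simp
 qed
qed

lemma zeta_series_has_sum:
 assumes s: "Re s > 1"
 shows "((%\<mu>. of_nat (eig_mult b \<mu>) * of_real \<mu> powr (- s)) has_sum (2 * riemann_zeta s + zeta_correction s)) (pos_eigs b)"
proof -
 let ?B = "%\<mu>. {j. lam j = \<mu>}"
 have bij: "bij_betw snd (Sigma (pos_eigs b) ?B) pos_idx"
  by (rule bij_betwI[of _ _ _ "%j. (lam j, j)"]) (auto simp: pos_idx_def pos_eigs_eq)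
 have "((%p. of_real (lam (snd p)) powr (- s)) has_sum (2 * riemann_zeta s + zeta_correction s)) (Sigma (pos_eigs b) ?B)"
  using has_sum_reindex_bij_betw[OF bij, of "%j. of_real (lam j) powr (- s)"] has_sum_pos_lam_powr[OF s] by blast
 thus ?thesis
 proof (rule has_sum_SigmaD)
  fix \<mu> assume mu: "\<mu> \<in> pos_eigs b"
  hence "eig_mult b \<mu> = card (?B \<mu>)" by (intro eig_mult_eq) (simp add: pos_eigs_eq)
  moreover have "((%j. of_real (lam j) powr (- s)) has_sum (\<Sum>j\<in>?B \<mu>. complex_of_real (lam j) powr (- s))) (?B \<mu>)"
   by (intro has_sum_finite finite_eigenspace)
  moreover have "(\<Sum>j\<in>?B \<mu>. complex_of_real (lam j) powr (- s)) = of_nat (card (?B \<mu>)) * of_real \<mu> powr (- s)" by simp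
  ultimately show "((%j. of_real (lam (snd (\<mu>, j))) powr (- s)) has_sum of_nat (eig_mult b \<mu>) * of_real \<mu> powr (- s)) (?B \<mu>)" by simp
 qed
qed

lemma holomorphic_zeta_continuation: "(%s. 2 * riemann_zeta s + zeta_correction s) holomorphic_on - eta_factor_zeros"
 using holomorphic_zeta_correction by (intro holomorphic_intros holomorphic_riemann_zeta) (auto intro: holomorphic_on_subset)

lemma connected_diff_eta_factor_zeros: "open S ==> connected S ==> connected (S - eta_factor_zeros)"
 by (rule connected_open_diff_countable) (use countable_eta_factor_zeros in auto)

lemma zeta_eq: assumes z: "Re z < 1" shows "zeta b z = 2 * riemann_zeta z + zeta_correction z"
 unfolding zeta_def
proof (rule the_equality)
 let ?h = "%s. 2 * riemann_zeta s + zeta_correction s"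
 have half: "{s. Re s > 1} \<subseteq> - eta_factor_zeros" and regular: "z \<notin> eta_factor_zeros" using Re_eta_factor_zero z by force+
 have series: "zeta_series b s = ?h s" if "Re s > 1" for s
  unfolding zeta_series_def by (rule infsumI[OF zeta_series_has_sum[OF that]])
 show "zeta_val b z (?h z)"
  unfolding zeta_val_def
 proof (intro exI[of _ "- eta_factor_zeros"] exI[of _ ?h] conjI allI impI)
  show "connected (- eta_factor_zeros)"
   using connected_diff_eta_factor_zeros[OF open_UNIV connected_UNIV] by (simp add: Compl_eq_Diff_UNIV)
  show "(%lam. of_nat (eig_mult b lam) * of_real lam powr - s) summable_on pos_eigs b" if "Re s > 1" for s
   using zeta_series_has_sum[OF that] has_sum_imp_summable by blast
 qed (use half regular closed_eta_factor_zeros holomorphic_zeta_continuation series in auto)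
 fix v assume "zeta_val b z v"
 then obtain S f where S: "open S" "connected S" "{s. Re s > 1} \<subseteq> S" "z \<in> S" "f holomorphic_on S"
  and f: "!!s. Re s > 1 ==> zeta_series b s = f s" "f z = v" unfolding zeta_val_def by blast
 have "f z = ?h z"
 proof (rule analytic_continuation_open[of "{s. Re s > 1}" "S - eta_factor_zeros" f ?h])
  show "{s. Re s > 1} \<noteq> {}" by (auto intro: exI[of _ 2])
  show "open (S - eta_factor_zeros)" using S(1) closed_eta_factor_zeros by auto
  show "f holomorphic_on S - eta_factor_zeros" "?h holomorphic_on S - eta_factor_zeros"
   using S(5) holomorphic_zeta_continuation by (auto intro: holomorphic_on_subset)
  show "f s = ?h s" if "s \<in> {s. Re s > 1}" for s using that f(1) series by simp
 qed (use S half regular in \<open>auto intro: connected_diff_eta_factor_zeros open_halfspace_Re_gt\<close>)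
 thus "v = ?h z" using f(2) by simp
qed

end

section \<open>Banded operators on sequences\<close>

definition band_op :: "nat => (int => cseq) => cseq => cseq" where
 "band_op N M f l = (\<Sum>k\<in>window N l. M l k * f k)"

definition banded :: "nat => (cseq => cseq) => bool" where
 "banded w P \<longleftrightarrow> (\<forall>f l F. finite F \<longrightarrow> window w l \<subseteq> F \<longrightarrow> P f l = (\<Sum>k\<in>F. P (delta k) l * f k))"

lemma bandedD: "banded w P ==> finite F ==> window w l \<subseteq> F ==> P f l = (\<Sum>k\<in>F. P (delta k) l * f k)"
 unfolding banded_def by blast

lemma band_op_delta: "band_op N M (delta k) l = (if \<bar>l - k\<bar> <= int N then M l k else 0)"
proof -
 have "band_op N M (delta k) l = (\<Sum>j\<in>window N l. if j = k then M l k else 0)"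
  unfolding band_op_def delta_def by (intro sum.cong) auto
 thus ?thesis by (auto simp: sum.delta)
qed

lemma banded_band_op: "banded N (band_op N M)"
 unfolding banded_def band_op_delta
proof (intro allI impI)
 fix f :: cseq and l F assume F: "finite F" "window N l \<subseteq> F"
 show "band_op N M f l = (\<Sum>k\<in>F. (if \<bar>l - k\<bar> <= int N then M l k else 0) * f k)"
  unfolding band_op_def by (rule sum.mono_neutral_cong_left[OF F]) auto
qed

lemma banded_delta_eq_0: assumes "banded w P" "\<bar>l - k\<bar> > int w" shows "P (delta k) l = 0"
proof -
 have "P (delta k) l = (\<Sum>j\<in>window w l. P (delta j) l * delta k j)" by (rule bandedD[OF assms(1)]) auto
 also have "... = 0" using assms(2) by (intro sum.neutral) (auto simp: delta_def)
 finally show ?thesis .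
qed

lemma banded_eq: "banded w P ==> P f l = (\<Sum>k\<in>window w l. P (delta k) l * f k)"
 by (rule bandedD) auto

lemma banded_add: assumes "banded w P" shows "P (%l. f l + g l) l = P f l + P g l"
 unfolding banded_eq[OF assms, of "%l. f l + g l"] banded_eq[OF assms, of f] banded_eq[OF assms, of g]
 by (simp add: distrib_left sum.distrib)

lemma banded_diff: assumes "banded w P" shows "P (%l. f l - g l) l = P f l - P g l"
 unfolding banded_eq[OF assms, of "%l. f l - g l"] banded_eq[OF assms, of f] banded_eq[OF assms, of g]
 by (simp add: right_diff_distrib sum_subtractf)

lemma banded_cmult: assumes "banded w P" shows "P (%l. z * f l) l = z * P f l"
 unfolding banded_eq[OF assms, of "%l. z * f l"] banded_eq[OF assms, of f] by (simp add: sum_distrib_left mult.left_commute)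

lemma banded_sum: assumes "banded w P" shows "P (%l. \<Sum>x\<in>X. f x l) l = (\<Sum>x\<in>X. P (f x) l)"
proof -
 have "P (%l. \<Sum>x\<in>X. f x l) l = (\<Sum>x\<in>X. \<Sum>k\<in>window w l. P (delta k) l * f x k)"
  unfolding banded_eq[OF assms, of "%l. \<Sum>x\<in>X. f x l"] sum_distrib_left by (rule sum.swap)
 also have "... = (\<Sum>x\<in>X. P (f x) l)" by (intro sum.cong refl banded_eq[OF assms, symmetric])
 finally show ?thesis .
qed

lemma banded_comp: assumes P: "banded v P" and Q: "banded w Q" shows "banded (v + w) (%f. P (Q f))"
 unfolding banded_def
proof (intro allI impI)
 fix f l F assume F: "finite F" "{l - int (v + w)..l + int (v + w)} \<subseteq> F"
 let ?J = "window v l"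
 have "P (Q f) l = (\<Sum>j\<in>?J. P (delta j) l * Q f j)" by (rule bandedD[OF P]) auto
 also have "... = (\<Sum>j\<in>?J. P (delta j) l * (\<Sum>k\<in>F. Q (delta k) j * f k))"
 proof (intro sum.cong refl arg_cong2[where f="(*)"])
  fix j assume "j \<in> ?J"
  hence "window w j \<subseteq> F" using F(2) by force
  thus "Q f j = (\<Sum>k\<in>F. Q (delta k) j * f k)" by (rule bandedD[OF Q F(1)])
 qed
 also have "... = (\<Sum>k\<in>F. (\<Sum>j\<in>?J. P (delta j) l * Q (delta k) j) * f k)"
  unfolding sum_distrib_left sum_distrib_right by (subst sum.swap) (simp add: mult.assoc)
 also have "... = (\<Sum>k\<in>F. P (Q (delta k)) l * f k)"
  by (intro sum.cong refl arg_cong2[where f="(*)"] banded_eq[OF P, symmetric])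
 finally show "P (Q f) l = (\<Sum>k\<in>F. P (Q (delta k)) l * f k)" .
qed

lemma banded_mono: "banded v P ==> v <= w ==> banded w P"
 unfolding banded_def by (smt (verit, ccfv_SIG) atLeastatMost_subset_iff of_nat_mono subset_trans)

lemma banded_id: "banded 0 (%f. f)"
 unfolding banded_def
proof (intro allI impI)
 fix f :: cseq and l :: int and F assume F: "finite F" "window 0 l \<subseteq> F"
 have "(\<Sum>k\<in>F. delta k l * f k) = (\<Sum>k\<in>F. if k = l then f l else 0)" by (intro sum.cong) (auto simp: delta_def)
 thus "f l = (\<Sum>k\<in>F. delta k l * f k)" using F by simp
qed

lemma banded_funpow: "banded w P ==> banded (p * w) (P ^^ p)"
proof (induction p)
 case 0
 thus ?case using banded_id by (simp add: id_def)
next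
 case (Suc p)
 thus ?case using banded_comp[of w P "p * w" "P ^^ p"] by (simp add: o_def)
qed

lemma banded_minus: "banded w P ==> banded w Q ==> banded w (%f l. P f l - Q f l)"
 unfolding banded_def left_diff_distrib sum_subtractf by (intro allI impI arg_cong2[where f="(-)"]) blast+

definition trace_on :: "int => (cseq => cseq) => complex" where "trace_on R P = (\<Sum>l\<in>{-R..R}. P (delta l) l)"

definition supported_on :: "int => (cseq => cseq) => bool" where
 "supported_on R P \<longleftrightarrow> (\<forall>k l. P (delta k) l \<noteq> 0 \<longrightarrow> \<bar>k\<bar> <= R \<and> \<bar>l\<bar> <= R)"

lemma supported_on_mono: "supported_on R P ==> R <= R' ==> supported_on R' P" unfolding supported_on_def by (meson order_trans)

lemma banded_eq_sum_if_eq_0: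
 assumes P: "banded w P" and f: "!!k. k \<notin> {-R..R} ==> P (delta k) l * f k = 0"
 shows "P f l = (\<Sum>k\<in>{-R..R}. P (delta k) l * f k)"
proof -
 have "P f l = (\<Sum>k\<in>{-R..R} \<union> window w l. P (delta k) l * f k)" by (rule bandedD[OF P]) auto
 also have "... = (\<Sum>k\<in>{-R..R}. P (delta k) l * f k)" by (rule sum.mono_neutral_right) (use f in auto)
 finally show ?thesis .
qed

lemma banded_supported_eq_sum: "banded w P ==> supported_on R P ==> P f l = (\<Sum>k\<in>{-R..R}. P (delta k) l * f k)"
 by (rule banded_eq_sum_if_eq_0) (force simp: supported_on_def)+

lemma trace_on_cyclic:
 assumes P: "banded w P" "supported_on R P" and Q: "banded v Q"
 shows "trace_on R (%f. P (Q f)) = trace_on R (%f. Q (P f))"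
proof -
 have QP: "Q (P (delta l)) l = (\<Sum>k\<in>{-R..R}. Q (delta k) l * P (delta l) k)" for l
  by (rule banded_eq_sum_if_eq_0[OF Q]) (use P(2) in \<open>force simp: supported_on_def\<close>)
 have PQ: "P (Q (delta l)) l = (\<Sum>k\<in>{-R..R}. P (delta k) l * Q (delta l) k)" for l
  by (rule banded_supported_eq_sum[OF P])
 show ?thesis unfolding trace_on_def PQ QP by (subst sum.swap) (simp add: mult.commute)
qed

lemma supported_on_comp: assumes P: "supported_on R P" "banded v P" and Q: "banded w Q" shows "supported_on (R + int w) (%f. P (Q f))"
 unfolding supported_on_def
proof (intro allI impI)
 fix k l assume "P (Q (delta k)) l \<noteq> 0"
 moreover have "P (Q (delta k)) l = (\<Sum>j\<in>window v l. P (delta j) l * Q (delta k) j)" by (rule bandedD[OF P(2)]) auto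
 ultimately obtain j where "P (delta j) l * Q (delta k) j \<noteq> 0" by (metis (no_types, lifting) sum.neutral)
 hence j: "P (delta j) l \<noteq> 0" "Q (delta k) j \<noteq> 0" by auto
 hence "\<bar>j - k\<bar> <= int w" using banded_delta_eq_0[OF Q, of j k] by linarith
 thus "\<bar>k\<bar> <= R + int w \<and> \<bar>l\<bar> <= R + int w" using j(1) P(1) unfolding supported_on_def by (smt (verit))
qed

definition formal_adjoint :: "(cseq => cseq) => (cseq => cseq) => bool" where
 "formal_adjoint P P' \<longleftrightarrow> (\<forall>k l. P' (delta l) k = cnj (P (delta k) l))"

lemma formal_adjoint_comp:
 assumes "formal_adjoint P P'" "formal_adjoint Q Q'" "banded v P" "banded v' Q'"
 shows "formal_adjoint (%f. P (Q f)) (%f. Q' (P' f))"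
 unfolding formal_adjoint_def
proof (intro allI)
 fix k l
 let ?F = "window v l \<union> {k - int v'..k + int v'}"
 have "Q' (P' (delta l)) k = (\<Sum>j\<in>?F. Q' (delta j) k * P' (delta l) j)" by (rule bandedD[OF assms(4)]) auto
 also have "... = cnj (\<Sum>j\<in>?F. P (delta j) l * Q (delta k) j)"
  using assms(1,2) by (simp add: formal_adjoint_def mult.commute)
 also have "(\<Sum>j\<in>?F. P (delta j) l * Q (delta k) j) = P (Q (delta k)) l" by (rule bandedD[OF assms(3), symmetric]) auto
 finally show "Q' (P' (delta l)) k = cnj (P (Q (delta k)) l)" .
qed

lemma formal_adjoint_funpow: "formal_adjoint P P ==> banded w P ==> formal_adjoint (P ^^ p) (P ^^ p)"
proof (induction p)
 case 0
 thus ?case by (auto simp: formal_adjoint_def delta_def)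
next
 case (Suc p)
 have "formal_adjoint (%f. P ((P ^^ p) f)) (%f. (P ^^ p) (P f))"
   by (rule formal_adjoint_comp[OF Suc.prems(1) Suc.IH[OF Suc.prems] Suc.prems(2) banded_funpow[OF Suc.prems(2)]])
 thus ?case by (simp add: o_def funpow_swap1)
qed

definition pos_semidef :: "(cseq => cseq) => bool" where
 "pos_semidef P \<longleftrightarrow> (\<forall>F y. finite F \<longrightarrow> (\<forall>l. l \<notin> F \<longrightarrow> y l = 0) \<longrightarrow> Re (\<Sum>l\<in>F. cnj (y l) * P y l) >= 0)"

lemma trace_on_sandwich_nonneg:
 assumes M: "banded w M" "banded w M'" "formal_adjoint M M'" and W: "pos_semidef W"
 shows "Re (trace_on R (%f. M (W (M' f)))) >= 0"
proof -
 have "Re (M (W (M' (delta x))) x) >= 0" for x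
 proof -
  let ?F = "window w x" and ?y = "M' (delta x)"
  have "M (W ?y) x = (\<Sum>k\<in>?F. M (delta k) x * W ?y k)" by (rule bandedD[OF M(1)]) auto
  also have "... = (\<Sum>k\<in>?F. cnj (?y k) * W ?y k)" using M(3) by (simp add: formal_adjoint_def)
  finally have e: "M (W ?y) x = (\<Sum>k\<in>?F. cnj (?y k) * W ?y k)" .
  have "\<forall>l. l \<notin> ?F \<longrightarrow> ?y l = 0" using banded_delta_eq_0[OF M(2), of _ x] by auto
  thus ?thesis unfolding e using W[unfolded pos_semidef_def, rule_format, of ?F ?y] by blast
 qed
 thus ?thesis unfolding trace_on_def by (simp add: sum_nonneg)
qed

lemma formal_adjoint_band_op: "(!!l k. M' k l = cnj (M l k)) ==> formal_adjoint (band_op N M) (band_op N M')"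
 by (auto simp: formal_adjoint_def band_op_delta abs_minus_commute)

lemma funpow_telescope:
 assumes T: "banded w T" and U: "banded w U" and d: "!!f l. T f l = U f l + D f l"
 shows "(T ^^ p) f l - (U ^^ p) f l = (\<Sum>i<p. (T ^^ i) (D ((U ^^ (p - 1 - i)) f)) l)"
proof (induction p arbitrary: l)
 case (Suc p)
 have "(T ^^ Suc p) f l - (U ^^ Suc p) f l = T ((T ^^ p) f) l - U ((U ^^ p) f) l" by simp
 also have "... = (T ((T ^^ p) f) l - T ((U ^^ p) f) l) + D ((U ^^ p) f) l" using d[of "(U ^^ p) f" l] by simp
 also have "T ((T ^^ p) f) l - T ((U ^^ p) f) l = T (%l. (T ^^ p) f l - (U ^^ p) f l) l" by (rule banded_diff[OF T, symmetric])
 also have "... = (\<Sum>i<p. T ((T ^^ i) (D ((U ^^ (p - 1 - i)) f))) l)"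
  unfolding Suc.IH by (rule banded_sum[OF T])
 also have "(\<Sum>i<p. T ((T ^^ i) (D ((U ^^ (p - 1 - i)) f))) l) + D ((U ^^ p) f) l = (\<Sum>i<Suc p. (T ^^ i) (D ((U ^^ (Suc p - 1 - i)) f)) l)"
  unfolding sum.lessThan_Suc_shift by simp
 finally show ?case .
qed simp

section \<open>The operators of the flow\<close>

definition flow_coef :: "nat => cseq => cseq" where
 "flow_coef N a n = (\<Sum>j\<in>freqs N. of_int ((n - 2 * j) * sgn j) * (a j * a (n - j)))"

abbreviation sqrt_abs :: cseq where "sqrt_abs l \<equiv> of_real (sqrt \<bar>of_int l\<bar>)"

lemma sqrt_abs_mult_self: "sqrt_abs l * sqrt_abs l = of_int \<bar>l\<bar>"
 by (simp flip: of_real_mult) (metis of_int_abs of_real_of_int_eq)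

definition toep_entry :: "cseq => int => cseq" where
 "toep_entry a l k = sqrt_abs l * sqrt_abs k * a (l - k)"

locale hermitian_band =
 fixes N :: nat and a :: cseq
 assumes band: "!!k. \<bar>k\<bar> > int N ==> a k = 0"
  and hermitian: "!!k. cnj (a k) = a (- k)"
begin

definition toep where "toep = band_op N (toep_entry a)"
definition sgn_toep where "sgn_toep = band_op N (%l k. of_int (sgn l) * toep_entry a l k)"
definition conj_toep where "conj_toep = band_op N (%l k. of_int (sgn l * sgn k) * toep_entry a l k)"
definition cross where "cross = band_op N (%l k. if l * k < 0 then toep_entry a l k else 0)"
definition lax_left where "lax_left = band_op N (%l k. of_int (sgn (l - k) * sgn k) * toep_entry a l k)"
definition lax_right where "lax_right = band_op N (%l k. of_int (sgn l * sgn (l - k)) * toep_entry a l k)"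
definition sgn_op :: "cseq => cseq" where "sgn_op f l = of_int (sgn l) * f l"

lemmas op_defs = toep_def sgn_toep_def conj_toep_def cross_def lax_left_def lax_right_def

lemma banded_ops: "banded N toep" "banded N sgn_toep" "banded N conj_toep" "banded N cross" "banded N lax_left" "banded N lax_right"
 unfolding op_defs by (rule banded_band_op)+

lemma banded_sgn_op: "banded 0 sgn_op"
 unfolding banded_def sgn_op_def
proof (intro allI impI)
 fix f :: cseq and l :: int and S assume S: "finite S" "window 0 l \<subseteq> S"
 have "(\<Sum>k\<in>S. of_int (sgn l) * delta k l * f k) = (\<Sum>k\<in>S. if k = l then of_int (sgn l) * f l else 0)" by (intro sum.cong) (auto simp: delta_def)
 thus "of_int (sgn l) * f l = (\<Sum>k\<in>S. of_int (sgn l) * delta k l * f k)" using S by simp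
qed

lemma sgn_toep_eq: "sgn_toep f = sgn_op (toep f)"
 by (rule ext) (simp add: sgn_toep_def toep_def sgn_op_def band_op_def sum_distrib_left mult.assoc)

lemma conj_toep_eq: "conj_toep f = sgn_op (toep (sgn_op f))"
 by (rule ext) (simp add: conj_toep_def toep_def sgn_op_def band_op_def sum_distrib_left mult_ac)

lemma toep_sgn_op_sgn_op: "toep (sgn_op (sgn_op f)) = toep f" "sgn_op (sgn_op (toep f)) = toep f"
proof -
 have s: "complex_of_int (sgn k) * of_int (sgn k) = 1" if "k \<noteq> 0" for k :: int
  using that by (auto simp: sgn_if)
 show "toep (sgn_op (sgn_op f)) = toep f"
  unfolding toep_def sgn_op_def band_op_def
 proof (intro ext sum.cong refl)
  fix l k
  show "toep_entry a l k * (of_int (sgn k) * (of_int (sgn k) * f k)) = toep_entry a l k * f k"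
   using s[of k] by (cases "k = 0") (auto simp: toep_entry_def simp flip: mult.assoc)
 qed
 show "sgn_op (sgn_op (toep f)) = toep f"
 proof
  fix l show "sgn_op (sgn_op (toep f)) l = toep f l"
   using s[of l] by (cases "l = 0") (auto simp: toep_def sgn_op_def band_op_def toep_entry_def simp flip: mult.assoc)
 qed
qed

lemma lax_left_minus_lax_right: "lax_left f l - lax_right f l = - 2 * cross f l"
proof -
 have "of_int (sgn (l - k) * sgn k) * toep_entry a l k * f k - of_int (sgn l * sgn (l - k)) * toep_entry a l k * f k
   = - 2 * ((if l * k < 0 then toep_entry a l k else 0) * f k)" for k
 proof (cases "l = 0 \<or> k = 0")
  case True
  thus ?thesis by (auto simp: toep_entry_def)
 next
  case False
  hence "sgn (l - k) * sgn k - sgn l * sgn (l - k) = (if l * k < 0 then - 2 else 0)"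
   by (auto simp: sgn_if mult_less_0_iff)
  hence "of_int (sgn (l - k) * sgn k - sgn l * sgn (l - k)) * toep_entry a l k * f k = - 2 * ((if l * k < 0 then toep_entry a l k else 0) * f k)"
   by auto
  thus ?thesis by (simp add: left_diff_distrib)
 qed
 thus ?thesis unfolding lax_left_def lax_right_def cross_def band_op_def by (simp add: sum_subtractf[symmetric] sum_distrib_left)
qed

lemma toep_eq_conj_toep_plus_cross: "toep f l = conj_toep f l + 2 * cross f l"
proof -
 have "toep_entry a l k * f k = of_int (sgn l * sgn k) * toep_entry a l k * f k + 2 * ((if l * k < 0 then toep_entry a l k else 0) * f k)" for k
 proof (cases "l = 0 \<or> k = 0")
  case True
  thus ?thesis by (auto simp: toep_entry_def)
 next
  case False
  hence "sgn l * sgn k = (if l * k < 0 then - 1 else 1)" by (auto simp: sgn_if mult_less_0_iff)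
  thus ?thesis by auto
 qed
 thus ?thesis unfolding toep_def conj_toep_def cross_def band_op_def by (simp add: sum.distrib[symmetric] sum_distrib_left)
qed

lemma flow_coef_eq_0: assumes "\<bar>n\<bar> > int N" shows "flow_coef N a n = 0"
proof -
 let ?J = "{j \<in> freqs N. \<bar>n - j\<bar> <= int N}"
 let ?t = "%j. of_int ((n - 2 * j) * sgn j) * (a j * a (n - j))"
 have "flow_coef N a n = (\<Sum>j\<in>?J. ?t j)"
  unfolding flow_coef_def by (rule sum.mono_neutral_right) (auto simp: not_le intro!: band)
 also have "... = (\<Sum>j\<in>?J. - ?t j)"
 proof (rule sum.reindex_bij_witness[of _ "%j. n - j" "%j. n - j"])
  fix j assume j: "j \<in> ?J"
  hence "sgn (n - j) = sgn j" using assms by (auto simp: sgn_if)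
  thus "- ?t (n - j) = ?t j"
   by (simp add: algebra_simps)
 qed auto
 also have "... = - (\<Sum>j\<in>?J. ?t j)"
  by (rule sum_negf)
 also have "... = - flow_coef N a n"
  unfolding flow_coef_def by (intro arg_cong[where f=uminus] sum.mono_neutral_left) (auto simp: not_le intro!: band)
 finally show ?thesis by simp
qed

lemma band_op_eq_sum: assumes "!!l k. \<bar>l - k\<bar> > int N ==> M l k = 0" "finite S" "window N l \<subseteq> S"
 shows "band_op N M f l = (\<Sum>k\<in>S. M l k * f k)"
 unfolding band_op_def by (rule sum.mono_neutral_left) (use assms in auto)

lemma toep_entry_mult_sgn:
 "of_int (sgn j) * (toep_entry u l j * toep_entry v j k) = (sqrt_abs l * sqrt_abs k) * (of_int j * (u (l - j) * v (j - k)))"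
proof -
 have "of_int (sgn j) * (toep_entry u l j * toep_entry v j k)
   = (sqrt_abs j * sqrt_abs j) * of_int (sgn j) * (sqrt_abs l * sqrt_abs k * (u (l - j) * v (j - k)))"
  by (simp add: toep_entry_def mult_ac)
 also have "(sqrt_abs j * sqrt_abs j) * of_int (sgn j) = of_int j"
  unfolding sqrt_abs_mult_self by (simp flip: of_int_mult add: abs_mult_sgn)
 finally show ?thesis by (simp add: mult_ac)
qed

lemma band_op_comp:
 assumes M': "!!j k. \<bar>j - k\<bar> > int N ==> M' j k = 0"
 shows "band_op N M (band_op N M' f) l = (\<Sum>k\<in>{l - 2 * int N..l + 2 * int N}. (\<Sum>j\<in>window N l. M l j * M' j k) * f k)"
proof -
 have "band_op N M (band_op N M' f) l = (\<Sum>j\<in>window N l. M l j * (\<Sum>k\<in>{l - 2 * int N..l + 2 * int N}. M' j k * f k))"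
  unfolding band_op_def[of N M]
  by (intro sum.cong refl arg_cong2[where f="(*)"] band_op_eq_sum M') auto
 also have "... = (\<Sum>k\<in>{l - 2 * int N..l + 2 * int N}. (\<Sum>j\<in>window N l. M l j * M' j k) * f k)"
  unfolding sum_distrib_left sum_distrib_right by (subst sum.swap) (simp add: mult.assoc)
 finally show ?thesis .
qed

lemma lax_left_toep:
 "lax_left (toep f) l = (\<Sum>k\<in>{l - 2 * int N..l + 2 * int N}. (sqrt_abs l * sqrt_abs k) *
  (\<Sum>i\<in>freqs N. of_int ((l - i) * sgn i) * (a i * a (l - k - i))) * f k)"
proof -
 let ?I = "window N l"
 have "(\<Sum>j\<in>?I. of_int (sgn (l - j) * sgn j) * toep_entry a l j * toep_entry a j k)
   = (sqrt_abs l * sqrt_abs k) * (\<Sum>i\<in>freqs N. of_int ((l - i) * sgn i) * (a i * a (l - k - i)))" for k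
 proof -
  have "of_int (sgn (l - j) * sgn j) * toep_entry a l j * toep_entry a j k
    = (sqrt_abs l * sqrt_abs k) * (of_int (j * sgn (l - j)) * (a (l - j) * a (j - k)))" for j
   using arg_cong[OF toep_entry_mult_sgn[of j a l a k], of "%z. of_int (sgn (l - j)) * z"] by (simp add: mult_ac)
  hence "(\<Sum>j\<in>?I. of_int (sgn (l - j) * sgn j) * toep_entry a l j * toep_entry a j k)
    = (sqrt_abs l * sqrt_abs k) * (\<Sum>j\<in>?I. of_int (j * sgn (l - j)) * (a (l - j) * a (j - k)))"
   by (simp only: sum_distrib_left)
  also have "(\<Sum>j\<in>?I. of_int (j * sgn (l - j)) * (a (l - j) * a (j - k))) = (\<Sum>i\<in>freqs N. of_int ((l - i) * sgn i) * (a i * a (l - k - i)))"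
   by (rule sum.reindex_bij_witness[of _ "%i. l - i" "%j. l - j"]) (auto simp: algebra_simps)
  finally show ?thesis .
 qed
 thus ?thesis unfolding lax_left_def toep_def by (subst band_op_comp) (auto simp: toep_entry_def band)
qed

lemma toep_lax_right:
 "toep (lax_right f) l = (\<Sum>k\<in>{l - 2 * int N..l + 2 * int N}. (sqrt_abs l * sqrt_abs k) *
  (\<Sum>i\<in>freqs N. of_int ((k + i) * sgn i) * (a i * a (l - k - i))) * f k)"
proof -
 let ?I = "window N l" and ?g = "%k j. of_int (j * sgn (j - k)) * (a (l - j) * a (j - k))"
 have "(\<Sum>j\<in>?I. toep_entry a l j * (of_int (sgn j * sgn (j - k)) * toep_entry a j k))
   = (sqrt_abs l * sqrt_abs k) * (\<Sum>i\<in>freqs N. of_int ((k + i) * sgn i) * (a i * a (l - k - i)))" for k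
 proof -
  have "toep_entry a l j * (of_int (sgn j * sgn (j - k)) * toep_entry a j k)
    = (sqrt_abs l * sqrt_abs k) * ?g k j" for j
   using arg_cong[OF toep_entry_mult_sgn[of j a l a k], of "%z. of_int (sgn (j - k)) * z"] by (simp add: mult_ac)
  hence "(\<Sum>j\<in>?I. toep_entry a l j * (of_int (sgn j * sgn (j - k)) * toep_entry a j k))
    = (sqrt_abs l * sqrt_abs k) * (\<Sum>j\<in>?I. ?g k j)"
   by (simp only: sum_distrib_left)
  also have "(\<Sum>j\<in>?I. ?g k j) = (\<Sum>j\<in>?I \<inter> window N k. ?g k j)"
   by (rule sum.mono_neutral_right) (auto simp: band)
  also have "... = (\<Sum>j\<in>window N k. ?g k j)"
   by (rule sum.mono_neutral_left) (auto simp: not_le intro!: band)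
  also have "... = (\<Sum>i\<in>freqs N. of_int ((k + i) * sgn i) * (a i * a (l - k - i)))"
   by (rule sum.reindex_bij_witness[of _ "%i. k + i" "%j. j - k"]) (auto simp: algebra_simps)
  finally show ?thesis .
 qed
 thus ?thesis unfolding lax_right_def toep_def by (subst band_op_comp) (auto simp: toep_entry_def band)
qed

text \<open>The flow in Lax form, with the two factors differing by a multiple of \<open>cross\<close>.\<close>

lemma flow_commutator: "band_op N (toep_entry (flow_coef N a)) f l = lax_left (toep f) l - toep (lax_right f) l"
proof -
 have split: "flow_coef N a (l - k) = (\<Sum>i\<in>freqs N. of_int ((l - i) * sgn i) * (a i * a (l - k - i)))
   - (\<Sum>i\<in>freqs N. of_int ((k + i) * sgn i) * (a i * a (l - k - i)))" for k
  unfolding flow_coef_def sum_subtractf[symmetric] by (intro sum.cong refl) (simp add: algebra_simps)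
 have "band_op N (toep_entry (flow_coef N a)) f l
   = (\<Sum>k\<in>{l - 2 * int N..l + 2 * int N}. (sqrt_abs l * sqrt_abs k) * flow_coef N a (l - k) * f k)"
  by (subst band_op_eq_sum[where S="{l - 2 * int N..l + 2 * int N}"]) (auto simp: toep_entry_def flow_coef_eq_0)
 thus ?thesis
  unfolding lax_left_toep toep_lax_right split by (simp only: left_diff_distrib right_diff_distrib sum_subtractf)
qed

lemma formal_adjoint_ops: "formal_adjoint toep toep" "formal_adjoint conj_toep conj_toep" "formal_adjoint cross cross"
proof -
 have h: "toep_entry a k l = cnj (toep_entry a l k)" for l k by (simp add: toep_entry_def hermitian mult.commute)
 show "formal_adjoint toep toep" "formal_adjoint conj_toep conj_toep" "formal_adjoint cross cross"
   unfolding toep_def conj_toep_def cross_def by (auto intro!: formal_adjoint_band_op simp: h[symmetric] mult.commute)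
qed

lemma supported_on_cross: "supported_on (int N) cross"
 unfolding supported_on_def cross_def band_op_delta by (auto simp: mult_less_0_iff split: if_splits)

lemma sgn_op_cross_sgn_op: "sgn_op (cross (sgn_op f)) l = - cross f l"
proof -
 have "of_int (sgn l) * ((if l * k < 0 then toep_entry a l k else 0) * (of_int (sgn k) * f k))
   = - ((if l * k < 0 then toep_entry a l k else 0) * f k)" for k
 proof (cases "l * k < 0")
  case True
  hence "complex_of_int (sgn l) * of_int (sgn k) = - 1" by (auto simp: sgn_if mult_less_0_iff)
  thus ?thesis using True by (simp add: mult_ac) (simp flip: mult.assoc)
 qed auto
 thus ?thesis unfolding sgn_op_def cross_def band_op_def by (simp add: sum_distrib_left sum_negf[symmetric])
qed

lemma conj_toep_power: "p > 0 ==> (conj_toep ^^ p) f = sgn_op ((toep ^^ p) (sgn_op f))"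
proof (induction p)
 case (Suc p)
 show ?case
 proof (cases "p = 0")
  case False
  hence "(conj_toep ^^ p) f = sgn_op ((toep ^^ p) (sgn_op f))" using Suc by blast
  hence "(conj_toep ^^ Suc p) f = sgn_op (toep (sgn_op (sgn_op ((toep ^^ p) (sgn_op f)))))" using conj_toep_eq[of "(conj_toep ^^ p) f"] by simp
  thus ?thesis by (simp add: toep_sgn_op_sgn_op)
 qed (simp add: conj_toep_eq)
qed simp

lemma trace_cross_sandwich_nonneg:
 assumes A: "banded N A" "formal_adjoint A A" "pos_semidef A" and B: "banded N B" "formal_adjoint B B"
  and R: "R >= int N + int ((2 * q + 1) * N + (N + 2 * q' * N))"
 shows "Re (trace_on R (%f. cross ((A ^^ (2 * q + 1)) (cross ((B ^^ (2 * q')) f))))) >= 0"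
proof -
 let ?FAB = "%f. cross ((A ^^ (2 * q + 1)) (cross ((B ^^ (2 * q')) f)))"
 have bandedA: "banded (k * N) (A ^^ k)" and bandedB: "banded (k * N) (B ^^ k)" for k
   by (rule banded_funpow[OF A(1)], rule banded_funpow[OF B(1)])
 have splitA: "(A ^^ (2 * q + 1)) f = (A ^^ q) (A ((A ^^ q) f))" for f by (simp add: mult_2 funpow_add funpow_swap1)
 have splitB: "(B ^^ (2 * q')) f = (B ^^ q') ((B ^^ q') f)" for f by (simp add: mult_2 funpow_add)
 define P where "P f = cross ((A ^^ (2 * q + 1)) (cross ((B ^^ q') f)))" for f
 have bandedP: "banded (N + ((2 * q + 1) * N + (N + q' * N))) P" unfolding P_def by (intro banded_comp banded_ops(4) bandedA bandedB)
 have "supported_on (int N + int ((2 * q + 1) * N + (N + q' * N))) P" unfolding P_def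
   by (rule supported_on_comp[OF supported_on_cross banded_ops(4) banded_comp[OF bandedA banded_comp[OF banded_ops(4) bandedB]]])
 hence supportP: "supported_on R P"
 proof (rule supported_on_mono)
  have "(2 * q + 1) * N + (N + q' * N) <= (2 * q + 1) * N + (N + 2 * q' * N)" by simp
  thus "int N + int ((2 * q + 1) * N + (N + q' * N)) <= R" using R by linarith
 qed
 have "trace_on R ?FAB = trace_on R (%f. P ((B ^^ q') f))" by (simp only: P_def splitB)
 also have "... = trace_on R (%f. (B ^^ q') (P f))" by (rule trace_on_cyclic[OF bandedP supportP bandedB])
 also have "... = trace_on R (%f. (%f. (B ^^ q') (cross ((A ^^ q) f))) (A ((%f. (A ^^ q) (cross ((B ^^ q') f))) f)))"
   by (simp only: P_def splitA)
 finally have sandwich: "trace_on R ?FAB = ..." .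
 show ?thesis unfolding sandwich
 proof (rule trace_on_sandwich_nonneg[OF _ _ _ A(3)])
  show "banded (q' * N + (N + q * N)) (%f. (B ^^ q') (cross ((A ^^ q) f)))" by (intro banded_comp banded_ops(4) bandedA bandedB)
  have "banded (q * N + (N + q' * N)) (%f. (A ^^ q) (cross ((B ^^ q') f)))" by (intro banded_comp banded_ops(4) bandedA bandedB)
  thus "banded (q' * N + (N + q * N)) (%f. (A ^^ q) (cross ((B ^^ q') f)))" by (rule banded_mono) simp
  have "formal_adjoint (%f. (B ^^ q') ((%f. cross ((A ^^ q) f)) f)) (%f. (%f. (A ^^ q) (cross f)) ((B ^^ q') f))"
   by (rule formal_adjoint_comp[where v="q' * N" and v'="q * N + N"], rule formal_adjoint_funpow[OF B(2,1)],
     rule formal_adjoint_comp[where v=N and v'="q * N"], rule formal_adjoint_ops(3), rule formal_adjoint_funpow[OF A(2,1)],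
     rule banded_ops(4), rule bandedA, rule bandedB, rule banded_comp[OF bandedA banded_ops(4)])
  thus "formal_adjoint (%f. (B ^^ q') (cross ((A ^^ q) f))) (%f. (A ^^ q) (cross ((B ^^ q') f)))" by simp
 qed
qed

lemma pos_semidef_conj_toep:
 assumes "pos_semidef toep"
 shows "pos_semidef conj_toep"
 unfolding pos_semidef_def
proof (intro allI impI)
 fix S and y :: cseq assume S: "finite S" "\<forall>l. l \<notin> S \<longrightarrow> y l = (0::complex)"
 have "(\<Sum>l\<in>S. cnj (y l) * conj_toep y l) = (\<Sum>l\<in>S. cnj (sgn_op y l) * toep (sgn_op y) l)"
  unfolding conj_toep_eq by (intro sum.cong) (auto simp: sgn_op_def)
 thus "Re (\<Sum>l\<in>S. cnj (y l) * conj_toep y l) >= 0"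
  using assms[unfolded pos_semidef_def, rule_format, of S "sgn_op y"] S by (simp add: sgn_op_def)
qed

lemma banded_power_ops: "banded (p * N) (toep ^^ p)" "banded (p * N) (sgn_toep ^^ p)" "banded (p * N) (conj_toep ^^ p)"
 by (intro banded_funpow banded_ops)+

lemma trace_cross_conj_toep_power:
 assumes p: "p > 0" and R: "R >= int N + int (p * N)"
 shows "trace_on R (%f. cross ((conj_toep ^^ p) f)) = - trace_on R (%f. cross ((toep ^^ p) f))"
proof -
 have banded: "banded (N + (0 + p * N)) (%f. cross (sgn_op ((toep ^^ p) f)))"
  by (intro banded_comp banded_ops banded_sgn_op banded_power_ops)
 have "supported_on (int N + int (0 + p * N)) (%f. cross (sgn_op ((toep ^^ p) f)))"
  by (intro supported_on_comp[OF supported_on_cross banded_ops(4)] banded_comp banded_sgn_op banded_power_ops)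
 hence supported: "supported_on R (%f. cross (sgn_op ((toep ^^ p) f)))" by (rule supported_on_mono) (use R in simp)
 have "trace_on R (%f. cross ((conj_toep ^^ p) f)) = trace_on R (%f. cross (sgn_op ((toep ^^ p) (sgn_op f))))"
  using conj_toep_power[OF p] by simp
 also have "... = trace_on R (%f. sgn_op (cross (sgn_op ((toep ^^ p) f))))"
  by (rule trace_on_cyclic[OF banded supported banded_sgn_op])
 also have "... = - trace_on R (%f. cross ((toep ^^ p) f))" unfolding trace_on_def sgn_op_cross_sgn_op by (rule sum_negf)
 finally show ?thesis .
qed

lemma trace_cross_power_expansion:
 assumes p: "p > 0" and R: "R >= int N + int (p * N)"
 shows "trace_on R (%f. cross ((toep ^^ p) f)) = (\<Sum>i<p. trace_on R (%f. cross ((toep ^^ i) (cross ((conj_toep ^^ (p - 1 - i)) f)))))"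
proof -
 let ?g = "%i f. cross ((toep ^^ i) (cross ((conj_toep ^^ (p - 1 - i)) f)))"
 have "(toep ^^ p) f l - (conj_toep ^^ p) f l = (\<Sum>i<p. (toep ^^ i) ((%l. 2 * cross ((conj_toep ^^ (p - 1 - i)) f) l)) l)" for f l
  by (rule funpow_telescope[OF banded_ops(1,3) toep_eq_conj_toep_plus_cross])
 hence telescope: "(toep ^^ p) f l - (conj_toep ^^ p) f l = (\<Sum>i<p. 2 * (toep ^^ i) (cross ((conj_toep ^^ (p - 1 - i)) f)) l)" for f l
  by (simp add: banded_cmult[OF banded_power_ops(1)])
 have "cross ((toep ^^ p) f) l - cross ((conj_toep ^^ p) f) l = (\<Sum>i<p. 2 * (?g i f) l)" for f l
 proof -
  have "cross ((toep ^^ p) f) l - cross ((conj_toep ^^ p) f) l = cross (%l. (toep ^^ p) f l - (conj_toep ^^ p) f l) l"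
   by (rule banded_diff[OF banded_ops(4), symmetric])
  also have "... = (\<Sum>i<p. cross (%l. 2 * (toep ^^ i) (cross ((conj_toep ^^ (p - 1 - i)) f)) l) l)"
   unfolding telescope by (rule banded_sum[OF banded_ops(4)])
  finally show ?thesis by (simp add: banded_cmult[OF banded_ops(4)])
 qed
 hence "trace_on R (%f. cross ((toep ^^ p) f)) - trace_on R (%f. cross ((conj_toep ^^ p) f))
   = (\<Sum>i<p. 2 * trace_on R (%f. (?g i f)))"
  unfolding trace_on_def sum_subtractf[symmetric] by (simp add: sum_distrib_left) (subst sum.swap, simp)
 thus ?thesis unfolding trace_cross_conj_toep_power[OF assms] by (simp add: sum_distrib_left[symmetric])
qed

lemma trace_cross_mixed_power_nonneg:
 assumes toep: "pos_semidef toep" and odd: "odd (i + j)" and R: "R >= int N + int (i * N + (N + j * N))"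
 shows "Re (trace_on R (%f. cross ((toep ^^ i) (cross ((conj_toep ^^ j) f))))) >= 0"
proof (cases "odd i")
 case True
 then obtain q q' where q: "i = 2 * q + 1" "j = 2 * q'" using odd by (metis even_add evenE oddE)
 show ?thesis using R unfolding q
  by (rule trace_cross_sandwich_nonneg[OF banded_ops(1) formal_adjoint_ops(1) toep banded_ops(3) formal_adjoint_ops(2)])
next
 case False
 then obtain q q' where q: "i = 2 * q" "j = 2 * q' + 1" using odd by (metis even_add evenE oddE)
 have "int (i * N) <= int (i * N + (N + j * N))" by (intro of_nat_mono) simp
 hence "int N + int (i * N) <= R" using R by linarith
 hence supported: "supported_on R (%f. cross ((toep ^^ i) f))"
  by (rule supported_on_mono[OF supported_on_comp[OF supported_on_cross banded_ops(4) banded_power_ops(1)]])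
 have "trace_on R (%f. cross ((toep ^^ i) (cross ((conj_toep ^^ j) f)))) = trace_on R (%f. cross ((conj_toep ^^ j) (cross ((toep ^^ i) f))))"
  by (rule trace_on_cyclic[OF banded_comp[OF banded_ops(4) banded_power_ops(1)] supported banded_comp[OF banded_ops(4) banded_power_ops(3)]])
 moreover have "R >= int N + int (j * N + (N + i * N))" using R by (simp add: add_ac)
 hence "Re (trace_on R (%f. cross ((conj_toep ^^ j) (cross ((toep ^^ i) f))))) >= 0" unfolding q
  by (rule trace_cross_sandwich_nonneg[OF banded_ops(3) formal_adjoint_ops(2)
    pos_semidef_conj_toep[OF toep] banded_ops(1) formal_adjoint_ops(1)])
 ultimately show ?thesis by simp
qed

lemma trace_cross_power_nonneg:
 assumes p: "even p" "p > 0" and R: "R >= int N + int (p * N)" and toep: "pos_semidef toep"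
 shows "Re (trace_on R (%f. cross ((toep ^^ p) f))) >= 0"
proof -
 have "Re (trace_on R (%f. cross ((toep ^^ i) (cross ((conj_toep ^^ (p - 1 - i)) f))))) >= 0" if i: "i < p" for i
 proof (rule trace_cross_mixed_power_nonneg[OF toep])
  have sum: "i + (p - 1 - i) = p - 1" using i by simp
  show "odd (i + (p - 1 - i))" unfolding sum using p by simp
  have "i * N + (N + (p - 1 - i) * N) = p * N" using i by (simp add: add_mult_distrib[symmetric] mult_Suc[symmetric] del: mult_Suc)
  thus "R >= int N + int (i * N + (N + (p - 1 - i) * N))" using R by simp
 qed
 thus ?thesis unfolding trace_cross_power_expansion[OF p(2) R] Re_sum by (intro sum_nonneg) auto
qed

lemma toep_one_sided:
 assumes \<sigma>: "\<sigma> = 1 \<or> \<sigma> = -1" and f: "!!k. \<sigma> * k <= c ==> f k = 0" and l: "\<sigma> * l <= c - int N"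
 shows "toep f l = 0"
 unfolding toep_def band_op_def
proof (intro sum.neutral ballI)
 fix k assume "k \<in> window N l"
 hence "\<sigma> * k <= c" using l \<sigma> by auto
 thus "toep_entry a l k * f k = 0" by (simp add: f)
qed

lemma sgn_toep_power_one_sided:
 assumes \<sigma>: "\<sigma> = 1 \<or> \<sigma> = -1" and f: "!!l. \<sigma> * l <= c ==> f l = 0" and c: "c >= int (p * N)"
 shows "(sgn_toep ^^ p) f = (%l. of_int (\<sigma> ^ p) * (toep ^^ p) f l) \<and> (\<forall>l. \<sigma> * l <= c - int (p * N) \<longrightarrow> (toep ^^ p) f l = 0)"
 using c
proof (induction p)
 case 0
 thus ?case using f by auto
next
 case (Suc p)
 hence IH: "(sgn_toep ^^ p) f = (%l. of_int (\<sigma> ^ p) * (toep ^^ p) f l)" "!!l. \<sigma> * l <= c - int (p * N) ==> (toep ^^ p) f l = 0" by auto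
 have vanish: "(toep ^^ Suc p) f l = 0" if "\<sigma> * l <= c - int (Suc p * N)" for l
  using toep_one_sided[where c="c - int (p * N)" and f="(toep ^^ p) f" and l=l, OF \<sigma> IH(2)] that by simp
 have "(sgn_toep ^^ Suc p) f l = of_int (\<sigma> ^ Suc p) * (toep ^^ Suc p) f l" for l
 proof -
  have "(sgn_toep ^^ Suc p) f l = of_int (sgn l) * (of_int (\<sigma> ^ p) * (toep ^^ Suc p) f l)"
   using IH(1) by (simp add: sgn_toep_eq sgn_op_def banded_cmult[OF banded_ops(1)])
  also have "... = of_int (\<sigma> ^ Suc p) * (toep ^^ Suc p) f l"
  proof (cases "\<sigma> * l <= 0")
   case True
   hence "(toep ^^ Suc p) f l = 0" using Suc.prems by (intro vanish) linarith
   thus ?thesis by simp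
  next
   case False
   hence "sgn l = \<sigma>" using \<sigma> by (auto simp: sgn_if)
   thus ?thesis by simp
  qed
  finally show ?thesis .
 qed
 thus ?case using vanish by auto
qed

definition even_defect :: "nat => cseq => cseq" where "even_defect p f l = (toep ^^ p) f l - (sgn_toep ^^ p) f l"
definition odd_defect :: "nat => cseq => cseq" where "odd_defect p f l = (toep ^^ p) f l - (sgn_toep ^^ p) (sgn_op f) l"

lemma banded_even_defect: "banded (p * N) (even_defect p)" unfolding even_defect_def[abs_def]
  by (intro banded_minus banded_power_ops(1) banded_power_ops(2))
lemma banded_odd_defect: "banded (p * N) (odd_defect p)"
 unfolding odd_defect_def[abs_def] using banded_comp[OF banded_power_ops(2) banded_sgn_op] by (intro banded_minus banded_power_ops(1)) auto

lemma defect_far_column: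
 assumes "\<bar>k\<bar> > int (p * N)"
 shows "even p ==> even_defect p (delta k) l = 0" "odd p ==> odd_defect p (delta k) l = 0"
proof -
 define \<sigma> where "\<sigma> = sgn k"
 have "k \<noteq> 0" using assms of_nat_0_le_iff[of "p * N", where 'a=int] by linarith
 hence sg: "\<sigma> = 1 \<or> \<sigma> = -1" by (auto simp: \<sigma>_def sgn_if)
 have k: "\<sigma> * k > int (p * N)" using assms by (auto simp: \<sigma>_def sgn_if split: if_splits)
 have z: "delta k l = 0" if "\<sigma> * l <= int (p * N)" for l using that k by (auto simp: delta_def)
 have sgn_toep: "(sgn_toep ^^ p) (delta k) l = of_int (\<sigma> ^ p) * (toep ^^ p) (delta k) l"
   using sgn_toep_power_one_sided[where \<sigma>=\<sigma> and f="delta k" and c="int (p * N)" and p=p, OF sg z] by simp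
 show "even_defect p (delta k) l = 0" if "even p" using sgn_toep that sg by (auto simp: even_defect_def)
 show "odd_defect p (delta k) l = 0" if "odd p"
 proof -
  have "sgn_op (delta k) = (%l. of_int \<sigma> * delta k l)" by (auto simp: sgn_op_def delta_def \<sigma>_def)
  hence "(sgn_toep ^^ p) (sgn_op (delta k)) l = of_int \<sigma> * (sgn_toep ^^ p) (delta k) l" by (simp add: banded_cmult[OF banded_power_ops(2)])
  thus ?thesis using sgn_toep that sg by (auto simp: odd_defect_def)
 qed
qed

lemma supported_on_if_far_columns_eq_0:
 assumes P: "banded w P" and far: "!!k l. \<bar>k\<bar> > int w ==> P (delta k) l = 0"
 shows "supported_on (2 * int w) P"
 unfolding supported_on_def
proof (intro allI impI)
 fix k l assume nz: "P (delta k) l \<noteq> 0"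
 have "\<bar>k\<bar> <= int w" using far[of k l] nz by linarith
 moreover have "\<bar>l - k\<bar> <= int w" using banded_delta_eq_0[OF P, of l k] nz by linarith
 ultimately show "\<bar>k\<bar> <= 2 * int w \<and> \<bar>l\<bar> <= 2 * int w" by linarith
qed

lemma supported_on_even_defect: "even p ==> supported_on (2 * int (p * N)) (even_defect p)"
 by (rule supported_on_if_far_columns_eq_0[OF banded_even_defect defect_far_column(1)])

lemma supported_on_odd_defect: "odd p ==> supported_on (2 * int (p * N)) (odd_defect p)"
 by (rule supported_on_if_far_columns_eq_0[OF banded_odd_defect defect_far_column(2)])

lemma odd_defect_toep: "odd_defect p (toep f) l = even_defect (Suc p) f l"
 by (simp add: odd_defect_def even_defect_def funpow_swap1 sgn_toep_eq)

end

section \<open>Special values\<close>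

lemma sqrt_abs_mult_sgn: "sqrt_abs l * (of_int (sgn l) * (sqrt_abs l * x)) = of_int l * x"
proof -
 have "sqrt_abs l * (of_int (sgn l) * (sqrt_abs l * x)) = of_int (sgn l) * (sqrt_abs l * sqrt_abs l) * x" by (simp add: mult_ac)
 thus ?thesis unfolding sqrt_abs_mult_self of_int_mult[symmetric] by (simp add: mult.commute[of "sgn l"] abs_mult_sgn)
qed

context pos_trig_poly
begin

sublocale ops: hermitian_band N bc by unfold_locales (simp_all add: band cnj_bc)

definition sqrt_mode :: "int => cseq" where "sqrt_mode n l = sqrt_abs l * mode_coef n l"

lemma toep_sqrt_abs: "ops.toep (%l. sqrt_abs l * x l) l = sqrt_abs l * bLam x l"
proof -
 have "ops.toep (%l. sqrt_abs l * x l) l = (\<Sum>k\<in>window N l. sqrt_abs l * (bc (l - k) * (sqrt_abs k * sqrt_abs k * x k)))"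
  unfolding ops.toep_def band_op_def toep_entry_def by (simp add: mult_ac)
 also have "... = (\<Sum>j\<in>freqs N. sqrt_abs l * (bc j * (of_int \<bar>l - j\<bar> * x (l - j))))"
  unfolding sqrt_abs_mult_self by (rule sum.reindex_bij_witness[of _ "%j. l - j" "%k. l - k"]) auto
 finally show ?thesis by (simp add: bLam_def mult_b_def sum_distrib_left)
qed

lemma toep_power_sqrt_abs: "(ops.toep ^^ p) (%l. sqrt_abs l * x l) = (%l. sqrt_abs l * (bLam ^^ p) x l)"
 by (induction p) (auto simp: toep_sqrt_abs)

lemma toep_sgn_sqrt_mode: "ops.toep (ops.sgn_op (sqrt_mode n)) l = of_int n * sqrt_mode n l"
proof -
 have "ops.toep (ops.sgn_op (sqrt_mode n)) l = (\<Sum>k\<in>window N l. sqrt_abs l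
   * (bc (l - k) * (sqrt_abs k * (of_int (sgn k) * (sqrt_abs k * mode_coef n k)))))"
  unfolding ops.toep_def band_op_def toep_entry_def ops.sgn_op_def sqrt_mode_def by (simp add: mult_ac)
 also have "... = (\<Sum>j\<in>freqs N. sqrt_abs l * (bc j * of_int (l - j) * mode_coef n (l - j)))"
  unfolding sqrt_abs_mult_sgn by (rule sum.reindex_bij_witness[of _ "%j. l - j" "%k. l - k"]) auto
 also have "... = sqrt_abs l * (of_int n * mode_coef n l)" unfolding sum_distrib_left[symmetric] mode_coef_recursion ..
 finally show ?thesis by (simp add: sqrt_mode_def mult_ac)
qed

lemma sgn_toep_power_sgn_sqrt_mode: "(ops.sgn_toep ^^ q) (ops.sgn_op (sqrt_mode n)) = (%l. of_int (n ^ q) * ops.sgn_op (sqrt_mode n) l)"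
proof (induction q)
 case (Suc q)
 have "(ops.sgn_toep ^^ Suc q) (ops.sgn_op (sqrt_mode n)) l
   = of_int (sgn l) * ops.toep (%l. of_int (n ^ q) * ops.sgn_op (sqrt_mode n) l) l" for l
  using ops.sgn_toep_eq[of "(ops.sgn_toep ^^ q) (ops.sgn_op (sqrt_mode n))"] unfolding Suc by (simp add: Suc ops.sgn_op_def)
 hence "(ops.sgn_toep ^^ Suc q) (ops.sgn_op (sqrt_mode n)) l = of_int (n ^ Suc q) * ops.sgn_op (sqrt_mode n) l" for l
  unfolding banded_cmult[OF ops.banded_ops(1)] toep_sgn_sqrt_mode ops.sgn_op_def[of "sqrt_mode n" l] by simp
 thus ?case by (rule ext)
qed simp

lemma rapid_mode_coef: "rapid (mode_coef n)"
 using rapid_mode_sum[OF rapid_delta[of n]] unfolding mode_sum_delta[abs_def] .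

lemma rapid_bLam_power: "rapid x ==> rapid ((bLam ^^ p) x)"
 by (induction p) (auto intro: rapid_bLam)

lemma has_sum_toep_power_sqrt_mode:
 "((%l. (ops.toep ^^ q) (sqrt_mode n) l * cnj (sqrt_mode n l)) has_sum Lam_pair ((bLam ^^ q) (mode_coef n)) n) UNIV"
proof -
 have "((%l. (bLam ^^ q) (mode_coef n) l * (of_int \<bar>l\<bar> * cnj (mode_coef n l))) has_sum Lam_pair ((bLam ^^ q) (mode_coef n)) n) UNIV"
  unfolding Lam_pair_def by (intro has_sum_infsum Lam_pair_summable rapid_bLam_power rapid_mode_coef)
 moreover have "(bLam ^^ q) (mode_coef n) l * (of_int \<bar>l\<bar> * cnj (mode_coef n l)) = (ops.toep ^^ q) (sqrt_mode n) l * cnj (sqrt_mode n l)" for l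
  unfolding sqrt_mode_def[abs_def] toep_power_sqrt_abs sqrt_abs_mult_self[symmetric] by simp
 ultimately show ?thesis by simp
qed

lemma has_sum_sgn_toep_power_sqrt_mode:
 "((%l. (ops.sgn_toep ^^ q) (ops.sgn_op (sqrt_mode n)) l * cnj (sqrt_mode n l)) has_sum of_int (n ^ Suc q)) UNIV"
proof -
 have "((%l. of_int (n ^ q) * (of_int l * mode_coef n l * cnj (mode_coef n l))) has_sum of_int (n ^ q) * of_int n) UNIV"
  using has_sum_cmult_right[OF mode_coef_orthogonality[of n n], of "of_int (n ^ q)"] by simp
 moreover have "of_int (n ^ q) * (of_int l * mode_coef n l * cnj (mode_coef n l))
   = (ops.sgn_toep ^^ q) (ops.sgn_op (sqrt_mode n)) l * cnj (sqrt_mode n l)" for l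
 proof -
  have "(ops.sgn_toep ^^ q) (ops.sgn_op (sqrt_mode n)) l * cnj (sqrt_mode n l)
    = of_int (n ^ q) * (sqrt_abs l * (of_int (sgn l) * (sqrt_abs l * (mode_coef n l * cnj (mode_coef n l)))))"
   unfolding sgn_toep_power_sgn_sqrt_mode ops.sgn_op_def sqrt_mode_def by (simp add: mult_ac)
  thus ?thesis unfolding sqrt_abs_mult_sgn by (simp add: mult_ac)
 qed
 ultimately show ?thesis by (simp add: mult.commute)
qed

lemma odd_defect_form:
 assumes q: "odd q" and R: "R >= 2 * int (q * N)"
 shows "Lam_pair ((bLam ^^ q) (mode_coef n)) n - of_int (n ^ Suc q)
   = (\<Sum>l\<in>{-R..R}. \<Sum>k\<in>{-R..R}. ops.odd_defect q (delta k) l * (sqrt_mode n k * cnj (sqrt_mode n l)))"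
proof -
 have form: "((%l. ops.odd_defect q (sqrt_mode n) l * cnj (sqrt_mode n l))
   has_sum (Lam_pair ((bLam ^^ q) (mode_coef n)) n - of_int (n ^ Suc q))) UNIV"
  using has_sum_diff[OF has_sum_toep_power_sqrt_mode has_sum_sgn_toep_power_sqrt_mode] by (simp add: ops.odd_defect_def left_diff_distrib)
 have supported: "supported_on R (ops.odd_defect q)" by (rule supported_on_mono[OF ops.supported_on_odd_defect[OF q] R])
 have expand: "ops.odd_defect q (sqrt_mode n) l = (\<Sum>k\<in>{-R..R}. ops.odd_defect q (delta k) l * sqrt_mode n k)" for l
  by (rule banded_supported_eq_sum[OF ops.banded_odd_defect supported])
 have "ops.odd_defect q (sqrt_mode n) l = 0" if "l \<notin> {-R..R}" for l
  unfolding expand using supported that by (intro sum.neutral) (force simp: supported_on_def)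
 hence "((%l. ops.odd_defect q (sqrt_mode n) l * cnj (sqrt_mode n l))
   has_sum (\<Sum>l\<in>{-R..R}. ops.odd_defect q (sqrt_mode n) l * cnj (sqrt_mode n l))) UNIV"
  by (intro has_sum_finite_neutralI) auto
 from has_sum_unique[OF form this] show ?thesis unfolding expand by (simp add: sum_distrib_right mult.assoc)
qed

lemma has_sum_trace_even_defect:
 assumes q: "odd q" and R: "R >= 2 * int (q * N)"
 shows "((%n. Lam_pair ((bLam ^^ q) (mode_coef n)) n - of_int (n ^ Suc q)) has_sum trace_on R (ops.even_defect (Suc q))) UNIV"
proof -
 have completeness: "((%n. sqrt_mode n k * cnj (sqrt_mode n l)) has_sum toep_entry bc k l) UNIV" for k l
  using has_sum_cmult_right[OF mode_coef_completeness[of k l], of "sqrt_abs k * sqrt_abs l"]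
  by (simp add: sqrt_mode_def toep_entry_def mult_ac)
 have "ops.toep (delta l) k = toep_entry bc k l" for k l
  unfolding ops.toep_def band_op_delta by (auto simp: toep_entry_def band)
 hence "trace_on R (ops.even_defect (Suc q)) = (\<Sum>l\<in>{-R..R}. \<Sum>k\<in>{-R..R}. ops.odd_defect q (delta k) l * toep_entry bc k l)"
  unfolding trace_on_def ops.odd_defect_toep[symmetric]
  by (intro sum.cong refl, subst banded_supported_eq_sum[OF ops.banded_odd_defect
    supported_on_mono[OF ops.supported_on_odd_defect[OF q] R]]) simp
 thus ?thesis unfolding odd_defect_form[OF assms]
  by (simp only:) (intro has_sum_sum has_sum_cmult_right completeness finite_atLeastAtMost_int)
qed

lemma mode_op_power_eq: assumes y: "rapid y" shows "(mode_op ^^ Suc q) y = Lam_pair ((bLam ^^ q) (mode_sum y))"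
proof (induction q)
 case (Suc q)
 have "(mode_op ^^ Suc (Suc q)) y = Lam_pair (mode_sum (Lam_pair ((bLam ^^ q) (mode_sum y))))"
  using Suc mode_op_def[of "(mode_op ^^ Suc q) y"] by simp
 also have "mode_sum (Lam_pair ((bLam ^^ q) (mode_sum y))) = bLam ((bLam ^^ q) (mode_sum y))"
  by (rule ext, rule mode_sum_Lam_pair) (intro rapid_bLam_power rapid_mode_sum y)
 finally show ?case by simp
qed (simp add: mode_op_def)

lemma rapid_mode_op_power: "rapid y ==> rapid ((mode_op ^^ p) y)"
 by (induction p) (auto intro: rapid_mode_op)

end

context mode_eigenbasis
begin

lemma l2_form_mode_op_power: assumes y: "rapid y" shows "l2_form ((mode_op ^^ p) y) (\<psi> j) = of_real (lam j ^ p) * l2_form y (\<psi> j)"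
proof (induction p)
 case (Suc p)
 have rapid: "rapid ((mode_op ^^ p) y)" by (rule rapid_mode_op_power[OF y])
 have "l2_form ((mode_op ^^ Suc p) y) (\<psi> j) = of_real (lam j) * l2_form ((mode_op ^^ p) y) (\<psi> j)"
  using l2_form_mode_op[OF rapid rapid_half_sobolev[OF psi_rapid[of j]]] psi_form[OF rapid_half_sobolev[OF rapid]] by simp
 thus ?case using Suc by simp
qed simp

lemma parseval_psi_polarized:
 assumes f: "rapid f" and g: "rapid g"
 shows "((%j. Re (l2_form f (\<psi> j) * cnj (l2_form g (\<psi> j)))) has_sum Re (l2_form f g)) UNIV"
proof -
 define h where "h n = f n + g n" for n
 have h: "rapid h" unfolding h_def by (rule rapid_add[OF f g])
 note sobolev = rapid_half_sobolev[OF f] rapid_half_sobolev[OF g] rapid_half_sobolev[OF h] rapid_half_sobolev[OF psi_rapid]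
 have add: "l2_form h u = l2_form f u + l2_form g u" if "u \<in> half_sobolev" for u
  using l2_form_comb[OF sobolev(1,2) that, of 1] by (simp add: h_def[abs_def])
 have cmod_add: "(cmod (u + v))\<^sup>2 = (cmod u)\<^sup>2 + (cmod v)\<^sup>2 + 2 * Re (u * cnj v)" for u v :: complex
  by (simp add: cmod_power2) (simp add: algebra_simps power2_eq_square)
 have "((%j. (1/2) * ((cmod (l2_form h (\<psi> j)))\<^sup>2 - (cmod (l2_form f (\<psi> j)))\<^sup>2 - (cmod (l2_form g (\<psi> j)))\<^sup>2)) has_sum
  (1/2) * (Re (l2_form h h) - Re (l2_form f f) - Re (l2_form g g))) UNIV"
  by (intro has_sum_cmult_right has_sum_diff has_sum_parseval_psi f g h)
 moreover have "Re (l2_form h h) = Re (l2_form f f) + Re (l2_form g g) + 2 * Re (l2_form f g)"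
  unfolding add[OF sobolev(3)] using l2_form_cnj[of f h] l2_form_cnj[of g h] l2_form_cnj[of g f]
  unfolding add[OF sobolev(1)] add[OF sobolev(2)] by simp
 ultimately show ?thesis unfolding add[OF sobolev(4)] cmod_add by (simp add: algebra_simps)
qed

lemma has_sum_weight_lam_power: "((%j. weight n j * lam j ^ p) has_sum Re ((mode_op ^^ p) (delta n) n)) UNIV"
proof -
 have "((%j. Re (l2_form ((mode_op ^^ p) (delta n)) (\<psi> j) * cnj (l2_form (delta n) (\<psi> j))))
   has_sum Re (l2_form ((mode_op ^^ p) (delta n)) (delta n))) UNIV"
  by (intro parseval_psi_polarized rapid_mode_op_power rapid_delta)
 moreover have "l2_form f (delta n) = f n" for f using l2_form_cnj[of f "delta n"] l2_form_delta[of n f] by simp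
 moreover have "Re (of_real (lam j ^ p) * cnj (\<psi> j n) * \<psi> j n) = weight n j * lam j ^ p" for j
  unfolding weight_def by (simp add: cmod_power2 del: of_real_power) (simp add: algebra_simps power2_eq_square)
 ultimately show ?thesis unfolding l2_form_mode_op_power[OF rapid_delta] l2_form_delta by simp
qed

lemma has_sum_correction_term:
 assumes p: "p > 0" and n: "n \<noteq> 0"
 shows "((%j. correction_term (- of_nat p) (n, j)) has_sum of_real (Re ((mode_op ^^ p) (delta n) n) - \<bar>of_int n\<bar> ^ p)) pos_idx"
proof -
 have "((%j. weight n j * lam j ^ p) has_sum Re ((mode_op ^^ p) (delta n) n)) pos_idx"
  by (rule has_sum_cong_neutral[THEN iffD1, OF _ _ _ has_sum_weight_lam_power[of n p]])
   (auto simp: pos_idx_def weight_def not_less psi_eq_0_if_nonpos[OF _ n])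
 moreover have "((%j. weight n j * \<bar>of_int n\<bar> ^ p) has_sum \<bar>of_int n\<bar> ^ p) pos_idx"
  using has_sum_cmult_left[OF has_sum_weight_pos_idx[OF n]] by fastforce
 ultimately have "((%j. complex_of_real (weight n j * lam j ^ p - weight n j * \<bar>of_int n\<bar> ^ p)) has_sum
   of_real (Re ((mode_op ^^ p) (delta n) n) - \<bar>of_int n\<bar> ^ p)) pos_idx"
  by (intro has_sum_of_real has_sum_diff)
 moreover have "correction_term (- of_nat p) (n, j) = complex_of_real (weight n j * lam j ^ p - weight n j * \<bar>of_int n\<bar> ^ p)"
   if "j \<in> pos_idx" for j
 proof -
  have "complex_of_real x powr of_nat p = of_real (x ^ p)" if "x > 0" for x
   using that by (simp add: powr_nat')
  from this[of "lam j"] this[of "\<bar>of_int n\<bar>"] show ?thesis using that n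
   by (simp add: correction_term_def pos_idx_def right_diff_distrib)
 qed
 ultimately show ?thesis by (simp only: cong: has_sum_cong)
qed

lemma has_sum_zeta_correction:
 assumes p: "p > 0"
 shows "((%n. complex_of_real (Re ((mode_op ^^ p) (delta n) n) - \<bar>of_int n\<bar> ^ p)) has_sum zeta_correction (- of_nat p)) {n. n \<noteq> 0}"
proof (rule has_sum_SigmaD)
 show "(correction_term (- of_nat p) has_sum zeta_correction (- of_nat p)) (Sigma {n. n \<noteq> 0} (%_. pos_idx))"
  using has_sum_infsum[OF abs_summable_summable[OF correction_term_abs_summable]] by (simp add: zeta_correction_def pos_pairs_def)
qed (use has_sum_correction_term[OF p] in simp)

theorem zeta_correction_even:
 assumes m: "m >= 1" and R: "R >= 2 * int ((2 * m) * N)"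
 shows "zeta_correction (- 2 * of_nat m) = of_real (Re (trace_on R (ops.even_defect (2 * m))))"
proof -
 let ?f = "%n. complex_of_real (Re ((mode_op ^^ (2 * m)) (delta n) n) - \<bar>of_int n\<bar> ^ (2 * m))"
 define q where "q = 2 * m - 1"
 have q: "odd q" "Suc q = 2 * m" using m by (auto simp: q_def)
 have "int (q * N) <= int (2 * m * N)" by (intro of_nat_mono mult_right_mono) (simp_all add: q_def)
 hence "R >= 2 * int (q * N)" using R by linarith
 hence sum: "((%n. complex_of_real (Re (Lam_pair ((bLam ^^ q) (mode_coef n)) n - of_int (n ^ Suc q))))
   has_sum of_real (Re (trace_on R (ops.even_defect (Suc q))))) UNIV"
  by (intro has_sum_of_real has_sum_Re has_sum_trace_even_defect q(1))
 have diagonal: "Lam_pair ((bLam ^^ q) (mode_coef n)) n = (mode_op ^^ (2 * m)) (delta n) n" for n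
  using mode_op_power_eq[OF rapid_delta, of q n] unfolding q(2) mode_sum_delta[abs_def] by simp
 have "Re (of_int (n ^ Suc q)) = \<bar>of_int n\<bar> ^ (2 * m)" for n unfolding q(2) by (simp add: power_even_abs)
 hence trace: "(?f has_sum of_real (Re (trace_on R (ops.even_defect (2 * m))))) UNIV"
  using sum unfolding diagonal q(2) by simp
 have "(mode_op ^^ (2 * m)) (delta 0) 0 = 0"
  unfolding diagonal[symmetric] Lam_pair_def by (rule infsum_0) (simp add: mode_coef_0)
 hence "(?f has_sum of_real (Re (trace_on R (ops.even_defect (2 * m))))) {n. n \<noteq> 0}"
  using m by (intro has_sum_cong_neutral[THEN iffD1, OF _ _ _ trace]) auto
 from has_sum_unique[OF has_sum_zeta_correction[of "2 * m"] this] m show ?thesis by simp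
qed

theorem zeta_correction_minus_1: "zeta_correction (- 1) = of_real (\<Sum>\<^sub>\<infinity>n\<in>{n. n \<noteq> 0}. Re (remainder n n))"
proof -
 have "mode_op (delta n) n = of_int \<bar>n\<bar> + remainder n n" for n
  unfolding mode_op_eq[OF rapid_delta] by (subst infsum_single[of n]) (auto simp: delta_def)
 hence "((%n. complex_of_real (Re (remainder n n))) has_sum zeta_correction (- 1)) {n. n \<noteq> 0}"
  using has_sum_zeta_correction[of 1] by simp
 from has_sum_Re[OF this] this show ?thesis by (auto simp: complex_eq_iff dest!: infsumI has_sum_Im)
qed

end

section \<open>Lipschitz systems of ordinary differential equations\<close>

lemma at_within_Icc_eq_Ici: "t < S ==> at t within {0..S} = at t within {0::real..}"
 by (rule at_within_nhd[of t "{..<S}"]) auto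

lemma has_vector_derivative_integral_Ici:
 fixes g :: "real => complex"
 assumes "continuous_on {0..} g" "t >= 0"
 shows "((%t. integral {0..t} g) has_vd g t) (at t within {0..})"
 using integral_has_vector_derivative[of 0 "t + 1" g t] continuous_on_subset[OF assms(1), of "{0..t+1}"] assms(2)
 by (simp add: at_within_Icc_eq_Ici)

lemma nonincreasing_if_deriv_nonpos:
 fixes f :: "real => real"
 assumes "!!t. t \<in> {a..b} ==> (f has_real_derivative f' t) (at t within {a..b})" "!!t. t \<in> {a..b} ==> f' t <= 0" "a <= b"
 shows "f b <= f a"
proof (cases "a < b")
 case True
 obtain x where x: "x \<in> {a<..<b}" "f b - f a = f' x * (b - a)"
  using mvt_simple[OF True, of f "%x h. f' x * h"] assms(1) unfolding has_field_derivative_def by auto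
 thus ?thesis using assms(2)[of x] mult_nonpos_nonneg[of "f' x" "b - a"] by auto
qed (use assms in auto)

lemma gronwall_nonpos:
 fixes h :: "real => real"
 assumes h: "!!t. t \<in> {0..S} ==> (h has_real_derivative h' t) (at t within {0..S})" "!!t. t \<in> {0..S} ==> h' t <= K * h t"
  and "h 0 <= 0" "S >= 0"
 shows "h S <= 0"
proof -
 have "h S * exp (- K * S) <= h 0 * exp (- K * 0)"
 proof (rule nonincreasing_if_deriv_nonpos[OF _ _ assms(4), where f="%t. h t * exp (- K * t)"])
  fix t assume t: "t \<in> {0..S}"
  show "((%t. h t * exp (- K * t)) has_real_derivative (h' t - K * h t) * exp (- K * t)) (at t within {0..S})"
   by (rule derivative_eq_intros h(1)[OF t] refl | simp add: algebra_simps)+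
  show "(h' t - K * h t) * exp (- K * t) <= 0" using h(2)[OF t] by (intro mult_nonpos_nonneg) auto
 qed
 hence "h S * exp (- K * S) <= 0" using assms(3) by simp
 thus ?thesis by (simp add: mult_le_0_iff)
qed

lemma has_real_derivative_norm_sq:
 fixes u :: "real => 'a::real_inner"
 assumes "(u has_vd u') (at t within S)"
 shows "((%t. (norm (u t))\<^sup>2) has_real_derivative 2 * (u t \<bullet> u')) (at t within S)"
proof -
 have "((%t. u t \<bullet> u t) has_derivative (%h. u t \<bullet> (h *\<^sub>R u') + (h *\<^sub>R u') \<bullet> u t)) (at t within S)"
  using assms unfolding has_vector_derivative_def by (intro has_derivative_inner)
 moreover have "(%h. u t \<bullet> (h *\<^sub>R u') + (h *\<^sub>R u') \<bullet> u t) = (*) (2 * (u t \<bullet> u'))" by (auto simp: inner_commute)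
 ultimately show ?thesis unfolding has_field_derivative_def power2_norm_eq_inner by simp
qed

lemma has_integral_power_div_fact:
 assumes "t >= 0"
 shows "((%s::real. s ^ k / fact k) has_integral t ^ Suc k / fact (Suc k)) {0..t}"
proof -
 have "((%s. s ^ Suc k / fact (Suc k)) has_vd s ^ k / fact k) (at s within {0..t})" for s :: real
 proof -
  have "((%s. s ^ Suc k / fact (Suc k)) has_real_derivative (real (Suc k) * s ^ k / fact (Suc k))) (at s within {0..t})"
   using DERIV_cdivide[OF DERIV_pow[of "Suc k" s "{0..t}"]] by (simp del: fact_Suc of_nat_Suc power_Suc)
  moreover have "real (Suc k) * s ^ k / fact (Suc k) = s ^ k / fact k" by simp
  ultimately show ?thesis by (simp only: has_real_derivative_iff_has_vector_derivative)
 qed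
 from fundamental_theorem_of_calculus[OF assms this] show ?thesis by simp
qed

locale lipschitz_system =
 fixes F :: "cseq => cseq" and I :: "int set" and L :: real
 assumes finite_I: "finite I" and L_nonneg: "L >= 0"
  and lipschitz: "!!x y n. n \<in> I ==> cmod (F x n - F y n) <= L * (\<Sum>k\<in>I. cmod (x k - y k))"
begin

lemma tendsto_F:
 assumes u: "!!k. k \<in> I ==> ((%s. u s k) \<longlongrightarrow> v k) G" and n: "n \<in> I"
 shows "((%s. F (u s) n) \<longlongrightarrow> F v n) G"
proof -
 have "((%s. L * (\<Sum>k\<in>I. cmod (u s k - v k))) \<longlongrightarrow> L * (\<Sum>k\<in>I. cmod (v k - v k))) G"
  by (intro tendsto_intros u)
 hence "((%s. L * (\<Sum>k\<in>I. cmod (u s k - v k))) \<longlongrightarrow> 0) G" by simp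
 hence "((%s. F (u s) n - F v n) \<longlongrightarrow> 0) G"
  by (rule Lim_null_comparison[rotated]) (simp add: lipschitz[OF n])
 thus ?thesis by (simp add: LIM_zero_iff)
qed

lemma continuous_on_F:
 assumes "!!k. k \<in> I ==> continuous_on S (%s. u s k)" "n \<in> I"
 shows "continuous_on S (%s. F (u s) n)"
 using assms unfolding continuous_on_def by (auto intro!: tendsto_F)

lemma uniform_limit_F:
 assumes u: "!!k. k \<in> I ==> uniform_limit S (%m s. u m s k) (%s. v s k) G" and n: "n \<in> I"
 shows "uniform_limit S (%m s. F (u m s) n) (%s. F (v s) n) G"
 unfolding uniform_limit_iff
proof (intro allI impI)
 fix e :: real assume e: "e > 0"
 define d where "d = e / (L * real (card I) + 1)"
 have d: "d > 0" using e L_nonneg by (simp add: d_def add_nonneg_pos)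
 have "\<forall>\<^sub>F m in G. \<forall>k\<in>I. \<forall>s\<in>S. dist (u m s k) (v s k) < d"
  using u d by (intro eventually_ball_finite finite_I) (auto simp: uniform_limit_iff)
 thus "\<forall>\<^sub>F m in G. \<forall>s\<in>S. dist (F (u m s) n) (F (v s) n) < e"
 proof eventually_elim
  case (elim m)
  show ?case
  proof
   fix s assume s: "s \<in> S"
   have "dist (F (u m s) n) (F (v s) n) <= L * (\<Sum>k\<in>I. cmod (u m s k - v s k))" unfolding dist_norm by (rule lipschitz[OF n])
   also have "... <= L * (real (card I) * d)" using elim s L_nonneg
    by (intro mult_left_mono sum_bounded_above) (auto simp: dist_norm less_imp_le)
   also have "... < (L * real (card I) + 1) * d" using d by (simp add: distrib_right)
   also have "... = e" using L_nonneg by (simp add: d_def add_nonneg_pos less_imp_neq[symmetric] add_nonneg_eq_0_iff)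
   finally show "dist (F (u m s) n) (F (v s) n) < e" .
  qed
 qed
qed

fun picard :: "cseq => nat => real => cseq" where
 "picard x0 0 t n = x0 n"
| "picard x0 (Suc k) t n = x0 n + (if n \<in> I then integral {0..t} (%s. F (picard x0 k s) n) else 0)"

lemma continuous_on_picard: "continuous_on {0..} (%t. picard x0 k t n)"
proof (induction k arbitrary: n)
 case (Suc k)
 have "continuous_on {0..} (%t. integral {0..t} (%s. F (picard x0 k s) n))" if "n \<in> I"
  by (rule continuous_on_vector_derivative[OF has_vector_derivative_integral_Ici[OF continuous_on_F[OF Suc that]]]) auto
 thus ?case by (cases "n \<in> I") (auto intro!: continuous_intros)
qed simp

lemma integrable_F_picard: "n \<in> I ==> (%s. F (picard x0 k s) n) integrable_on {0..t}"
 by (intro integrable_continuous_real continuous_on_F continuous_on_subset[OF continuous_on_picard]) auto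

lemma picard_increment_bound:
 assumes "t >= 0"
 shows "(\<Sum>n\<in>I. cmod (picard x0 (Suc k) t n - picard x0 k t n)) <= (\<Sum>n\<in>I. cmod (F x0 n)) * (L * real (card I)) ^ k * (t ^ Suc k / fact (Suc k))"
 using assms
proof (induction k arbitrary: t)
 case 0
 have "picard x0 0 s = x0" for s by auto
 hence "cmod (picard x0 (Suc 0) t n - picard x0 0 t n) = cmod (F x0 n) * t" if "n \<in> I" for n
  using 0 that by (simp add: norm_mult scaleR_conv_of_real)
 thus ?case unfolding sum_distrib_right by (intro sum_mono) simp
next
 case (Suc k)
 define B where "B = (\<Sum>n\<in>I. cmod (F x0 n)) * (L * real (card I)) ^ k"
 have integral: "((%s. L * (B * (s ^ Suc k / fact (Suc k)))) has_integral L * (B * (t ^ Suc (Suc k) / fact (Suc (Suc k))))) {0..t}"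
  by (intro has_integral_mult_right has_integral_power_div_fact Suc.prems)
 have "cmod (picard x0 (Suc (Suc k)) t n - picard x0 (Suc k) t n) <= L * (B * (t ^ Suc (Suc k) / fact (Suc (Suc k))))" if n: "n \<in> I" for n
 proof -
  have "picard x0 (Suc (Suc k)) t n - picard x0 (Suc k) t n = integral {0..t} (%s. F (picard x0 (Suc k) s) n - F (picard x0 k s) n)"
   using n integral_diff[OF integrable_F_picard[OF n, of x0 "Suc k" t] integrable_F_picard[OF n, of x0 k t]] by simp
  also have "cmod ... <= integral {0..t} (%s. L * (B * (s ^ Suc k / fact (Suc k))))"
  proof (rule integral_norm_bound_integral)
   show "(%s. F (picard x0 (Suc k) s) n - F (picard x0 k s) n) integrable_on {0..t}" by (intro integrable_diff integrable_F_picard n)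
   fix s assume s: "s \<in> {0..t}"
   have "cmod (F (picard x0 (Suc k) s) n - F (picard x0 k s) n) <= L * (\<Sum>n\<in>I. cmod (picard x0 (Suc k) s n - picard x0 k s n))"
    by (rule lipschitz[OF n])
   also have "... <= L * (B * (s ^ Suc k / fact (Suc k)))" unfolding B_def using s by (intro mult_left_mono Suc.IH L_nonneg) auto
   finally show "cmod (F (picard x0 (Suc k) s) n - F (picard x0 k s) n) <= L * (B * (s ^ Suc k / fact (Suc k)))" .
  qed (use integral in auto)
  finally show ?thesis using integral_unique[OF integral] by simp
 qed
 hence "(\<Sum>n\<in>I. cmod (picard x0 (Suc (Suc k)) t n - picard x0 (Suc k) t n))
   <= of_nat (card I) * (L * (B * (t ^ Suc (Suc k) / fact (Suc (Suc k)))))"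
  by (rule sum_bounded_above)
 thus ?case by (simp add: B_def mult_ac del: fact_Suc)
qed

definition picard_limit :: "cseq => real => cseq" where
 "picard_limit x0 t n = x0 n + (\<Sum>k. picard x0 (Suc k) t n - picard x0 k t n)"

lemma picard_telescope: "x0 n + (\<Sum>k<m. picard x0 (Suc k) t n - picard x0 k t n) = picard x0 m t n"
 by (induction m) (simp_all del: picard.simps(2) add: algebra_simps)

lemma uniform_limit_picard:
 assumes n: "n \<in> I"
 shows "uniform_limit {0..S} (%m t. picard x0 m t n) (%t. picard_limit x0 t n) sequentially"
proof -
 define C M where "C = (\<Sum>n\<in>I. cmod (F x0 n))" and "M = L * real (card I)"
 have C: "C >= 0" "M >= 0" using L_nonneg by (auto simp: C_def M_def sum_nonneg)
 have "uniform_limit {0..S} (%m t. \<Sum>k<m. picard x0 (Suc k) t n - picard x0 k t n) (%t. \<Sum>k. picard x0 (Suc k) t n - picard x0 k t n) sequentially"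
 proof (rule Weierstrass_m_test)
  show "summable (%k. C * S * ((M * S) ^ k /\<^sub>R fact k))" by (intro summable_mult summable_exp_generic)
  fix k t assume t: "t \<in> {0..S}"
  have "cmod (picard x0 (Suc k) t n - picard x0 k t n) <= (\<Sum>n\<in>I. cmod (picard x0 (Suc k) t n - picard x0 k t n))"
   using finite_I n by (intro member_le_sum) auto
  also have "... <= C * M ^ k * (t ^ Suc k / fact (Suc k))" unfolding C_def M_def using t by (intro picard_increment_bound) auto
  also have "... <= C * M ^ k * (S ^ Suc k / fact k)"
   using t C by (intro mult_left_mono frac_le power_mono) (auto simp: fact_mono)
  also have "... = C * S * ((M * S) ^ k /\<^sub>R fact k)" by (simp add: field_simps power_mult_distrib)
  finally show "norm (picard x0 (Suc k) t n - picard x0 k t n) <= C * S * ((M * S) ^ k /\<^sub>R fact k)" .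
 qed
 hence "uniform_limit {0..S} (%m t. x0 n + (\<Sum>k<m. picard x0 (Suc k) t n - picard x0 k t n)) (%t. picard_limit x0 t n) sequentially"
  unfolding picard_limit_def by (intro uniform_limit_add uniform_limit_const)
 thus ?thesis unfolding picard_telescope .
qed

lemma continuous_on_picard_limit:
 assumes n: "n \<in> I"
 shows "continuous_on {0..} (%t. picard_limit x0 t n)"
 unfolding continuous_on_eq_continuous_within
proof
 fix t :: real assume t: "t \<in> {0..}"
 have "continuous_on {0..t+1} (%t. picard_limit x0 t n)"
  by (rule uniform_limit_theorem[OF _ uniform_limit_picard[OF n]]) (auto intro!: always_eventually continuous_on_subset[OF continuous_on_picard])
 hence "continuous (at t within {0..t+1}) (%t. picard_limit x0 t n)" using t by (simp add: continuous_on_eq_continuous_within)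
 thus "continuous (at t within {0..}) (%t. picard_limit x0 t n)" by (simp add: at_within_Icc_eq_Ici)
qed

lemma picard_limit_integral_equation:
 assumes t: "t >= 0" and n: "n \<in> I"
 shows "picard_limit x0 t n = x0 n + integral {0..t} (%s. F (picard_limit x0 s) n)"
proof -
 have "uniform_limit (cbox 0 t) (%m s. F (picard x0 m s) n) (%s. F (picard_limit x0 s) n) sequentially"
  unfolding cbox_interval by (intro uniform_limit_F uniform_limit_picard n)
 hence "(%m. integral {0..t} (%s. F (picard x0 m s) n)) \<longlonglongrightarrow> integral {0..t} (%s. F (picard_limit x0 s) n)"
 proof (rule uniform_limit_integral_cbox)
  show "continuous_on (cbox 0 t) (%s. F (picard x0 m s) n)" for m
   by (intro continuous_on_F[OF continuous_on_subset[OF continuous_on_picard] n]) auto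
  fix P Q assume P: "!!m. ((%s. F (picard x0 m s) n) has_integral P m) (cbox 0 t)"
    "((%s. F (picard_limit x0 s) n) has_integral Q) (cbox 0 t)" "P \<longlonglongrightarrow> Q"
  thus ?thesis using integral_unique[OF P(1)] integral_unique[OF P(2)] by simp
 qed simp
 hence "(%m. picard x0 (Suc m) t n) \<longlonglongrightarrow> x0 n + integral {0..t} (%s. F (picard_limit x0 s) n)"
  using n by (auto intro!: tendsto_intros)
 moreover have "(%m. picard x0 (Suc m) t n) \<longlonglongrightarrow> picard_limit x0 t n"
  by (rule LIMSEQ_Suc, rule tendsto_uniform_limitI[OF uniform_limit_picard[OF n, where S=t]]) (use t in simp)
 ultimately show ?thesis by (rule LIMSEQ_unique[rotated])
qed

lemma solution_exists:
 obtains x where "!!n. x 0 n = x0 n" "!!n t. n \<notin> I ==> x t n = x0 n"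
  "!!n t. n \<in> I ==> t >= 0 ==> ((%t. x t n) has_vd F (x t) n) (at t within {0..})"
proof
 let ?x = "picard_limit x0"
 show "?x t n = x0 n" if "n \<notin> I" for t n
 proof -
  have "picard x0 k t n = x0 n" for k using that by (cases k) auto
  thus ?thesis by (simp add: picard_limit_def del: picard.simps)
 qed
 show "?x 0 n = x0 n" for n
 proof -
  have "picard x0 k 0 n = x0 n" for k by (cases k) auto
  thus ?thesis by (simp add: picard_limit_def del: picard.simps)
 qed
 fix n t assume n: "n \<in> I" and t: "(t::real) >= 0"
 have "((%t. x0 n + integral {0..t} (%s. F (?x s) n)) has_vd 0 + F (?x t) n) (at t within {0..})"
  by (rule has_vector_derivative_add[OF has_vector_derivative_const
     has_vector_derivative_integral_Ici[OF continuous_on_F[OF continuous_on_picard_limit n] t]])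
 thus "((%t. ?x t n) has_vd F (?x t) n) (at t within {0..})"
  using has_vector_derivative_transform[of t "{0..}" "%t. ?x t n" "%t. x0 n + integral {0..t} (%s. F (?x s) n)" "F (?x t) n"]
   n t picard_limit_integral_equation by simp
qed

lemma sum_inner_F_diff_le:
 "(\<Sum>n\<in>I. 2 * ((x n - y n) \<bullet> (F x n - F y n))) <= 2 * L * real (card I) * (\<Sum>n\<in>I. (cmod (x n - y n))\<^sup>2)"
proof -
 let ?s = "\<Sum>k\<in>I. cmod (x k - y k)"
 have "(\<Sum>n\<in>I. 2 * ((x n - y n) \<bullet> (F x n - F y n))) <= (\<Sum>n\<in>I. 2 * (cmod (x n - y n) * (L * ?s)))"
  using lipschitz by (intro sum_mono mult_left_mono order_trans[OF norm_cauchy_schwarz]) auto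
 also have "... = 2 * L * ?s\<^sup>2" by (simp add: sum_distrib_left[symmetric] sum_distrib_right[symmetric] power2_eq_square)
 also have "... <= 2 * L * (real (card I) * (\<Sum>n\<in>I. (cmod (x n - y n))\<^sup>2))"
  using Cauchy_Schwarz_ineq_sum[of "%_. 1" "%k. cmod (x k - y k)" I] L_nonneg by (intro mult_left_mono) auto
 finally show ?thesis by simp
qed

lemma solution_unique:
 assumes x: "!!n t. n \<in> I ==> t \<in> {0..S} ==> ((%t. x t n) has_vd F (x t) n) (at t within {0..S})"
  and y: "!!n t. n \<in> I ==> t \<in> {0..S} ==> ((%t. y t n) has_vd F (y t) n) (at t within {0..S})"
  and initial: "!!n. n \<in> I ==> x 0 n = y 0 n" and S: "S >= 0" and n: "n \<in> I"
 shows "x S n = y S n"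
proof -
 define h where "h t = (\<Sum>n\<in>I. (cmod (x t n - y t n))\<^sup>2)" for t
 have "h S <= 0"
 proof (rule gronwall_nonpos[OF _ _ _ S])
  fix t assume t: "t \<in> {0..S}"
  show "(h has_real_derivative (\<Sum>n\<in>I. 2 * ((x t n - y t n) \<bullet> (F (x t) n - F (y t) n)))) (at t within {0..S})"
   unfolding h_def[abs_def] using t by (intro DERIV_sum has_real_derivative_norm_sq has_vector_derivative_diff x y) auto
  show "(\<Sum>n\<in>I. 2 * ((x t n - y t n) \<bullet> (F (x t) n - F (y t) n))) <= 2 * L * real (card I) * h t"
   unfolding h_def by (rule sum_inner_F_diff_le)
 qed (use initial in \<open>simp add: h_def\<close>)
 moreover have "(cmod (x S n - y S n))\<^sup>2 <= h S" unfolding h_def using finite_I n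
   by (intro member_le_sum[of n I "%n. (cmod (x S n - y S n))\<^sup>2"]) auto
 ultimately have "(cmod (x S n - y S n))\<^sup>2 <= 0" by linarith
 thus ?thesis by simp
qed

end

section \<open>Curves of trigonometric polynomials\<close>

definition re_trig :: "nat => cseq => real => real" where "re_trig N c t = Re (trig_poly N c t)"

lemma re_trig_deriv: "(re_trig N c has_real_derivative re_trig N (%k. \<i> * of_int k * c k) t) (at t within S)"
 unfolding re_trig_def[abs_def] has_real_derivative_iff_has_vector_derivative
 by (rule bounded_linear.has_vector_derivative[OF bounded_linear_Re has_vector_derivative_trig_poly])

lemma re_trig_derivs: "(deriv ^^ j) (re_trig N c) = re_trig N (%k. (\<i> * of_int k) ^ j * c k)"
proof (induction j)
 case (Suc j)
 have "deriv (re_trig N (%k. (\<i> * of_int k) ^ j * c k)) t = re_trig N (%k. \<i> * of_int k * ((\<i> * of_int k) ^ j * c k)) t" for t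
  by (rule DERIV_imp_deriv[OF re_trig_deriv])
 thus ?case using Suc by (auto simp: mult.assoc)
qed simp

lemma re_trig_period: "re_trig N c (t + 2 * pi) = re_trig N c t" by (simp add: re_trig_def trig_poly_period)

lemma circ_smooth_re_trig: "circ_smooth (re_trig N c)"
 unfolding circ_smooth_def
proof
 show "smooth_fun (re_trig N c)"
  by (rule smooth_fun_coinduct[of "range (re_trig N)"]) (use re_trig_deriv in blast, simp)
qed (simp add: re_trig_period)

lemma abs_re_trig_le: "\<bar>re_trig N c t\<bar> <= (\<Sum>k\<in>freqs N. cmod (c k))"
proof -
 have "\<bar>re_trig N c t\<bar> <= cmod (trig_poly N c t)" unfolding re_trig_def by (rule abs_Re_le_cmod)
 also have "... <= (\<Sum>k\<in>freqs N. cmod (c k))" unfolding trig_poly_def by (rule sum_norm_le) (simp add: norm_mult)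
 finally show ?thesis .
qed

lemma re_trig_diff: "re_trig N (%k. c k - d k) t = re_trig N c t - re_trig N d t"
 by (simp add: re_trig_def trig_poly_def left_diff_distrib sum_subtractf)

lemma re_trig_scaleR: "re_trig N (%k. r *\<^sub>R c k) t = r * re_trig N c t"
 by (simp add: re_trig_def trig_poly_def sum_distrib_left)

lemma continuous_on_re_trig: "continuous_on S (re_trig N c)"
 unfolding re_trig_def[abs_def] by (intro continuous_intros)

lemma re_trig_translate_into_period: obtains s where "s \<in> {0..2*pi}" "!!c. re_trig N c s = re_trig N c t"
proof -
 obtain m :: int where m: "t + of_int m * (2 * pi) \<in> {0..2*pi}" by (rule translate_into_period)
 have "re_trig N c (t + of_int m * (2 * pi)) = re_trig N c t" for c
 proof -
  interpret periodic_fun_simple "re_trig N c" "2 * pi" by unfold_locales (rule re_trig_period)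
  show ?thesis by (rule plus_of_int)
 qed
 thus thesis by (rule that[OF m])
qed

lemma continuous_on_re_trig_joint:
 assumes "!!k. continuous_on S (%\<tau>. x \<tau> k)"
 shows "continuous_on (S \<times> A) (%p. re_trig N (x (fst p)) (snd p))"
 unfolding re_trig_def trig_poly_def by (intro continuous_intros continuous_on_compose2[OF assms continuous_on_fst]) auto

lemma re_trig_curve_deriv:
 assumes "!!k. ((%\<tau>. x \<tau> k) has_vd x' k) (at \<tau> within S)"
 shows "((%\<tau>. re_trig N (x \<tau>) t) has_real_derivative re_trig N x' t) (at \<tau> within S)"
 unfolding re_trig_def[abs_def] trig_poly_def has_real_derivative_iff_has_vector_derivative
 by (intro bounded_linear.has_vector_derivative[OF bounded_linear_Re] has_vector_derivative_sum has_vector_derivative_mult_left assms)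

lemma eventually_re_trig_derivs_small:
 assumes "!!k. ((%\<sigma>. d \<sigma> k) \<longlongrightarrow> 0) G" "e > 0"
 shows "\<forall>\<^sub>F \<sigma> in G. \<forall>t. \<bar>re_trig N (%k. (\<i> * of_int k) ^ j * d \<sigma> k) t\<bar> <= e"
proof -
 have "((%\<sigma>. \<Sum>k\<in>freqs N. cmod ((\<i> * of_int k) ^ j * d \<sigma> k)) \<longlongrightarrow> (\<Sum>k\<in>freqs N. cmod ((\<i> * of_int k) ^ j * 0))) G"
  by (intro tendsto_intros assms)
 hence "\<forall>\<^sub>F \<sigma> in G. (\<Sum>k\<in>freqs N. cmod ((\<i> * of_int k) ^ j * d \<sigma> k)) < e"
  using assms(2) by (intro order_tendstoD(2)) auto
 thus ?thesis
 proof eventually_elim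
  case (elim \<sigma>)
  show ?case using order_trans[OF abs_re_trig_le less_imp_le[OF elim]] by blast
 qed
qed

lemma curve_deriv_re_trig:
 assumes "!!k \<tau>. \<tau> >= 0 ==> ((%\<tau>. x \<tau> k) has_vd x' \<tau> k) (at \<tau> within {0..})"
 shows "curve_deriv (%\<tau>. re_trig N (x \<tau>)) (%\<tau>. re_trig N (x' \<tau>))"
 unfolding curve_deriv_def re_trig_derivs
proof (intro allI impI)
 fix j :: nat and \<tau> e :: real assume \<tau>: "\<tau> >= 0" and e: "e > 0"
 let ?q = "%\<sigma>. %k. (x \<sigma> k - x \<tau> k) /\<^sub>R (\<sigma> - \<tau>) - x' \<tau> k"
 let ?d = "%c k. (\<i> * of_int k) ^ j * c k"
 have "((%\<sigma>. (x \<sigma> k - x \<tau> k) /\<^sub>R (\<sigma> - \<tau>) - x' \<tau> k) \<longlongrightarrow> 0) (at \<tau> within {0..})" for k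
  using assms[OF \<tau>] unfolding has_vector_derivative_iff_slope by (rule LIM_zero)
 hence "\<forall>\<^sub>F \<sigma> in at \<tau> within {0..}. \<forall>t. \<bar>re_trig N (?d (?q \<sigma>)) t\<bar> <= e"
  using e by (rule eventually_re_trig_derivs_small)
 moreover have "re_trig N (?d (?q \<sigma>)) t =
  (re_trig N (?d (x \<sigma>)) t - re_trig N (?d (x \<tau>)) t) / (\<sigma> - \<tau>) - re_trig N (?d (x' \<tau>)) t" for \<sigma> t
 proof -
  have "?d (?q \<sigma>) = (%k. inverse (\<sigma> - \<tau>) *\<^sub>R (?d (x \<sigma>) k - ?d (x \<tau>) k) - ?d (x' \<tau>) k)"
   by (simp add: right_diff_distrib)
  thus ?thesis by (simp only: re_trig_diff re_trig_scaleR divide_inverse mult.commute)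
 qed
 ultimately show "\<forall>\<^sub>F \<sigma> in at \<tau> within {0..}. \<forall>t. \<bar>(re_trig N (?d (x \<sigma>)) t - re_trig N (?d (x \<tau>)) t) / (\<sigma> - \<tau>) - re_trig N (?d (x' \<tau>)) t\<bar> <= e"
  by simp
qed

lemma curve_cont_re_trig:
 assumes "!!k. continuous_on {0..} (%\<tau>. x \<tau> k)"
 shows "curve_cont (%\<tau>. re_trig N (x \<tau>))"
 unfolding curve_cont_def re_trig_derivs
proof (intro allI impI)
 fix j :: nat and \<tau> e :: real assume \<tau>: "\<tau> >= 0" and e: "e > 0"
 have "((%\<sigma>. x \<sigma> k - x \<tau> k) \<longlongrightarrow> 0) (at \<tau> within {0..})" for k
  using assms[of k] \<tau> by (simp add: continuous_on_def LIM_zero_iff)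
 hence "\<forall>\<^sub>F \<sigma> in at \<tau> within {0..}. \<forall>t. \<bar>re_trig N (%k. (\<i> * of_int k) ^ j * (x \<sigma> k - x \<tau> k)) t\<bar> <= e"
  using e by (rule eventually_re_trig_derivs_small)
 thus "\<forall>\<^sub>F \<sigma> in at \<tau> within {0..}. \<forall>t. \<bar>re_trig N (%k. (\<i> * of_int k) ^ j * x \<sigma> k) t - re_trig N (%k. (\<i> * of_int k) ^ j * x \<tau> k) t\<bar> <= e"
  by (simp add: right_diff_distrib re_trig_diff)
qed

definition flow_solution_on :: "real set => nat => (real => cseq) => bool" where
 "flow_solution_on S N x \<longleftrightarrow> (\<forall>\<tau>\<in>S. hermitian_band N (x \<tau>) \<and> (\<forall>k. ((%\<tau>. x \<tau> k) has_vd flow_coef N (x \<tau>) k) (at \<tau> within S)))"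

lemma flow_solution_onD:
 assumes "flow_solution_on S N x" "\<tau> \<in> S"
 shows "hermitian_band N (x \<tau>)" "((%\<tau>. x \<tau> k) has_vd flow_coef N (x \<tau>) k) (at \<tau> within S)"
 using assms by (auto simp: flow_solution_on_def)

lemma flow_solution_on_subset: "flow_solution_on S N x ==> T \<subseteq> S ==> flow_solution_on T N x"
 unfolding flow_solution_on_def by (meson has_vector_derivative_within_subset subsetD)

text \<open>Differentiating along the flow preserves the polynomials in the coefficients, so solutions are smooth in time.\<close>

inductive coef_polynomial :: "(real => cseq) => (real => complex) => bool" for x where
 coef: "coef_polynomial x (%\<tau>. x \<tau> k)"
| const: "coef_polynomial x (%\<tau>. c)"
| add: "coef_polynomial x f ==> coef_polynomial x g ==> coef_polynomial x (%\<tau>. f \<tau> + g \<tau>)"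
| mult: "coef_polynomial x f ==> coef_polynomial x g ==> coef_polynomial x (%\<tau>. f \<tau> * g \<tau>)"

lemma coef_polynomial_flow_coef: "coef_polynomial x (%\<tau>. flow_coef N (x \<tau>) n)"
proof -
 have "coef_polynomial x (%\<tau>. \<Sum>j\<in>J. h j * (x \<tau> j * x \<tau> (n - j)))" if "finite J" for J and h :: cseq
  using that
 proof (induction J rule: finite_induct)
  case empty
  show ?case unfolding sum.empty by (rule coef_polynomial.const)
 next
  case (insert j J)
  thus ?case by (simp, intro coef_polynomial.add coef_polynomial.mult coef_polynomial.const coef_polynomial.coef)
 qed
 thus ?thesis by (simp add: flow_coef_def)
qed

lemma coef_polynomial_deriv:
 assumes x: "flow_solution_on {0..} N x" and f: "coef_polynomial x f"
 shows "\<exists>f'. coef_polynomial x f' \<and> (\<forall>\<tau>\<ge>0. (f has_vd f' \<tau>) (at \<tau> within {0..}))"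
 using f
proof induction
 case (coef k)
 show ?case using coef_polynomial_flow_coef flow_solution_onD(2)[OF x] by (metis atLeast_iff)
next
 case (const c)
 show ?case using coef_polynomial.const has_vector_derivative_const by blast
next
 case (add f g)
 then obtain f' g' where "coef_polynomial x f'" "coef_polynomial x g'"
  "\<forall>\<tau>\<ge>0. (f has_vd f' \<tau>) (at \<tau> within {0..})" "\<forall>\<tau>\<ge>0. (g has_vd g' \<tau>) (at \<tau> within {0..})" by blast
 thus ?case by (intro exI[of _ "%\<tau>. f' \<tau> + g' \<tau>"]) (simp add: has_vector_derivative_add coef_polynomial.add)
next
 case (mult f g)
 then obtain f' g' where "coef_polynomial x f'" "coef_polynomial x g'"
  "\<forall>\<tau>\<ge>0. (f has_vd f' \<tau>) (at \<tau> within {0..})" "\<forall>\<tau>\<ge>0. (g has_vd g' \<tau>) (at \<tau> within {0..})" by blast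
 thus ?case using mult.hyps
  by (intro exI[of _ "%\<tau>. f \<tau> * g' \<tau> + f' \<tau> * g \<tau>"]) (simp add: has_vector_derivative_mult coef_polynomial.add coef_polynomial.mult)
qed

lemma smooth_curve_re_trig:
 assumes x: "flow_solution_on {0..} N x"
 shows "smooth_curve (%\<tau>. re_trig N (x \<tau>))"
proof -
 obtain D where D: "!!f. coef_polynomial x f ==> coef_polynomial x (D f)"
  "!!f \<tau>. coef_polynomial x f ==> \<tau> >= 0 ==> (f has_vd D f \<tau>) (at \<tau> within {0..})"
  using coef_polynomial_deriv[OF x] by metis
 define X where "X n \<tau> k = (D ^^ n) (%\<tau>. x \<tau> k) \<tau>" for n \<tau> k
 have "coef_polynomial x ((D ^^ n) (%\<tau>. x \<tau> k))" for n k
  by (induction n) (auto intro: D(1) coef_polynomial.coef)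
 hence deriv: "((%\<tau>. X n \<tau> k) has_vd X (Suc n) \<tau> k) (at \<tau> within {0..})" if "\<tau> >= 0" for n \<tau> k
  using D(2) that unfolding X_def by simp
 hence "continuous_on {0..} (%\<tau>. X n \<tau> k)" for n k
  by (rule continuous_on_vector_derivative) simp
 thus ?thesis unfolding smooth_curve_def
  by (intro exI[of _ "%n \<tau>. re_trig N (X n \<tau>)"] conjI allI impI circ_smooth_re_trig curve_cont_re_trig curve_deriv_re_trig deriv)
   (simp_all add: X_def[abs_def])
qed

section \<open>The flow equation\<close>

lemma trig_poly_cmult: "trig_poly N (%k. z * c k) t = z * trig_poly N c t"
 by (simp add: trig_poly_def sum_distrib_left mult.assoc)

lemma trig_poly_eq_re_trig: assumes "!!k. cnj (c k) = c (- k)" shows "trig_poly N c t = of_real (re_trig N c t)"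
proof -
 have "cnj (trig_poly N c t) = (\<Sum>k\<in>freqs N. c (- k) * cis (- (of_int k * t)))" by (simp add: trig_poly_def assms cis_cnj)
 also have "... = trig_poly N c t" unfolding trig_poly_def by (rule sum.reindex_bij_witness[of _ uminus uminus]) auto
 finally show ?thesis unfolding re_trig_def by (metis Reals_cnj_iff of_real_Re)
qed

lemma flow_coef_cnj: "flow_coef N (%k. cnj (a (- k))) n = cnj (flow_coef N a (- n))"
 unfolding flow_coef_def cnj_sum
 by (rule sum.reindex_bij_witness[of _ uminus uminus]) (auto simp: algebra_simps)

context hermitian_band
begin

lemma flow_coef_hermitian: "cnj (flow_coef N a k) = flow_coef N a (- k)"
 using flow_coef_cnj[of N a "- k"] hermitian[of "- k" for k] by simp

lemma trig_poly_flow_coef: "trig_poly N (flow_coef N a) t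
  = trig_poly N (%j. of_int (sgn j) * a j) t * trig_poly N (%k. of_int k * a k) t - trig_poly N a t * trig_poly N (%j. of_int \<bar>j\<bar> * a j) t"
proof -
 let ?I = "freqs N" and ?e = "%k. cis (of_int k * t)"
 let ?S = "%j. \<Sum>n\<in>{- 2 * int N..2 * int N}. of_int ((n - 2 * j) * sgn j) * (a j * a (n - j)) * ?e n"
 have "trig_poly N (flow_coef N a) t = (\<Sum>n\<in>{- 2 * int N..2 * int N}. flow_coef N a n * ?e n)"
  unfolding trig_poly_def by (rule sum.mono_neutral_left) (auto simp: flow_coef_eq_0)
 also have "... = (\<Sum>j\<in>?I. \<Sum>n\<in>{- 2 * int N..2 * int N}. of_int ((n - 2 * j) * sgn j) * (a j * a (n - j)) * ?e n)"
  unfolding flow_coef_def sum_distrib_right by (rule sum.swap)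
 also have "... = (\<Sum>j\<in>?I. \<Sum>k\<in>?I. of_int (sgn j) * a j * ?e j * (of_int k * a k * ?e k) - a k * ?e k * (of_int \<bar>j\<bar> * a j * ?e j))"
 proof (rule sum.cong[OF refl])
  fix j assume j: "j \<in> ?I"
  have "(?S j) = (\<Sum>n\<in>window N j. of_int ((n - 2 * j) * sgn j) * (a j * a (n - j)) * ?e n)"
   using j by (intro sum.mono_neutral_right) (auto simp: band)
  also have "... = (\<Sum>k\<in>?I. of_int ((k - j) * sgn j) * (a j * a k) * (?e j * ?e k))"
   by (rule sum.reindex_bij_witness[of _ "%k. k + j" "%n. n - j"]) (auto simp: cis_mult algebra_simps)
  also have "... = (\<Sum>k\<in>?I. of_int (sgn j) * a j * ?e j * (of_int k * a k * ?e k) - a k * ?e k * (of_int \<bar>j\<bar> * a j * ?e j))"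
  proof (intro sum.cong refl)
   fix k
   have "complex_of_int ((k - j) * sgn j) = of_int (sgn j) * of_int k - of_int \<bar>j\<bar>"
    unfolding abs_sgn[of j] by (simp add: algebra_simps)
   thus "of_int ((k - j) * sgn j) * (a j * a k) * (?e j * ?e k)
     = of_int (sgn j) * a j * ?e j * (of_int k * a k * ?e k) - a k * ?e k * (of_int \<bar>j\<bar> * a j * ?e j)"
    by (simp only:) (simp add: algebra_simps del: of_int_abs)
  qed
  finally show "(?S j) = ..." .
 qed
 also have "... = trig_poly N (%j. of_int (sgn j) * a j) t * trig_poly N (%k. of_int k * a k) t
   - trig_poly N a t * trig_poly N (%j. of_int \<bar>j\<bar> * a j) t"
  unfolding trig_poly_def sum_subtractf sum_product by (intro arg_cong2[where f="(-)"] refl) (rule sum.swap)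
 finally show ?thesis .
qed

lemma flow_equation_rhs:
 assumes f: "!!t. complex_of_real (f t) = trig_poly N a t"
 shows "- cx f t * Lam (cx f) t + Hil (cx f) t * Dop (cx f) t = trig_poly N (flow_coef N a) t"
proof -
 have f: "cx f = trig_poly N a" by (rule ext) (simp add: cx_def f)
 have fourier: "fourier (trig_poly N a) k = a k" for k by (simp add: fourier_trig_poly band)
 have "Lam (cx f) t = trig_poly N (%j. of_int \<bar>j\<bar> * a j) t"
  unfolding f Lam_eq_trig_series fourier by (rule trig_series_finite) (simp add: band)
 moreover have "Hil (cx f) t = trig_poly N (%j. of_int (sgn j) * a j) t"
  unfolding f Hil_def fourier exp_eq_cis trig_series_def[symmetric] by (rule trig_series_finite) (simp add: band)
 moreover have "Dop (cx f) t = trig_poly N (%k. of_int k * a k) t"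
  unfolding f Dop_def vector_derivative_at[OF has_vector_derivative_trig_poly] mult.assoc trig_poly_cmult by (simp flip: mult.assoc)
 ultimately show ?thesis unfolding trig_poly_flow_coef by (simp add: f)
qed

definition conjugate where "conjugate = re_trig N (%j. - \<i> * (of_int (sgn j) * a j))"

lemma trig_poly_real: "trig_poly N a t = of_real (re_trig N a t)" by (rule trig_poly_eq_re_trig) (rule hermitian)

lemma re_trig_flow_coef: "re_trig N (flow_coef N a) t
  = conjugate t * re_trig N (%k. \<i> * of_int k * a k) t - re_trig N a t * re_trig N (%j. of_int \<bar>j\<bar> * a j) t"
proof -
 have "trig_poly N (%j. - \<i> * (of_int (sgn j) * a j)) t = of_real (conjugate t)"
  unfolding conjugate_def by (rule trig_poly_eq_re_trig) (simp add: hermitian)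
 hence sgn: "trig_poly N (%j. of_int (sgn j) * a j) t = \<i> * of_real (conjugate t)"
  unfolding trig_poly_cmult by (simp add: complex_eq_iff)
 have "trig_poly N (%k. \<i> * of_int k * a k) t = of_real (re_trig N (%k. \<i> * of_int k * a k) t)"
  by (rule trig_poly_eq_re_trig) (simp add: hermitian)
 hence deriv: "trig_poly N (%k. of_int k * a k) t = - \<i> * of_real (re_trig N (%k. \<i> * of_int k * a k) t)"
  unfolding mult.assoc trig_poly_cmult by (simp add: complex_eq_iff)
 have "trig_poly N (%j. of_int \<bar>j\<bar> * a j) t = of_real (re_trig N (%j. of_int \<bar>j\<bar> * a j) t)"
  by (rule trig_poly_eq_re_trig) (simp add: hermitian)
 thus ?thesis unfolding re_trig_def[of N "flow_coef N a"] trig_poly_flow_coef sgn deriv trig_poly_real by simp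
qed

lemma conjugate_deriv: "(conjugate has_real_derivative re_trig N (%j. of_int \<bar>j\<bar> * a j) t) (at t within S)"
proof -
 have "\<i> * of_int k * (- \<i> * (of_int (sgn k) * a k)) = of_int (k * sgn k) * a k" for k by (simp add: algebra_simps)
 hence "\<i> * of_int k * (- \<i> * (of_int (sgn k) * a k)) = of_int \<bar>k\<bar> * a k" for k by (simp only: abs_sgn)
 thus ?thesis unfolding conjugate_def using re_trig_deriv[of N "%j. - \<i> * (of_int (sgn j) * a j)" t S] by simp
qed

lemma norm_coef_le_coef_0: assumes "!!t. re_trig N a t > 0" shows "cmod (a n) <= Re (a 0)"
proof -
 have a: "a n = integral {0..2*pi} (%t. of_real (re_trig N a t) * cis (- (of_int n * t))) / of_real (2 * pi)" for n
  unfolding trig_poly_real[symmetric] fourier_cis[symmetric] by (simp add: fourier_trig_poly band)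
 have integrable: "re_trig N a integrable_on {0..2*pi}" by (intro integrable_continuous_real continuous_on_re_trig)
 have "cmod (integral {0..2*pi} (%t. of_real (re_trig N a t) * cis (- (of_int n * t)))) <= integral {0..2*pi} (re_trig N a)"
  by (rule integral_norm_bound_integral) (auto intro!: integrable_continuous_real
    continuous_intros continuous_on_re_trig integrable simp: norm_mult assms less_imp_le)
 moreover have "Re (a 0) = integral {0..2*pi} (re_trig N a) / (2 * pi)"
  using a[of 0] integral_linear[OF integrable bounded_linear_of_real[where 'a=complex]] by (simp add: o_def)
 ultimately show ?thesis by (subst a[of n]) (simp add: norm_divide divide_right_mono)
qed

lemma Re_flow_coef_0_nonpos: "Re (flow_coef N a 0) <= 0"
proof -
 have "Re (of_int ((0 - 2 * j) * sgn j) * (a j * a (0 - j))) = - 2 * of_int \<bar>j\<bar> * (cmod (a j))\<^sup>2" for j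
 proof -
  have "a j * a (0 - j) = of_real ((cmod (a j))\<^sup>2)" using complex_norm_square[of "a j"] hermitian[of j] by simp
  thus ?thesis by (simp add: abs_sgn)
 qed
 thus ?thesis unfolding flow_coef_def Re_sum by (intro sum_nonpos) (simp add: mult_nonpos_nonneg)
qed

lemma re_trig_flow_coef_at_min:
 assumes "!!s. re_trig N a t <= re_trig N a s"
 shows "re_trig N (flow_coef N a) t = - re_trig N a t * re_trig N (%j. of_int \<bar>j\<bar> * a j) t"
proof -
 have "re_trig N (%k. \<i> * of_int k * a k) t = 0"
  by (rule DERIV_local_min[OF re_trig_deriv zero_less_one]) (use assms in simp)
 thus ?thesis unfolding re_trig_flow_coef by simp
qed

end

section \<open>Positivity and global existence\<close>

lemma first_touching_time:
 fixes g :: "real => real => real"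
 assumes K: "compact K" and cont: "continuous_on ({0..S} \<times> K) (%p. g (fst p) (snd p))"
  and initial: "!!t. t \<in> K ==> g 0 t > \<delta>" and touch: "\<sigma> \<in> {0..S}" "s \<in> K" "g \<sigma> s <= \<delta>"
 obtains \<tau> t where "0 < \<tau>" "\<tau> <= S" "t \<in> K" "g \<tau> t = \<delta>" "!!s. s \<in> K ==> g \<tau> s >= \<delta>"
  "!!\<sigma>. 0 <= \<sigma> ==> \<sigma> < \<tau> ==> g \<sigma> t > \<delta>"
proof -
 define Z where "Z = {p \<in> {0..S} \<times> K. g (fst p) (snd p) <= \<delta>}"
 have "closed Z" unfolding Z_def
  by (intro continuous_on_closed_Collect_le closed_Times cont continuous_intros closed_atLeastAtMost compact_imp_closed K)
 hence "compact (({0..S} \<times> K) \<inter> Z)" by (intro compact_Int_closed compact_Times compact_Icc K)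
 moreover have "({0..S} \<times> K) \<inter> Z = Z" by (auto simp: Z_def)
 ultimately have "compact Z" by simp
 moreover have "(\<sigma>, s) \<in> Z" using touch by (simp add: Z_def)
 ultimately obtain p where p: "p \<in> Z" "!!q. q \<in> Z ==> fst p <= fst q"
  using continuous_attains_inf[of Z fst, OF _ _ continuous_on_fst[OF continuous_on_id]] by blast
 obtain \<tau> t where pt: "p = (\<tau>, t)" by force
 have \<tau>: "\<tau> \<in> {0..S}" and t: "t \<in> K" and le: "g \<tau> t <= \<delta>" using p(1) by (auto simp: Z_def pt)
 have before: "g \<sigma> s > \<delta>" if "0 <= \<sigma>" "\<sigma> < \<tau>" "s \<in> K" for \<sigma> s
  using p(2)[of "(\<sigma>, s)"] that \<tau> by (force simp: pt Z_def not_less)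
 have "\<tau> \<noteq> 0" using le initial[OF t] by auto
 hence \<tau>0: "\<tau> > 0" using \<tau> by auto
 have ge: "g \<tau> s >= \<delta>" if s: "s \<in> K" for s
 proof (rule continuous_ge_on_closure[where S="{0..<\<tau>}" and f="%\<sigma>. g \<sigma> s"])
  have "continuous_on {0..S} (%\<sigma>. g \<sigma> s)"
   using continuous_on_compose2[OF cont continuous_on_Pair[OF continuous_on_id[of "{0..S}"] continuous_on_const[of _ s]]] s by auto
  thus "continuous_on (closure {0..<\<tau>}) (%\<sigma>. g \<sigma> s)" using \<tau>0 \<tau> by (simp add: continuous_on_subset)
 qed (use \<tau>0 before s in \<open>auto simp: less_imp_le\<close>)
 show thesis using that[OF \<tau>0 _ t _ ge before[OF _ _ t]] \<tau> le ge[OF t] by auto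
qed

lemma continuous_on_flow_solution: "flow_solution_on S N x ==> continuous_on S (%\<tau>. x \<tau> k)"
 by (rule continuous_on_vector_derivative[OF flow_solution_onD(2)])

lemma Re_coef_0_nonincreasing:
 assumes x: "flow_solution_on {0..S} N x" and S: "S >= 0"
 shows "Re (x S 0) <= Re (x 0 0)"
proof (rule nonincreasing_if_deriv_nonpos[OF _ _ S])
 fix s assume s: "s \<in> {0..S}"
 show "((%s. Re (x s 0)) has_real_derivative Re (flow_coef N (x s) 0)) (at s within {0..S})"
  unfolding has_real_derivative_iff_has_vector_derivative
  by (rule bounded_linear.has_vector_derivative[OF bounded_linear_Re flow_solution_onD(2)[OF x s]])
 show "Re (flow_coef N (x s) 0) <= 0" by (rule hermitian_band.Re_flow_coef_0_nonpos[OF flow_solution_onD(1)[OF x s]])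
qed

text \<open>At a minimum of \<open>re_trig N (x \<tau>)\<close> the transport term vanishes, so \<open>exp (K \<tau>)\<close> times the minimum cannot decrease for large \<open>K\<close>.\<close>

lemma flow_positive:
 assumes S: "S >= 0" and x: "flow_solution_on {0..S} N x" and B: "!!\<tau> k. \<tau> \<in> {0..S} ==> cmod (x \<tau> k) <= B"
  and pos: "!!t. re_trig N (x 0) t > 0"
 shows "re_trig N (x S) t > 0"
proof -
 define K where "K = (\<Sum>j\<in>freqs N. \<bar>of_int j\<bar> * B) + 1"
 define g where "g \<tau> t = exp (K * \<tau>) * re_trig N (x \<tau>) t" for \<tau> t
 obtain t0 where t0: "!!t. t \<in> {0..2*pi} ==> re_trig N (x 0) t0 <= re_trig N (x 0) t"
  using continuous_attains_inf[of "{0..2*pi}" "re_trig N (x 0)", OF compact_Icc _ continuous_on_re_trig] by force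
 define \<delta> where "\<delta> = re_trig N (x 0) t0 / 2"
 have \<delta>: "\<delta> > 0" using pos by (simp add: \<delta>_def)
 have initial: "g 0 t > \<delta>" if "t \<in> {0..2*pi}" for t using t0[OF that] pos[of t0] by (simp add: g_def \<delta>_def)
 have cont: "continuous_on ({0..S} \<times> {0..2*pi}) (%p. g (fst p) (snd p))"
  unfolding g_def by (intro continuous_intros continuous_on_re_trig_joint continuous_on_flow_solution[OF x])
 have "g S s > \<delta>" if s: "s \<in> {0..2*pi}" for s
 proof (rule ccontr)
  assume "\<not> g S s > \<delta>"
  then obtain \<tau> t where touch: "0 < \<tau>" "\<tau> <= S" "t \<in> {0..2*pi}" "g \<tau> t = \<delta>" "!!s. s \<in> {0..2*pi} ==> g \<tau> s >= \<delta>"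
    "!!\<sigma>. 0 <= \<sigma> ==> \<sigma> < \<tau> ==> g \<sigma> t > \<delta>"
   using first_touching_time[where \<sigma>=S and s=s, OF compact_Icc cont initial] S s by (metis atLeastAtMost_iff linorder_not_less order_refl)
  have \<tau>: "\<tau> \<in> {0..S}" using touch by simp
  interpret hermitian_band N "x \<tau>" by (rule flow_solution_onD(1)[OF x \<tau>])
  have minimum: "re_trig N (x \<tau>) t <= re_trig N (x \<tau>) s" for s
   by (rule re_trig_translate_into_period[of N s]) (use touch(4,5) in \<open>force simp: g_def\<close>)
  have positive: "re_trig N (x \<tau>) t > 0" using \<delta> touch(4) unfolding g_def by (metis exp_gt_zero zero_less_mult_pos)
  have "re_trig N (%j. of_int \<bar>j\<bar> * x \<tau> j) t <= (\<Sum>j\<in>freqs N. cmod (of_int \<bar>j\<bar> * x \<tau> j))" using abs_re_trig_le abs_le_D1 by blast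
  also have "... <= (\<Sum>j\<in>freqs N. \<bar>of_int j\<bar> * B)" by (intro sum_mono) (simp add: norm_mult mult_left_mono B[OF \<tau>])
  finally have "re_trig N (%j. of_int \<bar>j\<bar> * x \<tau> j) t < K" by (simp add: K_def)
  hence "exp (K * \<tau>) * K * re_trig N (x \<tau>) t + re_trig N (flow_coef N (x \<tau>)) t * exp (K * \<tau>) > 0"
   unfolding re_trig_flow_coef_at_min[OF minimum] using positive by (simp add: algebra_simps flip: distrib_left)
  moreover have "((%\<sigma>. g \<sigma> t) has_real_derivative exp (K * \<tau>) * K * re_trig N (x \<tau>) t
    + re_trig N (flow_coef N (x \<tau>)) t * exp (K * \<tau>)) (at \<tau> within {0..S})"
   unfolding g_def by (intro DERIV_mult re_trig_curve_deriv flow_solution_onD(2)[OF x \<tau>]) (auto intro!: derivative_eq_intros)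
  ultimately obtain d where d: "d > 0" "!!h. h > 0 ==> \<tau> - h \<in> {0..S} ==> h < d ==> g (\<tau> - h) t < g \<tau> t"
   using has_real_derivative_pos_inc_left by blast
  define h where "h = min d \<tau> / 2"
  have "0 < h" "h < d" "h < \<tau>" using d(1) touch(1) by (auto simp: h_def)
  thus False using d(2)[of h] touch(6)[of "\<tau> - h"] touch(2,4) by auto
 qed
 moreover obtain s where "s \<in> {0..2*pi}" "re_trig N (x S) s = re_trig N (x S) t" using re_trig_translate_into_period by metis
 ultimately have "exp (K * S) * re_trig N (x S) t > 0" using \<delta> unfolding g_def by (metis less_trans)
 thus ?thesis by (simp add: zero_less_mult_iff)
qed

abbreviation box_clamp :: "real => complex => complex" where "box_clamp B \<equiv> clamp (Complex (- B) (- B)) (Complex B B)"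

definition truncate_coef :: "nat => real => cseq => cseq" where
 "truncate_coef N B x k = (if \<bar>k\<bar> <= int N then box_clamp B (x k) else 0)"

lemma norm_box_clamp_le: assumes "B >= 0" shows "cmod (box_clamp B z) <= 2 * B"
proof -
 have "box_clamp B z \<in> cbox (Complex (- B) (- B)) (Complex B B)"
  by (rule clamp_in_interval) (use assms in \<open>auto simp: Basis_complex_def inner_complex_def\<close>)
 thus ?thesis using cmod_le[of "box_clamp B z"] by (auto simp: in_cbox_complex_iff)
qed

lemma box_clamp_eq: "cmod z <= B ==> box_clamp B z = z"
 using abs_Re_le_cmod[of z] abs_Im_le_cmod[of z] by (intro clamp_cancel_cbox) (auto simp: in_cbox_complex_iff)

lemma box_clamp_cnj: "B >= 0 ==> box_clamp B (cnj z) = cnj (box_clamp B z)"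
 by (auto simp: clamp_def Basis_complex_def inner_complex_def complex_eq_iff)

lemma truncate_coef_eq: assumes "hermitian_band N x" "!!k. cmod (x k) <= B" shows "truncate_coef N B x = x"
 by (rule ext) (auto simp: truncate_coef_def box_clamp_eq assms(2) hermitian_band.band[OF assms(1)])

lemma norm_truncate_coef_le: "B >= 0 ==> cmod (truncate_coef N B x k) <= 2 * B"
 by (simp add: truncate_coef_def norm_box_clamp_le)

lemma norm_truncate_coef_diff_le: "cmod (truncate_coef N B x k - truncate_coef N B y k) <= (\<Sum>k\<in>freqs N. cmod (x k - y k))"
proof (cases "\<bar>k\<bar> <= int N")
 case True
 hence "cmod (x k - y k) <= (\<Sum>k\<in>freqs N. cmod (x k - y k))" by (intro member_le_sum[of k _ "%k. cmod (x k - y k)"]) auto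
 thus ?thesis using dist_clamps_le_dist_args[of "Complex (- B) (- B)" "Complex B B" "x k" "y k"] True
  by (simp add: truncate_coef_def dist_norm)
qed (simp add: truncate_coef_def sum_nonneg)

lemma norm_mult_diff_le:
 fixes u u' v v' :: complex
 assumes "cmod u <= B" "cmod v' <= B" "cmod (u - u') <= s" "cmod (v - v') <= s"
 shows "cmod (u * v - u' * v') <= 2 * B * s"
proof -
 have "u * v - u' * v' = u * (v - v') + (u - u') * v'" by (simp add: algebra_simps)
 also have "cmod ... <= B * s + s * B"
  using assms by (intro norm_triangle_le add_mono) (auto simp: norm_mult intro!: mult_mono intro: order_trans[OF norm_ge_zero])
 finally show ?thesis by simp
qed

lemma lipschitz_truncated_flow:
 assumes B: "B >= 0"
 shows "lipschitz_system (%x. flow_coef N (truncate_coef N B x)) (freqs N) (real (card (freqs N)) * (3 * real N * (4 * B)))"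
proof
 let ?I = "freqs N"
 fix x y :: cseq and n assume n: "n \<in> ?I"
 define s where "s = (\<Sum>k\<in>?I. cmod (x k - y k))"
 let ?a = "truncate_coef N B x" and ?b = "truncate_coef N B y"
 have "cmod (flow_coef N ?a n - flow_coef N ?b n) <= (\<Sum>j\<in>?I. 3 * real N * (4 * B * s))"
  unfolding flow_coef_def sum_subtractf[symmetric] right_diff_distrib[symmetric]
 proof (rule sum_norm_le)
  fix j assume j: "j \<in> ?I"
  have "\<bar>(n - 2 * j) * sgn j\<bar> <= 3 * int N" using n j by (auto simp: abs_mult sgn_if)
  hence "cmod (of_int ((n - 2 * j) * sgn j)) <= 3 * real N"
   unfolding norm_of_int of_int_abs[symmetric] by linarith
  moreover have "cmod (?a j * ?a (n - j) - ?b j * ?b (n - j)) <= 2 * (2 * B) * s"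
   unfolding s_def by (intro norm_mult_diff_le norm_truncate_coef_le norm_truncate_coef_diff_le B)
  ultimately show "cmod (of_int ((n - 2 * j) * sgn j) * (?a j * ?a (n - j) - ?b j * ?b (n - j))) <= 3 * real N * (4 * B * s)"
   unfolding norm_mult[of "of_int ((n - 2 * j) * sgn j)"] by (intro mult_mono) auto
 qed
 thus "cmod (flow_coef N ?a n - flow_coef N ?b n) <= real (card ?I) * (3 * real N * (4 * B)) * (\<Sum>k\<in>?I. cmod (x k - y k))"
  unfolding s_def[symmetric] by (simp only: sum_constant mult_ac)
qed (use B in auto)

locale truncated_flow =
 fixes N :: nat and a :: cseq and B :: real and x :: "real => cseq"
 assumes a_hermitian: "hermitian_band N a" and a_pos: "!!t. re_trig N a t > 0" and B_eq: "B = Re (a 0) + 1"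
  and x_0: "x 0 = a" and x_outside: "!!n t. n \<notin> freqs N ==> x t n = a n"
  and x_deriv: "!!n t. n \<in> freqs N ==> t >= 0 ==> ((%t. x t n) has_vd flow_coef N (truncate_coef N B (x t)) n) (at t within {0..})"
begin

lemma norm_a_less: "cmod (a n) < B"
 using hermitian_band.norm_coef_le_coef_0[OF a_hermitian a_pos, of n] by (simp add: B_eq)

lemma B_nonneg: "B >= 0" using norm_a_less[of 0] norm_ge_zero[of "a 0"] by linarith

lemma x_eq_0: assumes "\<bar>n\<bar> > int N" shows "x t n = 0"
proof -
 have "n \<notin> freqs N" using assms by auto
 thus ?thesis using x_outside hermitian_band.band[OF a_hermitian assms] by simp
qed

lemma cnj_x: assumes t: "t >= 0" shows "cnj (x t k) = x t (- k)"
proof (cases "k \<in> freqs N")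
 case True
 have reflect: "truncate_coef N B (%k. cnj (x s (- k))) = (%k. cnj (truncate_coef N B (x s) (- k)))" for s
  by (rule ext) (simp add: truncate_coef_def box_clamp_cnj[OF B_nonneg])
 have "(%k. cnj (x t (- k))) (- k) = x t (- k)"
 proof (rule lipschitz_system.solution_unique[OF lipschitz_truncated_flow[OF B_nonneg], where x="%t k. cnj (x t (- k))" and y=x and S=t])
  fix n s assume n: "n \<in> freqs N" and s: "s \<in> {0..t}"
  show deriv: "((%t. x t n) has_vd flow_coef N (truncate_coef N B (x s)) n) (at s within {0..t})" if "n \<in> freqs N" for n
   by (rule has_vector_derivative_within_subset[OF x_deriv[OF that]]) (use s in auto)
  have "((%t. cnj (x t (- n))) has_vd cnj (flow_coef N (truncate_coef N B (x s)) (- n))) (at s within {0..t})"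
   by (rule bounded_linear.has_vector_derivative[OF bounded_linear_cnj deriv]) (use n in auto)
  thus "((%t. cnj (x t (- n))) has_vd flow_coef N (truncate_coef N B (%k. cnj (x s (- k)))) n) (at s within {0..t})"
   unfolding reflect flow_coef_cnj .
 qed (use True t x_0 hermitian_band.hermitian[OF a_hermitian] in auto)
 thus ?thesis by simp
next
 case False
 hence "\<bar>k\<bar> > int N" by auto
 thus ?thesis by (simp add: x_eq_0)
qed

lemma hermitian_x: "t >= 0 ==> hermitian_band N (x t)"
 by unfold_locales (simp_all add: x_eq_0 cnj_x)

lemma continuous_on_x: "continuous_on {0..} (%t. x t n)"
proof (cases "n \<in> freqs N")
 case True
 show ?thesis by (rule continuous_on_vector_derivative[OF x_deriv[OF True]]) simp
qed (simp add: x_outside)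

lemma flow_solution_if_bounded:
 assumes S: "S \<subseteq> {0..}" and bound: "!!s n. s \<in> S ==> cmod (x s n) <= B"
 shows "flow_solution_on S N x"
 unfolding flow_solution_on_def
proof (intro ballI conjI allI)
 fix s k assume s: "s \<in> S"
 show hermitian: "hermitian_band N (x s)" using s S by (intro hermitian_x) auto
 have truncate: "truncate_coef N B (x s) = x s" by (rule truncate_coef_eq[OF hermitian bound[OF s]])
 show "((%t. x t k) has_vd flow_coef N (x s) k) (at s within S)"
 proof (cases "k \<in> freqs N")
  case True
  show ?thesis using x_deriv[OF True, of s] s S unfolding truncate by (meson atLeast_iff has_vector_derivative_within_subset subsetD)
 next
  case False
  hence "flow_coef N (x s) k = 0" by (intro hermitian_band.flow_coef_eq_0[OF hermitian]) auto
  thus ?thesis using False by (simp add: x_outside)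
 qed
qed

lemma bound_propagates:
 assumes t: "t >= 0" and before: "!!s n. 0 <= s ==> s < t ==> cmod (x s n) < B"
 shows "re_trig N (x t) s > 0" "cmod (x t n) < B"
proof -
 have bounded: "cmod (x s n) <= B" if s: "s \<in> {0..t}" for s n
 proof (cases "s < t \<or> t = 0")
  case True
  thus ?thesis using before[of s n] s norm_a_less[of n] x_0 by auto
 next
  case False
  show ?thesis
  proof (rule continuous_le_on_closure[where S="{0..<t}" and f="%s. cmod (x s n)"])
   show "continuous_on (closure {0..<t}) (%s. cmod (x s n))"
    using False t by (intro continuous_intros continuous_on_subset[OF continuous_on_x]) auto
  qed (use False s t before in \<open>auto simp: less_imp_le\<close>)
 qed
 have solution: "flow_solution_on {0..t} N x" by (rule flow_solution_if_bounded) (use bounded in auto)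
 show pos: "re_trig N (x t) s > 0" for s by (rule flow_positive[OF t solution bounded]) (auto simp: x_0 a_pos)
 have "cmod (x t n) <= Re (x t 0)" by (rule hermitian_band.norm_coef_le_coef_0[OF hermitian_x[OF t] pos])
 thus "cmod (x t n) < B" using Re_coef_0_nonincreasing[OF solution t] by (simp add: B_eq x_0)
qed

lemma norm_x_less: assumes t: "t >= 0" shows "cmod (x t n) < B"
proof (rule ccontr)
 assume n: "\<not> cmod (x t n) < B"
 define bad where "bad = (\<Union>k\<in>freqs N. {s \<in> {0..}. B <= cmod (x s k)})"
 have badI: "s \<in> bad" if "s >= 0" "\<not> cmod (x s k) < B" for s k
  using that x_eq_0[of k s] norm_a_less[of 0] norm_ge_zero[of "a 0"]
    unfolding bad_def by (cases "\<bar>k\<bar> <= int N") (auto simp: not_less intro!: bexI[of _ k])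
 have "closed bad" unfolding bad_def
  by (intro closed_UN ballI continuous_on_closed_Collect_le continuous_intros continuous_on_x) auto
 moreover have below: "bdd_below bad" by (intro bdd_belowI[of _ 0]) (auto simp: bad_def)
 ultimately have Inf: "Inf bad \<in> bad" using badI[OF t n] by (intro closed_contains_Inf) auto
 have before: "cmod (x s k) < B" if "0 <= s" "s < Inf bad" for s k
  using badI[OF that(1), of k] cInf_lower[OF _ below, of s] that(2) by force
 obtain k where k: "Inf bad >= 0" "B <= cmod (x (Inf bad) k)" using Inf unfolding bad_def by blast
 show False using bound_propagates(2)[OF k(1) before, of k] k(2) by simp
qed

lemma flow_solution: "flow_solution_on {0..} N x" and x_pos: "t >= 0 ==> re_trig N (x t) s > 0"
 using bound_propagates(1) norm_x_less by (auto intro!: flow_solution_if_bounded less_imp_le)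

end

theorem flow_exists:
 assumes a: "hermitian_band N a" and pos: "!!t. re_trig N a t > 0"
 obtains x where "x 0 = a" "flow_solution_on {0..} N x" "!!\<tau> t. \<tau> >= 0 ==> re_trig N (x \<tau>) t > 0"
proof -
 define B where "B = Re (a 0) + 1"
 have "cmod (a 0) <= Re (a 0)" by (rule hermitian_band.norm_coef_le_coef_0[OF a pos])
 hence B: "B >= 0" unfolding B_def using norm_ge_zero[of "a 0"] by linarith
 obtain x where x: "!!n. x 0 n = a n" "!!n t. n \<notin> freqs N ==> x t n = a n"
  "!!n t. n \<in> freqs N ==> t >= 0 ==> ((%t. x t n) has_vd flow_coef N (truncate_coef N B (x t)) n) (at t within {0..})"
  by (rule lipschitz_system.solution_exists[OF lipschitz_truncated_flow[OF B], of a]) blast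
 interpret truncated_flow N a B x by unfold_locales (use a pos x B_def in \<open>auto simp: hermitian_band_def\<close>)
 show thesis by (rule that[OF x_0 flow_solution x_pos])
qed

lemma flow_solution_bounded:
 assumes x: "flow_solution_on {0..S} N x"
 obtains C where "!!\<tau> k. \<tau> \<in> {0..S} ==> cmod (x \<tau> k) <= C"
proof -
 have "bounded ((%\<tau>. \<Sum>k\<in>freqs N. cmod (x \<tau> k)) ` {0..S})"
  by (intro compact_imp_bounded compact_continuous_image continuous_on_sum continuous_on_norm continuous_on_flow_solution[OF x] compact_Icc)
 then obtain C where C: "C > 0" "!!\<tau>. \<tau> \<in> {0..S} ==> norm (\<Sum>k\<in>freqs N. cmod (x \<tau> k)) <= C" unfolding bounded_pos by blast
 have "cmod (x \<tau> k) <= C" if \<tau>: "\<tau> \<in> {0..S}" for \<tau> k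
 proof (cases "\<bar>k\<bar> <= int N")
  case True
  hence "cmod (x \<tau> k) <= (\<Sum>k\<in>freqs N. cmod (x \<tau> k))" by (intro member_le_sum[of k _ "%k. cmod (x \<tau> k)"]) auto
  thus ?thesis using C(2)[OF \<tau>] by simp
 qed (use C(1) hermitian_band.band[OF flow_solution_onD(1)[OF x \<tau>], of k] in simp)
 thus thesis by (rule that)
qed

lemma flow_unique:
 assumes x: "flow_solution_on {0..} N x" and y: "flow_solution_on {0..} N y" and initial: "x 0 = y 0" and S: "S >= 0"
 shows "x S = y S"
proof
 fix n
 note sol = flow_solution_on_subset[OF x, of "{0..S}"] flow_solution_on_subset[OF y, of "{0..S}"]
 obtain C D where C: "!!\<tau> k. \<tau> \<in> {0..S} ==> cmod (x \<tau> k) <= C" and D: "!!\<tau> k. \<tau> \<in> {0..S} ==> cmod (y \<tau> k) <= D"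
  using flow_solution_bounded[OF sol(1)] flow_solution_bounded[OF sol(2)] by (metis atLeastAtMost_iff atLeast_iff subsetI)
 define B where "B = max C D"
 have B: "B >= 0" using C[of 0 0] S order_trans[OF norm_ge_zero, of "x 0 0" C] by (auto simp: B_def)
 have deriv: "((%\<tau>. z \<tau> k) has_vd flow_coef N (truncate_coef N B (z \<tau>)) k) (at \<tau> within {0..S})"
  if z: "flow_solution_on {0..S} N z" "\<tau> \<in> {0..S}" "!!k. cmod (z \<tau> k) <= B" for z \<tau> k
  unfolding truncate_coef_eq[OF flow_solution_onD(1)[OF z(1,2)] z(3)] by (rule flow_solution_onD(2)[OF z(1,2)])
 show "x S n = y S n"
 proof (cases "n \<in> freqs N")
  case True
  show ?thesis
   by (rule lipschitz_system.solution_unique[OF lipschitz_truncated_flow[OF B], where x=x and y=y, OF deriv deriv _ S True])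
     (use C D initial sol in \<open>auto simp: B_def le_max_iff_disj\<close>)
 next
  case False
  thus ?thesis using S hermitian_band.band[OF flow_solution_onD(1)[OF x]] hermitian_band.band[OF flow_solution_onD(1)[OF y]] by auto
 qed
qed

section \<open>Monotone traces along the flow\<close>

context hermitian_band
begin

lemma toeplitz_form_eq_fourier:
 "(\<Sum>l\<in>S. \<Sum>k\<in>S. cnj (z l) * z k * a (l - k)) = fourier (%t. of_real (re_trig N a t * (cmod (\<Sum>k\<in>S. z k * cis (of_int k * t)))\<^sup>2)) 0"
proof -
 let ?h = "%t. \<Sum>l\<in>S. \<Sum>k\<in>S. cnj (z l) * z k * (cis (of_int (k - l) * t) * trig_poly N a t)"
 have "(\<Sum>l\<in>S. \<Sum>k\<in>S. cnj (z l) * z k * a (l - k)) = (\<Sum>l\<in>S. \<Sum>k\<in>S. fourier (%t. cnj (z l) * z k * (cis (of_int (k - l) * t) * trig_poly N a t)) 0)"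
  unfolding fourier_cmult fourier_shift fourier_trig_poly by (intro sum.cong refl) (auto simp: band)
 also have "... = fourier (%t. (?h t)) 0"
  by (subst fourier_sum, (intro continuous_intros)[1], intro sum.cong refl, rule fourier_sum[symmetric], intro continuous_intros)
 also have "(%t. (?h t)) = (%t. of_real (re_trig N a t * (cmod (\<Sum>k\<in>S. z k * cis (of_int k * t)))\<^sup>2))"
 proof
  fix t
  let ?g = "\<Sum>k\<in>S. z k * cis (of_int k * t)"
  have "cis (of_int (k - l) * t) = cnj (cis (of_int l * t)) * cis (of_int k * t)" for k l
   by (simp add: cis_cnj cis_mult algebra_simps)
  hence "((?h t)) = (\<Sum>l\<in>S. \<Sum>k\<in>S. cnj (z l * cis (of_int l * t)) * (z k * cis (of_int k * t))) * trig_poly N a t"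
   by (simp add: sum_distrib_left sum_distrib_right mult_ac)
  also have "(\<Sum>l\<in>S. \<Sum>k\<in>S. cnj (z l * cis (of_int l * t)) * (z k * cis (of_int k * t))) = cnj ?g * ?g"
   unfolding cnj_sum sum_product ..
  also have "... = of_real ((cmod ?g)\<^sup>2)" using complex_norm_square[of ?g] by (simp add: mult.commute)
  finally show "((?h t)) = of_real (re_trig N a t * (cmod ?g)\<^sup>2)"
   by (simp add: trig_poly_real mult.commute)
 qed
 finally show ?thesis .
qed

lemma pos_semidef_toep:
 assumes pos: "!!t. re_trig N a t > 0"
 shows "pos_semidef toep"
 unfolding pos_semidef_def
proof (intro allI impI)
 fix S and y :: cseq assume S: "finite S" "\<forall>l. l \<notin> S \<longrightarrow> y l = 0"
 define z where "z k = sqrt_abs k * y k" for k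
 let ?h = "%t. re_trig N a t * (cmod (\<Sum>k\<in>S. z k * cis (of_int k * t)))\<^sup>2"
 have "toep y l = (\<Sum>k\<in>S. toep_entry a l k * y k)" for l
 proof -
  have "toep y l = (\<Sum>k\<in>window N l \<union> S. toep_entry a l k * y k)"
   unfolding toep_def by (rule band_op_eq_sum) (auto simp: toep_entry_def band S)
  also have "... = (\<Sum>k\<in>S. toep_entry a l k * y k)" by (rule sum.mono_neutral_right) (use S in auto)
  finally show ?thesis .
 qed
 hence form: "(\<Sum>l\<in>S. cnj (y l) * toep y l) = fourier (%t. of_real (?h t)) 0"
  unfolding toeplitz_form_eq_fourier[symmetric] by (simp add: z_def toep_entry_def sum_distrib_left mult_ac)
 have integrable: "?h integrable_on {0..2*pi}"
  by (intro integrable_continuous_real continuous_intros continuous_on_re_trig)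
 have "Re (fourier (%t. of_real (?h t)) 0) = integral {0..2*pi} ?h / (2 * pi)"
  using integral_linear[OF integrable bounded_linear_of_real[where 'a=complex]] by (simp add: fourier_cis o_def)
 also have "... >= 0" by (intro divide_nonneg_pos integral_nonneg integrable) (auto simp: pos less_imp_le)
 finally show "Re (\<Sum>l\<in>S. cnj (y l) * toep y l) >= 0" unfolding form .
qed

lemma sgn_op_lax_left: "sgn_op (lax_left f) = lax_right (sgn_op f)"
 by (rule ext) (simp add: sgn_op_def lax_left_def lax_right_def band_op_def sum_distrib_left mult_ac)

lemma trace_toep_power_cross:
 assumes i: "i < p" and R: "R >= int N + int (p * N)"
 shows "trace_on R (%f. (toep ^^ i) (%l. - 2 * cross ((toep ^^ (p - i)) f) l)) = - 2 * trace_on R (%f. cross ((toep ^^ p) f))"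
proof -
 have "int ((p - i) * N) <= int (p * N)" by (intro of_nat_mono mult_right_mono) auto
 hence "int N + int ((p - i) * N) <= R" using R by linarith
 hence supported: "supported_on R (%f. cross ((toep ^^ (p - i)) f))"
  by (rule supported_on_mono[OF supported_on_comp[OF supported_on_cross banded_ops(4) banded_power_ops(1)]])
 have "trace_on R (%f. cross ((toep ^^ (p - i)) ((toep ^^ i) f))) = trace_on R (%f. (toep ^^ i) (cross ((toep ^^ (p - i)) f)))"
  by (rule trace_on_cyclic[OF banded_comp[OF banded_ops(4) banded_power_ops(1)] supported banded_power_ops(1)])
 moreover have "(toep ^^ (p - i)) ((toep ^^ i) f) = (toep ^^ p) f" for f
  using i funpow_add[of "p - i" i toep] by (simp add: fun_eq_iff)
 ultimately show ?thesis unfolding trace_on_def banded_cmult[OF banded_power_ops(1)] by (simp add: sum_distrib_left[symmetric] sum_negf)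
qed

end

locale positive_flow =
 fixes N :: nat and x :: "real => cseq"
 assumes solution: "flow_solution_on {0..} N x"
  and pos: "!!\<tau> t. \<tau> >= 0 ==> re_trig N (x \<tau>) t > 0"
  and volume_0: "integral {0..2*pi} (%t. 1 / re_trig N (x 0) t) = 2 * pi"
begin

lemma hermitian: "\<tau> >= 0 ==> hermitian_band N (x \<tau>)"
 and x_deriv: "\<tau> >= 0 ==> ((%\<tau>. x \<tau> k) has_vd flow_coef N (x \<tau>) k) (at \<tau> within {0..})"
 using flow_solution_onD[OF solution] by auto

abbreviation toep_at where "toep_at \<tau> \<equiv> hermitian_band.toep N (x \<tau>)"
abbreviation sgn_toep_at where "sgn_toep_at \<tau> \<equiv> hermitian_band.sgn_toep N (x \<tau>)"
abbreviation lax_at where "lax_at \<tau> \<equiv> hermitian_band.lax_right N (x \<tau>)"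
abbreviation cross_at where "cross_at \<tau> \<equiv> hermitian_band.cross N (x \<tau>)"
abbreviation even_defect_at where "even_defect_at \<tau> \<equiv> hermitian_band.even_defect N (x \<tau>)"

lemma toep_deriv:
 assumes \<tau>: "\<tau> >= 0" and f: "!!l. ((%\<tau>. f \<tau> l) has_vd f' l) (at \<tau> within {0..})"
 shows "((%\<tau>. toep_at \<tau> (f \<tau>) l) has_vd toep_at \<tau> f' l + band_op N (toep_entry (flow_coef N (x \<tau>))) (f \<tau>) l) (at \<tau> within {0..})"
proof -
 let ?D = "\<Sum>k\<in>window N l. sqrt_abs l * sqrt_abs k * x \<tau> (l - k) * f' k + sqrt_abs l * sqrt_abs k * flow_coef N (x \<tau>) (l - k) * f \<tau> k"
 have toep: "toep_at \<sigma> g l = (\<Sum>k\<in>window N l. sqrt_abs l * sqrt_abs k * x \<sigma> (l - k) * g k)" if "\<sigma> >= 0" for \<sigma> g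
  unfolding hermitian_band.toep_def[OF hermitian[OF that]] band_op_def toep_entry_def by simp
 have "((%\<sigma>. \<Sum>k\<in>window N l. sqrt_abs l * sqrt_abs k * x \<sigma> (l - k) * f \<sigma> k) has_vd
  ?D) (at \<tau> within {0..})"
  by (intro has_vector_derivative_sum has_vector_derivative_mult has_vector_derivative_mult_right x_deriv f \<tau>)
 hence "((%\<sigma>. toep_at \<sigma> (f \<sigma>) l) has_vd
  ?D) (at \<tau> within {0..})"
  by (rule has_vector_derivative_transform[rotated 2]) (use \<tau> toep in auto)
 thus ?thesis unfolding toep[OF \<tau>] band_op_def toep_entry_def sum.distrib .
qed

lemma toep_power_deriv:
 assumes \<tau>: "\<tau> >= 0"
 shows "((%\<tau>. (toep_at \<tau> ^^ p) f l) has_vd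
  lax_at \<tau> ((toep_at \<tau> ^^ p) f) l - (toep_at \<tau> ^^ p) (lax_at \<tau> f) l +
    (\<Sum>i<p. (toep_at \<tau> ^^ i) (%l. - 2 * cross_at \<tau> ((toep_at \<tau> ^^ (p - i)) f) l) l)) (at \<tau> within {0..})"
proof (induction p arbitrary: l)
 case (Suc p)
 interpret h: hermitian_band N "x \<tau>" by (rule hermitian[OF \<tau>])
 let ?u = "(h.toep ^^ p) f" and ?G = "%i l. - 2 * h.cross ((h.toep ^^ (p - i)) f) l"
 let ?v = "%l. h.lax_right ?u l - (h.toep ^^ p) (h.lax_right f) l + (\<Sum>i<p. (h.toep ^^ i) (?G i) l)"
 have "((%\<tau>. toep_at \<tau> ((toep_at \<tau> ^^ p) f) l) has_vd
   h.toep ?v l + band_op N (toep_entry (flow_coef N (x \<tau>))) ?u l) (at \<tau> within {0..})"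
  by (rule toep_deriv[OF \<tau> Suc.IH])
 moreover have "h.toep ?v l
  = h.toep (h.lax_right ?u) l - h.toep ((h.toep ^^ p) (h.lax_right f)) l + (\<Sum>i<p. h.toep ((h.toep ^^ i) (?G i)) l)"
  unfolding banded_add[OF h.banded_ops(1)] banded_diff[OF h.banded_ops(1)] banded_sum[OF h.banded_ops(1)] ..
 moreover have "band_op N (toep_entry (flow_coef N (x \<tau>))) ?u l
   = h.lax_right (h.toep ?u) l - 2 * h.cross (h.toep ?u) l - h.toep (h.lax_right ?u) l"
  using h.flow_commutator[of ?u l] h.lax_left_minus_lax_right[of "h.toep ?u" l] by (simp add: diff_eq_eq)
 moreover have "(\<Sum>i<Suc p. (h.toep ^^ i) (%l. - 2 * h.cross ((h.toep ^^ (Suc p - i)) f) l) l)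
   = - 2 * h.cross (h.toep ?u) l + (\<Sum>i<p. h.toep ((h.toep ^^ i) (?G i)) l)"
  unfolding sum.lessThan_Suc_shift by simp
 ultimately show ?case by (simp only: funpow.simps o_apply) (simp add: algebra_simps)
qed simp

lemma sgn_toep_power_deriv:
 assumes \<tau>: "\<tau> >= 0"
 shows "((%\<tau>. (sgn_toep_at \<tau> ^^ p) f l) has_vd lax_at \<tau> ((sgn_toep_at \<tau> ^^ p) f) l - (sgn_toep_at \<tau> ^^ p) (lax_at \<tau> f) l) (at \<tau> within {0..})"
proof (induction p arbitrary: l)
 case (Suc p)
 interpret h: hermitian_band N "x \<tau>" by (rule hermitian[OF \<tau>])
 let ?u = "(h.sgn_toep ^^ p) f"
 let ?E = "h.lax_right (h.sgn_toep ?u) l - h.sgn_toep ((h.sgn_toep ^^ p) (h.lax_right f)) l"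
 let ?D = "h.toep (%l. h.lax_right ?u l - (h.sgn_toep ^^ p) (h.lax_right f) l) l + band_op N (toep_entry (flow_coef N (x \<tau>))) ?u l"
 have sgn_toep: "sgn_toep_at \<sigma> g l = of_int (sgn l) * toep_at \<sigma> g l" if "\<sigma> >= 0" for \<sigma> g l
  using hermitian_band.sgn_toep_eq[OF hermitian[OF that]] hermitian_band.sgn_op_def[OF hermitian[OF that]] by metis
 have "((%\<tau>. of_int (sgn l) * toep_at \<tau> ((sgn_toep_at \<tau> ^^ p) f) l) has_vd
   of_int (sgn l) * ?D) (at \<tau> within {0..})"
  by (rule has_vector_derivative_mult_right[OF toep_deriv[OF \<tau> Suc.IH]])
 moreover have "of_int (sgn l) * ?D
   = ?E"
 proof -
  have "of_int (sgn l) * h.lax_left (h.toep ?u) l = h.lax_right (h.sgn_toep ?u) l"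
   using fun_cong[OF h.sgn_op_lax_left, of "h.toep ?u" l] h.sgn_toep_eq[of ?u] by (simp add: h.sgn_op_def)
  thus ?thesis unfolding banded_diff[OF h.banded_ops(1)] h.flow_commutator using sgn_toep[OF \<tau>] by (simp add: algebra_simps)
 qed
 ultimately have "((%\<tau>. of_int (sgn l) * toep_at \<tau> ((sgn_toep_at \<tau> ^^ p) f) l) has_vd
   ?E) (at \<tau> within {0..})" by simp
 hence "((%\<tau>. (sgn_toep_at \<tau> ^^ Suc p) f l) has_vd ?E) (at \<tau> within {0..})"
  by (rule has_vector_derivative_transform[rotated 2]) (use \<tau> sgn_toep in auto)
 thus ?case by simp
qed simp

lemma even_defect_deriv:
 assumes \<tau>: "\<tau> >= 0"
 shows "((%\<tau>. even_defect_at \<tau> p f l) has_vd lax_at \<tau> (even_defect_at \<tau> p f) l - even_defect_at \<tau> p (lax_at \<tau> f) l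
  + (\<Sum>i<p. (toep_at \<tau> ^^ i) (%l. - 2 * cross_at \<tau> ((toep_at \<tau> ^^ (p - i)) f) l) l)) (at \<tau> within {0..})"
proof -
 interpret h: hermitian_band N "x \<tau>" by (rule hermitian[OF \<tau>])
 have "h.lax_right (h.even_defect p f) l = h.lax_right ((h.toep ^^ p) f) l - h.lax_right ((h.sgn_toep ^^ p) f) l"
  unfolding h.even_defect_def[abs_def] by (rule banded_diff[OF h.banded_ops(6)])
 hence split: "h.lax_right ((h.toep ^^ p) f) l - (h.toep ^^ p) (h.lax_right f) l
   + z - (h.lax_right ((h.sgn_toep ^^ p) f) l - (h.sgn_toep ^^ p) (h.lax_right f) l)
  = h.lax_right (h.even_defect p f) l - h.even_defect p (h.lax_right f) l + z" for z by (simp add: h.even_defect_def)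
 have "((%\<tau>. (toep_at \<tau> ^^ p) f l - (sgn_toep_at \<tau> ^^ p) f l) has_vd lax_at \<tau> (even_defect_at \<tau> p f) l - even_defect_at \<tau> p (lax_at \<tau> f) l
  + (\<Sum>i<p. (toep_at \<tau> ^^ i) (%l. - 2 * cross_at \<tau> ((toep_at \<tau> ^^ (p - i)) f) l) l)) (at \<tau> within {0..})"
  using has_vector_derivative_diff[OF toep_power_deriv[OF \<tau>, of p f l] sgn_toep_power_deriv[OF \<tau>, of p f l]] unfolding split .
 thus ?thesis by (rule has_vector_derivative_transform[rotated 2]) (use \<tau> hermitian_band.even_defect_def[OF hermitian] in auto)
qed

lemma trace_even_defect_deriv:
 assumes \<tau>: "\<tau> >= 0" and p: "even p" "p > 0" and R: "R >= 2 * int (p * N)"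
 shows "((%\<tau>. trace_on R (even_defect_at \<tau> p)) has_vd - 2 * of_nat p * trace_on R (%f. cross_at \<tau> ((toep_at \<tau> ^^ p) f))) (at \<tau> within {0..})"
proof -
 interpret h: hermitian_band N "x \<tau>" by (rule hermitian[OF \<tau>])
 let ?C = "%l. h.lax_right (h.even_defect p (delta l)) l - h.even_defect p (h.lax_right (delta l)) l"
 let ?G = "%l. \<Sum>i<p. (h.toep ^^ i) (%l'. - 2 * h.cross ((h.toep ^^ (p - i)) (delta l)) l') l"
 have "int N <= int (p * N)" using p(2) by (intro of_nat_mono) simp
 hence R': "R >= int N + int (p * N)" using R by linarith
 have cyclic: "trace_on R (%f. h.even_defect p (h.lax_right f)) = trace_on R (%f. h.lax_right (h.even_defect p f))"
  by (rule trace_on_cyclic[OF h.banded_even_defect supported_on_mono[OF h.supported_on_even_defect[OF p(1)] R] h.banded_ops(6)])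
 have "(\<Sum>l\<in>{-R..R}. (?C l)
   + (?G l))
  = trace_on R (%f. h.lax_right (h.even_defect p f)) - trace_on R (%f. h.even_defect p (h.lax_right f))
   + (\<Sum>l\<in>{-R..R}. \<Sum>i<p. (h.toep ^^ i) (%l'. - 2 * h.cross ((h.toep ^^ (p - i)) (delta l)) l') l)"
  unfolding trace_on_def by (simp add: sum.distrib sum_subtractf)
 also have "... = (\<Sum>i<p. trace_on R (%f. (h.toep ^^ i) (%l'. - 2 * h.cross ((h.toep ^^ (p - i)) f) l')))"
  unfolding trace_on_def by (subst sum.swap) (simp add: cyclic[unfolded trace_on_def])
 also have "... = - 2 * of_nat p * trace_on R (%f. h.cross ((h.toep ^^ p) f))"
  using h.trace_toep_power_cross[OF _ R'] by simp
 finally have "(\<Sum>l\<in>{-R..R}. (?C l)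
   + (?G l))
  = - 2 * of_nat p * trace_on R (%f. h.cross ((h.toep ^^ p) f))" .
 moreover have "((%\<tau>. trace_on R (even_defect_at \<tau> p)) has_vd (\<Sum>l\<in>{-R..R}. (?C l)
   + (?G l))) (at \<tau> within {0..})"
  unfolding trace_on_def by (intro has_vector_derivative_sum even_defect_deriv \<tau>)
 ultimately show ?thesis by simp
qed

theorem trace_even_defect_nonincreasing:
 assumes p: "even p" "p > 0" and \<tau>: "\<tau> >= 0" and R: "R >= 2 * int (p * N)"
 shows "Re (trace_on R (even_defect_at \<tau> p)) <= Re (trace_on R (even_defect_at 0 p))"
proof (rule nonincreasing_if_deriv_nonpos[OF _ _ \<tau>])
 fix \<sigma> assume "\<sigma> \<in> {0..\<tau>}"
 hence \<sigma>: "\<sigma> >= 0" by simp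
 let ?h = "%\<sigma>. Re (trace_on R (even_defect_at \<sigma> p))"
 let ?c = "trace_on R (%f. cross_at \<sigma> ((toep_at \<sigma> ^^ p) f))"
 have "(?h has_real_derivative Re (- 2 * of_nat p * ?c)) (at \<sigma> within {0..})"
  unfolding has_real_derivative_iff_has_vector_derivative
  by (rule bounded_linear.has_vector_derivative[OF bounded_linear_Re trace_even_defect_deriv[OF \<sigma> p R]])
 thus "(?h has_real_derivative Re (- 2 * of_nat p * ?c)) (at \<sigma> within {0..\<tau>})"
  by (rule DERIV_subset) auto
 have "int N <= int (p * N)" using p(2) by (intro of_nat_mono) simp
 hence "Re ?c >= 0"
  using R by (intro hermitian_band.trace_cross_power_nonneg[OF hermitian[OF \<sigma>] p]
    hermitian_band.pos_semidef_toep[OF hermitian[OF \<sigma>] pos[OF \<sigma>]]) linarith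
 thus "Re (- 2 * of_nat p * ?c) <= 0" by (simp add: mult_nonpos_nonneg)
qed

end

section \<open>The flux of the first special value\<close>

lemma (in pos_trig_family) coefs_opposite_sign_bound:
 obtains C where "C >= 0" "!!i n l. i \<in> I ==> n * l < 0 ==> bracket l ^ 2 * cmod (coefs i n l) <= C / bracket n ^ 2 / bracket l ^ 2"
proof -
 obtain C where C: "C >= 0" "\<forall>i\<in>I. \<forall>n l. n * l <= 0 \<longrightarrow> bracket n ^ 4 * bracket l ^ 4 * cmod (coefs i n l) <= C"
  using coefs_opposite_sign_decay[of 4] by blast
 have "bracket l ^ 2 * cmod (coefs i n l) <= C / bracket n ^ 2 / bracket l ^ 2" if "i \<in> I" "n * l < 0" for i n l
 proof -
  have "bracket n ^ 2 * bracket l ^ 4 * cmod (coefs i n l) <= bracket n ^ 4 * bracket l ^ 4 * cmod (coefs i n l)"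
   by (intro mult_right_mono power_increasing bracket_ge_1) (auto simp: less_imp_le)
  also have "... <= C" using C(2) that by simp
  finally show ?thesis by (simp add: field_simps power_numeral_reduce)
 qed
 thus thesis by (rule that[OF C(1)])
qed

lemma summable_on_inverse_bracket_sq_pair: "(%(n, l). C / bracket n ^ 2 / bracket l ^ 2) summable_on UNIV"
 using summable_on_cmult_right[OF summable_on_product[OF summable_on_inverse_bracket_sq summable_on_inverse_bracket_sq], of C]
 by (simp add: case_prod_unfold)

lemma summable_on_bracket_pair_bound:
 fixes f :: "int \<times> int => real"
 assumes "!!n l. \<bar>f (n, l)\<bar> <= C / bracket n ^ 2 / bracket l ^ 2"
 shows "f summable_on UNIV"
 by (rule abs_summable_summable, rule abs_summable_dominated[OF summable_on_inverse_bracket_sq_pair[of C]])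
   (use assms in \<open>auto split: prod.splits\<close>)

context pos_trig_poly
begin

lemma mode_coef_opposite_sign_bound:
 obtains C where "C >= 0" "!!n l. n * l < 0 ==> bracket l ^ 2 * cmod (mode_coef n l) <= C / bracket n ^ 2 / bracket l ^ 2"
proof -
 obtain \<delta> M where "pos_trig_family {()} N \<delta> M (%_. bc) (%_. b) (%_. \<phi>)" by (rule singleton_family)
 then interpret pos_trig_family "{()}" N \<delta> M "%_. bc" "%_. b" "%_. \<phi>" .
 show thesis using coefs_opposite_sign_bound that by (metis singletonI)
qed

definition cross_mass :: "int \<times> int => real" where
 "cross_mass p = (case p of (n, l) => if n * l < 0 then 2 * of_int \<bar>l\<bar> * (cmod (mode_coef n l))\<^sup>2 else 0)"

lemma summable_cross_mass: "cross_mass summable_on UNIV"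
proof -
 obtain C where C: "C >= 0" "!!n l. n * l < 0 ==> bracket l ^ 2 * cmod (mode_coef n l) <= C / bracket n ^ 2 / bracket l ^ 2"
  using mode_coef_opposite_sign_bound by blast
 have "\<bar>cross_mass (n, l)\<bar> <= 2 * C / bracket n ^ 2 / bracket l ^ 2" for n l
 proof (cases "n * l < 0")
  case True
  have "bracket l <= bracket l ^ 2" using self_le_power[OF bracket_ge_1] by simp
  hence "\<bar>real_of_int l\<bar> * (cmod (mode_coef n l) * cmod (mode_coef n l)) <= bracket l ^ 2 * (cmod (mode_coef n l) * 1)"
   by (intro mult_mono norm_mode_coef_le_1 order_trans[OF abs_le_bracket]) auto
  also have "... <= C / bracket n ^ 2 / bracket l ^ 2" using C(2)[OF True] by simp
  finally show ?thesis using True by (simp add: cross_mass_def power2_eq_square abs_mult)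
 qed (simp add: cross_mass_def C(1))
 thus ?thesis by (rule summable_on_bracket_pair_bound)
qed

lemma Re_remainder_diagonal:
 assumes n: "n \<noteq> 0"
 shows "Re (remainder n n) = (INFSUM l. cross_mass (n, l))"
proof -
 have "(%l. cross_mass (n, l)) summable_on UNIV"
  using summable_on_SigmaD1[of "%n l. cross_mass (n, l)" UNIV "%_. UNIV" n] summable_cross_mass by simp
 hence "((%l. complex_of_real (cross_mass (n, l))) has_sum of_real (INFSUM l. cross_mass (n, l))) UNIV"
  by (intro has_sum_of_real has_sum_infsum)
 moreover have "complex_of_real (cross_mass (n, l)) = of_int (\<bar>l\<bar> - sgn n * l) * cnj (mode_coef n l) * mode_coef n l" for l
 proof -
  have "\<bar>l\<bar> - sgn n * l = (if n * l < 0 then 2 * \<bar>l\<bar> else 0)"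
   using n by (auto simp: sgn_if mult_less_0_iff)
  moreover have "cnj (mode_coef n l) * mode_coef n l = of_real ((cmod (mode_coef n l))\<^sup>2)"
   using complex_norm_square[of "mode_coef n l"] by (simp add: mult.commute)
  ultimately show ?thesis by (simp add: cross_mass_def mult.assoc) (metis of_int_abs of_real_of_int_eq)
 qed
 ultimately have "((%l. of_int (\<bar>l\<bar> - sgn n * l) * cnj (mode_coef n l) * mode_coef n l) has_sum of_real (INFSUM l. cross_mass (n, l))) UNIV"
   by simp
 thus ?thesis unfolding remainder_def by (simp add: infsumI)
qed

lemma trace_remainder: "(\<Sum>\<^sub>\<infinity>n\<in>{n. n \<noteq> 0}. Re (remainder n n)) = (INFSUM p. cross_mass p)"
proof -
 have "(\<Sum>\<^sub>\<infinity>n\<in>{n. n \<noteq> 0}. Re (remainder n n)) = (\<Sum>\<^sub>\<infinity>n\<in>{n. n \<noteq> 0}. INFSUM l. cross_mass (n, l))"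
  by (intro infsum_cong) (simp add: Re_remainder_diagonal)
 also have "... = (INFSUM n. INFSUM l. cross_mass (n, l))" by (rule infsum_cong_neutral) (auto simp: cross_mass_def)
 also have "... = (INFSUM p. cross_mass p)"
  using infsum_Sigma'_banach[of "%n l. cross_mass (n, l)" UNIV "%_. UNIV"] summable_cross_mass by simp
 finally show ?thesis .
qed

text \<open>The time derivative of \<open>mode_coef\<close> along the flow, up to a rotation of the mode.\<close>

definition mode_velocity :: "int => cseq" where
 "mode_velocity n l = (\<Sum>j\<in>freqs N. of_int (sgn j) * bc j * (of_int (l - j) * mode_coef n (l - j)))"

definition cross_mass_deriv :: "int \<times> int => real" where
 "cross_mass_deriv p = (case p of (n, l) => if n * l < 0 then 4 * of_int \<bar>l\<bar> * Re (cnj (mode_coef n l) * mode_velocity n l) else 0)"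

definition coupling :: "int => int => int => real" where "coupling n l k = Re (bc (l - k) * (mode_coef n k * cnj (mode_coef n l)))"

definition flux :: "int => int => int => real" where
 "flux n l k = 4 * of_int \<bar>l\<bar> * (of_int (sgn (l - k)) * of_int k) * coupling n l k"

lemma coupling_sym: "coupling n k l = coupling n l k"
proof -
 have "cnj (bc (k - l) * (mode_coef n l * cnj (mode_coef n k))) = bc (l - k) * (mode_coef n k * cnj (mode_coef n l))"
  using cnj_bc[of "k - l"] by (simp add: mult_ac)
 from this[symmetric] show ?thesis unfolding coupling_def by (simp only: cnj.simps)
qed

lemma coupling_band: "\<bar>l - k\<bar> > int N ==> coupling n l k = 0" by (simp add: coupling_def band)

lemma cross_mass_deriv_eq_flux:
 assumes "n * l < 0"
 shows "cross_mass_deriv (n, l) = (\<Sum>k\<in>window N l. flux n l k)"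
proof -
 have "mode_velocity n l = (\<Sum>k\<in>window N l. of_int (sgn (l - k)) * bc (l - k) * (of_int k * mode_coef n k))"
  unfolding mode_velocity_def by (rule sum.reindex_bij_witness[of _ "%k. l - k" "%j. l - j"]) auto
 moreover have "4 * of_int \<bar>l\<bar> * Re (cnj (mode_coef n l) * (of_int (sgn (l - k)) * bc (l - k) * (of_int k * mode_coef n k))) = flux n l k" for k
 proof -
  have "cnj (mode_coef n l) * (of_int (sgn (l - k)) * bc (l - k) * (of_int k * mode_coef n k))
    = of_real (of_int (sgn (l - k)) * of_int k) * (bc (l - k) * (mode_coef n k * cnj (mode_coef n l)))"
   by (simp add: mult_ac)
  moreover have "Re (of_real u * z) = u * Re z" for u z by simp
  ultimately show ?thesis unfolding flux_def coupling_def by (simp only: mult.assoc)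
 qed
 ultimately show ?thesis using assms by (simp add: cross_mass_def cross_mass_deriv_def sum_distrib_left Re_sum)
qed

lemma abs_flux_le:
 assumes M: "!!k. cmod (bc k) <= M"
 shows "\<bar>flux n l k\<bar> <= 4 * M * (\<bar>of_int l\<bar> * cmod (mode_coef n l)) * (\<bar>of_int k\<bar> * cmod (mode_coef n k))"
proof -
 have "\<bar>coupling n l k\<bar> <= M * (cmod (mode_coef n k) * cmod (mode_coef n l))"
  unfolding coupling_def by (rule order_trans[OF abs_Re_le_cmod]) (simp add: norm_mult mult_right_mono M)
 hence "(4 * \<bar>of_int l\<bar> * \<bar>of_int k\<bar>) * \<bar>coupling n l k\<bar> <= (4 * \<bar>of_int l\<bar> * \<bar>of_int k\<bar>) * (M * (cmod (mode_coef n k) * cmod (mode_coef n l)))"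
  by (rule mult_left_mono) auto
 moreover have "\<bar>flux n l k\<bar> <= (4 * \<bar>of_int l\<bar> * \<bar>of_int k\<bar>) * \<bar>coupling n l k\<bar>"
  unfolding flux_def abs_mult by (intro mult_right_mono) (auto simp: sgn_if)
 ultimately show ?thesis by (simp add: mult_ac)
qed

lemma abs_sum_flux_le:
 assumes M: "!!k. cmod (bc k) <= M" and C: "bracket l ^ 2 * cmod (mode_coef n l) <= C / bracket n ^ 2 / bracket l ^ 2"
 shows "\<bar>\<Sum>k\<in>window N l. if P k then flux n l k else 0\<bar> <= real (2 * N + 1) * (4 * M * (1 + real N) * C) / bracket n ^ 2 / bracket l ^ 2"
proof -
 have M0: "M >= 0" using order_trans[OF norm_ge_zero M] .
 have "\<bar>if P k then flux n l k else 0\<bar> <= 4 * M * (1 + real N) * (C / bracket n ^ 2 / bracket l ^ 2)" if k: "k \<in> window N l" for k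
 proof -
  have "\<bar>real_of_int k\<bar> <= \<bar>real_of_int l\<bar> + real N" using k by auto
  also have "... <= (1 + real N) * bracket l" by (simp add: bracket_def algebra_simps)
  finally have k_bound: "\<bar>real_of_int k\<bar> * cmod (mode_coef n k) <= (1 + real N) * bracket l * 1"
   by (intro mult_mono norm_mode_coef_le_1) (auto simp: less_imp_le)
  have "\<bar>flux n l k\<bar> <= 4 * M * (bracket l * cmod (mode_coef n l)) * ((1 + real N) * bracket l * 1)"
   by (rule order_trans[OF abs_flux_le[OF M]]) (intro mult_mono k_bound abs_le_bracket mult_nonneg_nonneg, auto simp: M0 less_imp_le)
  also have "... = 4 * M * (1 + real N) * (bracket l ^ 2 * cmod (mode_coef n l))" by (simp add: power2_eq_square mult_ac)
  also have "... <= 4 * M * (1 + real N) * (C / bracket n ^ 2 / bracket l ^ 2)" using M0 by (intro mult_left_mono C) auto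
  finally have "\<bar>flux n l k\<bar> <= 4 * M * (1 + real N) * (C / bracket n ^ 2 / bracket l ^ 2)" .
  thus ?thesis using abs_ge_zero[of "flux n l k"] by auto
 qed
 hence "\<bar>\<Sum>k\<in>window N l. if P k then flux n l k else 0\<bar> <= (\<Sum>k\<in>window N l. 4 * M * (1 + real N) * (C / bracket n ^ 2 / bracket l ^ 2))"
  by (intro order_trans[OF sum_abs sum_mono])
 thus ?thesis by (simp add: add_divide_distrib algebra_simps)
qed

definition same_side_flux :: "int => int => int => real" where "same_side_flux n l k = (if n * l < 0 \<and> n * k < 0 then flux n l k else 0)"

definition cross_side_flux :: "int => int => int => real" where "cross_side_flux n l k = (if n * l < 0 \<and> n * k > 0 then flux n l k else 0)"

lemma cross_mass_deriv_split:
 "cross_mass_deriv (n, l) = (\<Sum>k\<in>window N l. same_side_flux n l k) + (\<Sum>k\<in>window N l. cross_side_flux n l k)"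
proof (cases "n * l < 0")
 case True
 have "flux n l k = same_side_flux n l k + cross_side_flux n l k" for k
  using True by (auto simp: same_side_flux_def cross_side_flux_def flux_def not_less le_less)
 thus ?thesis unfolding cross_mass_deriv_eq_flux[OF True] by (simp add: sum.distrib)
qed (simp add: cross_mass_deriv_def same_side_flux_def cross_side_flux_def)

lemma same_side_flux_antisym: "same_side_flux n k l = - same_side_flux n l k"
proof (cases "n * l < 0 \<and> n * k < 0")
 case True
 have "sgn (k - l) = - sgn (l - k)" by (simp add: sgn_if)
 moreover have "of_int \<bar>l\<bar> * of_int k = (of_int \<bar>k\<bar> * of_int l :: real)" using True by (auto simp: mult_less_0_iff abs_if)
 ultimately show ?thesis using True by (simp add: same_side_flux_def flux_def coupling_sym[of n k l])
qed (auto simp: same_side_flux_def)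

lemma sum_same_side_flux: "(INFSUM l. \<Sum>k\<in>window N l. same_side_flux n l k) = 0"
proof -
 obtain M where M: "M >= 0" "!!k. cmod (bc k) <= M" using bc_bounded by blast
 define g where "g l = \<bar>real_of_int l\<bar> * cmod (mode_coef n l)" for l
 have g: "g summable_on UNIV" unfolding g_def by (rule mode_coef_freq_summable)
 have "norm (same_side_flux n l k) <= (4 * M * g l) * g k" for l k
  using abs_flux_le[OF M(2), of n l k] M(1) by (simp add: same_side_flux_def g_def)
 hence "(INFSUM l. INFSUM k. same_side_flux n l k) = (INFSUM k. INFSUM l. same_side_flux n l k)"
  by (intro infsum_swap_product[of "%l. 4 * M * g l" g] summable_on_cmult_right g) (auto simp: g_def M(1))
 also have "... = (INFSUM k. INFSUM l. - same_side_flux n k l)" by (intro infsum_cong) (rule same_side_flux_antisym)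
 also have "... = - (INFSUM l. INFSUM k. same_side_flux n l k)" unfolding infsum_uminus ..
 finally have "(INFSUM l. INFSUM k. same_side_flux n l k) = 0" by simp
 moreover have "(\<Sum>k\<in>window N l. same_side_flux n l k) = (INFSUM k. same_side_flux n l k)" for l
  by (rule infsumI[symmetric], rule has_sum_finite_neutralI) (auto simp: same_side_flux_def flux_def coupling_band)
 ultimately show ?thesis by simp
qed

definition exchange :: "int => int => int => real" where "exchange n l k = - 4 * of_int \<bar>l * k\<bar> * coupling n l k"

lemma exchange_sym: "exchange n k l = exchange n l k" by (simp add: exchange_def coupling_sym[of n k l] mult.commute[of k l])

lemma exchange_band: "\<bar>l - k\<bar> > int N ==> exchange n l k = 0" by (simp add: exchange_def coupling_band)

lemma cross_side_flux_eq: assumes "n * l < 0" "n * k > 0" shows "cross_side_flux n l k = exchange n l k"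
proof -
 have "of_int (sgn (l - k)) * of_int k = (- of_int \<bar>k\<bar> :: real)" using assms by (auto simp: mult_less_0_iff zero_less_mult_iff sgn_if)
 thus ?thesis using assms by (simp add: cross_side_flux_def flux_def exchange_def abs_mult)
qed

lemma sum_window_cross_side_flux:
 assumes l: "n * l < 0"
 shows "(\<Sum>k\<in>window N l. cross_side_flux n l k) = (\<Sum>k\<in>freqs N \<inter> {k. n * k > 0}. exchange n l k)"
proof -
 let ?P = "freqs N \<inter> {k. n * k > 0}"
 have "(\<Sum>k\<in>window N l. cross_side_flux n l k) = (\<Sum>k\<in>window N l \<inter> ?P. cross_side_flux n l k)"
  using l by (intro sum.mono_neutral_right) (auto simp: cross_side_flux_def zero_less_mult_iff mult_less_0_iff)
 also have "... = (\<Sum>k\<in>?P. exchange n l k)"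
  using l by (intro sum.mono_neutral_cong_left) (auto simp: cross_side_flux_eq intro!: exchange_band)
 finally show ?thesis .
qed

lemma sum_cross_side_flux:
 "(INFSUM l. \<Sum>k\<in>window N l. cross_side_flux n l k) = (\<Sum>l\<in>{- int N..-1}. \<Sum>k\<in>{1..int N}. exchange n l k)"
proof (cases "n = 0")
 case True
 thus ?thesis by (auto simp: cross_side_flux_def exchange_def coupling_def mode_coef_0 intro!: sum.neutral)
next
 case False
 let ?M = "freqs N \<inter> {l. n * l < 0}" and ?P = "freqs N \<inter> {k. n * k > 0}"
 have "(INFSUM l. \<Sum>k\<in>window N l. cross_side_flux n l k) = (\<Sum>l\<in>?M. \<Sum>k\<in>window N l. cross_side_flux n l k)"
 proof (rule infsumI, rule has_sum_finite_neutralI)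
  fix l assume l: "l \<in> UNIV - ?M"
  show "(\<Sum>k\<in>window N l. cross_side_flux n l k) = 0"
  proof (rule sum.neutral, rule ballI)
   fix k assume "k \<in> window N l"
   thus "cross_side_flux n l k = 0" using l by (auto simp: cross_side_flux_def zero_less_mult_iff mult_less_0_iff)
  qed
 qed auto
 also have "... = (\<Sum>l\<in>?M. \<Sum>k\<in>?P. exchange n l k)" by (intro sum.cong refl sum_window_cross_side_flux) auto
 also have "... = (\<Sum>l\<in>{- int N..-1}. \<Sum>k\<in>{1..int N}. exchange n l k)"
 proof (cases "n > 0")
  case True
  hence "?M = {- int N..-1}" "?P = {1..int N}" by (auto simp: zero_less_mult_iff mult_less_0_iff)
  thus ?thesis by simp
 next
  case neg: False
  hence "?M = {1..int N}" "?P = {- int N..-1}" using False by (auto simp: zero_less_mult_iff mult_less_0_iff)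
  thus ?thesis by (subst sum.swap) (simp add: exchange_sym)
 qed
 finally show ?thesis .
qed

lemma sum_exchange_nonpos: "(INFSUM n. \<Sum>l\<in>{- int N..-1}. \<Sum>k\<in>{1..int N}. exchange n l k) <= 0"
proof -
 have "((%n. exchange n l k) has_sum (- 4 * of_int \<bar>l * k\<bar> * (cmod (bc (l - k)))\<^sup>2)) UNIV" for l k
 proof -
  have "((%n. - 4 * of_int \<bar>l * k\<bar> * Re (bc (l - k) * (mode_coef n k * cnj (mode_coef n l))))
    has_sum (- 4 * of_int \<bar>l * k\<bar> * Re (bc (l - k) * bc (k - l)))) UNIV"
   by (rule has_sum_cmult_right[OF has_sum_Re[OF has_sum_cmult_right[OF mode_coef_completeness]]])
  moreover have "Re (bc (l - k) * bc (k - l)) = (cmod (bc (l - k)))\<^sup>2"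
   using cnj_bc[of "l - k"] complex_norm_square[of "bc (l - k)"] by (metis minus_diff_eq Re_complex_of_real)
  ultimately show ?thesis by (simp only: exchange_def coupling_def)
 qed
 hence "((%n. \<Sum>l\<in>{- int N..-1}. \<Sum>k\<in>{1..int N}. exchange n l k)
   has_sum (\<Sum>l\<in>{- int N..-1}. \<Sum>k\<in>{1..int N}. - 4 * of_int \<bar>l * k\<bar> * (cmod (bc (l - k)))\<^sup>2)) UNIV"
  by (intro has_sum_sum) auto
 thus ?thesis by (simp only: infsumI) (intro sum_nonpos, simp)
qed

lemma summable_flux_sums:
 "(%(n, l). \<Sum>k\<in>window N l. same_side_flux n l k) summable_on UNIV"
 "(%(n, l). \<Sum>k\<in>window N l. cross_side_flux n l k) summable_on UNIV"
proof -
 obtain M where M: "M >= 0" "!!k. cmod (bc k) <= M" using bc_bounded by blast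
 obtain C where C: "C >= 0" "!!n l. n * l < 0 ==> bracket l ^ 2 * cmod (mode_coef n l) <= C / bracket n ^ 2 / bracket l ^ 2"
  using mode_coef_opposite_sign_bound by blast
 have bound: "\<bar>\<Sum>k\<in>window N l. if n * l < 0 \<and> P n k then flux n l k else 0\<bar>
   <= real (2 * N + 1) * (4 * M * (1 + real N) * C) / bracket n ^ 2 / bracket l ^ 2" for P n l
 proof (cases "n * l < 0")
  case True
  thus ?thesis using abs_sum_flux_le[OF M(2) C(2)[OF True], of "P n"] by simp
 qed (use M(1) C(1) in simp)
 show "(%(n, l). \<Sum>k\<in>window N l. same_side_flux n l k) summable_on UNIV"
  by (rule summable_on_bracket_pair_bound) (use bound[where P="%n k. n * k < 0"] in \<open>simp only: same_side_flux_def prod.case\<close>)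
 show "(%(n, l). \<Sum>k\<in>window N l. cross_side_flux n l k) summable_on UNIV"
  by (rule summable_on_bracket_pair_bound) (use bound[where P="%n k. n * k > 0"] in \<open>simp only: cross_side_flux_def prod.case\<close>)
qed

text \<open>The fluxes within a half line cancel, and the flux across 0 is nonpositive by completeness of the modes.\<close>

theorem sum_cross_mass_deriv_nonpos: "(INFSUM p. cross_mass_deriv p) <= 0"
proof -
 have "cross_mass_deriv = (%p. (case p of (n, l) => \<Sum>k\<in>window N l. same_side_flux n l k)
   + (case p of (n, l) => \<Sum>k\<in>window N l. cross_side_flux n l k))"
  using cross_mass_deriv_split by auto
 hence "(INFSUM p. cross_mass_deriv p) = (INFSUM (n, l). \<Sum>k\<in>window N l. same_side_flux n l k)
   + (INFSUM (n, l). \<Sum>k\<in>window N l. cross_side_flux n l k)"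
  using infsum_add[OF summable_flux_sums] by simp
 also have "(INFSUM (n, l). \<Sum>k\<in>window N l. same_side_flux n l k) = 0"
  using infsum_Sigma'_banach[of "%n l. \<Sum>k\<in>window N l. same_side_flux n l k" UNIV "%_. UNIV"] summable_flux_sums(1)
   by (simp add: sum_same_side_flux)
 also have "(INFSUM (n, l). \<Sum>k\<in>window N l. cross_side_flux n l k) = (INFSUM n. \<Sum>l\<in>{- int N..-1}. \<Sum>k\<in>{1..int N}. exchange n l k)"
  using infsum_Sigma'_banach[of "%n l. \<Sum>k\<in>window N l. cross_side_flux n l k" UNIV "%_. UNIV"] summable_flux_sums(2)
   by (simp add: sum_cross_side_flux)
 finally show ?thesis using sum_exchange_nonpos by simp
qed

end

section \<open>Evolution of the change of variables\<close>

lemma has_real_derivative_signed_integral: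
 fixes f :: "real => real"
 assumes f: "continuous_on UNIV f"
 shows "((%t. integral {0..t} f - integral {t..0} f) has_real_derivative f t) (at t)"
proof -
 define R where "R = \<bar>t\<bar> + 1"
 have R: "t \<in> {-R<..<R}" "R > 0" by (auto simp: R_def)
 have integrable: "f integrable_on {u..v}" for u v by (rule integrable_continuous_real[OF continuous_on_subset[OF f]]) simp
 have signed: "integral {-R..s} f - integral {-R..0} f = integral {0..s} f - integral {s..0} f" if "s \<in> {-R<..<R}" for s
 proof (cases "s >= 0")
  case True
  thus ?thesis using Henstock_Kurzweil_Integration.integral_combine[of "-R" 0 s f] integrable R by (cases "s = 0") auto
 next
  case False
  thus ?thesis using Henstock_Kurzweil_Integration.integral_combine[of "-R" s 0 f] integrable that by auto
 qed
 have "((%s. integral {-R..s} f) has_real_derivative f t) (at t within {-R..R})"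
  by (rule integral_has_real_derivative) (use R continuous_on_subset[OF f] in auto)
 hence "((%s. integral {-R..s} f) has_real_derivative f t) (at t)"
  using at_within_interior[of t "{-R..R}"] R by simp
 from DERIV_diff[OF this DERIV_const[of "integral {-R..0} f"]]
 have "((%s. integral {-R..s} f - integral {-R..0} f) has_real_derivative f t) (at t)" by simp
 thus ?thesis by (rule has_field_derivative_transform_within_open[where S="{-R<..<R}"]) (use R signed in auto)
qed

lemma fourier_param_deriv:
 assumes u: "!!\<tau> t. \<tau> \<in> S ==> t \<in> {0..2*pi} ==> ((%\<tau>. u \<tau> t) has_vd u' \<tau> t) (at \<tau> within S)"
  and cont: "!!\<tau>. \<tau> \<in> S ==> continuous_on {0..2*pi} (u \<tau>)" and cont': "continuous_on (S \<times> {0..2*pi}) (%p. u' (fst p) (snd p))"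
  and \<tau>: "\<tau> \<in> S" and "convex S"
 shows "((%\<tau>. fourier (u \<tau>) k) has_vd fourier (u' \<tau>) k) (at \<tau> within S)"
proof -
 have "((%\<tau>. integral (cbox 0 (2*pi)) (%t. u \<tau> t * cis (- (of_int k * t))))
   has_vd integral (cbox 0 (2*pi)) (%t. u' \<tau> t * cis (- (of_int k * t)))) (at \<tau> within S)"
 proof (rule leibniz_rule_vector_derivative)
  show "((%\<tau>. u \<tau> t * cis (- (of_int k * t))) has_vd u' \<sigma> t * cis (- (of_int k * t))) (at \<sigma> within S)" if "\<sigma> \<in> S" "t \<in> cbox 0 (2*pi)" for \<sigma> t
   using that by (intro has_vector_derivative_mult_left u) auto
  show "(%t. u \<sigma> t * cis (- (of_int k * t))) integrable_on cbox 0 (2*pi)" if "\<sigma> \<in> S" for \<sigma>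
   using cont[OF that] by (intro integrable_continuous continuous_intros) auto
  show "continuous_on (S \<times> cbox 0 (2*pi)) (%(\<sigma>, t). u' \<sigma> t * cis (- (of_int k * t)))"
   unfolding split_def cbox_interval by (intro continuous_intros cont')
 qed (use assms in auto)
 from has_vector_derivative_mult_left[OF this, of "1 / of_real (2 * pi)"] show ?thesis
  unfolding fourier_cis cbox_interval by simp
qed

lemma continuous_on_fixed_fst:
 assumes "continuous_on (S \<times> A) (%p. f (fst p) (snd p))" "\<tau> \<in> S"
 shows "continuous_on A (f \<tau>)"
proof -
 have "(%t. (\<tau>, t)) ` A \<subseteq> S \<times> A" using assms(2) by auto
 from continuous_on_compose2[OF assms(1) continuous_on_Pair[OF continuous_on_const continuous_on_id] this] show ?thesis by simp
qed

context positive_flow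
begin

definition drift where "drift \<tau> t = re_trig N (%j. - \<i> * (of_int (sgn j) * x \<tau> j)) t / re_trig N (x \<tau>) t"

definition drift_deriv where "drift_deriv \<tau> t = - re_trig N (flow_coef N (x \<tau>)) t / (re_trig N (x \<tau>) t)\<^sup>2"

definition phase where "phase \<tau> t = integral {0..t} (%s. 1 / re_trig N (x \<tau>) s) - integral {t..0} (%s. 1 / re_trig N (x \<tau>) s)"

lemma continuous_on_x: "continuous_on {0..} (%\<tau>. x \<tau> k)"
 by (rule continuous_on_flow_solution[OF solution])

lemma nonzero: "\<tau> >= 0 ==> re_trig N (x \<tau>) t \<noteq> 0" using pos[of \<tau> t] by simp

lemma drift_space_deriv: assumes "\<tau> >= 0" shows "(drift \<tau> has_real_derivative drift_deriv \<tau> t) (at t within S)"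
proof -
 interpret h: hermitian_band N "x \<tau>" by (rule hermitian[OF assms])
 from DERIV_divide[OF h.conjugate_deriv re_trig_deriv nonzero[OF assms], of t S] show ?thesis
  unfolding drift_def[abs_def] drift_deriv_def h.re_trig_flow_coef h.conjugate_def power2_eq_square by (simp add: algebra_simps)
qed

lemma inverse_time_deriv: assumes "\<tau> >= 0" shows "((%\<tau>. 1 / re_trig N (x \<tau>) t) has_real_derivative drift_deriv \<tau> t) (at \<tau> within {0..})"
proof -
 have "((%\<tau>. re_trig N (x \<tau>) t) has_real_derivative re_trig N (flow_coef N (x \<tau>)) t) (at \<tau> within {0..})"
  by (rule re_trig_curve_deriv) (rule x_deriv[OF assms])
 from DERIV_divide[OF DERIV_const[of 1] this nonzero[OF assms]] show ?thesis
  unfolding drift_deriv_def power2_eq_square by simp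
qed

lemma continuous_on_joint:
 "continuous_on ({0..} \<times> A) (%p. re_trig N (x (fst p)) (snd p))"
 "continuous_on ({0..} \<times> A) (%p. drift_deriv (fst p) (snd p))" "continuous_on ({0..} \<times> A) (%p. drift (fst p) (snd p))"
 unfolding drift_deriv_def drift_def flow_coef_def by (auto intro!: continuous_intros continuous_on_re_trig_joint continuous_on_x simp: nonzero)

lemma continuous_on_inverse: "\<tau> >= 0 ==> continuous_on S (%t. 1 / re_trig N (x \<tau>) t)"
 by (intro continuous_intros continuous_on_re_trig) (auto simp: nonzero)

lemma integral_inverse_time_deriv:
 assumes \<tau>: "\<tau> >= 0" and t: "t >= 0"
 shows "((%\<tau>. integral {0..t} (%s. 1 / re_trig N (x \<tau>) s)) has_real_derivative drift \<tau> t - drift \<tau> 0) (at \<tau> within {0..})"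
proof -
 have "((%\<tau>. integral (cbox 0 t) (%s. 1 / re_trig N (x \<tau>) s)) has_real_derivative integral (cbox 0 t) (drift_deriv \<tau>)) (at \<tau> within {0..})"
 proof (rule leibniz_rule_field_derivative)
  show "continuous_on ({0..} \<times> cbox 0 t) (%(\<tau>, s). drift_deriv \<tau> s)" unfolding split_def by (rule continuous_on_joint)
  show "(%s. 1 / re_trig N (x \<sigma>) s) integrable_on cbox 0 t" if "\<sigma> \<in> {0..}" for \<sigma>
   using that by (intro integrable_continuous continuous_on_inverse) auto
 qed (use \<tau> inverse_time_deriv in auto)
 moreover have "(drift_deriv \<tau> has_integral drift \<tau> t - drift \<tau> 0) {0..t}"
  by (rule fundamental_theorem_of_calculus[OF t]) (use drift_space_deriv[OF \<tau>] in \<open>simp add: has_real_derivative_iff_has_vector_derivative\<close>)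
 ultimately show ?thesis by (simp add: integral_unique)
qed

lemma volume: assumes "\<tau> >= 0" shows "integral {0..2*pi} (%s. 1 / re_trig N (x \<tau>) s) = 2 * pi"
proof -
 have drift_periodic: "drift \<sigma> (2 * pi) - drift \<sigma> 0 = 0" for \<sigma>
  using re_trig_period[of N _ 0] by (simp add: drift_def)
 have "\<exists>c. \<forall>\<sigma>\<in>{0..}. integral {0..2*pi} (%s. 1 / re_trig N (x \<sigma>) s) = c"
 proof (rule has_field_derivative_zero_constant)
  show "((%\<sigma>. integral {0..2*pi} (%s. 1 / re_trig N (x \<sigma>) s)) has_real_derivative 0) (at \<sigma> within {0..})" if "\<sigma> \<in> {0..}" for \<sigma>
   using integral_inverse_time_deriv[of \<sigma> "2 * pi"] that unfolding drift_periodic by simp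
 qed simp
 thus ?thesis using volume_0 assms by (metis atLeast_iff order_refl)
qed

lemma phase_space_deriv: "\<tau> >= 0 ==> (phase \<tau> has_real_derivative 1 / re_trig N (x \<tau>) t) (at t)"
 unfolding phase_def[abs_def] by (rule has_real_derivative_signed_integral[OF continuous_on_inverse])

lemma phase_0: "phase \<tau> 0 = 0" by (simp add: phase_def)

lemma phase_plus_2pi: assumes \<tau>: "\<tau> >= 0" shows "phase \<tau> (t + 2 * pi) = phase \<tau> t + 2 * pi"
proof -
 have "((%t. phase \<tau> (t + 2 * pi) - phase \<tau> t) has_real_derivative 0) (at t)" for t
 proof -
  have "((%t. phase \<tau> (t + 2 * pi)) has_real_derivative 1 / re_trig N (x \<tau>) t) (at t)"
   using phase_space_deriv[OF \<tau>, of "t + 2 * pi"] unfolding re_trig_period by (simp add: DERIV_shift)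
  from DERIV_diff[OF this phase_space_deriv[OF \<tau>]] show ?thesis by simp
 qed
 hence "phase \<tau> (t + 2 * pi) - phase \<tau> t = phase \<tau> (0 + 2 * pi) - phase \<tau> 0" by (intro DERIV_isconst_all) auto
 also have "... = 2 * pi" using volume[OF \<tau>] by (simp add: phase_def)
 finally show ?thesis by simp
qed

lemma pos_trig_poly_x: assumes \<tau>: "\<tau> >= 0" shows "pos_trig_poly N (x \<tau>) (re_trig N (x \<tau>)) (phase \<tau>)"
proof -
 interpret h: hermitian_band N "x \<tau>" by (rule hermitian[OF \<tau>])
 show ?thesis by unfold_locales (auto simp: h.band h.trig_poly_real pos \<tau> phase_plus_2pi intro!: phase_space_deriv)
qed

lemma phase_eq_integral: assumes \<tau>: "\<tau> >= 0" shows "phase \<tau> t = integral {0..1} (%s. t * (1 / re_trig N (x \<tau>) (t * s)))"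
proof -
 have "((%s. phase \<tau> (t * s)) has_vd t * (1 / re_trig N (x \<tau>) (t * s))) (at s within {0..1})" for s
  unfolding has_real_derivative_iff_has_vector_derivative[symmetric]
  using DERIV_chain2[OF phase_space_deriv[OF \<tau>, of "t * s"] DERIV_cmult_Id[of t s "{0..1}"]] by (simp add: mult.commute)
 hence "((%s. t * (1 / re_trig N (x \<tau>) (t * s))) has_integral phase \<tau> (t * 1) - phase \<tau> (t * 0)) {0..1}"
  by (intro fundamental_theorem_of_calculus) auto
 thus ?thesis by (simp add: integral_unique phase_0)
qed

lemma continuous_on_phase_joint: "continuous_on ({0..} \<times> A) (%p. phase (fst p) (snd p))"
proof -
 have "continuous_on (({0..} \<times> A) \<times> cbox 0 1) (%z. snd (fst z) * (1 / re_trig N (x (fst (fst z))) (snd (fst z) * snd z)))"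
 proof (intro continuous_intros)
  have "continuous_on (({0..} \<times> A) \<times> cbox (0::real) 1) (%z. (fst (fst z), snd (fst z) * snd z))" by (intro continuous_intros)
  moreover have "(%z. (fst (fst z), snd (fst z) * snd z)) ` (({0..} \<times> A) \<times> cbox (0::real) 1) \<subseteq> {0..} \<times> UNIV" by auto
  ultimately show "continuous_on (({0..} \<times> A) \<times> cbox 0 1) (%z. re_trig N (x (fst (fst z))) (snd (fst z) * snd z))"
   using continuous_on_compose2[OF continuous_on_joint(1)[of UNIV]] by fastforce
  show "\<forall>z\<in>({0..} \<times> A) \<times> cbox 0 1. re_trig N (x (fst (fst z))) (snd (fst z) * snd z) \<noteq> 0" by (auto simp: nonzero)
 qed
 hence "continuous_on ({0..} \<times> A) (%p. integral (cbox 0 1) (%s. snd p * (1 / re_trig N (x (fst p)) (snd p * s))))"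
  by (intro integral_continuous_on_param) (simp add: split_def)
 thus ?thesis by (rule continuous_on_cong[THEN iffD1, OF refl, rotated]) (auto simp: phase_eq_integral)
qed

lemma cis_phase_time_deriv:
 assumes \<tau>: "\<tau> >= 0" and t: "t >= 0"
 shows "((%\<tau>. cis (of_int n * phase \<tau> t)) has_vd \<i> * of_real (of_int n * (drift \<tau> t - drift \<tau> 0))
   * cis (of_int n * phase \<tau> t)) (at \<tau> within {0..})"
proof -
 have "phase \<sigma> t = integral {0..t} (%s. 1 / re_trig N (x \<sigma>) s)" for \<sigma> using t by (cases "t = 0") (auto simp: phase_def)
 hence "((%\<sigma>. phase \<sigma> t) has_real_derivative drift \<tau> t - drift \<tau> 0) (at \<tau> within {0..})" using integral_inverse_time_deriv[OF assms] by simp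
 thus ?thesis by (rule has_vector_derivative_cis)
qed

abbreviation mode_coef_at where "mode_coef_at \<tau> \<equiv> pos_trig_poly.mode_coef (phase \<tau>)"
abbreviation mode_velocity_at where "mode_velocity_at \<tau> \<equiv> pos_trig_poly.mode_velocity N (x \<tau>) (phase \<tau>)"

lemma fourier_drift_mode:
 assumes \<tau>: "\<tau> >= 0"
 shows "fourier (%t. of_real (drift \<tau> t) * (\<i> * of_int n * cis (of_int n * phase \<tau> t))) l = mode_velocity_at \<tau> n l"
proof -
 let ?f = "%t. of_real (drift \<tau> t) * (\<i> * of_int n * cis (of_int n * phase \<tau> t))"
 interpret g: pos_trig_poly N "x \<tau>" "re_trig N (x \<tau>)" "phase \<tau>" by (rule pos_trig_poly_x[OF \<tau>])
 define u where "u t = \<i> * of_int n * (1 / of_real (re_trig N (x \<tau>) t)) * g.mode n t" for t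
 have u_cont: "continuous_on S u" for S unfolding u_def by (intro continuous_intros continuous_on_re_trig) (auto simp: nonzero \<tau>)
 have fourier_u: "fourier u m = \<i> * of_int m * g.mode_coef n m" for m unfolding u_def by (rule g.fourier_mode_deriv)
 have "(?f t) = (\<Sum>j\<in>freqs N. (- \<i> * (of_int (sgn j) * x \<tau> j)) * (cis (of_int j * t) * u t))" for t
 proof -
  have "(?f t) = of_real (re_trig N (%j. - \<i> * (of_int (sgn j) * x \<tau> j)) t) * u t"
   unfolding drift_def u_def by (simp add: nonzero \<tau> g.mode_def)
  also have "of_real (re_trig N (%j. - \<i> * (of_int (sgn j) * x \<tau> j)) t) = trig_poly N (%j. - \<i> * (of_int (sgn j) * x \<tau> j)) t"
   by (rule trig_poly_eq_re_trig[symmetric]) (simp add: hermitian_band.hermitian[OF hermitian[OF \<tau>]])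
  finally show ?thesis unfolding trig_poly_def by (simp only: sum_distrib_right mult.assoc)
 qed
 hence "fourier (%t. (?f t)) l
  = (\<Sum>j\<in>freqs N. (- \<i> * (of_int (sgn j) * x \<tau> j)) * (\<i> * of_int (l - j) * g.mode_coef n (l - j)))"
  by (simp only:) (subst fourier_sum, intro continuous_intros u_cont, simp only: fourier_cmult fourier_shift fourier_u)
 also have "... = g.mode_velocity n l" unfolding g.mode_velocity_def
 proof (intro sum.cong refl)
  fix j
  have "(- \<i> * z) * (\<i> * m * w) = z * (m * w)" for z m w by (simp add: complex_eq_iff algebra_simps)
  thus "(- \<i> * (of_int (sgn j) * x \<tau> j)) * (\<i> * of_int (l - j) * g.mode_coef n (l - j))
    = of_int (sgn j) * x \<tau> j * (of_int (l - j) * g.mode_coef n (l - j))" .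
 qed
 finally show ?thesis .
qed

lemma mode_coef_time_deriv:
 assumes \<tau>: "\<tau> >= 0"
 shows "((%\<tau>. mode_coef_at \<tau> n l) has_vd mode_velocity_at \<tau> n l - \<i> * of_int n * of_real (drift \<tau> 0) * mode_coef_at \<tau> n l) (at \<tau> within {0..})"
proof -
 let ?E = "%\<tau> t. cis (of_int n * phase \<tau> t)" and ?E' = "%\<tau> t. \<i> * of_real (of_int n * (drift \<tau> t - drift \<tau> 0)) * cis (of_int n * phase \<tau> t)"
 have mode_coef: "mode_coef_at \<sigma> n l = fourier (?E \<sigma>) l" if "\<sigma> >= 0" for \<sigma>
  unfolding pos_trig_poly.mode_coef_def[OF pos_trig_poly_x[OF that]] pos_trig_poly.mode_def[OF pos_trig_poly_x[OF that], abs_def] ..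
 have E_cont: "continuous_on ({0..} \<times> A) (%p. ?E (fst p) (snd p))" for A
  by (intro continuous_intros continuous_on_phase_joint)
 have drift_0_cont: "continuous_on ({0..} \<times> A) (%p. drift (fst p) 0)" for A :: "real set"
 proof -
  have "(%p. (fst p, 0)) ` ({0..} \<times> A) \<subseteq> {0..} \<times> (UNIV :: real set)" by auto
  from continuous_on_compose2[OF continuous_on_joint(3)[of UNIV]
    continuous_on_Pair[OF continuous_on_fst[OF continuous_on_id] continuous_on_const] this]
  show ?thesis by simp
 qed
 have "((%\<tau>. fourier (?E \<tau>) l) has_vd fourier (?E' \<tau>) l) (at \<tau> within {0..})"
 proof (rule fourier_param_deriv)
  show "continuous_on ({0..} \<times> {0..2*pi}) (%p. ?E' (fst p) (snd p))"
   by (intro continuous_intros E_cont continuous_on_joint drift_0_cont continuous_on_phase_joint)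
 qed (use \<tau> cis_phase_time_deriv continuous_on_fixed_fst[OF E_cont] in auto)
 hence "((%\<tau>. mode_coef_at \<tau> n l) has_vd fourier (?E' \<tau>) l) (at \<tau> within {0..})"
  by (rule has_vector_derivative_transform[rotated 2]) (use \<tau> mode_coef in auto)
 moreover have "fourier (?E' \<tau>) l = mode_velocity_at \<tau> n l - \<i> * of_int n * of_real (drift \<tau> 0) * mode_coef_at \<tau> n l"
 proof -
  have "continuous_on {0..2*pi} (drift \<tau>)" "continuous_on {0..2*pi} (?E \<tau>)"
   using \<tau> continuous_on_fixed_fst[OF continuous_on_joint(3)] continuous_on_fixed_fst[OF E_cont] by auto
  hence "fourier (%t. of_real (drift \<tau> t) * (\<i> * of_int n * ?E \<tau> t) - \<i> * of_int n * of_real (drift \<tau> 0) * ?E \<tau> t) l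
    = fourier (%t. of_real (drift \<tau> t) * (\<i> * of_int n * ?E \<tau> t)) l - fourier (%t. \<i> * of_int n * of_real (drift \<tau> 0) * ?E \<tau> t) l"
   unfolding fourier_cis left_diff_distrib
   by (subst integral_diff) (auto intro!: integrable_continuous_real continuous_intros simp: diff_divide_distrib)
  thus ?thesis unfolding fourier_drift_mode[OF \<tau>] fourier_cmult mode_coef[OF \<tau>] by (simp add: algebra_simps)
 qed
 ultimately show ?thesis by simp
qed

end

section \<open>Monotonicity of the special values\<close>

context positive_flow
begin

lemma Re_x_0_le: "\<tau> >= 0 ==> Re (x \<tau> 0) <= Re (x 0 0)"
 by (rule Re_coef_0_nonincreasing[OF flow_solution_on_subset[OF solution]]) auto

lemma norm_x_le: assumes "\<tau> >= 0" shows "cmod (x \<tau> k) <= Re (x 0 0)"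
 using hermitian_band.norm_coef_le_coef_0[OF hermitian[OF assms] pos[OF assms], of k] Re_x_0_le[OF assms] by linarith

lemma flow_family: assumes S: "S >= 0" obtains \<delta> where "pos_trig_family {0..S} N \<delta> (Re (x 0 0)) x (%\<tau>. re_trig N (x \<tau>)) phase"
proof -
 let ?K = "{0..S} \<times> {0..2*pi}"
 have "continuous_on ?K (%p. re_trig N (x (fst p)) (snd p))" by (rule continuous_on_subset[OF continuous_on_joint(1)]) auto
 then obtain p where p: "p \<in> ?K" "!!r. r \<in> ?K ==> re_trig N (x (fst p)) (snd p) <= re_trig N (x (fst r)) (snd r)"
  using continuous_attains_inf[of ?K "%p. re_trig N (x (fst p)) (snd p)"] S by (auto simp: compact_Times)
 have "re_trig N (x (fst p)) (snd p) <= re_trig N (x \<tau>) t" if "\<tau> \<in> {0..S}" for \<tau> t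
  by (rule re_trig_translate_into_period[of N t]) (use p(2) that in fastforce)
 hence "pos_trig_family {0..S} N (re_trig N (x (fst p)) (snd p)) (Re (x 0 0)) x (%\<tau>. re_trig N (x \<tau>)) phase"
  by (intro pos_trig_family.intro) (use p(1) pos pos_trig_poly_x norm_x_le in auto)
 thus thesis by (rule that)
qed

abbreviation cross_mass_at where "cross_mass_at \<tau> \<equiv> pos_trig_poly.cross_mass (phase \<tau>)"
abbreviation cross_mass_deriv_at where "cross_mass_deriv_at \<tau> \<equiv> pos_trig_poly.cross_mass_deriv N (x \<tau>) (phase \<tau>)"

lemma cross_mass_time_deriv:
 assumes \<tau>: "\<tau> >= 0" shows "((%\<tau>. cross_mass_at \<tau> p) has_real_derivative cross_mass_deriv_at \<tau> p) (at \<tau> within {0..})"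
proof -
 interpret g: pos_trig_poly N "x \<tau>" "re_trig N (x \<tau>)" "phase \<tau>" by (rule pos_trig_poly_x[OF \<tau>])
 obtain n l where p: "p = (n, l)" by force
 have "((%\<tau>. (cmod (mode_coef_at \<tau> n l))\<^sup>2) has_real_derivative
   2 * (g.mode_coef n l \<bullet> (g.mode_velocity n l - \<i> * of_int n * of_real (drift \<tau> 0) * g.mode_coef n l))) (at \<tau> within {0..})"
  by (rule has_real_derivative_norm_sq[OF mode_coef_time_deriv[OF \<tau>]])
 moreover have "c \<bullet> (w - \<i> * of_int n * of_real r * c) = Re (cnj c * w)" for c w r
  by (simp add: inner_complex_def algebra_simps)
 ultimately have sq: "((%\<tau>. (cmod (mode_coef_at \<tau> n l))\<^sup>2)
   has_real_derivative 2 * Re (cnj (g.mode_coef n l) * g.mode_velocity n l)) (at \<tau> within {0..})"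
  by (simp only:)
 have "((%\<tau>. if n * l < 0 then 2 * of_int \<bar>l\<bar> * (cmod (mode_coef_at \<tau> n l))\<^sup>2 else 0)
   has_real_derivative cross_mass_deriv_at \<tau> p) (at \<tau> within {0..})"
  using DERIV_cmult[OF sq, of "2 * of_int \<bar>l\<bar>"] by (simp add: p g.cross_mass_deriv_def mult_ac)
 thus ?thesis
  by (rule has_field_derivative_transform_within[OF _ zero_less_one]) (use \<tau> pos_trig_poly.cross_mass_def[OF pos_trig_poly_x] p in auto)
qed

lemma continuous_on_cross_mass_deriv: "continuous_on {0..} (%\<tau>. cross_mass_deriv_at \<tau> p)"
proof -
 obtain n l where p: "p = (n, l)" by force
 let ?f = "%\<tau>. 4 * of_int \<bar>l\<bar> * Re (cnj (mode_coef_at \<tau> n l)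
   * (\<Sum>j\<in>freqs N. of_int (sgn j) * x \<tau> j * (of_int (l - j) * mode_coef_at \<tau> n (l - j))))"
 have coef: "continuous_on {0..} (%\<tau>. mode_coef_at \<tau> n l)" for n l by (rule continuous_on_vector_derivative[OF mode_coef_time_deriv]) simp
 have "continuous_on {0..} (%\<tau>. (?f \<tau>))"
  by (intro continuous_intros coef continuous_on_x)
 hence "continuous_on {0..} (%\<tau>. if n * l < 0 then (?f \<tau>) else 0)"
  by (cases "n * l < 0") (simp_all only: if_True if_False continuous_on_const)
 thus ?thesis
  by (rule continuous_on_cong[THEN iffD1, OF refl, rotated])
   (simp add: p pos_trig_poly.cross_mass_deriv_def[OF pos_trig_poly_x] pos_trig_poly.mode_velocity_def[OF pos_trig_poly_x])
qed

lemma cross_mass_deriv_bound: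
 assumes S: "S >= 0"
 obtains D where "!!\<tau> n l. \<tau> \<in> {0..S} ==> \<bar>cross_mass_deriv_at \<tau> (n, l)\<bar> <= D / bracket n ^ 2 / bracket l ^ 2"
proof -
 obtain \<delta> where "pos_trig_family {0..S} N \<delta> (Re (x 0 0)) x (%\<tau>. re_trig N (x \<tau>)) phase" by (rule flow_family[OF S])
 then interpret f: pos_trig_family "{0..S}" N \<delta> "Re (x 0 0)" x "%\<tau>. re_trig N (x \<tau>)" phase .
 obtain C where C: "C >= 0" "!!\<tau> n l. \<tau> \<in> {0..S} ==> n * l < 0
   ==> bracket l ^ 2 * cmod (mode_coef_at \<tau> n l) <= C / bracket n ^ 2 / bracket l ^ 2"
  using f.coefs_opposite_sign_bound by blast
 have M: "Re (x 0 0) >= 0" using order_trans[OF norm_ge_zero norm_x_le[of 0 0]] by simp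
 have "\<bar>cross_mass_deriv_at \<tau> (n, l)\<bar> <= real (2 * N + 1) * (4 * Re (x 0 0) * (1 + real N) * C) / bracket n ^ 2 / bracket l ^ 2"
   if \<tau>: "\<tau> \<in> {0..S}" for \<tau> n l
 proof -
  interpret g: pos_trig_poly N "x \<tau>" "re_trig N (x \<tau>)" "phase \<tau>" by (rule f.member[OF \<tau>])
  show ?thesis
  proof (cases "n * l < 0")
   case True
   show ?thesis using g.abs_sum_flux_le[OF f.bc_bound[OF \<tau>] C(2)[OF \<tau> True], of "%_. True"] unfolding g.cross_mass_deriv_eq_flux[OF True] by simp
  qed (use C(1) M in \<open>simp add: g.cross_mass_deriv_def\<close>)
 qed
 thus thesis by (rule that)
qed

theorem sum_cross_mass_nonincreasing: assumes S: "S >= 0" shows "(INFSUM p. cross_mass_at S p) <= (INFSUM p. cross_mass_at 0 p)"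
proof -
 obtain D where D: "!!\<tau> n l. \<tau> \<in> {0..S} ==> \<bar>cross_mass_deriv_at \<tau> (n, l)\<bar> <= D / bracket n ^ 2 / bracket l ^ 2"
   by (rule cross_mass_deriv_bound[OF S]) blast
 let ?I = "integral {0..S} (%\<tau>. INFSUM p. cross_mass_deriv_at \<tau> p)"
 have "((%p. integral {0..S} (%\<tau>. cross_mass_deriv_at \<tau> p)) has_sum ?I) UNIV"
 proof (rule has_sum_integral[OF _ _ summable_on_inverse_bracket_sq_pair[of D]])
  show "continuous_on {0..S} (%\<tau>. cross_mass_deriv_at \<tau> p)" for p
    using continuous_on_subset[OF continuous_on_cross_mass_deriv, of "{0..S}"] by simp
  show "norm (cross_mass_deriv_at \<tau> p) <= (case p of (n, l) => D / bracket n ^ 2 / bracket l ^ 2)" if "\<tau> \<in> {0..S}" for p \<tau>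
   using D[OF that, of "fst p" "snd p"] by (simp add: split_def)
 qed
 moreover have "integral {0..S} (%\<tau>. cross_mass_deriv_at \<tau> p) = cross_mass_at S p - cross_mass_at 0 p" for p
 proof (rule integral_unique, rule fundamental_theorem_of_calculus[OF S])
  fix \<tau> assume \<tau>: "\<tau> \<in> {0..S}"
  show "((%\<tau>. cross_mass_at \<tau> p) has_vd cross_mass_deriv_at \<tau> p) (at \<tau> within {0..S})"
   unfolding has_real_derivative_iff_has_vector_derivative[symmetric] by (rule DERIV_subset[OF cross_mass_time_deriv]) (use \<tau> in auto)
 qed
 ultimately have "((%p. cross_mass_at S p - cross_mass_at 0 p) has_sum ?I) UNIV" by simp
 moreover have "((%p. cross_mass_at S p - cross_mass_at 0 p) has_sum ((INFSUM p. cross_mass_at S p) - (INFSUM p. cross_mass_at 0 p))) UNIV"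
  by (intro has_sum_diff has_sum_infsum pos_trig_poly.summable_cross_mass[OF pos_trig_poly_x] S order_refl)
 ultimately have "(INFSUM p. cross_mass_at S p) - (INFSUM p. cross_mass_at 0 p) = ?I" using has_sum_unique by blast
 moreover have "?I <= 0"
 proof (cases "(%\<tau>. INFSUM p. cross_mass_deriv_at \<tau> p) integrable_on {0..S}")
  case True
  have "?I <= integral {0..S} (%\<tau>. 0::real)"
   by (rule integral_le[OF True]) (use pos_trig_poly.sum_cross_mass_deriv_nonpos[OF pos_trig_poly_x] in auto)
  thus ?thesis by simp
 qed (simp add: not_integrable_integral)
 ultimately show ?thesis by linarith
qed

lemma mode_eigenbasis_at:
 assumes \<tau>: "\<tau> >= 0" obtains \<psi> lam where "mode_eigenbasis N (x \<tau>) (re_trig N (x \<tau>)) (phase \<tau>) \<psi> lam"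
 using pos_trig_poly.mode_eigenbasis_exists[OF pos_trig_poly_x[OF \<tau>]] by blast

lemma zeta_minus_1:
 assumes \<tau>: "\<tau> >= 0"
 shows "zeta (re_trig N (x \<tau>)) (- 1) = 2 * riemann_zeta (- 1) + of_real (INFSUM p. cross_mass_at \<tau> p)"
proof -
 obtain \<psi> lam where "mode_eigenbasis N (x \<tau>) (re_trig N (x \<tau>)) (phase \<tau>) \<psi> lam" by (rule mode_eigenbasis_at[OF \<tau>])
 then interpret e: mode_eigenbasis N "x \<tau>" "re_trig N (x \<tau>)" "phase \<tau>" \<psi> lam .
 show ?thesis using e.zeta_eq[of "- 1"] unfolding e.zeta_correction_minus_1 e.trace_remainder by simp
qed

lemma zeta_even:
 assumes \<tau>: "\<tau> >= 0" and m: "m >= 1" and R: "R >= 2 * int ((2 * m) * N)"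
 shows "zeta (re_trig N (x \<tau>)) (- 2 * of_nat m) = 2 * riemann_zeta (- 2 * of_nat m) + of_real (Re (trace_on R (even_defect_at \<tau> (2 * m))))"
proof -
 obtain \<psi> lam where "mode_eigenbasis N (x \<tau>) (re_trig N (x \<tau>)) (phase \<tau>) \<psi> lam" by (rule mode_eigenbasis_at[OF \<tau>])
 then interpret e: mode_eigenbasis N "x \<tau>" "re_trig N (x \<tau>)" "phase \<tau>" \<psi> lam .
 have "Re (- 2 * of_nat m :: complex) < 1" by simp
 from e.zeta_eq[OF this] show ?thesis unfolding e.zeta_correction_even[OF m R] .
qed

theorem zeta_minus_1_nonincreasing: "\<tau> >= 0 ==> Re (zeta (re_trig N (x \<tau>)) (- 1)) <= Re (zeta (re_trig N (x 0)) (- 1))"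
 using sum_cross_mass_nonincreasing[of \<tau>] by (simp add: zeta_minus_1)

theorem zeta_even_nonincreasing:
 assumes "\<tau> >= 0" "m >= 1" shows "Re (zeta (re_trig N (x \<tau>)) (- 2 * of_nat m)) <= Re (zeta (re_trig N (x 0)) (- 2 * of_nat m))"
 unfolding zeta_even[OF assms order_refl] zeta_even[OF order_refl assms(2) order_refl]
 using trace_even_defect_nonincreasing[of "2 * m" \<tau>] assms by (simp only: plus_complex.simps Re_complex_of_real add_le_cancel_left) simp

end

section \<open>Solutions of the flow equation\<close>

lemma band_limited:
 assumes f: "circ_smooth f" and band: "\<forall>k. \<bar>k\<bar> > int N \<longrightarrow> fourier (cx f) k = 0"
 shows "hermitian_band N (fourier (cx f))" "f = re_trig N (fourier (cx f))"
proof -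
 have smooth: "circ_smooth_c (cx f)" using f smooth_fun_const[of 0] by (simp add: circ_smooth_c_def cx_def circ_smooth_def)
 show "hermitian_band N (fourier (cx f))"
  using band cnj_fourier[of "cx f"] by unfold_locales (auto simp: cx_def)
 have "complex_of_real (f t) = trig_poly N (fourier (cx f)) t" for t
  using circ_smooth_c_inversion[OF smooth, of t] trig_series_finite[of N "fourier (cx f)" t] band by (simp add: cx_def)
 thus "f = re_trig N (fourier (cx f))" unfolding re_trig_def by (metis Re_complex_of_real ext)
qed

lemma cx_re_trig: "hermitian_band N c ==> cx (re_trig N c) = trig_poly N c"
 by (rule ext) (simp add: cx_def hermitian_band.trig_poly_real)

lemma fourier_re_trig: "hermitian_band N c ==> fourier (cx (re_trig N c)) k = c k"
 unfolding cx_re_trig fourier_trig_poly by (auto simp: hermitian_band.band)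

lemma flow_equation_re_trig:
 assumes "hermitian_band N c"
 shows "complex_of_real (re_trig N (flow_coef N c) t)
   = - cx (re_trig N c) t * Lam (cx (re_trig N c)) t + Hil (cx (re_trig N c)) t * Dop (cx (re_trig N c)) t"
proof -
 interpret hermitian_band N c by (rule assms)
 show ?thesis unfolding flow_equation_rhs[OF trig_poly_real[symmetric]]
  by (rule trig_poly_eq_re_trig[symmetric]) (rule flow_coef_hermitian)
qed

lemma flow_sol_re_trig:
 assumes solution: "flow_solution_on {0..} N x" and pos: "!!\<tau> t. \<tau> >= 0 ==> re_trig N (x \<tau>) t > 0"
 shows "flow_sol N (re_trig N (x 0)) (%\<tau>. re_trig N (x \<tau>))"
proof -
 have hermitian: "\<tau> >= 0 ==> hermitian_band N (x \<tau>)" for \<tau> by (rule flow_solution_onD(1)[OF solution]) simp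
 show ?thesis unfolding flow_sol_def
 proof (intro conjI exI[of _ "%\<tau>. re_trig N (flow_coef N (x \<tau>))"] allI impI)
  show "smooth_curve (%\<tau>. re_trig N (x \<tau>))" by (rule smooth_curve_re_trig[OF solution])
  show "curve_deriv (%\<tau>. re_trig N (x \<tau>)) (%\<tau>. re_trig N (flow_coef N (x \<tau>)))"
    by (rule curve_deriv_re_trig[OF flow_solution_onD(2)[OF solution]]) simp
 qed (simp_all add: pos flow_equation_re_trig[OF hermitian] fourier_re_trig[OF hermitian] hermitian_band.band[OF hermitian])
qed

lemma norm_coef_le_if_re_trig_le:
 assumes d: "!!k. cnj (d k) = d (- k)" and le: "!!t. \<bar>re_trig N d t\<bar> <= e" and k: "\<bar>k\<bar> <= int N"
 shows "cmod (d k) <= e"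
proof -
 have "cmod (fourier (trig_poly N d) k) <= e"
  by (rule norm_fourier_le[OF continuous_on_trig_poly]) (simp add: trig_poly_eq_re_trig[of d, OF d] le)
 thus ?thesis using k by (simp add: fourier_trig_poly)
qed

lemma coef_deriv_if_curve_deriv:
 assumes y: "!!\<tau>. \<tau> >= 0 ==> hermitian_band N (y \<tau>)" and z: "hermitian_band N z"
  and b: "!!\<tau>. \<tau> >= 0 ==> b \<tau> = re_trig N (y \<tau>)" and deriv: "curve_deriv b g" and g: "g \<tau> = re_trig N z" and \<tau>: "\<tau> >= 0"
 shows "((%\<tau>. y \<tau> k) has_vd z k) (at \<tau> within {0..})"
 unfolding has_vector_derivative_iff_slope
proof (rule tendstoI)
 fix e :: real assume e: "e > 0"
 have "\<forall>\<^sub>F \<sigma> in at \<tau> within {0..}. \<forall>t. \<bar>((deriv ^^ 0) (b \<sigma>) t - (deriv ^^ 0) (b \<tau>) t) / (\<sigma> - \<tau>) - (deriv ^^ 0) (g \<tau>) t\<bar> <= e / 2"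
  using deriv \<tau> e unfolding curve_deriv_def by (meson half_gt_zero)
 moreover have "\<forall>\<^sub>F \<sigma> in at \<tau> within {0..}. \<sigma> >= 0" by (simp add: eventually_at_filter)
 ultimately show "\<forall>\<^sub>F \<sigma> in at \<tau> within {0..}. dist ((y \<sigma> k - y \<tau> k) /\<^sub>R (\<sigma> - \<tau>)) (z k) < e"
 proof eventually_elim
  case (elim \<sigma>)
  define d where "d k = inverse (\<sigma> - \<tau>) *\<^sub>R (y \<sigma> k - y \<tau> k) - z k" for k
  have "re_trig N d t = (re_trig N (y \<sigma>) t - re_trig N (y \<tau>) t) / (\<sigma> - \<tau>) - g \<tau> t" for t
   unfolding d_def re_trig_diff re_trig_scaleR g by (simp add: divide_inverse mult.commute)
  hence "\<bar>re_trig N d t\<bar> <= e / 2" for t using elim(1) b[OF elim(2)] b[OF \<tau>] by simp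
  moreover have "cnj (d k) = d (- k)" for k
   unfolding d_def using hermitian_band.hermitian[OF y[OF elim(2)]] hermitian_band.hermitian[OF y[OF \<tau>]] hermitian_band.hermitian[OF z] by simp
  ultimately have "cmod (d k) <= e / 2" if "\<bar>k\<bar> <= int N" using that by (intro norm_coef_le_if_re_trig_le)
  moreover have "d k = 0" if "\<bar>k\<bar> > int N"
   using that by (simp add: d_def hermitian_band.band[OF y[OF elim(2)]] hermitian_band.band[OF y[OF \<tau>]] hermitian_band.band[OF z])
  ultimately have "cmod (d k) < e" using e by (cases "\<bar>k\<bar> <= int N") auto
  thus ?case by (simp add: d_def dist_norm)
 qed
qed

lemma hermitian_band_flow_coef: "hermitian_band N c ==> hermitian_band N (flow_coef N c)"
 by unfold_locales (simp_all add: hermitian_band.flow_coef_eq_0 hermitian_band.flow_coef_hermitian)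

lemma circ_smooth_smooth_curve: assumes "smooth_curve g" "\<tau> >= 0" shows "circ_smooth (g \<tau>)"
proof -
 obtain A where "A 0 = g" "\<forall>n. (\<forall>\<tau>\<ge>0. circ_smooth (A n \<tau>)) \<and> curve_cont (A n) \<and> curve_deriv (A n) (A (Suc n))"
  using assms(1) unfolding smooth_curve_def by metis
 thus ?thesis using assms(2) by metis
qed

lemma flow_sol_coefs:
 assumes b: "flow_sol N a b"
 shows "flow_solution_on {0..} N (%\<tau>. fourier (cx (b \<tau>)))" "\<tau> >= 0 ==> b \<tau> = re_trig N (fourier (cx (b \<tau>)))"
proof -
 define y where "y \<tau> = fourier (cx (b \<tau>))" for \<tau>
 have smooth: "circ_smooth (b \<sigma>)" if "\<sigma> >= 0" for \<sigma>
  using b circ_smooth_smooth_curve[OF _ that] by (simp add: flow_sol_def)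
 have "\<forall>k. \<bar>k\<bar> > int N \<longrightarrow> fourier (cx (b \<sigma>)) k = 0" if "\<sigma> >= 0" for \<sigma> using b that unfolding flow_sol_def by blast
 note limited = band_limited[OF smooth this, folded y_def]
 obtain g where g: "curve_deriv b g" "!!\<tau> t. \<tau> >= 0 ==> complex_of_real (g \<tau> t)
   = - cx (b \<tau>) t * Lam (cx (b \<tau>)) t + Hil (cx (b \<tau>)) t * Dop (cx (b \<tau>)) t"
  using b unfolding flow_sol_def by blast
 have flow: "g \<tau> = re_trig N (flow_coef N (y \<tau>))" if \<tau>: "\<tau> >= 0" for \<tau>
  using g(2)[OF \<tau>] flow_equation_re_trig[OF limited(1)[OF \<tau> \<tau>]] limited(2)[OF \<tau> \<tau>] by (metis ext of_real_eq_iff)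
 show "\<tau> >= 0 ==> b \<tau> = re_trig N (fourier (cx (b \<tau>)))" using limited(2) by (simp add: y_def)
 have "((%\<tau>. y \<tau> k) has_vd flow_coef N (y \<tau>) k) (at \<tau> within {0..})" if "\<tau> >= 0" for \<tau> k
  using coef_deriv_if_curve_deriv[where y=y and b=b, OF _ hermitian_band_flow_coef _ g(1) flow] limited that by blast
 thus "flow_solution_on {0..} N (%\<tau>. fourier (cx (b \<tau>)))"
  using limited(1) by (simp add: flow_solution_on_def flip: y_def)
qed

lemma flow_sol_unique:
 assumes b: "flow_sol N a b" and x: "flow_solution_on {0..} N x" "x 0 = fourier (cx a)" and \<tau>: "\<tau> >= 0"
 shows "b \<tau> = re_trig N (x \<tau>)"
proof -
 have "b 0 = a" using b unfolding flow_sol_def by blast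
 hence "fourier (cx (b \<tau>)) = x \<tau>"
  using flow_unique[OF flow_sol_coefs(1)[OF b] x(1) _ \<tau>] x(2) by simp
 thus ?thesis using flow_sol_coefs(2)[OF b \<tau>] by simp
qed

lemma (in positive_flow) re_trig_in_Kc:
 assumes \<tau>: "\<tau> >= 0" and "Re (fourier (cx (re_trig N (x 0))) 0) <= c 0" and "Re (zeta (re_trig N (x 0)) (- 1)) <= c 1"
  and "!!m::nat. m >= 1 ==> Re (zeta (re_trig N (x 0)) (- 2 * of_nat m)) <= c (m + 1)"
 shows "re_trig N (x \<tau>) \<in> Kc c"
 unfolding Kc_def
proof (intro CollectI conjI allI impI)
 show "Re (fourier (cx (re_trig N (x \<tau>))) 0) <= c 0"
  using Re_x_0_le[OF \<tau>] assms(2) by (simp add: fourier_re_trig[OF hermitian] \<tau>)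
 show "Re (zeta (re_trig N (x \<tau>)) (- 1)) <= c 1" by (rule order_trans[OF zeta_minus_1_nonincreasing[OF \<tau>] assms(3)])
 show "Re (zeta (re_trig N (x \<tau>)) (- 2 * of_nat m)) <= c (m + 1)" if "m >= 1" for m
  by (rule order_trans[OF zeta_even_nonincreasing[OF \<tau> that] assms(4)[OF that]])
qed (use \<tau> circ_smooth_re_trig pos volume in auto)

theorem theorem6p2:
  fixes a :: "real \<Rightarrow> real" and N :: nat
  assumes "circ_smooth a"
    and "\<forall>\<theta>. a \<theta> > 0"
    and "integral {0..2*pi} (\<lambda>\<theta>. 1 / a \<theta>) = 2 * pi"
    and "\<forall>k::int. \<bar>k\<bar> > int N \<longrightarrow> fourier (cx a) k = 0"
  shows "\<exists>\<alpha>. flow_sol N a \<alpha> \<and>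
           (\<forall>\<beta>. flow_sol N a \<beta> \<longrightarrow> (\<forall>\<tau>\<ge>0. \<beta> \<tau> = \<alpha> \<tau>)) \<and>
           (\<forall>c::nat \<Rightarrow> real. (\<forall>k. c k > 0) \<and> c 0 \<ge> Re (fourier (cx a) 0) \<and>
              c 1 \<ge> Re (zeta a (-1)) \<and>
              (\<forall>m::nat. m \<ge> 1 \<longrightarrow> c (m + 1) \<ge> Re (zeta a (- 2 * of_nat m)))
            \<longrightarrow> (\<forall>\<tau>\<ge>0. \<alpha> \<tau> \<in> Kc c))"
proof -
 note a = band_limited[OF assms(1,4)]
 have "re_trig N (fourier (cx a)) t > 0" for t using assms(2) a(2) by metis
 then obtain x where x: "x 0 = fourier (cx a)" "flow_solution_on {0..} N x" "!!\<tau> t. \<tau> >= 0 ==> re_trig N (x \<tau>) t > 0"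
  by (rule flow_exists[OF a(1)]) blast
 have a_eq: "re_trig N (x 0) = a" using a(2) x(1) by simp
 interpret positive_flow N x by unfold_locales (use x(2,3) a_eq assms(3) in simp_all)
 have "flow_sol N a (%\<tau>. re_trig N (x \<tau>))" using flow_sol_re_trig[OF x(2,3)] a_eq by simp
 moreover have "\<beta> \<tau> = re_trig N (x \<tau>)" if "flow_sol N a \<beta>" "\<tau> >= 0" for \<beta> \<tau>
  by (rule flow_sol_unique[OF that(1) x(2,1) that(2)])
 moreover have "re_trig N (x \<tau>) \<in> Kc c" if "c 0 >= Re (fourier (cx a) 0)" "c 1 >= Re (zeta a (-1))"
   "\<forall>m::nat. m >= 1 \<longrightarrow> c (m + 1) >= Re (zeta a (- 2 * of_nat m))" "\<tau> >= 0" for c \<tau>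
  using that by (intro re_trig_in_Kc) (simp_all add: a_eq)
 ultimately show ?thesis by blast
qed

end
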